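(* Let $(s_1,\ldots,s_r)\in\mathbb{N}^r$ with $r\ge2$. If $\zeta_A(s_1,\ldots,s_r)$ is zeta-like, then each of $\zeta_A(s_2,\ldots,s_r),\ \zeta_A(s_3,\ldots,s_r),\ \ldots,\ \zeta_A(s_r)$ is Eulerian. In particular, each of $s_2,\ldots,s_r$ is divisible by $q-1$.
   Context: $\mathbb{N}$ is the set of positive integers; $q$ is a power of a prime; $A=\mathbb{F}_q[\theta]$, $A_+$ its set of monic polynomials, $k=\mathbb{F}_q(\theta)$, $k_\infty=\mathbb{F}_q((1/\theta))$. $\zeta_A(s_1,\ldots,s_r)=\sum\frac{1}{a_1^{s_1}\cdots a_r^{s_r}}\in k_\infty$, the sum over $(a_1,\ldots,a_r)\in A_+^r$ with $\deg a_1>\cdots>\deg a_r$; these values are nonzero. Let $D_0=1$, $D_i=\prod_{j=0}^{i-1}(\theta^{q^i}-\theta^{q^j})$; $\exp_{\mathbf{C}}(z)=\sum_{i\ge0}z^{q^i}/D_i$ is the Carlitz exponential on the completion $\mathbb{C}_\infty$ of an algebraic closure of $k_\infty$, and $\tilde\pi\in\mathbb{C}_\infty$ is a fixed fundamental period of the Carlitz module: $\ker\exp_{\mathbf{C}}=A\tilde\pi$. With $w=s_1+\cdots+s_r$, $\zeta_A(s_1,\ldots,s_r)$ is called Eulerian if $\zeta_A(s_1,\ldots,s_r)/\tilde\pi^{w}\in k$, and zeta-like if $\zeta_A(s_1,\ldots,s_r)/\zeta_A(w)$ is algebraic over $k$ (by a known result this is equivalent to the ratio lying in $k$). *)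

theory Defs
  imports
    "HOL-Analysis.Analysis"
    "HOL-Computational_Algebra.Computational_Algebra"
    "HOL-Algebra.Algebraic_Closure_Type"
begin

text \<open>
  \<open>'a\<close> is the finite field of \<open>q = CARD('a)\<close> elements and \<open>A = 'a poly\<close>.
  The completion of \<open>k = Frac A\<close> at infinity is \<open>'a fls\<close>, where the series variable
  \<^term>\<open>fls_X\<close> stands for \<open>1/\<theta>\<close>, so that \<open>\<theta>\<close> is \<^term>\<open>fls_X_inv\<close>.
  The library metric on \<open>'a fls\<close> is \<open>dist x 0 = 2 powi (- fls_subdegree x)\<close> for \<open>x \<noteq> 0\<close>; taking base 2
  rather than \<open>q\<close> only replaces the absolute value by a power of itself.
\<close>

definition A_to_kinf :: "'a::field poly \<Rightarrow> 'a fls" where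
  "A_to_kinf a = poly (map_poly fls_const a) fls_X_inv"

definition k_in_kinf :: "'a::field fls set" where
  "k_in_kinf = {A_to_kinf a / A_to_kinf b | a b. b \<noteq> 0}"

definition algebraic_over :: "'b::field set \<Rightarrow> 'b \<Rightarrow> bool" where
  "algebraic_over K x \<longleftrightarrow> (\<exists>p. p \<noteq> 0 \<and> (\<forall>i. Polynomial.coeff p i \<in> K) \<and> poly p x = 0)"

definition mzv_index :: "nat \<Rightarrow> 'a::field poly list set" where
  "mzv_index r = {as. length as = r \<and> (\<forall>a\<in>set as. Polynomial.lead_coeff a = 1)
                      \<and> sorted_wrt (\<lambda>a b. Polynomial.degree a > Polynomial.degree b) as}"

definition zeta_A :: "nat list \<Rightarrow> 'a::{finite,field} fls" where
  "zeta_A s = (\<Sum>\<^sub>\<infinity>as\<in>mzv_index (length s). 1 / (\<Prod>i<length s. A_to_kinf (as ! i) ^ (s ! i)))"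

text \<open>
  The completion of an algebraic closure of \<open>k\<^sub>\<infinity>\<close> is given up to isometric isomorphism:
  it is a complete field with an absolute value \<open>\<lambda>x. dist x 0\<close> that extends the one on
  \<open>k\<^sub>\<infinity>\<close>, and in which an algebraic closure of \<open>k\<^sub>\<infinity>\<close> is embedded densely by \<open>\<iota>\<close>.
  Completeness is part of the sort of \<open>'c\<close>.
\<close>

locale C_infinity =
  fixes \<iota> :: "'a::{finite,field} fls alg_closure \<Rightarrow> 'c::{field,complete_space}"
  assumes hom_one: "\<iota> 1 = 1"
    and hom_add: "\<iota> (x + y) = \<iota> x + \<iota> y"
    and hom_mult: "\<iota> (x * y) = \<iota> x * \<iota> y"
    and dist_diff: "dist u v = dist (u - v) (0::'c)"
    and dist_mult: "dist (u * v) (0::'c) = dist u 0 * dist v 0"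
    and dist_ultrametric: "dist (u::'c) w \<le> max (dist u v) (dist v w)"
    and dist_extends: "dist (\<iota> (to_ac z)) 0 = dist z 0"
    and dense: "closure (range \<iota>) = UNIV"

definition carlitz_D :: "nat \<Rightarrow> 'a::{finite,field} poly" where
  "carlitz_D i = (\<Prod>j<i. Polynomial.monom 1 (CARD('a) ^ i) - Polynomial.monom 1 (CARD('a) ^ j))"

definition carlitz_exp ::
    "('a::{finite,field} fls alg_closure \<Rightarrow> 'c::{field,complete_space}) \<Rightarrow> 'c \<Rightarrow> 'c" where
  "carlitz_exp \<iota> z =
     (\<Sum>i. z ^ (CARD('a) ^ i) / \<iota> (to_ac (A_to_kinf (carlitz_D i :: 'a poly))))"

definition fundamental_period ::
    "('a::{finite,field} fls alg_closure \<Rightarrow> 'c::{field,complete_space}) \<Rightarrow> 'c \<Rightarrow> bool" where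
  "fundamental_period \<iota> \<pi> \<longleftrightarrow>
     {z. carlitz_exp \<iota> z = 0} = {\<iota> (to_ac (A_to_kinf a)) * \<pi> | a. True}"

definition Eulerian ::
    "('a::{finite,field} fls alg_closure \<Rightarrow> 'c::{field,complete_space}) \<Rightarrow> 'c \<Rightarrow> nat list \<Rightarrow> bool"
  where
  "Eulerian \<iota> \<pi> s \<longleftrightarrow>
     \<iota> (to_ac (zeta_A s)) / \<pi> ^ sum_list s \<in> (\<lambda>x. \<iota> (to_ac x)) ` k_in_kinf"

definition zeta_like :: "'a::{finite,field} itself \<Rightarrow> nat list \<Rightarrow> bool" where
  "zeta_like (_ :: 'a itself) s \<longleftrightarrow>
     algebraic_over k_in_kinf (zeta_A s / zeta_A [sum_list s] :: 'a fls)"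

end

theory Submission
  imports Defs
begin

text \<open>
  Everything happens in the power series in \<open>t\<close> over \<open>k\<^sub>\<infinity>\<close>, on which the twist \<open>\<tau>\<close> raises coefficients to
  the \<open>q\<close>-th power; put \<open>b = t - \<theta>\<^sup>q\<close>. Polynomials \<open>H\<^sub>x \<in> A[t]\<close> interpolate the power sums of monic polynomials,
  so that the deformation series \<open>\<phi>\<^sub>s\<close> of the zeta values satisfy
  \<open>b\<^sup>w \<phi>(s,x) = \<tau>\<phi>(s,x) + b\<^sup>x H\<^sub>x \<tau>\<phi>(s)\<close>, where \<open>w\<close> is the weight of \<open>(s,x)\<close>, and take at \<open>t = \<theta>\<close> the value
  \<open>\<zeta>(s)\<close> up to a nonzero factor in \<open>A\<close>. By a criterion of Anderson, Brownawell and Papanikolas (in a version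
  proved with Siegel's lemma and Schwarz' lemma alone) a zeta-like value yields a relation between \<open>\<phi>\<close> of the
  initial segments of \<open>s\<close> and \<open>\<phi>(w)\<close>, with coefficients in \<open>A[c][t]\<close> for an algebraic \<open>c\<close>. Comparing the
  relation with its twist gives \<open>b\<^sup>D (P\<^sub>l + P\<^sub>l\<^sub>+\<^sub>1 H) \<tau>(p) = \<tau>(P\<^sub>l) p\<close>, where \<open>D\<close> is the weight of the
  final segment after \<open>l\<close>; a degree argument removes \<open>c\<close>. The lowest \<open>t\<close>-coefficient of \<open>H\<^sub>x\<close> is a constant times a
  power of \<open>\<theta>\<close>, hence a unit at \<open>\<theta> = -1\<close>; comparing lowest \<open>t\<close>-coefficients there proves both the linear
  independence needed on the way and \<open>q - 1 | D\<close>. Finally the combination \<open>N\<close> of the \<open>\<phi>\<close> of a final segment with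
  coefficients \<open>P\<^sub>l\<close> satisfies \<open>\<tau>(N) p = b\<^sup>D \<tau>(p) N\<close>, so that \<open>N \<Omega>\<^sup>D\<close> is a multiple of \<open>p\<close> by a rational
  function, which at \<open>t = \<theta>\<close> says \<open>\<zeta> \<Omega>(\<theta>)\<^sup>D \<in> k\<close>; and \<open>\<theta> (-\<theta>)\<^bsup>1/(q-1)\<^esup> / \<Omega>(\<theta>)\<close> is a zero of the Carlitz
  exponential.
\<close>

text \<open>The main obstacle is that the lowest \<open>t\<close>-coefficient of \<open>Hp x\<close>
  might cancel. Its generating series is the inverse of \<open>1 - \<beta>(x)\<close> for an
  additive series \<open>\<beta>\<close>. Lagrange inversion along the compositional inverse of
  \<open>\<beta>\<close> turns a coefficient into a sum over placements of tokens, one token for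
  each unit of each base-\<open>p\<close> digit of an exponent. The dominant placements solve an
  integer optimization problem. Each of them contributes the same monomial in
  \<open>\<theta>\<close>, because the monomial depends on their common cost alone, and their number
  is prime to \<open>p\<close>. The point \<open>\<theta> = -1\<close> is chosen because its residue
  field is the finite field itself and \<open>-\<theta>^q\<close> is 1 there, so that
  \<open>r^q = (-\<theta>^q)^D (r + v)\<close> reduces to \<open>r = r + v\<close>. Systems are
  indexed by trees because the relation involves two branches, the initial segments of
  \<open>s\<close> and the single index \<open>w\<close>, which meet at the constant series 1. This
  root has two children, so the equation in chain form holds only from \<open>l = 1\<close> on; that
  is why the result concerns proper final segments.\<close>

hide_const (open) Divisibility.prime Coset.order up_ring.coeff up_ring.monom Polynomials.degree module.smult
no_notation var (\<open>X\<index>\<close>)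

abbreviation AK :: "'a::field poly \<Rightarrow> 'a fls" where "AK \<equiv> A_to_kinf"

section \<open>Finite fields and the Frobenius power\<close>

lemma prime_CHAR_finite: "prime CHAR('a::{finite,field})"
 using prime_CHAR_semidom[where 'a = 'a] finite_imp_CHAR_pos[where 'a = 'a] by auto

lemma card_ge_2: "2 \<le> CARD('a::{finite,field})"
proof -
 have "card {0, 1::'a} \<le> CARD('a)" by (rule card_mono) auto
 then show ?thesis by simp
qed

text \<open>Multiplication by \<open>x\<close> permutes the nonzero elements, so their product does
  not change when it is multiplied by \<open>x ^ (q - 1)\<close>.\<close>

lemma finite_field_power_card:
 fixes x :: "'a::{finite,field}"
 shows "x ^ CARD('a) = x"
proof (cases "x = 0")
 case False
 let ?N = "UNIV - {0::'a}"
 have "bij_betw ((*) x) ?N ?N"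
  by (rule bij_betwI[where g = "\<lambda>y. y / x"]) (use False in auto)
 then have "(\<Prod>y\<in>?N. x * y) = \<Prod>?N"
  by (rule prod.reindex_bij_betw)
 then have "x ^ card ?N * \<Prod>?N = 1 * \<Prod>?N"
  by (simp add: prod.distrib)
 then have "x ^ card ?N = 1"
  by (subst (asm) mult_right_cancel) auto
 moreover have card: "CARD('a) = Suc (card ?N)"
  using card_ge_2[where 'a = 'a] by (simp add: card_Diff_singleton)
 ultimately show ?thesis unfolding card power_Suc by (simp only: mult_1_right)
qed (use card_ge_2[where 'a = 'a] in auto)

lemma finite_field_power_card_power:
 fixes x :: "'a::{finite,field}"
 shows "x ^ (CARD('a) ^ n) = x"
 by (induction n) (simp_all add: power_mult finite_field_power_card)

text \<open>The difference of the two sides has degree below \<open>q\<close>, since the leading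
  terms cancel, and it vanishes at all \<open>q\<close> elements of the field.\<close>

lemma one_plus_X_power_card:
 "[:1, 1:] ^ CARD('a) = monom 1 (CARD('a)) + (1 :: 'a::{finite,field} poly)"
proof -
 let ?q = "CARD('a)"
 let ?P = "[:1, 1:] ^ ?q - (monom 1 ?q + 1 :: 'a poly)"
 have co: "coeff ([:1, 1:] ^ ?q :: 'a poly) i = of_nat (?q choose i)" for i
  using coeff_linear_poly_power[of i ?q "1::'a" 1] by (cases "i \<le> ?q") (auto simp: coeff_eq_0 degree_linear_power binomial_eq_0)
 have q0: "?q > 0" using card_ge_2[where 'a = 'a] by simp
 have "degree ?P < ?q"
 proof (rule degree_lessI)
  show "?P \<noteq> 0 \<or> 0 < ?q" using q0 by simp
  show "\<forall>k\<ge>?q. coeff ?P k = 0"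
   using q0 by (auto simp: co Polynomial.coeff_monom binomial_eq_0 le_less)
 qed
 moreover have "poly ?P x = 0" for x
  by (simp add: poly_monom finite_field_power_card add.commute)
 then have "{x. poly ?P x = 0} = UNIV" by auto
 ultimately have "?P = 0"
  using card_poly_roots_bound[of ?P] by (cases "?P = 0") auto
 then show ?thesis by simp
qed

text \<open>If \<open>q = p^a * m\<close> with \<open>m > 1\<close> prime to \<open>p\<close>, then
  the coefficient of \<open>(1 + X)^q\<close> at \<open>X^(p^a)\<close> is \<open>m\<close>,
  computed through \<open>(1 + X^(p^a))^m\<close>, whereas \<open>one_plus_X_power_card\<close>
  makes it 0.\<close>

lemma card_finite_field: "\<exists>f\<ge>1. CARD('a::{finite,field}) = CHAR('a) ^ f"
proof -
 let ?q = "CARD('a)" and ?p = "CHAR('a)"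
 have p: "prime ?p" by (rule prime_CHAR_finite)
 obtain a m where am: "?q = ?p ^ a * m" "\<not> ?p dvd m"
  using multiplicity_decompose'[of ?q ?p] card_ge_2[where 'a = 'a] p
  by (metis UNIV_not_empty card_0_eq finite not_prime_unit)
 have "m = 1"
 proof (rule ccontr)
  assume "m \<noteq> 1"
  with am card_ge_2[where 'a = 'a] have m2: "m \<ge> 2" by (cases m) auto
  have P0: "?p ^ a > 0" using p prime_gt_0_nat by auto
  have e1: "?p ^ a * k = ?p ^ a \<longleftrightarrow> k = 1" for k using prime_gt_0_nat[OF p] by auto
  have X: "[:1, 1:] = (monom 1 1 + 1 :: 'a poly)"
   by (simp add: monom_Suc one_pCons monom_0)
  have fd: "(monom 1 1 + 1 :: 'a poly) ^ (?p ^ a) = monom 1 1 ^ (?p ^ a) + 1 ^ (?p ^ a)"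
   by (rule freshmans_dream'[where n = a]) (simp_all add: p)
  have "[:1, 1:] ^ ?q = ((monom 1 1 + 1 :: 'a poly) ^ (?p ^ a)) ^ m"
   by (simp only: X am(1) power_mult)
  also have "\<dots> = (monom 1 (?p ^ a) + 1) ^ m"
   unfolding fd by (simp add: monom_power)
  also have "\<dots> = (\<Sum>k\<le>m. of_nat (m choose k) * monom 1 (?p ^ a * k))"
   by (subst binomial_ring) (simp add: monom_power)
  also have "\<dots> = (\<Sum>k\<le>m. monom (of_nat (m choose k)) (?p ^ a * k))"
   by (simp add: of_nat_poly smult_monom)
  finally have "coeff ([:1, 1:] ^ ?q :: 'a poly) (?p ^ a) = (\<Sum>k\<le>m. if k = 1 then of_nat (m choose k) else 0)"
   by (simp add: coeff_sum Polynomial.coeff_monom e1 cong: if_cong)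
  also have "\<dots> = of_nat m" using m2 by (simp add: sum.delta)
  finally have "of_nat m = coeff (monom 1 ?q + (1 :: 'a poly)) (?p ^ a)"
   by (simp add: one_plus_X_power_card)
  also have "\<dots> = 0" using P0 m2 by (auto simp: am(1) Polynomial.coeff_monom)
  finally show False using am(2) of_nat_eq_0_iff_char_dvd[of m, where 'a = 'a] by simp
 qed
 then show ?thesis using am card_ge_2[where 'a = 'a] by (intro exI[of _ a]) (cases a; auto)
qed

text \<open>The ring is arbitrary of the right characteristic because the rule is needed for
  polynomials, Laurent series, iterated Laurent series and power series over these.\<close>

lemma frobenius_add:
 fixes x y :: "'b::comm_semiring_1"
 assumes "CHAR('b) = CHAR('a::{finite,field})"
 shows "(x + y) ^ (CARD('a) ^ n) = x ^ (CARD('a) ^ n) + y ^ (CARD('a) ^ n)"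
proof -
 obtain f where "CARD('a) = CHAR('a) ^ f" using card_finite_field by blast
 then show ?thesis
  by (intro freshmans_dream'[of _ "f * n"]) (simp_all add: assms prime_CHAR_finite power_mult)
qed

lemma frobenius_sum:
 fixes g :: "'c => 'b::comm_semiring_1"
 assumes "CHAR('b) = CHAR('a::{finite,field})"
 shows "(\<Sum>i\<in>A. g i) ^ (CARD('a) ^ n) = (\<Sum>i\<in>A. g i ^ (CARD('a) ^ n))"
proof -
 have "CARD('a) ^ n > 0" using card_ge_2[where 'a = 'a] by simp
 then show ?thesis
  by (induction A rule: infinite_finite_induct)
   (simp_all add: frobenius_add[OF assms] power_0_left)
qed

lemma frobenius_minus:
 fixes x :: "'b::comm_ring_1"
 assumes "CHAR('b) = CHAR('a::{finite,field})"
 shows "(- x) ^ (CARD('a) ^ n) = - (x ^ (CARD('a) ^ n))"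
proof -
 have "CARD('a) ^ n > 0" using card_ge_2[where 'a = 'a] by simp
 then have "x ^ (CARD('a) ^ n) + (- x) ^ (CARD('a) ^ n) = 0"
  using frobenius_add[OF assms, of x "- x" n] by (simp add: power_0_left)
 then show ?thesis by (simp add: eq_neg_iff_add_eq_0 add.commute)
qed

lemma frobenius_diff:
 fixes x y :: "'b::comm_ring_1"
 assumes "CHAR('b) = CHAR('a::{finite,field})"
 shows "(x - y) ^ (CARD('a) ^ n) = x ^ (CARD('a) ^ n) - y ^ (CARD('a) ^ n)"
 using frobenius_add[OF assms, of x "- y" n] by (simp add: frobenius_minus[OF assms])

no_notation vec_nth (infixl "$" 90)
unbundle fps_syntax

section \<open>The valuation on Laurent series\<close>

text \<open>The valuation at infinity is at least \<open>c\<close>. A predicate spares the case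
  distinction for 0 that a valuation function would need.\<close>

definition vge :: "int => 'a::zero fls => bool" where
 "vge c x \<longleftrightarrow> (\<forall>n<c. x $$ n = 0)"

lemma vge_0 [simp]: "vge c 0"
 by (simp add: vge_def)

lemma vge_mono: "vge c x ==> d \<le> c ==> vge d x"
 by (auto simp: vge_def)

lemma vge_add: "vge c x ==> vge c y ==> vge c (x + y :: 'a::monoid_add fls)"
 by (auto simp: vge_def)

lemma vge_uminus [simp]: "vge c (- x :: 'a::group_add fls) \<longleftrightarrow> vge c x"
 by (auto simp: vge_def)

lemma vge_diff: "vge c x ==> vge c y ==> vge c (x - y :: 'a::group_add fls)"
 by (auto simp: vge_def)

lemma vge_sum: "(\<And>i. i \<in> S ==> vge c (f i)) ==> vge c (\<Sum>i\<in>S. f i :: 'a::comm_monoid_add fls)"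
 by (induction S rule: infinite_finite_induct) (auto intro: vge_add)

lemma vge_subdegree: "x \<noteq> 0 ==> vge c x \<longleftrightarrow> c \<le> fls_subdegree x"
 unfolding vge_def using fls_subdegree_geI nth_fls_subdegree_nonzero
 by (metis fls_eq0_below_subdegree not_less order_less_le_trans)

lemma vge_mult:
 fixes x y :: "'a::idom fls"
 assumes "vge c x" "vge d y"
 shows "vge (c + d) (x * y)"
 using assms by (cases "x = 0 \<or> y = 0") (auto simp: vge_subdegree)

lemma vge_power:
 fixes x :: "'a::idom fls"
 assumes "vge c x"
 shows "vge (int n * c) (x ^ n)"
 using assms
 by (cases "x = 0") (auto simp: vge_subdegree fls_subdegree_pow mult_left_mono power_0_left)

lemma vge_one [simp]: "vge c (1 :: 'a::idom fls) \<longleftrightarrow> c \<le> 0"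
 by (simp add: vge_subdegree)

lemma vge_inverse:
 fixes x :: "'a::field fls"
 shows "x \<noteq> 0 ==> vge c (inverse x) \<longleftrightarrow> fls_subdegree x \<le> - c"
 by (auto simp: vge_subdegree)

lemma vge_prod:
 fixes f :: "'b => 'a::idom fls"
 shows "(\<And>i. i \<in> S ==> vge (c i) (f i)) ==> vge (\<Sum>i\<in>S. c i) (\<Prod>i\<in>S. f i)"
 by (induction S rule: infinite_finite_induct) (auto intro: vge_mult)

lemma vge_all_imp_0: "(\<And>c. vge c x) ==> x = 0"
 by (auto simp: vge_def fls_eq_iff intro: less_add_one)

lemma vge_ex: "\<exists>c. vge c x"
 by (rule exI[of _ "fls_subdegree x"]) (simp add: vge_def)

lemma vge_dist: "vge (int n) (x - y) \<longleftrightarrow> dist x y \<le> inverse (2 ^ n)" for x y :: "'a::group_add fls"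
proof (cases "x = y")
 case False
 show ?thesis
 proof (cases "fls_subdegree (x - y) \<ge> 0")
  case True
  then have "dist x y \<le> inverse (2 ^ n) \<longleftrightarrow> (2::real) ^ n \<le> 2 ^ nat (fls_subdegree (x - y))"
   using False by (simp add: dist_fls_def)
  then show ?thesis using False True by (auto simp: vge_subdegree le_nat_iff)
 next
  case neg: False
  then have "dist x y > 1" using False by (simp add: dist_fls_def)
  moreover have "inverse (2 ^ n) \<le> (1::real)" by (simp add: inverse_le_1_iff)
  ultimately show ?thesis using False neg by (auto simp: vge_subdegree)
 qed
qed auto

lemma tendsto_fls_iff:
 fixes l :: "'a::group_add fls"
 shows "(f \<longlongrightarrow> l) F \<longleftrightarrow> (\<forall>c. eventually (\<lambda>x. vge c (f x - l)) F)"
proof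
 assume L: "(f \<longlongrightarrow> l) F"
 show "\<forall>c. eventually (\<lambda>x. vge c (f x - l)) F"
 proof
  fix c
  have "eventually (\<lambda>x. dist (f x) l < inverse (2 ^ nat c)) F"
   using L by (rule tendstoD) simp
  then show "eventually (\<lambda>x. vge c (f x - l)) F"
  proof eventually_elim
   case (elim x)
   then have "vge (int (nat c)) (f x - l)" by (simp only: vge_dist less_imp_le)
   then show ?case by (rule vge_mono) simp
  qed
 qed
next
 assume R: "\<forall>c. eventually (\<lambda>x. vge c (f x - l)) F"
 show "(f \<longlongrightarrow> l) F"
 proof (rule tendstoI)
  fix e :: real assume "e > 0"
  then obtain n where n: "inverse (2 ^ n) < e"
   using real_arch_pow_inv[of e "1/2"] by (auto simp: power_one_over field_simps)
  from R have "eventually (\<lambda>x. vge (int n) (f x - l)) F" by blast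
  then show "eventually (\<lambda>x. dist (f x) l < e) F"
   by eventually_elim (use n in \<open>auto simp: vge_dist\<close>)
 qed
qed

text \<open>Completeness in ultrametric form: it suffices that consecutive differences tend to
  0.\<close>

lemma fls_Cauchy_limit:
 fixes s :: "nat => 'a::ab_group_add fls"
 assumes "\<And>c. \<exists>n0. \<forall>n\<ge>n0. vge c (s (Suc n) - s n)"
 shows "\<exists>l. \<forall>c. \<exists>n0. \<forall>n\<ge>n0. vge c (s n - l)"
proof -
 from assms obtain N where N: "\<And>c n. n \<ge> N c ==> vge c (s (Suc n) - s n)" by metis
 have st: "vge c (s (N c + k) - s (N c))" for c k
 proof (induction k)
  case (Suc k)
  then show ?case using vge_add[OF N[of c "N c + k"] Suc] by simp
 qed simp
 have st2: "vge c (s n - s m)" if "n \<ge> N c" "m \<ge> N c" for c n m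
  using vge_diff[OF st[of c "n - N c"] st[of c "m - N c"]] that by simp
 \<comment> \<open>From stage \<open>N (n + 1)\<close> on the coefficient at \<open>n\<close> no
   longer changes, so it is read off there.\<close>
 define L where "L = Abs_fls (\<lambda>n. s (N (n + 1)) $$ n)"
 have Lnth: "L $$ n = s (N (n + 1)) $$ n" for n
  unfolding L_def
 proof (rule nth_Abs_fls_lower_bound[of "min 0 (fls_subdegree (s (N 0)))"], safe)
  fix k assume k: "k < min 0 (fls_subdegree (s (N 0)))"
  have "vge (k + 1) (s (max (N 0) (N (k + 1))) - s (N (k + 1)))" by (rule st2) auto
  moreover have "vge (k + 1) (s (max (N 0) (N (k + 1))) - s (N 0))"
   by (rule vge_mono[OF st2[of 0]]) (use k in auto)
  ultimately have "s (N (k + 1)) $$ k = s (N 0) $$ k" by (auto simp: vge_def)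
  then show "s (N (k + 1)) $$ k = 0" using k by simp
 qed
 have "vge c (s n - L)" if "n \<ge> N c" for n c
  unfolding vge_def
 proof safe
  fix k assume k: "k < c"
  have "vge c (s (max (N c) (N (k + 1))) - s n)" by (rule st2) (use that in auto)
  moreover have "vge (k + 1) (s (max (N c) (N (k + 1))) - s (N (k + 1)))" by (rule st2) auto
  ultimately have "s n $$ k = s (N (k + 1)) $$ k" using k by (auto simp: vge_def)
  then show "(s n - L) $$ k = 0" by (simp add: Lnth)
 qed
 then show ?thesis by blast
qed

text \<open>A nonzero summand whose valuation is strictly the smallest has nothing to cancel
  against.\<close>

lemma distinct_subdegree_sum_0:
 fixes y :: "'i => 'a::comm_monoid_add fls"
 assumes "finite J" "(\<Sum>j\<in>J. y j) = 0"
  and dist: "\<And>i j. i \<in> J ==> j \<in> J ==> y i \<noteq> 0 ==> y j \<noteq> 0 ==> fls_subdegree (y i) = fls_subdegree (y j) ==> i = j"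
 shows "\<forall>j\<in>J. y j = 0"
proof (rule ccontr)
 assume "\<not> ?thesis"
 then have ne: "{j \<in> J. y j \<noteq> 0} \<noteq> {}" by auto
 define j where "j = arg_min_on (\<lambda>j. fls_subdegree (y j)) {j \<in> J. y j \<noteq> 0}"
 have fin: "finite {j \<in> J. y j \<noteq> 0}" using assms(1) by simp
 have j: "j \<in> J" "y j \<noteq> 0" using arg_min_if_finite(1)[OF fin ne, of "\<lambda>j. fls_subdegree (y j)"] by (auto simp: j_def)
 have min: "fls_subdegree (y j) \<le> fls_subdegree (y i)" if "i \<in> J" "y i \<noteq> 0" for i
  using arg_min_least[OF fin ne, of i] that by (auto simp: j_def)
 have "(\<Sum>i\<in>J. y i) $$ fls_subdegree (y j) = (\<Sum>i\<in>J. if i = j then y j $$ fls_subdegree (y j) else 0)"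
  unfolding fls_nth_sum
 proof (rule sum.cong[OF refl])
  fix i assume i: "i \<in> J"
  show "y i $$ fls_subdegree (y j) = (if i = j then y j $$ fls_subdegree (y j) else 0)"
   using min[OF i] dist[OF i j(1) _ j(2)] by (cases "y i = 0"; cases "i = j") force+
 qed
 also have "\<dots> = y j $$ fls_subdegree (y j)" using assms(1) j(1) by simp
 finally show False using assms(2) j(2) by simp
qed

section \<open>Polynomials in the completed field\<close>

lemma AK_0 [simp]: "AK 0 = 0"
 and AK_1 [simp]: "AK 1 = 1"
 by (simp_all add: A_to_kinf_def)

lemma AK_pCons: "AK (pCons c a) = fls_const c + fls_X_inv * AK a"
 by (simp add: A_to_kinf_def map_poly_pCons)

lemma AK_const: "AK [:c:] = fls_const c"
 by (simp add: AK_pCons)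

lemma AK_add: "AK (a + b) = AK a + AK b"
 by (induction a b rule: poly_induct2) (simp_all add: AK_pCons algebra_simps fls_plus_const[symmetric])

lemma AK_smult: "AK (smult c a) = fls_const c * AK a"
 by (induction a) (simp_all add: AK_pCons algebra_simps flip: fls_const_mult_const)

lemma AK_mult: "AK (a * b) = AK a * AK b"
 by (induction a) (simp_all add: AK_pCons AK_add AK_smult algebra_simps)

lemma AK_minus: "AK (- a) = - AK a"
 by (simp add: eq_neg_iff_add_eq_0 flip: AK_add)

lemma AK_diff: "AK (a - b) = AK a - AK b"
 using AK_add[of a "- b"] by (simp add: AK_minus)

lemma AK_power: "AK (a ^ n) = AK a ^ n"
 by (induction n) (simp_all add: AK_mult)

lemma AK_sum: "AK (\<Sum>i\<in>S. f i) = (\<Sum>i\<in>S. AK (f i))"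
 by (induction S rule: infinite_finite_induct) (simp_all add: AK_add)

lemma AK_prod: "AK (\<Prod>i\<in>S. f i) = (\<Prod>i\<in>S. AK (f i))"
 by (induction S rule: infinite_finite_induct) (simp_all add: AK_mult)

lemmas AK_hom = AK_add AK_mult AK_minus AK_diff
 AK_power AK_sum AK_prod AK_const

lemma AK_monom: "AK (monom c n) = fls_const c * fls_X_inv ^ n"
 by (induction n) (simp_all add: AK_pCons monom_Suc monom_0)

lemma AK_nth: "AK a $$ n = (if n \<le> 0 then coeff a (nat (- n)) else 0)"
proof (induction a arbitrary: n)
 case (pCons c a)
 have "AK (pCons c a) $$ n = (if n = 0 then c else 0) + AK a $$ (n + 1)"
  by (simp add: AK_pCons fls_X_inv_times_conv_shift)
 also have "\<dots> = (if n \<le> 0 then coeff (pCons c a) (nat (- n)) else 0)"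
  by (cases "nat (- n)") (auto simp: pCons.IH coeff_pCons nat_diff_distrib' split: nat.splits)
 finally show ?case .
qed simp

lemma vge_A: "vge (- int d) (AK a) \<longleftrightarrow> degree a \<le> d"
proof
 assume v: "vge (- int d) (AK a)"
 show "degree a \<le> d"
 proof (rule degree_le, safe)
  fix i assume "d < i"
  then have "AK a $$ (- int i) = 0" using v by (auto simp: vge_def)
  then show "coeff a i = 0" by (simp add: AK_nth)
 qed
qed (auto simp: vge_def AK_nth coeff_eq_0)

lemma AK_eq_0_iff [simp]: "AK a = 0 \<longleftrightarrow> a = 0"
proof
 assume "AK a = 0"
 then have "AK a $$ (- int i) = 0" for i by simp
 then show "a = 0" by (simp add: AK_nth poly_eq_iff)
qed simp

lemma AK_inj [simp]: "AK a = AK b \<longleftrightarrow> a = b"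
 using AK_eq_0_iff[of "a - b"] by (simp add: AK_diff del: AK_eq_0_iff)

lemma subdegree_A: "a \<noteq> 0 ==> fls_subdegree (AK a) = - int (degree a)"
 by (rule fls_subdegree_eqI) (auto simp: AK_nth coeff_eq_0)

text \<open>The discreteness of \<open>A\<close>: it turns decay of coefficients into termination in
  \<open>rationality\<close>.\<close>

lemma vge_1_A: "vge 1 (AK a) ==> a = 0"
 by (rule ccontr) (simp add: vge_subdegree subdegree_A)

section \<open>Power series in \<open>t\<close>, twists and convergence\<close>

definition tau :: "nat => 'a::{finite,field} fls fps => 'a fls fps" where
 "tau n f = Abs_fps (\<lambda>k. (f $ k) ^ (CARD('a) ^ n))"

definition emb :: "'a::field poly poly => 'a fls fps" where
 "emb P = Abs_fps (\<lambda>n. AK (coeff P n))"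

definition tw :: "nat => 'a::{finite,field} poly poly => 'a poly poly" where
 "tw n P = map_poly (\<lambda>a. a ^ (CARD('a) ^ n)) P"

definition thA :: "nat => 'a::{finite,field} poly" where
 "thA m = monom 1 (CARD('a) ^ m)"

definition th :: "nat => 'a::{finite,field} fls" where
 "th m = fls_X_inv ^ (CARD('a) ^ m)"

lemma card_power_pos [simp]: "CARD('a::{finite,field}) ^ n > 0"
 using card_ge_2[where 'a = 'a] by simp

lemma card_power_neq0 [simp]: "CARD('a::{finite,field}) ^ n \<noteq> 0"
 using card_power_pos[where 'a = 'a, of n] by simp

lemma zero_power_card [simp]: "(0 :: 'b::semiring_1) ^ (CARD('a::{finite,field}) ^ n) = 0"
 by (simp only: power_0_left card_power_neq0 if_False)

lemma tau_nth [simp]: "tau n f $ k = (f $ k) ^ (CARD('a) ^ n)" for f :: "'a::{finite,field} fls fps"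
 by (simp add: tau_def)

lemma emb_nth [simp]: "emb P $ n = AK (coeff P n)"
 by (simp add: emb_def)

lemma coeff_tw [simp]: "coeff (tw n P) k = coeff P k ^ (CARD('a) ^ n)"
 for P :: "'a::{finite,field} poly poly"
 by (simp add: tw_def coeff_map_poly)

lemma fls_frob_add: "(x + y) ^ (CARD('a) ^ n) = x ^ (CARD('a) ^ n) + y ^ (CARD('a) ^ n)" for x y :: "'a::{finite,field} fls"
 by (rule frobenius_add) simp
lemma fls_frob_diff: "(x - y) ^ (CARD('a) ^ n) = x ^ (CARD('a) ^ n) - y ^ (CARD('a) ^ n)" for x y :: "'a::{finite,field} fls"
 by (rule frobenius_diff) simp
lemma fls_frob_minus: "(- x) ^ (CARD('a) ^ n) = - (x ^ (CARD('a) ^ n))" for x y :: "'a::{finite,field} fls"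
 by (rule frobenius_minus) simp
lemma fls_frob_sum: "(\<Sum>i\<in>S. g i) ^ (CARD('a) ^ n) = (\<Sum>i\<in>S. g i ^ (CARD('a) ^ n))" for g :: "'b => 'a::{finite,field} fls"
 by (rule frobenius_sum) simp
lemma poly_frob_add: "(x + y) ^ (CARD('a) ^ n) = x ^ (CARD('a) ^ n) + y ^ (CARD('a) ^ n)" for x y :: "'a::{finite,field} poly"
 by (rule frobenius_add) simp
lemma poly_frob_diff: "(x - y) ^ (CARD('a) ^ n) = x ^ (CARD('a) ^ n) - y ^ (CARD('a) ^ n)" for x y :: "'a::{finite,field} poly"
 by (rule frobenius_diff) simp
lemma poly_frob_minus: "(- x) ^ (CARD('a) ^ n) = - (x ^ (CARD('a) ^ n))" for x y :: "'a::{finite,field} poly"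
 by (rule frobenius_minus) simp
lemma poly_frob_sum: "(\<Sum>i\<in>S. g i) ^ (CARD('a) ^ n) = (\<Sum>i\<in>S. g i ^ (CARD('a) ^ n))" for g :: "'b => 'a::{finite,field} poly"
 by (rule frobenius_sum) simp

lemma tau_0 [simp]: "tau n 0 = 0" by (simp add: fps_eq_iff)
lemma tau_1 [simp]: "tau n 1 = 1" by (simp add: fps_eq_iff)
lemma tau_const [simp]: "tau n (fps_const x :: 'a::{finite,field} fls fps) = fps_const (x ^ (CARD('a) ^ n))"
 by (simp add: fps_eq_iff)
lemma tau_X [simp]: "tau n fps_X = fps_X" by (simp add: fps_eq_iff)
lemma tau_add [simp]: "tau n (f + g) = tau n f + tau n g" by (simp add: fps_eq_iff fls_frob_add)
lemma tau_diff [simp]: "tau n (f - g) = tau n f - tau n g" by (simp add: fps_eq_iff fls_frob_diff)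
lemma tau_mult [simp]: "tau n (f * g) = tau n f * tau n g"
 by (simp add: fps_eq_iff fps_mult_nth fls_frob_sum power_mult_distrib)
lemma tau_power [simp]: "tau n (f ^ k) = tau n f ^ k" by (induction k) simp_all
lemma tau_sum: "tau n (\<Sum>i\<in>S. f i) = (\<Sum>i\<in>S. tau n (f i))" by (induction S rule: infinite_finite_induct) simp_all
lemma tau_prod: "tau n (\<Prod>i\<in>S. f i) = (\<Prod>i\<in>S. tau n (f i))" by (induction S rule: infinite_finite_induct) simp_all
lemma tau_tau: "tau m (tau n f) = tau (m + n) f"
 by (simp add: fps_eq_iff power_add mult.commute flip: power_mult)
lemma tau_0_left [simp]: "tau 0 f = f" by (simp add: fps_eq_iff)
lemma tau_eq_0_iff [simp]: "tau n f = 0 \<longleftrightarrow> f = 0" by (simp add: fps_eq_iff)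

lemma emb_0 [simp]: "emb 0 = 0" by (simp add: fps_eq_iff)
lemma emb_1 [simp]: "emb 1 = 1" by (simp add: fps_eq_iff)
lemma emb_add: "emb (P + Q) = emb P + emb Q" by (simp add: fps_eq_iff AK_add)
lemma emb_diff: "emb (P - Q) = emb P - emb Q" by (simp add: fps_eq_iff AK_diff)
lemma emb_minus: "emb (- P) = - emb P" by (simp add: fps_eq_iff AK_minus)
lemma emb_mult: "emb (P * Q) = emb P * emb Q"
 by (simp add: fps_eq_iff fps_mult_nth coeff_mult AK_hom atMost_atLeast0)
lemma emb_power: "emb (P ^ n) = emb P ^ n" by (induction n) (simp_all add: emb_mult)
lemma emb_sum: "emb (\<Sum>i\<in>S. f i) = (\<Sum>i\<in>S. emb (f i))"
 by (induction S rule: infinite_finite_induct) (simp_all add: emb_add)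
lemma emb_const: "emb [:a:] = fps_const (AK a)"
 by (simp add: fps_eq_iff coeff_pCons split: nat.split)
lemma emb_pCons: "emb (pCons a P) = fps_const (AK a) + fps_X * emb P"
 by (simp add: fps_eq_iff coeff_pCons split: nat.split)
lemma emb_eq_0_iff [simp]: "emb P = 0 \<longleftrightarrow> P = 0" by (simp add: fps_eq_iff poly_eq_iff[of P])
lemma emb_eq_iff [simp]: "emb P = emb Q \<longleftrightarrow> P = Q" by (simp add: fps_eq_iff poly_eq_iff[of P])

lemma tau_emb: "tau n (emb P) = emb (tw n P)" by (simp add: fps_eq_iff AK_power)

lemma tw_0 [simp]: "tw n 0 = 0" by (rule poly_eqI) simp
lemma tw_1 [simp]: "tw n 1 = 1" using tau_emb[of n 1] by (metis emb_1 emb_eq_iff tau_1)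
lemma tw_add: "tw n (P + Q) = tw n P + tw n Q" by (rule poly_eqI) (simp add: poly_frob_add)
lemma tw_diff: "tw n (P - Q) = tw n P - tw n Q" by (rule poly_eqI) (simp add: poly_frob_diff)
lemma tw_mult: "tw n (P * Q) = tw n P * tw n Q"
 by (rule poly_eqI) (simp add: coeff_mult poly_frob_sum power_mult_distrib)
lemma tw_power: "tw n (P ^ k) = tw n P ^ k" by (induction k) (simp_all add: tw_mult)
lemma tw_sum: "tw n (\<Sum>i\<in>S. f i) = (\<Sum>i\<in>S. tw n (f i))"
 by (induction S rule: infinite_finite_induct) (simp_all add: tw_add)
lemma tw_prod: "tw n (\<Prod>i\<in>S. f i) = (\<Prod>i\<in>S. tw n (f i))"
 by (induction S rule: infinite_finite_induct) (simp_all add: tw_mult)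
lemma tw_0_left [simp]: "tw 0 P = P" by (rule poly_eqI) simp
lemma tw_eq_0_iff [simp]: "tw n P = 0 \<longleftrightarrow> P = 0" unfolding tw_def by (rule map_poly_eq_0_iff) simp_all
lemma tw_pCons [simp]: "tw n (pCons a P :: 'a::{finite,field} poly poly) = pCons (a ^ (CARD('a) ^ n)) (tw n P)"
 by (rule poly_eqI) (simp add: coeff_pCons split: nat.split)
lemma degree_tw [simp]: "degree (tw n P) = degree P"
 unfolding tw_def by (rule degree_map_poly) simp

lemma poly_tw: "poly (tw n P) (x ^ (CARD('a) ^ n)) = poly P x ^ (CARD('a) ^ n)" for P :: "'a::{finite,field} poly poly"
 by (induction P) (simp_all add: poly_frob_add power_mult_distrib)

lemma AK_thA [simp]: "AK (thA m) = th m"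
 by (simp add: thA_def th_def AK_monom)
lemma thA_power [simp]: "thA m ^ (CARD('a) ^ n) = (thA (m + n) :: 'a::{finite,field} poly)"
 by (simp add: thA_def monom_power power_add)
lemma th_power [simp]: "th m ^ (CARD('a) ^ n) = (th (m + n) :: 'a::{finite,field} fls)"
 by (simp add: th_def power_add flip: power_mult)
lemma th_eq_0 [simp]: "th m \<noteq> 0" by (simp add: th_def)
lemma subdegree_th [simp]: "fls_subdegree (th m :: 'a::{finite,field} fls) = - (int CARD('a) ^ m)"
 by (simp add: th_def)
lemma th_inj [simp]: "th m = (th n :: 'a::{finite,field} fls) \<longleftrightarrow> m = n"
proof
 assume "th m = (th n :: 'a fls)"
 then have "fls_subdegree (th m :: 'a fls) = fls_subdegree (th n :: 'a fls)" by simp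
 then have "CARD('a) ^ m = CARD('a) ^ n" by (simp flip: of_nat_power)
 then show "m = n" using card_ge_2[where 'a = 'a] by (simp add: power_inject_exp)
qed simp
lemma thA_inj [simp]: "thA m = (thA n :: 'a::{finite,field} poly) \<longleftrightarrow> m = n"
 using th_inj[of m n, where 'a = 'a] AK_inj[of "thA m" "thA n"] by (metis AK_thA)
lemma degree_thA [simp]: "degree (thA m :: 'a::{finite,field} poly) = CARD('a) ^ m"
 by (simp add: thA_def degree_monom_eq)
lemma poly_tw_thA: "poly (tw n P) (thA (m + n)) = poly P (thA m) ^ (CARD('a) ^ n)" for P :: "'a::{finite,field} poly poly"
 using poly_tw[of n P "thA m"] by simp

text \<open>\<open>NB r c f\<close> bounds by \<open>c\<close> the degrees of the terms of \<open>f\<close> on the disc \<open>deg t \<le> r\<close>, and \<open>DD r f\<close> is convergence on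
 that disc; below, \<open>Ev r \<alpha> f x\<close> means that \<open>f\<close> takes the value \<open>x\<close> at the point \<open>\<alpha>\<close> of the disc.\<close>

definition NB :: "int => int => 'a::zero fls fps => bool" where
 "NB r c f \<longleftrightarrow> (\<forall>n. vge (r * int n - c) (f $ n))"

definition DD :: "int => 'a::zero fls fps => bool" where
 "DD r f \<longleftrightarrow> (\<forall>M. \<exists>n0. \<forall>n\<ge>n0. vge (r * int n + M) (f $ n))"

lemma NB_add: "NB r c f ==> NB r c g ==> NB r c (f + g :: 'a::monoid_add fls fps)"
 by (auto simp: NB_def intro: vge_add)
lemma NB_diff: "NB r c f ==> NB r c g ==> NB r c (f - g :: 'a::group_add fls fps)"
 by (auto simp: NB_def intro: vge_diff)
lemma NB_0 [simp]: "NB r c 0" by (simp add: NB_def)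
lemma NB_sum: "(\<And>i. i \<in> S ==> NB r c (f i)) ==> NB r c (\<Sum>i\<in>S. f i :: 'a::comm_monoid_add fls fps)"
 by (induction S rule: infinite_finite_induct) (auto intro: NB_add)
lemma NB_mono: "NB r c f ==> c \<le> d ==> NB r d f"
 by (auto simp: NB_def intro: vge_mono)
lemma NB_mono_r: "NB r c f ==> r' \<le> r ==> NB r' c f"
 unfolding NB_def by (metis vge_mono diff_right_mono mult_right_mono of_nat_0_le_iff)
lemma NB_mult:
 fixes f g :: "'a::idom fls fps"
 assumes "NB r c f" "NB r d g" shows "NB r (c + d) (f * g)"
 unfolding NB_def fps_mult_nth
proof (intro allI vge_sum)
 fix n i :: nat assume "i \<in> {0..n}"
 then have i: "i \<le> n" by simp
 have "vge ((r * int i - c) + (r * int (n - i) - d)) (f $ i * g $ (n - i))"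
  using assms by (intro vge_mult) (auto simp: NB_def)
 then show "vge (r * int n - (c + d)) (f $ i * g $ (n - i))"
  by (rule vge_mono) (simp add: i of_nat_diff algebra_simps)
qed
lemma NB_power:
 fixes f :: "'a::idom fls fps"
 assumes "NB r c f" shows "NB r (int n * c) (f ^ n)"
proof (induction n)
 case 0 show ?case by (auto simp: NB_def fps_one_def)
next
 case (Suc n) then show ?case using NB_mult[OF assms Suc] by (simp add: algebra_simps)
qed
lemma NB_const: "vge (- c) x ==> NB r c (fps_const x)"
 by (auto simp: NB_def)
lemma NB_1: "NB r 0 (1 :: 'a::idom fls fps)" by (auto simp: NB_def fps_one_def)
lemma NB_X: "NB r r (fps_X :: 'a::idom fls fps)" by (auto simp: NB_def fps_X_def)
lemma NB_tau:
 fixes f :: "'a::{finite,field} fls fps"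
 assumes "NB r c f" shows "NB (int (CARD('a) ^ n) * r) (int (CARD('a) ^ n) * c) (tau n f)"
 unfolding NB_def
proof
 fix k
 have "vge (r * int k - c) (f $ k)" using assms by (simp add: NB_def)
 from vge_power[OF this, of "CARD('a) ^ n"] show "vge (int (CARD('a) ^ n) * r * int k - int (CARD('a) ^ n) * c) (tau n f $ k)"
  by (simp add: algebra_simps)
qed

lemma DD_NB: assumes "DD r (f :: 'a::zero fls fps)" shows "\<exists>c\<ge>0. NB r c f"
proof -
 from assms obtain n0 where n0: "\<forall>n\<ge>n0. vge (r * int n + 0) (f $ n)" unfolding DD_def by blast
 define v where "v n = fls_subdegree (f $ n)" for n
 have v: "vge (v n) (f $ n)" for n by (simp add: v_def vge_def)
 define c where "c = (\<Sum>n<n0. \<bar>r * int n - v n\<bar>)"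
 have c0: "c \<ge> 0" by (simp add: c_def sum_nonneg)
 have "vge (r * int n - c) (f $ n)" for n
 proof (cases "n < n0")
  case True
  have "\<bar>r * int n - v n\<bar> \<le> c" unfolding c_def by (rule member_le_sum) (use True in auto)
  then show ?thesis by - (rule vge_mono[OF v[of n]], linarith)
 next
  case False then show ?thesis using n0 c0 by - (rule vge_mono[of "r * int n + 0"], auto)
 qed
 then show ?thesis using c0 by (auto simp: NB_def)
qed

lemma DD_add: "DD r f ==> DD r g ==> DD r (f + g :: 'a::monoid_add fls fps)"
 unfolding DD_def
proof
 fix M assume "\<forall>M. \<exists>n0. \<forall>n\<ge>n0. vge (r * int n + M) (f $ n)" "\<forall>M. \<exists>n0. \<forall>n\<ge>n0. vge (r * int n + M) (g $ n)"
 then obtain n1 n2 where "\<forall>n\<ge>n1. vge (r * int n + M) (f $ n)" "\<forall>n\<ge>n2. vge (r * int n + M) (g $ n)" by metis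
 then show "\<exists>n0. \<forall>n\<ge>n0. vge (r * int n + M) ((f + g) $ n)"
  by (intro exI[of _ "max n1 n2"]) (auto intro: vge_add)
qed
lemma DD_uminus [simp]: "DD r (- f :: 'a::group_add fls fps) \<longleftrightarrow> DD r f" by (simp add: DD_def)
lemma DD_diff: "DD r f ==> DD r g ==> DD r (f - g :: 'a::ab_group_add fls fps)"
 using DD_add[of r f "- g"] by simp
lemma DD_eventually_0: assumes "\<And>n. n \<ge> n0 ==> f $ n = 0" shows "DD r f"
 unfolding DD_def using assms by (auto intro!: exI[of _ n0])
lemma DD_0 [simp]: "DD r 0" by (rule DD_eventually_0) simp
lemma DD_const [simp]: "DD r (fps_const x)" by (rule DD_eventually_0[of 1]) simp
lemma DD_1 [simp]: "DD r (1 :: 'a::zero_neq_one fls fps)" by (rule DD_eventually_0[of 1]) simp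
lemma DD_X [simp]: "DD r (fps_X :: 'a::zero_neq_one fls fps)" by (rule DD_eventually_0[of 2]) simp
lemma DD_emb [simp]: "DD r (emb P)" by (rule DD_eventually_0[of "Suc (degree P)"]) (simp add: coeff_eq_0)
lemma DD_mono: assumes "DD r f" "r' \<le> r" shows "DD r' f"
 unfolding DD_def
proof
 fix M
 obtain n0 where "\<forall>n\<ge>n0. vge (r * int n + M) (f $ n)" using assms(1) unfolding DD_def by blast
 moreover have "r' * int n + M \<le> r * int n + M" for n using assms(2) by (simp add: mult_right_mono)
 ultimately show "\<exists>n0. \<forall>n\<ge>n0. vge (r' * int n + M) (f $ n)"
  using vge_mono by blast
qed
lemma DD_mult:
 fixes f g :: "'a::idom fls fps"
 assumes "DD r f" "DD r g" shows "DD r (f * g)"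
 unfolding DD_def
proof
 fix M
 obtain c d where c: "NB r c f" "c \<ge> 0" and d: "NB r d g" "d \<ge> 0" using DD_NB assms by metis
 obtain n1 n2 where n1: "\<forall>n\<ge>n1. vge (r * int n + (M + d)) (f $ n)"
  and n2: "\<forall>n\<ge>n2. vge (r * int n + (M + c)) (g $ n)" using assms unfolding DD_def by metis
 have "vge (r * int n + M) ((f * g) $ n)" if n: "n \<ge> n1 + n2" for n
  unfolding fps_mult_nth
 proof (rule vge_sum)
  fix i :: nat assume "i \<in> {0..n}" then have i: "i \<le> n" by simp
  show "vge (r * int n + M) (f $ i * g $ (n - i))"
  proof (cases "i \<ge> n1")
   case True
   then have "vge ((r * int i + (M + d)) + (r * int (n - i) - d)) (f $ i * g $ (n - i))"
    using n1 d by (intro vge_mult) (auto simp: NB_def)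
   then show ?thesis by (rule vge_mono) (simp add: i of_nat_diff algebra_simps)
  next
   case False
   then have "vge ((r * int i - c) + (r * int (n - i) + (M + c))) (f $ i * g $ (n - i))"
    using n2[rule_format, of "n - i"] c(1)[unfolded NB_def, rule_format, of i] n by (intro vge_mult) (assumption, linarith)
   then show ?thesis by (rule vge_mono) (simp add: i of_nat_diff algebra_simps)
  qed
 qed
 then show "\<exists>n0. \<forall>n\<ge>n0. vge (r * int n + M) ((f * g) $ n)" by blast
qed
lemma DD_power: "DD r f ==> DD r (f ^ n)" for f :: "'a::idom fls fps"
 by (induction n) (auto intro: DD_mult)
lemma DD_sum: "(\<And>i. i \<in> S ==> DD r (f i)) ==> DD r (\<Sum>i\<in>S. f i :: 'a::comm_monoid_add fls fps)"
 by (induction S rule: infinite_finite_induct) (auto intro: DD_add)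
lemma DD_prod: "(\<And>i. i \<in> S ==> DD r (f i)) ==> DD r (\<Prod>i\<in>S. f i :: 'a::idom fls fps)"
 by (induction S rule: infinite_finite_induct) (auto intro: DD_mult)
text \<open>The twist multiplies valuations by \<open>q^n\<close>, so the disc of convergence grows
  from \<open>r\<close> to \<open>q^n * r\<close>. This makes room for the zeros at the powers
  \<open>\<theta>^(q^m)\<close>.\<close>

lemma DD_tau:
 fixes f :: "'a::{finite,field} fls fps"
 assumes "DD r f" shows "DD (int (CARD('a) ^ n) * r) (tau n f)"
 unfolding DD_def
proof
 fix M
 let ?q = "int (CARD('a) ^ n)"
 obtain n0 where n0: "\<forall>k\<ge>n0. vge (r * int k + \<bar>M\<bar>) (f $ k)" using assms unfolding DD_def by blast
 have "vge (?q * r * int k + M) (tau n f $ k)" if "k \<ge> n0" for k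
 proof -
  have "vge (?q * (r * int k + \<bar>M\<bar>)) (tau n f $ k)" using vge_power[OF n0[rule_format, OF that], of "CARD('a) ^ n"] by simp
  moreover have "1 * \<bar>M\<bar> \<le> ?q * \<bar>M\<bar>" using card_power_pos[where 'a = 'a, of n] by (intro mult_right_mono) linarith+
  then have "M \<le> ?q * \<bar>M\<bar>" by linarith
  ultimately show ?thesis by - (erule vge_mono, simp only: distrib_left mult.assoc add_left_mono)
 qed
 then show "\<exists>n0. \<forall>k\<ge>n0. vge (?q * r * int k + M) (tau n f $ k)" by blast
qed
lemma DD_limit:
 assumes "\<And>M. \<exists>g. DD r g \<and> NB r M (f - g)" shows "DD r (f :: 'a::ab_group_add fls fps)"
 unfolding DD_def
proof
 fix M
 obtain g where g: "DD r g" "NB r (- M) (f - g)" using assms by blast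
 then obtain n0 where n0: "\<forall>n\<ge>n0. vge (r * int n + M) (g $ n)" unfolding DD_def by blast
 have "vge (r * int n + M) (f $ n)" if "n \<ge> n0" for n
 proof -
  have "vge (r * int n + M) ((f - g) $ n + g $ n)"
   using n0 that g(2) by (intro vge_add) (auto simp: NB_def)
  then show ?thesis by simp
 qed
 then show "\<exists>n0. \<forall>n\<ge>n0. vge (r * int n + M) (f $ n)" by blast
qed

section \<open>Evaluation of convergent power series\<close>

text \<open>Evaluation is encoded as division by \<open>X - \<alpha>\<close> with a convergent
  quotient and the value as remainder. Multiplicativity is then plain algebra, and at a zero the
  quotient that Schwarz' lemma needs is at hand.\<close>

definition Ev :: "int => 'a::field fls => 'a fls fps => 'a fls => bool" where
 "Ev r \<alpha> f x \<longleftrightarrow> vge (- r) \<alpha> \<and> (\<exists>F. DD r F \<and> f = fps_const x + (fps_X - fps_const \<alpha>) * F)"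

lemma linear_factor_nth:
 "(fps_const x + (fps_X - fps_const \<alpha>) * F) $ n = (if n = 0 then x - \<alpha> * F $ 0 else F $ (n - 1) - \<alpha> * F $ n)"
 for x :: "'a::field fls"
 by (cases n) (simp_all add: algebra_simps)

text \<open>The maximum principle. Iterating \<open>F_n = f_(n+1) + \<alpha> F_(n+1)\<close>
  expresses \<open>F_n\<close> by coefficients of \<open>f\<close> and one remote coefficient of
  \<open>F\<close>, which convergence makes harmless.\<close>

lemma NB_quotient:
 fixes \<alpha> :: "'a::field fls"
 assumes \<alpha>: "vge (- r) \<alpha>" and F: "DD r F" and f: "f = fps_const x + (fps_X - fps_const \<alpha>) * F" and c: "NB r c f"
 shows "NB r (c - r) F" "vge (- c) x"
proof -
 have fn: "f $ Suc n = F $ n - \<alpha> * F $ Suc n" for n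
  by (simp add: f linear_factor_nth del: fps_add_nth)
 have A: "vge (r * int (n + 1) - c) (F $ n - \<alpha> ^ k * F $ (n + k))" for n k
 proof (induction k)
  case (Suc k)
  have "vge (int k * (- r) + (r * int (Suc (n + k)) - c)) (\<alpha> ^ k * f $ Suc (n + k))"
   by (intro vge_mult vge_power \<alpha> c[unfolded NB_def, rule_format, of "Suc (n + k)"])
  then have "vge (r * int (n + 1) - c) (\<alpha> ^ k * f $ Suc (n + k))" by (simp add: algebra_simps)
  from vge_add[OF Suc this] show ?case by (simp add: fn algebra_simps)
 qed simp
 have B: "vge (r * int (n + 1) - c) (F $ n)" for n
 proof -
  obtain n0 where n0: "\<forall>m\<ge>n0. vge (r * int m + (r - c)) (F $ m)" using F unfolding DD_def by blast
  have "vge (int n0 * (- r) + (r * int (n + n0) + (r - c))) (\<alpha> ^ n0 * F $ (n + n0))"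
   using n0[rule_format, of "n + n0"] by (intro vge_mult vge_power \<alpha>) simp
  then have "vge (r * int (n + 1) - c) (\<alpha> ^ n0 * F $ (n + n0))" by (simp add: algebra_simps)
  from vge_add[OF A[of n n0] this] show ?thesis by simp
 qed
 show "NB r (c - r) F" unfolding NB_def using B by (simp add: algebra_simps)
 have "vge (- c) (f $ 0)" using c unfolding NB_def by (metis diff_0 mult_zero_right of_nat_0)
 moreover have "vge ((- r) + (r * int (0 + 1) - c)) (\<alpha> * F $ 0)" by (intro vge_mult \<alpha> B)
 ultimately have "vge (- c) (f $ 0 + \<alpha> * F $ 0)" by (intro vge_add) simp_all
 then show "vge (- c) x" by (simp add: f linear_factor_nth del: fps_add_nth)
qed

lemma Ev_bound: "Ev r \<alpha> f x ==> NB r c f ==> vge (- c) x"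
 unfolding Ev_def using NB_quotient(2) by metis

lemma Ev_const: "vge (- r) \<alpha> ==> Ev r \<alpha> (fps_const x) x"
 unfolding Ev_def by (intro conjI exI[of _ 0]) auto
lemma Ev_0: "vge (- r) \<alpha> ==> Ev r \<alpha> 0 0" using Ev_const[of r \<alpha> 0] by simp
lemma Ev_1: "vge (- r) \<alpha> ==> Ev r \<alpha> 1 1" using Ev_const[of r \<alpha> 1] by simp
lemma Ev_X: "vge (- r) \<alpha> ==> Ev r \<alpha> fps_X \<alpha>"
 unfolding Ev_def by (intro conjI exI[of _ 1]) auto

lemma Ev_add: assumes "Ev r \<alpha> f x" "Ev r \<alpha> g y" shows "Ev r \<alpha> (f + g) (x + y)"
proof -
 from assms obtain F G where "DD r F" "f = fps_const x + (fps_X - fps_const \<alpha>) * F"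
  "DD r G" "g = fps_const y + (fps_X - fps_const \<alpha>) * G" unfolding Ev_def by blast
 moreover from this have "f + g = fps_const (x + y) + (fps_X - fps_const \<alpha>) * (F + G)"
  by (simp only: flip: fps_const_add) (simp add: algebra_simps)
 ultimately show ?thesis using assms unfolding Ev_def by (blast intro: DD_add)
qed
lemma Ev_uminus: assumes "Ev r \<alpha> f x" shows "Ev r \<alpha> (- f) (- x)"
proof -
 from assms obtain F where "DD r F" "f = fps_const x + (fps_X - fps_const \<alpha>) * F" unfolding Ev_def by blast
 moreover from this have "- f = fps_const (- x) + (fps_X - fps_const \<alpha>) * (- F)"
  by (simp only: flip: fps_const_neg) (simp add: algebra_simps)
 ultimately show ?thesis using assms unfolding Ev_def by (metis DD_uminus)
qed
lemma Ev_diff: "Ev r \<alpha> f x ==> Ev r \<alpha> g y ==> Ev r \<alpha> (f - g) (x - y)"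
 using Ev_add[OF _ Ev_uminus, of r \<alpha> f x g y] by simp
lemma Ev_DD: "Ev r \<alpha> f x ==> DD r f"
 unfolding Ev_def by (auto intro!: DD_add DD_mult DD_diff)
lemma Ev_mult: assumes "Ev r \<alpha> f x" "Ev r \<alpha> g y" shows "Ev r \<alpha> (f * g) (x * y)"
proof -
 from assms obtain F G where F: "DD r F" "f = fps_const x + (fps_X - fps_const \<alpha>) * F"
  and G: "DD r G" "g = fps_const y + (fps_X - fps_const \<alpha>) * G" unfolding Ev_def by blast
 have "f * g = fps_const (x * y) + (fps_X - fps_const \<alpha>) * (fps_const x * G + g * F)"
  unfolding F(2) G(2) by (simp add: algebra_simps flip: fps_const_mult)
 then show ?thesis using assms F G Ev_DD[OF assms(2)] unfolding Ev_def
  by (intro conjI exI[of _ "fps_const x * G + g * F"]) (auto intro!: DD_add DD_mult)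
qed
lemma Ev_power: "Ev r \<alpha> f x ==> Ev r \<alpha> (f ^ n) (x ^ n)"
 by (induction n) (simp_all add: Ev_mult, simp add: Ev_def Ev_1[unfolded Ev_def])
lemma Ev_sum: "vge (- r) \<alpha> ==> (\<And>i. i \<in> S ==> Ev r \<alpha> (f i) (x i)) ==> Ev r \<alpha> (\<Sum>i\<in>S. f i) (\<Sum>i\<in>S. x i)"
 by (induction S rule: infinite_finite_induct) (auto intro: Ev_add Ev_0)
lemma Ev_prod: "vge (- r) \<alpha> ==> (\<And>i. i \<in> S ==> Ev r \<alpha> (f i) (x i)) ==> Ev r \<alpha> (\<Prod>i\<in>S. f i) (\<Prod>i\<in>S. x i)"
 by (induction S rule: infinite_finite_induct) (auto intro: Ev_mult Ev_1)
lemma Ev_emb: "vge (- r) (AK a) ==> Ev r (AK a) (emb P) (AK (poly P a))"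
 by (induction P) (auto simp: emb_pCons AK_hom intro!: Ev_add Ev_mult Ev_const Ev_X Ev_0)
lemma Ev_unique: assumes "Ev r \<alpha> f x" "Ev r \<alpha> f y" shows "x = y"
proof -
 have "Ev r \<alpha> 0 (x - y)" using Ev_diff[OF assms] by simp
 then have "vge c (x - y)" for c using Ev_bound[of r \<alpha> 0 _ "- c"] by simp
 then show ?thesis using vge_all_imp_0[of "x - y"] by simp
qed
text \<open>The tails \<open>L n\<close>, the limits of
  \<open>\<Sum>k<m. \<alpha>^k * f_(n+k)\<close>, satisfy
  \<open>L n = f_n + \<alpha> * L (n+1)\<close>. So \<open>L 0\<close> is the value and the later
  tails are the coefficients of the quotient.\<close>

lemma Ev_exists:
 assumes \<alpha>: "vge (- r) \<alpha>" and f: "DD r f" shows "\<exists>x. Ev r \<alpha> f (x :: 'a::field fls)"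
proof -
 define S where "S n m = (\<Sum>k<m. \<alpha> ^ k * f $ (n + k))" for n m
 have trm: "vge (r * int n + M) (\<alpha> ^ k * f $ (n + k))" if "vge (r * int (n + k) + M) (f $ (n + k))" for n k M
  using vge_mult[OF vge_power[OF \<alpha>, of k] that] by (simp add: algebra_simps)
 have "\<exists>l. \<forall>c. \<exists>m0. \<forall>m\<ge>m0. vge c (S n m - l)" for n
 proof (rule fls_Cauchy_limit)
  fix c
  obtain n0 where n0: "\<forall>m\<ge>n0. vge (r * int m + (c - r * int n)) (f $ m)" using f unfolding DD_def by blast
  show "\<exists>m0. \<forall>m\<ge>m0. vge c (S n (Suc m) - S n m)"
  proof (intro exI[of _ n0] allI impI)
   fix m assume "n0 \<le> m"
   then show "vge c (S n (Suc m) - S n m)" using trm[OF n0[rule_format, of "n + m"]] by (simp add: S_def)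
  qed
 qed
 then obtain L where L: "\<And>n c. \<exists>m0. \<forall>m\<ge>m0. vge c (S n m - L n)" by metis
 have rec: "L n = f $ n + \<alpha> * L (Suc n)" for n
 proof -
  obtain v where v: "vge v \<alpha>" using vge_ex by blast
  have "vge c (L n - (f $ n + \<alpha> * L (Suc n)))" for c
  proof -
   obtain m1 m2 where m1: "\<forall>m\<ge>m1. vge c (S n m - L n)" and m2: "\<forall>m\<ge>m2. vge (c - v) (S (Suc n) m - L (Suc n))"
    using L by metis
   define m where "m = max m1 m2"
   have SS: "S n (Suc m) = f $ n + \<alpha> * S (Suc n) m"
    unfolding S_def by (subst sum.lessThan_Suc_shift) (simp add: sum_distrib_left algebra_simps)
   have "vge c (S n (Suc m) - L n)" using m1 by (simp add: m_def)
   moreover have "vge c (\<alpha> * (S (Suc n) m - L (Suc n)))" using vge_mult[OF v, of "c - v"] m2 by (simp add: m_def)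
   ultimately have "vge c (\<alpha> * (S (Suc n) m - L (Suc n)) - (S n (Suc m) - L n))" by (rule vge_diff[rotated])
   then show ?thesis by (simp add: SS algebra_simps)
  qed
  then show ?thesis using vge_all_imp_0[of "L n - (f $ n + \<alpha> * L (Suc n))"] by simp
 qed
 have Lb: "\<exists>n0. \<forall>n\<ge>n0. vge (r * int n + M) (L n)" for M
 proof -
  obtain n0 where n0: "\<forall>m\<ge>n0. vge (r * int m + M) (f $ m)" using f unfolding DD_def by blast
  have "vge (r * int n + M) (L n)" if "n \<ge> n0" for n
  proof -
   obtain m where "vge (r * int n + M) (S n m - L n)" using L by blast
   moreover have "vge (r * int n + M) (S n m)" unfolding S_def by (intro vge_sum trm n0[rule_format]) (use that in simp)
   ultimately have "vge (r * int n + M) (S n m - (S n m - L n))" by (rule vge_diff[rotated])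
   then show ?thesis by simp
  qed
  then show ?thesis by blast
 qed
 define F where "F = Abs_fps (\<lambda>n. L (Suc n))"
 have "DD r F" unfolding DD_def
 proof
  fix M
  obtain n0 where "\<forall>n\<ge>n0. vge (r * int n + (M - r)) (L n)" using Lb by blast
  then have "\<forall>n\<ge>n0. vge (r * int (Suc n) + (M - r)) (L (Suc n))" by (metis le_SucI)
  then show "\<exists>n0. \<forall>n\<ge>n0. vge (r * int n + M) (F $ n)" by (auto simp: F_def algebra_simps)
 qed
 moreover have "f = fps_const (L 0) + (fps_X - fps_const \<alpha>) * F"
 proof (rule fps_ext)
  fix n show "f $ n = (fps_const (L 0) + (fps_X - fps_const \<alpha>) * F) $ n"
   using rec[of n] unfolding linear_factor_nth by (cases n) (simp_all add: F_def)
 qed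
 ultimately show ?thesis using \<alpha> unfolding Ev_def by blast
qed
lemma Ev_mono: assumes "Ev r \<alpha> f x" "r' \<le> r" "vge (- r') \<alpha>" shows "Ev r' \<alpha> f x"
 using assms DD_mono unfolding Ev_def by blast
lemma Ev_tau:
 fixes \<alpha> :: "'a::{finite,field} fls"
 assumes "Ev r \<alpha> f x"
 shows "Ev (int (CARD('a) ^ n) * r) (\<alpha> ^ (CARD('a) ^ n)) (tau n f) (x ^ (CARD('a) ^ n))"
proof -
 from assms obtain F where F: "vge (- r) \<alpha>" "DD r F" "f = fps_const x + (fps_X - fps_const \<alpha>) * F" unfolding Ev_def by blast
 have "vge (- (int (CARD('a) ^ n) * r)) (\<alpha> ^ (CARD('a) ^ n))" using vge_power[OF F(1), of "CARD('a) ^ n"] by simp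
 then show ?thesis using DD_tau[OF F(2), of n] F(3) unfolding Ev_def by (intro conjI exI[of _ "tau n F"]) auto
qed

section \<open>Counting and Siegel's lemma\<close>

text \<open>The nested form \<open>PS (PS UNIV T) D\<close> is the box of elements of
  \<open>A[t]\<close> of degree below \<open>D\<close> in \<open>t\<close> and below
  \<open>T\<close> in \<open>\<theta>\<close>; it is a finite additive group of known size.\<close>

definition PS :: "'b::zero set => nat => 'b poly set" where
 "PS C d = {p. (\<forall>i<d. coeff p i \<in> C) \<and> (\<forall>i\<ge>d. coeff p i = 0)}"

lemma bij_PS:
 fixes C :: "'b::zero set"
 shows "bij_betw (\<lambda>p. restrict (coeff p) {..<d}) (PS C d) (PiE {..<d} (\<lambda>_. C))"
proof -
 define g where "g h = Abs_poly (\<lambda>i. if i < d then h i else 0)" for h :: "nat => 'b"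
 have "coeff (g h) = (\<lambda>i. if i < d then h i else 0)" for h
  unfolding g_def by (rule coeff_Abs_poly[of d]) simp
 then have co: "coeff (g h) i = (if i < d then h i else 0)" for h i by simp
 show ?thesis
 proof (rule bij_betwI[where g = g])
  show "g \<in> ({..<d} \<rightarrow>\<^sub>E C) \<rightarrow> PS C d"
  proof
   fix h assume "h \<in> {..<d} \<rightarrow>\<^sub>E C"
   then have "\<forall>i<d. h i \<in> C" by (metis PiE_mem lessThan_iff)
   then show "g h \<in> PS C d" by (simp add: PS_def co)
  qed
  show "g (restrict (coeff p) {..<d}) = p" if "p \<in> PS C d" for p
  proof (rule poly_eqI)
   fix i show "coeff (g (restrict (coeff p) {..<d})) i = coeff p i"
    using that by (cases "i < d") (simp_all add: co PS_def)
  qed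
  show "restrict (coeff (g h)) {..<d} = h" if "h \<in> {..<d} \<rightarrow>\<^sub>E C" for h
  proof
   fix i show "restrict (coeff (g h)) {..<d} i = h i"
    using PiE_arb[OF that, of i] by (cases "i < d") (simp_all add: co)
  qed
  show "(\<lambda>p. restrict (coeff p) {..<d}) \<in> PS C d \<rightarrow> ({..<d} \<rightarrow>\<^sub>E C)"
   by (rule Pi_I, rule restrict_PiE_iff[THEN iffD2]) (simp add: PS_def)
 qed
qed

lemma card_PS: "card (PS C d) = card C ^ d"
 using bij_betw_same_card[OF bij_PS[of d C]] by (simp add: card_PiE)

lemma finite_PS: "finite C ==> finite (PS C d)"
 using bij_betw_finite[OF bij_PS[of d C]] by (simp add: finite_PiE)

lemma PS_degree_less: "p \<in> PS UNIV d \<longleftrightarrow> (p = 0 \<or> degree p < d)"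
proof
 assume p: "p \<in> PS UNIV d"
 show "p = 0 \<or> degree p < d"
 proof (rule ccontr)
  assume "\<not> ?thesis"
  then have "coeff p (degree p) \<noteq> 0" "d \<le> degree p" by auto
  then show False using p by (auto simp: PS_def)
 qed
qed (auto simp: PS_def coeff_eq_0)

text \<open>Pigeonhole: the box has more elements than the forms have joint values, so two elements
  share all values. Their difference stays in the box and is the solution.\<close>

lemma siegel:
 fixes L :: "'j => ('i => 'a::{finite,field} poly poly) => 'a poly"
 assumes "finite I" "finite J"
  and diff: "\<And>j a b. j \<in> J ==> L j (\<lambda>x. a x - b x) = L j a - L j b"
  and bound: "\<And>j a. j \<in> J ==> (\<And>x. x \<in> I ==> a x \<in> PS (PS UNIV T) D) ==> L j a \<in> PS UNIV (M j)"
  and less: "(\<Sum>j\<in>J. M j) < T * D * card I"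
 shows "\<exists>g. (\<forall>x\<in>I. g x \<in> PS (PS UNIV T) D) \<and> (\<exists>x\<in>I. g x \<noteq> 0) \<and> (\<forall>j\<in>J. L j g = 0)"
proof -
 define S where "S = PiE I (\<lambda>_. PS (PS (UNIV :: 'a set) T) D)"
 define f where "f a = restrict (\<lambda>j. L j a) J" for a
 have "f ` S \<subseteq> PiE J (\<lambda>j. PS UNIV (M j))"
  by (auto simp: f_def S_def intro!: bound)
 moreover have "finite (PiE J (\<lambda>j. PS (UNIV :: 'a set) (M j)))"
  by (intro finite_PiE assms finite_PS) simp
 ultimately have "card (f ` S) \<le> card (PiE J (\<lambda>j. PS (UNIV :: 'a set) (M j)))"
  by (intro card_mono)
 also have "\<dots> = CARD('a) ^ (\<Sum>j\<in>J. M j)"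
  by (simp add: card_PiE assms card_PS power_sum)
 also have "\<dots> < CARD('a) ^ (T * D * card I)"
  by (rule power_strict_increasing[OF less]) (use card_ge_2[where 'a = 'a] in simp)
 also have "\<dots> = card S"
  by (simp add: S_def card_PiE assms card_PS power_mult)
 finally have "\<not> inj_on f S" by (rule pigeonhole)
 then obtain a b where ab: "a \<in> S" "b \<in> S" "f a = f b" "a \<noteq> b" by (auto simp: inj_on_def)
 have "\<exists>x\<in>I. a x - b x \<noteq> 0"
  using ab by (auto simp: S_def intro: PiE_ext)
 moreover have "a x - b x \<in> PS (PS UNIV T) D" if "x \<in> I" for x
 proof -
  have "a x \<in> PS (PS UNIV T) D" "b x \<in> PS (PS UNIV T) D" using ab that by (auto simp: S_def)
  then show ?thesis by (auto simp: PS_def)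
 qed
 moreover have "L j (\<lambda>x. a x - b x) = 0" if "j \<in> J" for j
  using fun_cong[OF ab(3), of j] that by (simp add: f_def diff)
 ultimately show ?thesis by (intro exI[of _ "\<lambda>x. a x - b x"]) blast
qed

section \<open>Degree bounds in two variables\<close>

definition dtb :: "nat => nat => 'a::field poly poly => bool" where
 "dtb D T P \<longleftrightarrow> degree P \<le> D \<and> (\<forall>i. degree (coeff P i) \<le> T)"

lemma dtb_ex: "\<exists>C. dtb C C P"
proof -
 let ?s = "\<Sum>i\<le>degree P. degree (coeff P i)"
 have "degree (coeff P i) \<le> ?s" for i
 proof (cases "i \<le> degree P")
  case True then show ?thesis by (intro member_le_sum) auto
 qed (simp add: coeff_eq_0)
 then show ?thesis
  by (intro exI[of _ "degree P + ?s"]) (auto simp: dtb_def trans_le_add2)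
qed
lemma dtb_mono: "dtb D T P ==> D \<le> D' ==> T \<le> T' ==> dtb D' T' P"
 unfolding dtb_def by (meson order_trans)
lemma dtb_0 [simp]: "dtb D T 0" by (simp add: dtb_def)
lemma dtb_1 [simp]: "dtb D T 1" by (simp add: dtb_def)
lemma dtb_const: "degree a \<le> T ==> dtb 0 T [:a:]"
 by (auto simp: dtb_def coeff_pCons split: nat.split)
lemma dtb_add: "dtb D T P ==> dtb D T Q ==> dtb D T (P + Q)"
 by (auto simp: dtb_def intro: degree_add_le)
lemma dtb_sum: "(\<And>i. i \<in> S ==> dtb D T (f i)) ==> dtb D T (\<Sum>i\<in>S. f i)"
 by (induction S rule: infinite_finite_induct) (auto intro: dtb_add)
lemma dtb_mult: assumes "dtb D T P" "dtb D' T' Q" shows "dtb (D + D') (T + T') (P * Q)"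
 unfolding dtb_def
proof safe
 show "degree (P * Q) \<le> D + D'"
  using assms degree_mult_le[of P Q] unfolding dtb_def by linarith
 show "degree (coeff (P * Q) i) \<le> T + T'" for i
  unfolding coeff_mult
 proof (rule degree_sum_le)
  fix j assume "j \<in> {..i}"
  show "degree (coeff P j * coeff Q (i - j)) \<le> T + T'"
   using assms degree_mult_le[of "coeff P j" "coeff Q (i - j)"]
   unfolding dtb_def by (meson add_mono order_trans)
 qed simp
qed
lemma dtb_prod: "(\<And>i. i \<in> S ==> dtb D (T i) (f i)) ==> dtb (card S * D) (\<Sum>i\<in>S. T i) (\<Prod>i\<in>S. f i)"
 by (induction S rule: infinite_finite_induct) (auto intro: dtb_mult)
lemma dtb_tw: "dtb D T P ==> dtb D (CARD('a) ^ n * T) (tw n P)" for P :: "'a::{finite,field} poly poly"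
 by (auto simp: dtb_def degree_power_eq power_0_left intro!: mult_left_mono)
  (metis degree_power_le mult_le_mono2 order_trans mult.commute)
lemma degree_poly_dtb:
 assumes "dtb D T P" "degree a \<le> e"
 shows "degree (poly P a) \<le> T + D * e"
 unfolding poly_altdef
proof (rule degree_sum_le)
 fix i assume i: "i \<in> {..degree P}"
 then have iD: "i \<le> D" using assms by (auto simp: dtb_def)
 have "degree (coeff P i * a ^ i) \<le> T + i * e"
  using assms degree_mult_le[of "coeff P i" "a ^ i"] degree_power_le[of a i]
  by (auto simp: dtb_def mult.commute intro!: order_trans[OF degree_mult_le] add_mono order_trans[OF degree_power_le] mult_mono)
 also have "\<dots> \<le> T + D * e" using iD by simp
 finally show "degree (coeff P i * a ^ i) \<le> T + D * e" .
qed simp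
lemma NB_dtb:
 assumes "dtb D T P" "r \<ge> 0"
 shows "NB r (int T + r * int D) (emb P)"
 unfolding NB_def
proof
 fix n
 show "vge (r * int n - (int T + r * int D)) (emb P $ n)"
 proof (cases "n \<le> D")
  case True
  have "vge (- int T) (emb P $ n)" using assms by (simp add: vge_A dtb_def)
  then show ?thesis by (rule vge_mono) (use True assms in \<open>simp add: mult_left_mono\<close>)
 next
  case False
  then have "coeff P n = 0" using assms by (intro coeff_eq_0) (auto simp: dtb_def)
  then show ?thesis by simp
 qed
qed
lemma PS_dtb: "P \<in> PS (PS UNIV T) D ==> dtb (D - 1) (T - 1) P"
proof -
 assume P: "P \<in> PS (PS UNIV T) D"
 have "coeff P i \<in> PS UNIV T" for i
  using P by (cases "i < D") (auto simp: PS_def)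
 then have A: "coeff P i = 0 \<or> degree (coeff P i) < T" for i by (simp add: PS_degree_less)
 have "degree (coeff P i) \<le> T - 1" for i using A[of i] by auto
 moreover have "P \<in> PS UNIV D" using P by (auto simp: PS_def)
 ultimately show ?thesis by (auto simp: dtb_def PS_degree_less)
qed

section \<open>The Gauss valuation\<close>

definition gv :: "int => 'a::zero fls fps => bool" where
 "gv v f \<longleftrightarrow> (\<forall>n. vge v (f $ n)) \<and> (\<exists>n. f $ n \<noteq> 0 \<and> fls_subdegree (f $ n) = v)"

lemma gv_exists:
 assumes "f \<noteq> 0" "NB 0 c f" shows "\<exists>v\<ge>-c. gv v f"
proof -
 define S where "S = {k. \<exists>n. f $ n \<noteq> 0 \<and> k = nat (fls_subdegree (f $ n) + c)}"
 obtain n where "f $ n \<noteq> 0" using assms by (metis fps_nonzero_nth)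
 then have "nat (fls_subdegree (f $ n) + c) \<in> S" by (auto simp: S_def)
 then have L: "(LEAST k. k \<in> S) \<in> S" by (rule LeastI)
 then obtain m where m: "f $ m \<noteq> 0" "(LEAST k. k \<in> S) = nat (fls_subdegree (f $ m) + c)" by (auto simp: S_def)
 have nn: "fls_subdegree (f $ i) + c \<ge> 0" if "f $ i \<noteq> 0" for i
 proof -
  have "vge (- c) (f $ i)" using assms(2)[unfolded NB_def, rule_format, of i] by simp
  then have "- c \<le> fls_subdegree (f $ i)" using that by (simp add: vge_subdegree)
  then show ?thesis by simp
 qed
 have "vge (fls_subdegree (f $ m)) (f $ i)" for i
 proof (cases "f $ i = 0")
  case False
  then have "nat (fls_subdegree (f $ i) + c) \<in> S" by (auto simp: S_def)
  then have "(LEAST k. k \<in> S) \<le> nat (fls_subdegree (f $ i) + c)" by (rule Least_le)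
  then have "fls_subdegree (f $ m) \<le> fls_subdegree (f $ i)" using m nn[OF False] nn[OF m(1)] by simp
  then show ?thesis by (auto simp: vge_def)
 qed simp
 then show ?thesis using m(1) nn[OF m(1)] by (intro exI[of _ "fls_subdegree (f $ m)"]) (auto simp: gv_def)
qed

text \<open>Gauss' lemma: in the coefficient at the sum of the first indices where \<open>f\<close>
  and \<open>g\<close> attain their minima, exactly one product has the minimal valuation.\<close>

lemma gv_mult:
 fixes f g :: "'a::idom fls fps"
 assumes "gv v f" "gv w g" shows "gv (v + w) (f * g)"
proof -
 define P where "P v f n \<longleftrightarrow> f $ n \<noteq> 0 \<and> fls_subdegree (f $ n) = v" for v and f :: "'a fls fps" and n
 define m where "m = (LEAST n. P v f n)"
 define k where "k = (LEAST n. P w g n)"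
 have "\<exists>n. P v f n" "\<exists>n. P w g n" using assms by (auto simp: gv_def P_def)
 then have m: "P v f m" and k: "P w g k" unfolding m_def k_def by (auto intro: LeastI_ex)
 have v1: "vge (v + 1) (f $ n)" if "n < m" for n
 proof -
  have "\<not> P v f n" using not_less_Least that by (auto simp: m_def)
  moreover have "vge v (f $ n)" using assms by (simp add: gv_def)
  ultimately show ?thesis by (cases "f $ n = 0") (auto simp: P_def vge_subdegree)
 qed
 have w1: "vge (w + 1) (g $ n)" if "n < k" for n
 proof -
  have "\<not> P w g n" using not_less_Least that by (auto simp: k_def)
  moreover have "vge w (g $ n)" using assms by (simp add: gv_def)
  ultimately show ?thesis by (cases "g $ n = 0") (auto simp: P_def vge_subdegree)
 qed
 have fv: "vge v (f $ n)" and gw: "vge w (g $ n)" for n using assms by (auto simp: gv_def)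
 have "vge (v + w) ((f * g) $ n)" for n
  unfolding fps_mult_nth by (intro vge_sum vge_mult fv gw)
 moreover have "(f * g) $ (m + k) \<noteq> 0 \<and> fls_subdegree ((f * g) $ (m + k)) = v + w"
 proof -
  have "(f * g) $ (m + k) = f $ m * g $ k + (\<Sum>i\<in>{0..m+k} - {m}. f $ i * g $ (m + k - i))"
   unfolding fps_mult_nth by (subst sum.remove[of _ m]) auto
  moreover have "vge (v + w + 1) (\<Sum>i\<in>{0..m+k} - {m}. f $ i * g $ (m + k - i))"
  proof (rule vge_sum)
   fix i assume i: "i \<in> {0..m+k} - {m}"
   show "vge (v + w + 1) (f $ i * g $ (m + k - i))"
   proof (cases "i < m")
    case True
    from vge_mult[OF v1[OF this] gw] show ?thesis by (simp add: algebra_simps)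
   next
    case False
    with i have "m + k - i < k" by auto
    from vge_mult[OF fv w1[OF this]] show ?thesis by (simp add: algebra_simps)
   qed
  qed
  moreover have "(f $ m * g $ k) $$ (v + w) \<noteq> 0"
  proof -
   have "f $ m * g $ k \<noteq> 0" "fls_subdegree (f $ m * g $ k) = v + w" using m k by (auto simp: P_def)
   then show ?thesis using nth_fls_subdegree_nonzero[of "f $ m * g $ k"] by (simp only: not_False_eq_True)
  qed
  ultimately have nz: "(f * g) $ (m + k) $$ (v + w) \<noteq> 0" by (simp add: vge_def)
  then have "(f * g) $ (m + k) \<noteq> 0" by (metis fls_zero_nth)
  moreover have "vge (v + w) ((f * g) $ (m + k))" by fact
  ultimately show ?thesis using nz unfolding vge_def by (intro conjI fls_subdegree_eqI) simp_all
 qed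
 ultimately show ?thesis unfolding gv_def by blast
qed

lemma gv_tau:
 fixes f :: "'a::{finite,field} fls fps"
 assumes "gv v f" shows "gv (int (CARD('a) ^ n) * v) (tau n f)"
proof -
 obtain k where "f $ k \<noteq> 0" "fls_subdegree (f $ k) = v" using assms by (auto simp: gv_def)
 then show ?thesis using assms vge_power[of v _ "CARD('a) ^ n"]
  by (auto simp: gv_def fls_subdegree_pow intro!: exI[of _ k])
qed

lemma gv_emb:
 assumes "P \<noteq> 0" "dtb D T P" shows "\<exists>v. gv v (emb P) \<and> - int T \<le> v \<and> v \<le> 0"
proof -
 have "NB 0 (int T) (emb P)" using NB_dtb[OF assms(2), of 0] by simp
 then obtain v where v: "v \<ge> - int T" "gv v (emb P)" using gv_exists assms(1) by (metis emb_eq_0_iff)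
 then obtain k where "emb P $ k \<noteq> 0" "fls_subdegree (emb P $ k) = v" by (auto simp: gv_def)
 then have "v \<le> 0" by (auto simp: subdegree_A)
 then show ?thesis using v by blast
qed

lemma gv_le: "gv v f ==> \<exists>n. \<not> vge (v + 1) (f $ n)"
 unfolding gv_def by (metis vge_subdegree zle_add1_eq_le less_irrefl)

text \<open>Zeros are divided out one at a time. Each division improves the bound by
  \<open>r\<close> by \<open>NB_quotient\<close>, and the other points remain zeros of the
  quotient.\<close>

lemma schwarz:
 fixes f :: "'a::field fls fps"
 assumes "finite M" "\<And>\<alpha>. \<alpha> \<in> M ==> Ev r \<alpha> f 0" "NB r c f" "DD r f"
 shows "\<exists>F. DD r F \<and> f = (\<Prod>\<alpha>\<in>M. fps_X - fps_const \<alpha>) * F \<and> NB r (c - int (card M) * r) F"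
 using assms
proof (induction M arbitrary: f c rule: finite_induct)
 case empty then show ?case by (intro exI[of _ f]) auto
next
 case (insert \<alpha> M)
 have "Ev r \<alpha> f 0" using insert.prems by simp
 then obtain F where F: "vge (- r) \<alpha>" "DD r F" "f = fps_const 0 + (fps_X - fps_const \<alpha>) * F" unfolding Ev_def by blast
 have NF: "NB r (c - r) F" by (rule NB_quotient[OF F insert.prems(2)])
 have "Ev r a F 0" if a: "a \<in> M" for a
 proof -
  have ea: "Ev r a f 0" using insert.prems a by simp
  then have va: "vge (- r) a" by (simp add: Ev_def)
  obtain y where y: "Ev r a F y" using Ev_exists[OF va F(2)] by blast
  have "Ev r a f ((a - \<alpha>) * y)" using F(3) Ev_mult[OF Ev_diff[OF Ev_X[OF va] Ev_const[OF va]] y] by simp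
  then have "(a - \<alpha>) * y = 0" using Ev_unique ea by blast
  then show ?thesis using y insert.hyps a by auto
 qed
 then obtain G where "DD r G" "F = (\<Prod>\<alpha>\<in>M. fps_X - fps_const \<alpha>) * G" "NB r (c - r - int (card M) * r) G"
  using insert.IH[OF _ NF F(2)] by blast
 then show ?case using F(3) insert.hyps by (intro exI[of _ G]) (auto simp: algebra_simps)
qed

section \<open>Decomposition along the Frobenius\<close>

text \<open>The nonzero summands have valuations in different classes modulo \<open>q^n\<close>, so
  they cannot cancel.\<close>

lemma theta_independent:
 fixes x :: "nat => 'a::{finite,field} fls"
 assumes "(\<Sum>j<CARD('a) ^ n. fls_X_inv ^ j * x j ^ (CARD('a) ^ n)) = 0" "j < CARD('a) ^ n"
 shows "x j = 0"
proof -
 let ?Q = "CARD('a) ^ n"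
 have sd: "fls_subdegree (fls_X_inv ^ i * x i ^ ?Q) = - int i + int ?Q * fls_subdegree (x i)" if "x i \<noteq> 0" for i
  using that by (simp add: fls_subdegree_pow)
 have "\<forall>j\<in>{..<?Q}. fls_X_inv ^ j * x j ^ ?Q = 0"
 proof (rule distinct_subdegree_sum_0)
  fix i k assume "i \<in> {..<?Q}" "k \<in> {..<?Q}" "fls_X_inv ^ i * x i ^ ?Q \<noteq> 0" "fls_X_inv ^ k * x k ^ ?Q \<noteq> 0"
   "fls_subdegree (fls_X_inv ^ i * x i ^ ?Q) = fls_subdegree (fls_X_inv ^ k * x k ^ ?Q)"
  then have e: "- int i + int ?Q * fls_subdegree (x i) = - int k + int ?Q * fls_subdegree (x k)"
   and l: "i < ?Q" "k < ?Q" using sd[of i] sd[of k] by auto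
  then have "int ?Q * (fls_subdegree (x i) - fls_subdegree (x k)) = int i - int k" by (simp add: algebra_simps)
  then have "int ?Q dvd int i - int k" by (metis dvd_triv_left)
  then have "int i mod int ?Q = int k mod int ?Q" by (simp only: mod_eq_dvd_iff)
  then show "i = k" using l by (simp flip: zmod_int)
 qed (use assms in auto)
 then show ?thesis using assms by auto
qed

lemma poly_frobenius_decomp:
 fixes a :: "'a::{finite,field} poly"
 shows "\<exists>c. a = (\<Sum>j<CARD('a) ^ n. monom 1 j * c j ^ (CARD('a) ^ n))"
proof (induction a)
 case 0 show ?case by (rule exI[of _ "\<lambda>_. 0"]) simp
next
 case (pCons u a)
 let ?Q = "CARD('a) ^ n"
 obtain c where c: "a = (\<Sum>j<?Q. monom 1 j * c j ^ ?Q)" using pCons.IH by blast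
 obtain R where R: "?Q = Suc R" using card_power_pos[where 'a = 'a, of n] by (cases ?Q) auto
 \<comment> \<open>Multiplication by \<open>\<theta>\<close> moves component \<open>j\<close> to
   \<open>j + 1\<close>. The last component returns to place 0, with the factor
   \<open>\<theta>^Q\<close> absorbed as a \<open>Q\<close>-th power; the new constant is a
   \<open>Q\<close>-th power of itself.\<close>
 define c' where "c' j = (if j = 0 then [:u:] + monom 1 1 * c R else c (j - 1))" for j
 have "(\<Sum>j<?Q. monom 1 j * c' j ^ ?Q) = c' 0 ^ ?Q + (\<Sum>j<R. monom 1 (Suc j) * c j ^ ?Q)"
  unfolding R by (subst sum.lessThan_Suc_shift) (simp add: c'_def)
 also have "c' 0 ^ ?Q = [:u:] + monom 1 ?Q * c R ^ ?Q"
  by (simp add: c'_def poly_frob_add power_mult_distrib monom_power poly_const_pow finite_field_power_card_power)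
 also have "[:u:] + monom 1 ?Q * c R ^ ?Q + (\<Sum>j<R. monom 1 (Suc j) * c j ^ ?Q)
  = [:u:] + (\<Sum>j<?Q. monom 1 (Suc j) * c j ^ ?Q)"
  unfolding R by simp
 also have "\<dots> = [:u:] + monom 1 1 * a"
  by (simp add: c sum_distrib_left mult.assoc[symmetric] mult_monom)
 also have "\<dots> = pCons u a" by (simp add: monom_Suc monom_0)
 finally show ?case by (intro exI[of _ c']) simp
qed

lemma poly_poly_frobenius_decomp:
 fixes P :: "'a::{finite,field} poly poly"
 shows "\<exists>c. P = (\<Sum>j<CARD('a) ^ n. [:monom 1 j:] * tw n (c j))"
proof (induction P)
 case 0 show ?case by (rule exI[of _ "\<lambda>_. 0"]) simp
next
 case (pCons a P)
 obtain c where c: "P = (\<Sum>j<CARD('a) ^ n. [:monom 1 j:] * tw n (c j))" using pCons.IH by blast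
 obtain d where d: "a = (\<Sum>j<CARD('a) ^ n. monom 1 j * d j ^ (CARD('a) ^ n))" using poly_frobenius_decomp by blast
 have "pCons a P = [:a:] + pCons 0 P" by simp
 also have "\<dots> = (\<Sum>j<CARD('a) ^ n. [:monom 1 j * d j ^ (CARD('a) ^ n):]) + (\<Sum>j<CARD('a) ^ n. pCons 0 ([:monom 1 j:] * tw n (c j)))"
 proof -
  have s1: "[:\<Sum>j\<in>S. f j:] = (\<Sum>j\<in>S. [:f j:])" for f :: "nat => 'a poly" and S
  proof (induction S rule: infinite_finite_induct)
   case (insert x F) show ?case using insert.hyps by (simp flip: insert.IH)
  qed simp_all
  have s2: "pCons 0 (\<Sum>j\<in>S. f j) = (\<Sum>j\<in>S. pCons 0 (f j))" for f :: "nat => 'a poly poly" and S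
  proof (induction S rule: infinite_finite_induct)
   case (insert x F) show ?case using insert.hyps by (simp flip: insert.IH)
  qed simp_all
  show ?thesis by (subst d, subst c) (simp only: s1 s2)
 qed
 also have "\<dots> = (\<Sum>j<CARD('a) ^ n. [:monom 1 j:] * tw n (pCons (d j) (c j)))"
  by (simp add: mult.commute flip: sum.distrib)
 finally show ?case by (intro exI[of _ "\<lambda>j. pCons (d j) (c j)"]) simp
qed

section \<open>A linear independence criterion\<close>

text \<open>\<open>\<Phi>'\<close> is an inverse of \<open>\<Phi>\<close> up to the scalar
  \<open>\<delta>\<close>, so coefficient vectors can be moved between twists of
  \<open>\<psi>\<close> in both directions without leaving \<open>A[t]\<close>. The condition on
  \<open>\<delta>\<close> says that at the points \<open>\<theta>^(q^m)\<close> the scalars picked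
  up on the way down are nonzero.\<close>

locale abp_system =
 fixes I :: "'i set" and \<psi> :: "'i => 'a::{finite,field} fls fps"
  and \<Phi> \<Phi>' :: "'i => 'i => 'a poly poly" and \<beta> \<delta> :: "'a poly poly"
 assumes finI: "finite I"
  and psi_eq: "x \<in> I ==> emb \<beta> * \<psi> x = (\<Sum>y\<in>I. emb (\<Phi> x y) * tau 1 (\<psi> y))"
  and psi_eq': "x \<in> I ==> emb \<beta> * (\<Sum>y\<in>I. emb (\<Phi>' x y) * \<psi> y) = emb \<delta> * tau 1 (\<psi> x)"
  and inv: "x \<in> I ==> z \<in> I ==> (\<Sum>y\<in>I. \<Phi> x y * \<Phi>' y z) = (if x = z then \<delta> else 0)"
  and beta_nz: "\<beta> \<noteq> 0"
  and delta_nz: "m \<le> i ==> poly (tw i \<delta>) (thA m) \<noteq> 0"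
  and psi_DD: "x \<in> I ==> DD 1 (\<psi> x)"
begin

definition act :: "('i => 'i => 'a poly poly) => ('i => 'a poly poly) => 'i => 'a poly poly" where
 "act \<Psi> v y = (if y \<in> I then \<Sum>x\<in>I. v x * \<Psi> x y else 0)"

definition pr :: "('i => 'a poly poly) => nat => 'a fls fps" where
 "pr v n = (\<Sum>x\<in>I. emb (v x) * tau n (\<psi> x))"

text \<open>Products of twisted matrices: \<open>up m k\<close> rewrites a combination of the
  \<open>tau m (\<psi> x)\<close> as one of the \<open>tau (m + k) (\<psi> x)\<close>, up to twists
  of \<open>\<beta>\<close>; \<open>dn m k\<close> goes back from level \<open>m + k\<close> to
  level \<open>m\<close>.\<close>

fun up :: "nat => nat => ('i => 'a poly poly) => 'i => 'a poly poly" where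
 "up m 0 v = v"
| "up m (Suc k) v = act (\<lambda>x y. tw (m + k) (\<Phi> x y)) (up m k v)"

fun dn :: "nat => nat => ('i => 'a poly poly) => 'i => 'a poly poly" where
 "dn m 0 v = v"
| "dn m (Suc k) v = dn m k (act (\<lambda>x y. tw (m + k) (\<Phi>' x y)) v)"

lemma act_scale: "act \<Psi> (\<lambda>x. c * v x) = (\<lambda>x. c * act \<Psi> v x)"
 by (auto simp: act_def sum_distrib_left mult.assoc)

lemma dn_scale: "dn m k (\<lambda>x. c * v x) = (\<lambda>x. c * dn m k v x)"
 by (induction k arbitrary: v) (simp_all add: act_scale)

lemma tw_inv:
 assumes "x \<in> I" "z \<in> I"
 shows "(\<Sum>y\<in>I. tw n (\<Phi> x y) * tw n (\<Phi>' y z)) = (if x = z then tw n \<delta> else 0)"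
proof -
 have "(\<Sum>y\<in>I. tw n (\<Phi> x y) * tw n (\<Phi>' y z)) = tw n (\<Sum>y\<in>I. \<Phi> x y * \<Phi>' y z)"
  by (simp add: tw_sum tw_mult)
 then show ?thesis using assms by (simp add: inv)
qed

lemma act_inv:
 assumes "z \<in> I"
 shows "act (\<lambda>x y. tw n (\<Phi>' x y)) (act (\<lambda>x y. tw n (\<Phi> x y)) v) z = tw n \<delta> * v z"
proof -
 have "act (\<lambda>x y. tw n (\<Phi>' x y)) (act (\<lambda>x y. tw n (\<Phi> x y)) v) z
  = (\<Sum>y\<in>I. \<Sum>x\<in>I. v x * (tw n (\<Phi> x y) * tw n (\<Phi>' y z)))"
  using assms by (simp add: act_def sum_distrib_right mult.assoc)
 also have "\<dots> = (\<Sum>x\<in>I. v x * (\<Sum>y\<in>I. tw n (\<Phi> x y) * tw n (\<Phi>' y z)))"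
  by (subst sum.swap) (simp add: sum_distrib_left)
 also have "\<dots> = (\<Sum>x\<in>I. if x = z then v x * tw n \<delta> else 0)"
  using assms by (intro sum.cong) (auto simp: tw_inv)
 also have "\<dots> = tw n \<delta> * v z" using assms finI by (simp add: mult.commute)
 finally show ?thesis .
qed

lemma up_supp: "(\<And>x. x \<notin> I ==> v x = 0) ==> x \<notin> I ==> up m k v x = 0"
 by (cases k) (simp_all add: act_def)

lemma dn_up:
 assumes "\<And>x. x \<notin> I ==> v x = 0"
 shows "dn m k (up m k v) = (\<lambda>x. (\<Prod>i<k. tw (m + i) \<delta>) * v x)"
proof (induction k)
 case (Suc k)
 have "act (\<lambda>x y. tw (m + k) (\<Phi>' x y)) (act (\<lambda>x y. tw (m + k) (\<Phi> x y)) (up m k v)) = (\<lambda>x. tw (m + k) \<delta> * up m k v x)"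
 proof
  fix z show "act (\<lambda>x y. tw (m + k) (\<Phi>' x y)) (act (\<lambda>x y. tw (m + k) (\<Phi> x y)) (up m k v)) z = tw (m + k) \<delta> * up m k v z"
   using up_supp[of v z m k] assms by (cases "z \<in> I") (simp_all add: act_inv, simp add: act_def)
 qed
 then show ?case by (simp add: dn_scale Suc mult.assoc mult.left_commute)
qed simp

lemma pr_act: "pr (act (\<lambda>x y. tw n (\<Phi> x y)) v) (Suc n) = emb (tw n \<beta>) * pr v n"
proof -
 have "pr (act (\<lambda>x y. tw n (\<Phi> x y)) v) (Suc n) = (\<Sum>y\<in>I. \<Sum>x\<in>I. emb (v x) * (tau n (emb (\<Phi> x y)) * tau n (tau 1 (\<psi> y))))"
  by (simp add: pr_def act_def emb_sum emb_mult tau_emb tau_tau sum_distrib_right mult.assoc)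
 also have "\<dots> = (\<Sum>x\<in>I. emb (v x) * tau n (\<Sum>y\<in>I. emb (\<Phi> x y) * tau 1 (\<psi> y)))"
  by (subst sum.swap) (simp add: tau_sum sum_distrib_left)
 also have "\<dots> = (\<Sum>x\<in>I. emb (v x) * tau n (emb \<beta> * \<psi> x))"
  by (rule sum.cong) (simp_all add: psi_eq)
 finally show ?thesis by (simp add: pr_def tau_emb sum_distrib_left mult.left_commute)
qed

lemma pr_act': "emb (tw n \<beta>) * pr (act (\<lambda>x y. tw n (\<Phi>' x y)) v) n = emb (tw n \<delta>) * pr v (Suc n)"
proof -
 have "emb (tw n \<beta>) * pr (act (\<lambda>x y. tw n (\<Phi>' x y)) v) n
  = (\<Sum>y\<in>I. \<Sum>x\<in>I. emb (v x) * (tau n (emb \<beta>) * (tau n (emb (\<Phi>' x y)) * tau n (\<psi> y))))"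
  by (simp add: pr_def act_def emb_sum emb_mult tau_emb sum_distrib_left sum_distrib_right mult.assoc mult.left_commute)
 also have "\<dots> = (\<Sum>x\<in>I. emb (v x) * tau n (emb \<beta> * (\<Sum>y\<in>I. emb (\<Phi>' x y) * \<psi> y)))"
  by (subst sum.swap) (simp add: tau_sum sum_distrib_left)
 also have "\<dots> = (\<Sum>x\<in>I. emb (v x) * tau n (emb \<delta> * tau 1 (\<psi> x)))"
  by (rule sum.cong) (simp_all add: psi_eq')
 finally show ?thesis by (simp add: pr_def tau_emb tau_tau sum_distrib_left mult.left_commute)
qed

lemma pr_up: "pr (up m k v) (m + k) = emb (\<Prod>i<k. tw (m + i) \<beta>) * pr v m"
 by (induction k) (simp_all add: pr_act emb_mult mult.assoc mult.left_commute)

lemma pr_dn: "pr v (m + k) = 0 ==> pr (dn m k v) m = 0"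
proof (induction k arbitrary: v)
 case (Suc k)
 have "emb (tw (m + k) \<beta>) * pr (act (\<lambda>x y. tw (m + k) (\<Phi>' x y)) v) (m + k) = 0"
  using pr_act'[of "m + k" v] Suc.prems by simp
 then show ?case using beta_nz Suc.IH by simp
qed simp

lemma act_eval_cong:
 assumes "\<And>x. x \<in> I ==> a * poly (v x) \<alpha> = b * poly (w x) \<alpha>"
 shows "a * poly (act \<Psi> v y) \<alpha> = b * poly (act \<Psi> w y) \<alpha>"
proof (cases "y \<in> I")
 case True
 have "a * poly (act \<Psi> v y) \<alpha> = (\<Sum>x\<in>I. (a * poly (v x) \<alpha>) * poly (\<Psi> x y) \<alpha>)"
  using True by (simp add: act_def poly_sum sum_distrib_left mult.assoc)
 also have "\<dots> = (\<Sum>x\<in>I. (b * poly (w x) \<alpha>) * poly (\<Psi> x y) \<alpha>)" by (rule sum.cong) (simp_all add: assms)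
 also have "\<dots> = b * poly (act \<Psi> w y) \<alpha>"
  using True by (simp add: act_def poly_sum sum_distrib_left mult.assoc)
 finally show ?thesis .
qed (simp add: act_def)

text \<open>Transport is linear with coefficients in \<open>A[t]\<close>, so vectors that are
  proportional at one point remain so. In \<open>criterion\<close> this replaces the unknown vector
  \<open>g\<close> by the known one built from \<open>\<rho>\<close>.\<close>

lemma dn_eval_cong:
 assumes "\<And>x. x \<in> I ==> a * poly (v x) \<alpha> = b * poly (w x) \<alpha>" "x \<in> I"
 shows "a * poly (dn m k v x) \<alpha> = b * poly (dn m k w x) \<alpha>"
 using assms(1)
proof (induction k arbitrary: v w)
 case (Suc k)
 show ?case unfolding dn.simps by (rule Suc.IH) (rule act_eval_cong, rule Suc.prems)
qed (simp add: assms(2))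

lemma sum_geom_le: "(\<Sum>i<k. CARD('a) ^ (m + i)) \<le> CARD('a) ^ (m + k)"
proof (induction k)
 case (Suc k)
 have "(\<Sum>i<Suc k. CARD('a) ^ (m + i)) \<le> 2 * CARD('a) ^ (m + k)" using Suc by simp
 also have "\<dots> \<le> CARD('a) * CARD('a) ^ (m + k)" using card_ge_2[where 'a = 'a] by (intro mult_right_mono) auto
 finally show ?case by simp
qed simp

lemma dtb_up_sum:
 assumes C: "\<And>x y. x \<in> I ==> y \<in> I ==> dtb C C (\<Phi> x y)" and v: "\<And>x. x \<in> I ==> dtb a b (v x)" and y: "y \<in> I"
 shows "dtb (a + k * C) (b + (\<Sum>i<k. CARD('a) ^ (m + i)) * C) (up m k v y)"
 using y
proof (induction k arbitrary: y)
 case (Suc k)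
 have "dtb ((a + k * C) + C) ((b + (\<Sum>i<k. CARD('a) ^ (m + i)) * C) + CARD('a) ^ (m + k) * C) (up m k v x * tw (m + k) (\<Phi> x y))"
  if "x \<in> I" for x
  by (intro dtb_mult dtb_tw Suc.IH C that Suc.prems)
 from dtb_sum[OF this] show ?case using Suc.prems by (simp add: act_def algebra_simps)
qed (simp add: v)

lemma dtb_up:
 assumes "\<And>x y. x \<in> I ==> y \<in> I ==> dtb C C (\<Phi> x y)" and "\<And>x. x \<in> I ==> dtb a b (v x)" and "y \<in> I"
 shows "dtb (a + k * C) (b + CARD('a) ^ (m + k) * C) (up m k v y)"
 by (rule dtb_mono[OF dtb_up_sum[OF assms]]) (simp_all add: sum_geom_le)

end

lemma finite_uniform_bound:
 fixes P :: "'b => nat => bool"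
 assumes "finite S" "\<And>x. x \<in> S ==> \<exists>C. P x C" "\<And>x C D. P x C ==> C \<le> D ==> P x D"
 shows "\<exists>C. \<forall>x\<in>S. P x C"
 using assms(1,2)
proof (induction S rule: finite_induct)
 case (insert x S)
 then obtain C where "\<forall>y\<in>S. P y C" by auto
 moreover obtain D where "P x D" using insert.prems by blast
 ultimately have "\<forall>y\<in>S. P y C" "P x D" by auto
 then show ?case using assms(3) by (intro exI[of _ "max C D"]) (auto intro: assms(3))
qed simp

section \<open>The auxiliary function and its zeros at the points
  \<open>\<theta>^(q^m)\<close>\<close>

context abp_system
begin

text \<open>The \<open>m\<close>-fold twist of the given relation, transported to level
  \<open>N\<close> and evaluated at \<open>\<theta>^(q^m)\<close>. A vector whose value there is
  proportional to it annihilates the values of the \<open>tau N (\<psi> x)\<close>.\<close>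

definition vv :: "('i => 'a poly) => nat => nat => 'i => 'a poly" where
 "vv \<rho> N m x = poly (up m (N - m) (\<lambda>x. [:\<rho> x ^ (CARD('a) ^ m):]) x) (thA m)"

lemma dn_vv:
 assumes "\<And>x. x \<notin> I ==> \<rho> x = 0"
 shows "poly (dn m k (up m k (\<lambda>x. [:\<rho> x ^ (CARD('a) ^ m):])) x) (thA m)
  = (\<Prod>i<k. poly (tw (m + i) \<delta>) (thA m)) * \<rho> x ^ (CARD('a) ^ m)"
 using dn_up[of "\<lambda>x. [:\<rho> x ^ (CARD('a) ^ m):]" m k] assms by (simp add: poly_prod mult.commute)

lemma delta_prod_nz: "(\<Prod>i<k. poly (tw (m + i) \<delta>) (thA m)) \<noteq> 0"
 using delta_nz by simp

text \<open>Transporting back to level \<open>m\<close> recovers \<open>\<rho> ^ (q^m)\<close> up to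
  values of \<open>\<delta>\<close> that do not vanish.\<close>

lemma vv_nonzero:
 assumes "\<And>x. x \<notin> I ==> \<rho> x = 0" "x0 \<in> I" "\<rho> x0 \<noteq> 0"
 shows "\<exists>x\<in>I. vv \<rho> N m x \<noteq> 0"
proof (rule ccontr)
 assume "\<not> ?thesis"
 then have z: "1 * poly (up m (N - m) (\<lambda>x. [:\<rho> x ^ (CARD('a) ^ m):]) x) (thA m) = 0 * poly (0::'a poly poly) (thA m)" if "x \<in> I" for x
  using that by (auto simp: vv_def)
 have "1 * poly (dn m (N - m) (up m (N - m) (\<lambda>x. [:\<rho> x ^ (CARD('a) ^ m):])) x0) (thA m) = 0 * poly (dn m (N - m) (\<lambda>_. 0) x0) (thA m)"
  by (rule dn_eval_cong[OF z assms(2)])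
 then show False using assms(3) delta_prod_nz by (simp add: dn_vv[OF assms(1)])
qed

text \<open>The bound is uniform in \<open>m\<close> and of the order of \<open>q^N\<close>, like
  the parameter \<open>T\<close> of the unknowns, so that the constant \<open>t0\<close> in
  \<open>siegel_points\<close> can absorb it.\<close>

lemma vv_degree:
 assumes C: "\<And>x y. x \<in> I ==> y \<in> I ==> dtb C C (\<Phi> x y)" and r: "\<And>x. x \<in> I ==> degree (\<rho> x) \<le> C"
  and "x \<in> I" "m \<le> N"
 shows "degree (vv \<rho> N m x) \<le> 3 * C * CARD('a) ^ N"
proof -
 let ?q = "CARD('a)"
 have "dtb 0 (?q ^ m * C) [:\<rho> y ^ (?q ^ m):]" if "y \<in> I" for y
  using r[OF that] by (intro dtb_const order_trans[OF degree_power_le]) (simp add: mult.commute)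
 from dtb_up[OF C this assms(3)] have "dtb (0 + (N - m) * C) (?q ^ m * C + ?q ^ (m + (N - m)) * C) (up m (N - m) (\<lambda>x. [:\<rho> x ^ (?q ^ m):]) x)" .
 from degree_poly_dtb[OF this, of "thA m" "?q ^ m"]
 have "degree (vv \<rho> N m x) \<le> ?q ^ m * C + ?q ^ N * C + (N - m) * C * ?q ^ m"
  using assms(4) by (simp add: vv_def)
 moreover have "?q ^ m \<le> ?q ^ N" using assms(4) card_ge_2[where 'a = 'a] by (intro power_increasing) auto
 moreover have "(N - m) * ?q ^ m \<le> ?q ^ N"
 proof -
  have "N - m \<le> 2 ^ (N - m)" using less_exp[of "N - m"] by simp
  also have "\<dots> \<le> ?q ^ (N - m)" by (rule power_mono[OF card_ge_2]) simp
  finally have "(N - m) * ?q ^ m \<le> ?q ^ (N - m) * ?q ^ m" by (rule mult_right_mono) simp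
  then show ?thesis using assms(4) by (simp flip: power_add)
 qed
 ultimately have "degree (vv \<rho> N m x) \<le> ?q ^ N * C + ?q ^ N * C + ?q ^ N * C"
  by (elim order_trans) (intro add_mono, simp_all add: mult.commute mult.left_commute)
 then show ?thesis by (simp add: mult.commute mult.left_commute)
qed

lemma vge_th: "m \<le> N ==> vge (- int (CARD('a) ^ N)) (th m :: 'a fls)"
 using card_ge_2[where 'a = 'a] by (simp add: vge_subdegree power_increasing)

lemma psi_tau_DD: "x \<in> I ==> DD (int (CARD('a) ^ N)) (tau N (\<psi> x))"
 using DD_tau[OF psi_DD, of x N] by simp

text \<open>Twisting the assumed zero at \<open>\<theta>\<close> gives a zero of the twisted
  relation at \<open>\<theta>^(q^m)\<close>; transport to level \<open>N\<close> only multiplies by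
  polynomials.\<close>

lemma vanish_at:
 assumes "m \<le> N" and 0: "Ev 1 (th 0) (\<Sum>x\<in>I. fps_const (AK (\<rho> x)) * \<psi> x) 0"
  and c: "c \<noteq> 0" "\<And>x. x \<in> I ==> c * poly (g x) (thA m) = d * vv \<rho> N m x"
 shows "Ev (int (CARD('a) ^ N)) (th m) (pr g N) 0"
proof -
 let ?Q = "int (CARD('a) ^ N)" and ?R = "\<lambda>x. [:\<rho> x ^ (CARD('a) ^ m):]"
 note v = vge_th[OF assms(1)]
 have "\<forall>x\<in>I. \<exists>e. Ev ?Q (th m) (tau N (\<psi> x)) e" using Ev_exists[OF v psi_tau_DD] by blast
 then obtain e where e: "\<And>x. x \<in> I ==> Ev ?Q (th m) (tau N (\<psi> x)) (e x)" by metis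
 have emb: "Ev ?Q (th m) (emb P) (AK (poly P (thA m)))" for P :: "'a poly poly" using Ev_emb[of ?Q "thA m" P] v by simp
 have ev: "Ev ?Q (th m) (pr w N) (\<Sum>x\<in>I. AK (poly (w x) (thA m)) * e x)" for w
  unfolding pr_def by (intro Ev_sum v Ev_mult emb e)
 have pos: "vge (- int (CARD('a) ^ m)) (th m :: 'a fls)" by (rule vge_th) simp
 have le: "int (CARD('a) ^ m) \<le> ?Q" using assms(1) card_ge_2[where 'a = 'a] by (simp add: power_increasing)
 have "pr ?R m = tau m (\<Sum>x\<in>I. fps_const (AK (\<rho> x)) * \<psi> x)"
  by (simp add: pr_def emb_const tau_sum AK_power)
 then have "Ev (int (CARD('a) ^ m)) (th m) (pr ?R m) 0"
  using Ev_tau[OF 0, of m] by simp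
 then have "Ev (int (CARD('a) ^ m)) (th m) (emb (\<Prod>i<N-m. tw (m + i) \<beta>) * pr ?R m) (AK (poly (\<Prod>i<N-m. tw (m + i) \<beta>) (thA m)) * 0)"
  using Ev_emb[of "int (CARD('a) ^ m)" "thA m" "\<Prod>i<N-m. tw (m + i) \<beta>"] pos by (intro Ev_mult) simp_all
 then have "Ev (int (CARD('a) ^ m)) (th m) (pr (up m (N - m) ?R) N) 0"
  using pr_up[of m "N - m" ?R] assms(1) by simp
 \<comment> \<open>The twisted relation is known to converge on the disc of radius
   \<open>q^m\<close> only, so both values are compared on this smaller disc.\<close>
 moreover have "Ev (int (CARD('a) ^ m)) (th m) (pr (up m (N - m) ?R) N) (\<Sum>x\<in>I. AK (vv \<rho> N m x) * e x)"
  using Ev_mono[OF ev le pos] by (simp add: vv_def)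
 ultimately have z: "(\<Sum>x\<in>I. AK (vv \<rho> N m x) * e x) = 0" using Ev_unique by blast
 have "AK c * (\<Sum>x\<in>I. AK (poly (g x) (thA m)) * e x) = (\<Sum>x\<in>I. AK (c * poly (g x) (thA m)) * e x)"
  by (simp add: sum_distrib_left AK_mult mult.assoc)
 also have "\<dots> = (\<Sum>x\<in>I. AK (d * vv \<rho> N m x) * e x)" by (rule sum.cong) (simp_all add: c)
 also have "\<dots> = AK d * (\<Sum>x\<in>I. AK (vv \<rho> N m x) * e x)"
  by (simp add: sum_distrib_left AK_mult mult.assoc)
 finally have "(\<Sum>x\<in>I. AK (poly (g x) (thA m)) * e x) = 0" using c(1) z by simp
 then show ?thesis using ev[of g] by simp
qed

text \<open>Only proportionality to \<open>vv\<close> is imposed, measured against the pivot entry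
  \<open>p m\<close>; this costs \<open>l - 1\<close> equations per point instead of
  \<open>l\<close>. With \<open>N = 2ln\<close> points and \<open>t\<close>-degree below
  \<open>D = (2l-1)n\<close>, the unknowns exceed the leading term of the count by
  \<open>l * n * T\<close>, and \<open>t0\<close> makes this surplus outweigh the lower terms.
  Moreover \<open>N - D = n\<close>, which is the gain in \<open>schwarz\<close>.\<close>

lemma siegel_points:
 assumes C: "\<And>x y. x \<in> I ==> y \<in> I ==> dtb C C (\<Phi> x y)" and r: "\<And>x. x \<in> I ==> degree (\<rho> x) \<le> C"
  and supp: "\<And>x. x \<notin> I ==> \<rho> x = 0" and nz: "x0 \<in> I" "\<rho> x0 \<noteq> 0"
  and l: "l = card I" and t0: "t0 = (2 * CARD('a) + 6 * C) * l" and n: "n \<ge> 1"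
  and N: "N = 2 * l * n" and D: "D = (2 * l - 1) * n" and T: "T = t0 * CARD('a) ^ N"
 shows "\<exists>g p. (\<forall>x\<in>I. g x \<in> PS (PS UNIV T) D) \<and> (\<exists>x\<in>I. g x \<noteq> 0) \<and>
  (\<forall>m. p m \<in> I \<and> vv \<rho> N m (p m) \<noteq> 0) \<and>
  (\<forall>m\<in>{1..N}. \<forall>x\<in>I. vv \<rho> N m (p m) * poly (g x) (thA m) = poly (g (p m)) (thA m) * vv \<rho> N m x)"
proof -
 let ?q = "CARD('a)"
 have q2: "?q \<ge> 2" by (rule card_ge_2)
 define Qn where "Qn = ?q ^ N"
 have Qn: "Qn \<ge> 1" using card_power_pos[where 'a = 'a, of N] by (simp add: Qn_def del: card_power_pos)
 have TQ: "T = t0 * Qn" by (simp add: T Qn_def)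
 have "\<forall>m. \<exists>x. x \<in> I \<and> vv \<rho> N m x \<noteq> 0" using vv_nonzero[of \<rho> x0, OF supp nz] by blast
 then obtain p where p: "\<And>m. p m \<in> I" "\<And>m. vv \<rho> N m (p m) \<noteq> 0" by metis
 have l1: "l \<ge> 1" using nz(1) finI card_gt_0_iff[of I] by (auto simp: l Suc_le_eq)
 then obtain k where k: "l = Suc k" by (cases l) auto
 have T1: "T \<ge> 1" and D1: "D \<ge> 1" using l1 n q2 Qn by (auto simp: T t0 D Qn_def[symmetric])
 define J where "J = (SIGMA m:{1..N}. I - {p m})"
 define L where "L j g = poly (g (snd j)) (thA (fst j)) * vv \<rho> N (fst j) (p (fst j))
  - poly (g (p (fst j))) (thA (fst j)) * vv \<rho> N (fst j) (snd j)" for j and g :: "'i => 'a poly poly"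
 define M where "M j = T + D * ?q ^ fst j + 3 * C * Qn" for j :: "nat \<times> 'i"
 have "\<exists>g. (\<forall>x\<in>I. g x \<in> PS (PS UNIV T) D) \<and> (\<exists>x\<in>I. g x \<noteq> 0) \<and> (\<forall>j\<in>J. L j g = 0)"
 proof (rule siegel)
  show "finite I" by (rule finI)
  show "finite J" by (simp add: J_def finI)
  show "L j (\<lambda>x. a x - b x) = L j a - L j b" for j a b by (simp add: L_def algebra_simps)
  show "L j a \<in> PS UNIV (M j)" if j: "j \<in> J" and a: "\<And>x. x \<in> I ==> a x \<in> PS (PS UNIV T) D" for j a
  proof -
   obtain m x where mx: "j = (m, x)" "m \<le> N" "x \<in> I" using j by (auto simp: J_def)
   have b: "degree (poly (a y) (thA m) * vv \<rho> N m z) \<le> (T - 1) + (D - 1) * ?q ^ m + 3 * C * Qn" if "y \<in> I" "z \<in> I" for y z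
    using degree_poly_dtb[OF PS_dtb[OF a[OF that(1)]], of "thA m" "?q ^ m"] vv_degree[OF C r that(2) mx(2)]
    by (intro order_trans[OF degree_mult_le] add_mono) (simp_all add: Qn_def)
   have "degree (L j a) \<le> (T - 1) + (D - 1) * ?q ^ m + 3 * C * Qn"
    unfolding L_def mx fst_conv snd_conv by (intro degree_diff_le b p mx)
   also have "\<dots> < M j"
   proof -
    have "(D - 1) * ?q ^ m \<le> D * ?q ^ m" by simp
    then show ?thesis using T1 unfolding M_def mx fst_conv by linarith
   qed
   finally show ?thesis by (simp add: PS_degree_less)
  qed
  have sg: "(\<Sum>m\<in>{1..N}. ?q ^ m) \<le> ?q * Qn"
  proof -
   have "(\<Sum>m\<in>{1..N}. ?q ^ m) = (\<Sum>i<N. ?q ^ (1 + i))"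
    by (rule sum.reindex_bij_witness[of _ Suc "\<lambda>i. i - 1"]) auto
   then show ?thesis using sum_geom_le[of 1 N] by (simp add: Qn_def)
  qed
  have "(\<Sum>j\<in>J. M j) = (\<Sum>(m, x)\<in>J. M (m, x))" by (rule sum.cong) auto
  also have "\<dots> = (\<Sum>m\<in>{1..N}. \<Sum>x\<in>I - {p m}. M (m, x))"
   unfolding J_def by (rule sum.Sigma[symmetric]) (auto simp: finI)
  also have "\<dots> = (\<Sum>m\<in>{1..N}. k * (T + D * ?q ^ m + 3 * C * Qn))"
  proof (rule sum.cong[OF refl])
   fix m
   have "card (I - {p m}) = k" using p(1)[of m] k l finI by (simp add: card_Diff_singleton)
   then show "(\<Sum>x\<in>I - {p m}. M (m, x)) = k * (T + D * ?q ^ m + 3 * C * Qn)" by (simp add: M_def)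
  qed
  also have "\<dots> = k * (N * T + D * (\<Sum>m\<in>{1..N}. ?q ^ m) + N * (3 * C * Qn))"
   by (simp add: sum.distrib sum_distrib_left algebra_simps)
  also have "\<dots> \<le> k * (N * T + D * (?q * Qn) + N * (3 * C * Qn))"
   using sg by (intro mult_left_mono add_mono) auto
  also have "\<dots> = (k * (2 * (k + 1) * t0 + (2 * k + 1) * ?q + 6 * C * (k + 1))) * (n * Qn)"
   by (simp add: N D TQ k algebra_simps)
  also have "\<dots> < (t0 * (2 * k + 1) * (k + 1)) * (n * Qn)"
  proof (rule mult_strict_right_mono)
   have "k * ((2 * k + 1) * ?q + 6 * C * (k + 1)) \<le> k * ((2 * ?q + 6 * C) * (k + 1))"
    by (intro mult_left_mono) (simp_all add: algebra_simps)
   also have "\<dots> < (k + 1) * ((2 * ?q + 6 * C) * (k + 1))"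
    using q2 by (intro mult_strict_right_mono) auto
   also have "\<dots> = t0 * (k + 1)" by (simp add: t0 k)
   finally have "k * ((2 * k + 1) * ?q + 6 * C * (k + 1)) < t0 * (k + 1)" .
   moreover have "k * (2 * (k + 1) * t0 + (2 * k + 1) * ?q + 6 * C * (k + 1)) = k * (2 * (k + 1) * t0) + k * ((2 * k + 1) * ?q + 6 * C * (k + 1))"
    by (simp add: algebra_simps)
   moreover have "t0 * (2 * k + 1) * (k + 1) = k * (2 * (k + 1) * t0) + t0 * (k + 1)"
    by (simp add: algebra_simps)
   ultimately show "k * (2 * (k + 1) * t0 + (2 * k + 1) * ?q + 6 * C * (k + 1)) < t0 * (2 * k + 1) * (k + 1)" by linarith
   show "0 < n * Qn" using n Qn by simp
  qed
  also have "\<dots> = T * D * card I"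
   by (simp add: TQ D k algebra_simps flip: l)
  finally show "(\<Sum>j\<in>J. M j) < T * D * card I" .
 qed
 then obtain g where g: "\<forall>x\<in>I. g x \<in> PS (PS UNIV T) D" "\<exists>x\<in>I. g x \<noteq> 0" "\<forall>j\<in>J. L j g = 0" by blast
 have "vv \<rho> N m (p m) * poly (g x) (thA m) = poly (g (p m)) (thA m) * vv \<rho> N m x" if "m \<in> {1..N}" "x \<in> I" for m x
 proof (cases "x = p m")
  case False
  then have "(m, x) \<in> J" using that by (auto simp: J_def)
  then have "L (m, x) g = 0" using g(3) by blast
  then show ?thesis by (simp add: L_def mult.commute)
 qed (simp add: mult.commute)
 then show ?thesis using g p by blast
qed

end

section \<open>Vanishing of the auxiliary function and return to level 0\<close>

context abp_system
begin

text \<open>The coefficient vectors of the twists \<open>tau i (pr g N)\<close> for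
  \<open>i = 0, ..., l\<close>, all moved to level \<open>N + l\<close>, are \<open>l + 1\<close>
  vectors with \<open>l\<close> entries, hence dependent. Siegel's lemma finds a dependence with
  controlled degrees.\<close>

lemma relation_exists:
 assumes C: "\<And>x y. x \<in> I ==> y \<in> I ==> dtb C C (\<Phi> x y)"
  and l: "l = card I" and ne: "I \<noteq> {}"
  and g: "\<And>x. x \<in> I ==> dtb D0 T0 (g x)"
  and Tu: "Tu = CARD('a) ^ l * T0 + CARD('a) ^ (N + l) * C + 1"
 shows "\<exists>a. (\<forall>i\<in>{..l}. dtb (4 * l * (D0 + l * C + 1)) (4 * l * Tu) (a i)) \<and> (\<exists>i\<in>{..l}. a i \<noteq> 0) \<and>
  (\<forall>x\<in>I. (\<Sum>i\<in>{..l}. a i * up (N + i) (l - i) (\<lambda>x. tw i (g x)) x) = 0)"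
proof -
 let ?q = "CARD('a)"
 define u where "u i x = up (N + i) (l - i) (\<lambda>x. tw i (g x)) x" for i x
 define Du where "Du = D0 + l * C + 1"
 have l1: "l \<ge> 1" using ne finI card_gt_0_iff[of I] by (auto simp: l Suc_le_eq)
 have u: "dtb (Du - 1) (Tu - 1) (u i x)" if "i \<le> l" "x \<in> I" for i x
 proof -
  have "dtb (D0 + (l - i) * C) (?q ^ i * T0 + ?q ^ (N + i + (l - i)) * C) (u i x)"
   unfolding u_def by (rule dtb_up[OF C dtb_tw[OF g] that(2)])
  moreover have "?q ^ i * T0 \<le> ?q ^ l * T0" using that(1) card_ge_2[where 'a = 'a] by (intro mult_right_mono power_increasing) auto
  ultimately show ?thesis using that(1) by (elim dtb_mono) (simp_all add: Du_def Tu)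
 qed
 \<comment> \<open>The factor \<open>4 * l\<close> is large enough for
   \<open>l * (4l+1)^2 < (l+1) * (4l)^2\<close>, the comparison of equations with unknowns.\<close>
 define Da Ta where "Da = 4 * l * Du" and "Ta = 4 * l * Tu"
 define J where "J = I \<times> {..<Da + Du}"
 define L where "L j a = coeff (\<Sum>i\<in>{..l}. a i * u i (fst j)) (snd j)" for j and a :: "nat => 'a poly poly"
 have D1: "Du \<ge> 1" "Tu \<ge> 1" by (simp_all add: Du_def Tu)
 have DT: "Da \<ge> 1" "Ta \<ge> 1" using D1 l1 by (simp_all add: Da_def Ta_def Suc_le_eq)
 have bnd: "dtb (Da - 1 + (Du - 1)) (Ta - 1 + (Tu - 1)) (\<Sum>i\<in>{..l}. a i * u i x)"
  if a: "\<And>i. i \<in> {..l} ==> a i \<in> PS (PS UNIV Ta) Da" and x: "x \<in> I" for a x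
  by (intro dtb_sum dtb_mult PS_dtb a u x) auto
 have "\<exists>a. (\<forall>i\<in>{..l}. a i \<in> PS (PS UNIV Ta) Da) \<and> (\<exists>i\<in>{..l}. a i \<noteq> 0) \<and> (\<forall>j\<in>J. L j a = 0)"
 proof (rule siegel[where M = "\<lambda>_. Ta + Tu"])
  show "finite J" by (simp add: J_def finI)
  show "L j (\<lambda>x. a x - b x) = L j a - L j b" for j a b by (simp add: L_def left_diff_distrib sum_subtractf)
  show "L j a \<in> PS UNIV (Ta + Tu)" if j: "j \<in> J" and a: "\<And>x. x \<in> {..l} ==> a x \<in> PS (PS UNIV Ta) Da" for j a
  proof -
   have "degree (L j a) \<le> Ta - 1 + (Tu - 1)" using bnd[of a "fst j", OF a] j unfolding L_def dtb_def J_def by auto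
   then show ?thesis using DT D1 by (auto simp: PS_degree_less)
  qed
  have "(\<Sum>j\<in>J. Ta + Tu) = l * (4 * l + 1) * (4 * l + 1) * (Du * Tu)"
   by (simp add: J_def card_cartesian_product Da_def Ta_def algebra_simps flip: l)
  also have "\<dots> < 16 * l * l * (l + 1) * (Du * Tu)"
  proof (rule mult_strict_right_mono)
   have "l * (4 * l + 1) * (4 * l + 1) = 16 * (l * l * l) + 8 * (l * l) + l" by (simp add: algebra_simps)
   moreover have "16 * l * l * (l + 1) = 16 * (l * l * l) + 16 * (l * l)" by (simp add: algebra_simps)
   moreover have "l * 1 \<le> l * l" using l1 by (intro mult_left_mono) auto
   ultimately show "l * (4 * l + 1) * (4 * l + 1) < 16 * l * l * (l + 1)" using l1 by linarith
   show "0 < Du * Tu" using D1 by simp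
  qed
  also have "\<dots> = Ta * Da * card {..l}" by (simp add: Da_def Ta_def algebra_simps)
  finally show "(\<Sum>j\<in>J. Ta + Tu) < Ta * Da * card {..l}" .
 qed simp
 then obtain a where a: "\<forall>i\<in>{..l}. a i \<in> PS (PS UNIV Ta) Da" "\<exists>i\<in>{..l}. a i \<noteq> 0" "\<forall>j\<in>J. L j a = 0" by blast
 have "(\<Sum>i\<in>{..l}. a i * u i x) = 0" if x: "x \<in> I" for x
 proof (rule poly_eqI)
  fix k
  show "coeff (\<Sum>i\<in>{..l}. a i * u i x) k = coeff 0 k"
  proof (cases "k < Da + Du")
   case True
   then have "(x, k) \<in> J" using x by (simp add: J_def)
   then have "L (x, k) a = 0" using a(3) by blast
   then show ?thesis by (simp add: L_def)
  next
   case False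
   have "degree (\<Sum>i\<in>{..l}. a i * u i x) \<le> Da - 1 + (Du - 1)" using bnd[of a x] x a(1) by (auto simp: dtb_def)
   then show ?thesis using False DT by (simp add: coeff_eq_0)
  qed
 qed
 moreover have "dtb Da Ta (a i)" if "i \<in> {..l}" for i
  by (rule dtb_mono[OF PS_dtb[OF a(1)[rule_format, OF that]]]) auto
 ultimately show ?thesis using a(2) unfolding u_def Da_def Ta_def Du_def by blast
qed

text \<open>A nonzero \<open>E = pr g N\<close> would satisfy a linear relation between its twists,
  whose Gauss valuations are \<open>q^i * v\<close>. Since \<open>v\<close> exceeds the degree
  \<open>W\<close> of the coefficients, the term with the smallest index \<open>i0\<close> would
  stand alone.\<close>

lemma E_zero:
 assumes C: "\<And>x y. x \<in> I ==> y \<in> I ==> dtb C C (\<Phi> x y)" and Cb: "dtb C C \<beta>"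
  and l: "l = card I" and ne: "I \<noteq> {}"
  and g: "\<And>x. x \<in> I ==> dtb D0 T0 (g x)"
  and V: "NB 0 (- int V) (pr g N)"
  and large: "4 * l * (CARD('a) ^ l * T0 + CARD('a) ^ (N + l) * C + 1) + CARD('a) ^ (N + l) * C < V"
 shows "pr g N = 0"
proof (rule ccontr)
 let ?q = "CARD('a)" and ?E = "pr g N"
 assume E: "?E \<noteq> 0"
 define W where "W = 4 * l * (?q ^ l * T0 + ?q ^ (N + l) * C + 1) + ?q ^ (N + l) * C"
 obtain a where a: "\<And>i. i \<le> l ==> dtb (4 * l * (D0 + l * C + 1)) (4 * l * (?q ^ l * T0 + ?q ^ (N + l) * C + 1)) (a i)"
  "\<exists>i\<in>{..l}. a i \<noteq> 0"
  "\<And>x. x \<in> I ==> (\<Sum>i\<in>{..l}. a i * up (N + i) (l - i) (\<lambda>x. tw i (g x)) x) = 0"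
  using relation_exists[of C l D0 T0 g _ N, OF C l ne g refl] by (auto simp: Ball_def)
 define B where "B i = (\<Prod>j<l - i. tw (N + i + j) \<beta>)" for i
 have "dtb ((l - i) * C) (\<Sum>j<l - i. ?q ^ (N + i + j) * C) (B i)" for i
  using dtb_prod[of "{..<l - i}" C "\<lambda>j. ?q ^ (N + i + j) * C" "\<lambda>j. tw (N + i + j) \<beta>"] dtb_tw[OF Cb] by (simp add: B_def)
 moreover have "(\<Sum>j<l - i. ?q ^ (N + i + j) * C) \<le> ?q ^ (N + l) * C" if "i \<le> l" for i
  using sum_geom_le[of "N + i" "l - i"] that by (simp flip: sum_distrib_right)
 ultimately have B: "dtb ((l - i) * C) (?q ^ (N + l) * C) (B i)" if "i \<le> l" for i using that dtb_mono by blast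
 have B0: "B i \<noteq> 0" for i using beta_nz by (simp add: B_def)
 have prg: "pr (\<lambda>x. tw i (g x)) (N + i) = tau i ?E" for i
  by (simp add: pr_def tau_sum tau_emb tau_tau add.commute)
 have "(\<Sum>i\<in>{..l}. emb (a i * B i) * tau i ?E) = (\<Sum>i\<in>{..l}. emb (a i) * pr (up (N + i) (l - i) (\<lambda>x. tw i (g x))) (N + l))"
 proof (rule sum.cong[OF refl])
  fix i assume "i \<in> {..l}"
  then have "pr (up (N + i) (l - i) (\<lambda>x. tw i (g x))) (N + l) = emb (B i) * tau i ?E"
   using pr_up[of "N + i" "l - i" "\<lambda>x. tw i (g x)"] by (simp add: prg B_def)
  then show "emb (a i * B i) * tau i ?E = emb (a i) * pr (up (N + i) (l - i) (\<lambda>x. tw i (g x))) (N + l)"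
   by (simp add: emb_mult mult.assoc)
 qed
 also have "\<dots> = (\<Sum>x\<in>I. emb (\<Sum>i\<in>{..l}. a i * up (N + i) (l - i) (\<lambda>x. tw i (g x)) x) * tau (N + l) (\<psi> x))"
  unfolding pr_def by (simp add: sum_distrib_left sum_distrib_right emb_sum emb_mult mult.assoc, rule sum.swap)
 also have "\<dots> = 0" by (simp add: a(3))
 finally have rel: "(\<Sum>i\<in>{..l}. emb (a i * B i) * tau i ?E) = 0" .
 obtain v where v: "gv v ?E" "v \<ge> int V" using gv_exists[OF E V] by auto
 then have vW: "v > int W" using large unfolding W_def[symmetric] by linarith
 define i0 where "i0 = (LEAST i. i \<le> l \<and> a i \<noteq> 0)"
 have "\<exists>i. i \<le> l \<and> a i \<noteq> 0" using a(2) by auto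
 then have i0: "i0 \<le> l" "a i0 \<noteq> 0" unfolding i0_def by (metis (mono_tags, lifting) LeastI)+
 have least: "a i = 0" if "i < i0" for i using not_less_Least[of i "\<lambda>i. i \<le> l \<and> a i \<noteq> 0"] that i0(1) by (auto simp: i0_def)
 have aB: "dtb (4 * l * (D0 + l * C + 1) + (l - i) * C) W (a i * B i)" if "i \<le> l" for i
  unfolding W_def by (rule dtb_mult[OF a(1) B]) (use that in auto)
 obtain w where w: "gv w (emb (a i0 * B i0))" "w \<le> 0" using gv_emb[OF _ aB[OF i0(1)]] i0(2) B0 by auto
 define z where "z = int (?q ^ i0) * v"
 have "gv (w + z) (emb (a i0 * B i0) * tau i0 ?E)" unfolding z_def by (rule gv_mult[OF w(1) gv_tau[OF v(1)]])
 then obtain n where n: "\<not> vge (w + z + 1) ((emb (a i0 * B i0) * tau i0 ?E) $ n)" using gv_le by blast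
 have oth: "vge (z + 1) ((emb (a i * B i) * tau i ?E) $ n)" if i: "i \<in> {..l} - {i0}" for i
 proof (cases "i < i0")
  case False
  then have ii: "i0 + 1 \<le> i" "i \<le> l" using i by auto
  have "NB 0 (- v) ?E" using v(1) by (simp add: NB_def gv_def)
  then have "NB 0 (- (int (?q ^ i) * v)) (tau i ?E)" using NB_tau[of 0 "- v" ?E i] by simp
  moreover have "NB 0 (int W) (emb (a i * B i))" using NB_dtb[OF aB[OF ii(2)], of 0] by simp
  ultimately have "NB 0 (int W + - (int (?q ^ i) * v)) (emb (a i * B i) * tau i ?E)" by (intro NB_mult)
  from this[unfolded NB_def, rule_format, of n]
  have "vge (int (?q ^ i) * v - int W) ((emb (a i * B i) * tau i ?E) $ n)" by (simp add: algebra_simps)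
  moreover have "z + 1 \<le> int (?q ^ i) * v - int W"
  proof -
   have "?q ^ i0 + 1 \<le> 2 * ?q ^ i0" using card_power_pos[where 'a = 'a, of i0] by linarith
   also have "\<dots> \<le> ?q ^ (i0 + 1)" using card_ge_2[where 'a = 'a] by simp
   also have "\<dots> \<le> ?q ^ i" using ii card_ge_2[where 'a = 'a] by (intro power_increasing) auto
   finally have "int (?q ^ i0) + 1 \<le> int (?q ^ i)" by linarith
   then have "(int (?q ^ i0) + 1) * v \<le> int (?q ^ i) * v" using vW by (intro mult_right_mono) auto
   then show ?thesis using vW by (simp only: distrib_right z_def)
  qed
  ultimately show ?thesis by (rule vge_mono)
 qed (simp add: least)
 have "(emb (a i0 * B i0) * tau i0 ?E) $ n = - (\<Sum>i\<in>{..l} - {i0}. (emb (a i * B i) * tau i ?E) $ n)"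
  using arg_cong[OF rel, of "\<lambda>f. f $ n"] i0(1) by (subst (asm) sum.remove[of _ i0]) (simp_all add: fps_sum_nth eq_neg_iff_add_eq_0)
 then have "vge (z + 1) ((emb (a i0 * B i0) * tau i0 ?E) $ n)" using oth by (simp only: vge_uminus) (rule vge_sum)
 then have "vge (w + z + 1) ((emb (a i0 * B i0) * tau i0 ?E) $ n)" by (rule vge_mono) (use w(2) in simp)
 then show False using n by blast
qed

lemma NB_prod:
 fixes f :: "'b => 'a fls fps"
 shows "(\<And>i. i \<in> S ==> NB r (c i) (f i)) ==> NB r (\<Sum>i\<in>S. c i) (\<Prod>i\<in>S. f i)"
 by (induction S rule: infinite_finite_induct) (auto intro: NB_mult NB_1)

lemma uniform_constant:
 "\<exists>C. (\<forall>x\<in>I. \<forall>y\<in>I. dtb C C (\<Phi> x y)) \<and> dtb C C \<beta> \<and> (\<forall>x\<in>I. degree (\<rho> x) \<le> C) \<and> (\<forall>x\<in>I. NB 1 (int C) (\<psi> x))"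
proof -
 have "\<exists>C. \<forall>z\<in>I \<times> I. dtb C C (\<Phi> (fst z) (snd z))"
  by (rule finite_uniform_bound) (auto simp: finI dtb_ex intro: dtb_mono)
 then obtain C1 where "\<forall>z\<in>I \<times> I. dtb C1 C1 (\<Phi> (fst z) (snd z))" by blast
 then have C1: "\<forall>x\<in>I. \<forall>y\<in>I. dtb C1 C1 (\<Phi> x y)" by auto
 obtain C2 where C2: "dtb C2 C2 \<beta>" using dtb_ex by blast
 have "\<exists>C. \<forall>x\<in>I. degree (\<rho> x) \<le> C"
  by (rule finite_uniform_bound) (auto simp: finI)
 then obtain C3 where C3: "\<forall>x\<in>I. degree (\<rho> x) \<le> C3" by blast
 have "\<exists>C. \<forall>x\<in>I. NB 1 (int C) (\<psi> x)"
 proof (rule finite_uniform_bound[OF finI])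
  fix x assume "x \<in> I"
  then obtain c where "c \<ge> 0" "NB 1 c (\<psi> x)" using DD_NB[OF psi_DD] by blast
  then show "\<exists>C. NB 1 (int C) (\<psi> x)" by (intro exI[of _ "nat c"]) simp
 qed (auto intro: NB_mono)
 then obtain C4 where C4: "\<forall>x\<in>I. NB 1 (int C4) (\<psi> x)" by blast
 define C where "C = C1 + C2 + C3 + C4"
 have "C1 \<le> C" "C2 \<le> C" "C3 \<le> C" "C4 \<le> C" by (simp_all add: C_def)
 then show ?thesis using C1 C2 C3 C4
  by (intro exI[of _ C]) (auto intro: dtb_mono NB_mono order_trans)
qed

text \<open>Coefficients are split along \<open>\<theta>^j\<close>, \<open>j < q^m\<close>, with
  \<open>q^m\<close>-th powers as components. By \<open>theta_independent\<close> every component is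
  a relation of its own, and \<open>q^m\<close>-th roots can be taken. Some component belongs to a
  nonzero multiple of \<open>\<rho>\<close>.\<close>

lemma descend:
 assumes \<sigma>: "\<sigma> \<noteq> 0" "\<kappa> \<noteq> 0" and P0: "pr P0 m = 0"
  and ev: "\<And>x. x \<in> I ==> \<sigma> * poly (P0 x) (thA m) = \<kappa> * \<rho> x ^ (CARD('a) ^ m)"
 shows "\<exists>P \<mu>. \<mu> \<noteq> 0 \<and> (\<forall>x\<in>I. poly (P x) (thA 0) = \<mu> * \<rho> x) \<and> (\<Sum>x\<in>I. emb (P x) * \<psi> x) = 0"
proof -
 let ?Q = "CARD('a) ^ m"
 have "\<forall>x. \<exists>c. P0 x = (\<Sum>j<?Q. [:monom 1 j:] * tw m (c j))" using poly_poly_frobenius_decomp by blast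
 then obtain c where c: "\<And>x. P0 x = (\<Sum>j<?Q. [:monom 1 j:] * tw m (c x j))" by metis
 \<comment> \<open>The extra factor makes the multiplier \<open>\<sigma>\<close> on the left a full
   \<open>?Q\<close>-th power, so that it can enter the components.\<close>
 define \<kappa>' where "\<kappa>' = \<sigma> ^ (?Q - 1) * \<kappa>"
 obtain k where k: "\<kappa>' = (\<Sum>j<?Q. monom 1 j * k j ^ ?Q)" using poly_frobenius_decomp by blast
 have pe: "\<sigma> * poly (c x j) (thA 0) = k j * \<rho> x" if x: "x \<in> I" and j: "j < ?Q" for x j
 proof -
  have "poly (P0 x) (thA m) = (\<Sum>j<?Q. monom 1 j * poly (c x j) (thA 0) ^ ?Q)"
   using poly_tw_thA[of m _ 0, where 'a = 'a] by (simp add: c poly_sum)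
  then have "\<sigma> ^ ?Q * poly (P0 x) (thA m) = (\<Sum>j<?Q. monom 1 j * (\<sigma> * poly (c x j) (thA 0)) ^ ?Q)"
   by (simp add: sum_distrib_left power_mult_distrib mult.left_commute)
  moreover have "\<sigma> ^ ?Q * poly (P0 x) (thA m) = \<kappa>' * \<rho> x ^ ?Q"
  proof -
   have "\<sigma> ^ ?Q = \<sigma> ^ (?Q - 1) * \<sigma>" by (metis card_power_neq0 power_minus_mult bot_nat_0.not_eq_extremum)
   then show ?thesis using ev[OF x] by (simp add: \<kappa>'_def mult.assoc)
  qed
  moreover have "\<kappa>' * \<rho> x ^ ?Q = (\<Sum>j<?Q. monom 1 j * (k j * \<rho> x) ^ ?Q)"
   by (simp add: k sum_distrib_right power_mult_distrib mult.assoc)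
  ultimately have "(\<Sum>j<?Q. monom 1 j * (\<sigma> * poly (c x j) (thA 0) - k j * \<rho> x) ^ ?Q) = 0"
   by (simp add: poly_frob_diff right_diff_distrib sum_subtractf)
  then have "AK (\<Sum>j<?Q. monom 1 j * (\<sigma> * poly (c x j) (thA 0) - k j * \<rho> x) ^ ?Q) = 0"
   by (simp only: AK_0)
  then have "(\<Sum>j<?Q. fls_X_inv ^ j * AK (\<sigma> * poly (c x j) (thA 0) - k j * \<rho> x) ^ ?Q) = 0"
   by (simp only: AK_sum AK_mult AK_power AK_monom fls_const_1 mult_1)
  from theta_independent[OF this j] show ?thesis by simp
 qed
 have "\<kappa>' \<noteq> 0" using \<sigma> by (simp add: \<kappa>'_def)
 then obtain j where j: "j < ?Q" "k j \<noteq> 0" unfolding k by (metis (no_types, lifting) lessThan_iff mult_zero_right sum.neutral zero_power_card)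
 define y where "y j = (\<Sum>x\<in>I. emb (c x j) * \<psi> x)" for j
 have "pr P0 m = (\<Sum>x\<in>I. \<Sum>j<?Q. fps_const (fls_X_inv ^ j) * (emb (tw m (c x j)) * tau m (\<psi> x)))"
  unfolding pr_def c by (simp add: emb_sum emb_mult emb_const AK_monom sum_distrib_right mult.assoc del: mult_pCons_left)
 also have "\<dots> = (\<Sum>j<?Q. fps_const (fls_X_inv ^ j) * tau m (y j))"
  by (subst sum.swap) (simp add: y_def tau_sum tau_emb sum_distrib_left)
 finally have py: "(\<Sum>j<?Q. fps_const (fls_X_inv ^ j) * tau m (y j)) = 0" using P0 by simp
 have "y j $ n = 0" for n
 proof -
  have "(\<Sum>j<?Q. fls_X_inv ^ j * (y j $ n) ^ ?Q) = 0" using arg_cong[OF py, of "\<lambda>f. f $ n"] by (simp add: fps_sum_nth)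
  from theta_independent[OF this j(1)] show ?thesis .
 qed
 then have y0: "y j = 0" by (simp add: fps_eq_iff)
 have "(\<Sum>x\<in>I. emb ([:\<sigma>:] * c x j) * \<psi> x) = fps_const (AK \<sigma>) * y j"
  unfolding y_def sum_distrib_left by (intro sum.cong refl) (simp only: emb_mult emb_const mult.assoc)
 then have "(\<Sum>x\<in>I. emb ([:\<sigma>:] * c x j) * \<psi> x) = 0" using y0 by simp
 moreover have "\<forall>x\<in>I. poly ([:\<sigma>:] * c x j) (thA 0) = k j * \<rho> x" using pe j by simp
 ultimately show ?thesis using j(2) by (intro exI[of _ "\<lambda>x. [:\<sigma>:] * c x j"] exI[of _ "k j"] conjI)
qed

text \<open>The function \<open>pr g N\<close> vanishes at \<open>\<theta>^(q^m)\<close> for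
  \<open>1 \<le> m \<le> N\<close>, is therefore too small to be nonzero, and so is itself a
  relation at level \<open>N\<close>. At a point where \<open>g\<close> does not vanish its value is
  proportional to \<open>vv\<close>, and going down to level \<open>m\<close> and then to 0 turns it
  into a relation over \<open>\<rho>\<close>.\<close>

theorem criterion:
 assumes supp: "\<And>x. x \<notin> I ==> \<rho> x = 0" and nz: "x0 \<in> I" "\<rho> x0 \<noteq> 0"
  and 0: "Ev 1 (th 0) (\<Sum>x\<in>I. fps_const (AK (\<rho> x)) * \<psi> x) 0"
 shows "\<exists>P \<mu>. \<mu> \<noteq> 0 \<and> (\<forall>x\<in>I. poly (P x) (thA 0) = \<mu> * \<rho> x) \<and> (\<Sum>x\<in>I. emb (P x) * \<psi> x) = 0"
proof -
 let ?q = "CARD('a)"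
 obtain C where "\<forall>x\<in>I. \<forall>y\<in>I. dtb C C (\<Phi> x y)" and Cb: "dtb C C \<beta>"
  and "\<forall>x\<in>I. degree (\<rho> x) \<le> C" "\<forall>x\<in>I. NB 1 (int C) (\<psi> x)" using uniform_constant by blast
 then have C: "\<And>x y. x \<in> I ==> y \<in> I ==> dtb C C (\<Phi> x y)" and Cr: "\<And>x. x \<in> I ==> degree (\<rho> x) \<le> C"
  and Cp: "\<And>x. x \<in> I ==> NB 1 (int C) (\<psi> x)" by auto
 define l where "l = card I"
 have ne: "I \<noteq> {}" using nz by auto
 have l1: "l \<ge> 1" using ne finI card_gt_0_iff[of I] by (auto simp: l_def Suc_le_eq)
 define t0 where "t0 = (2 * ?q + 6 * C) * l"
 \<comment> \<open>In units of \<open>q^N\<close>, this is the smallness that \<open>E_zero\<close>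
   asks for.\<close>
 define C2 where "C2 = 4 * l * (?q ^ l * t0 + ?q ^ l * C + 1) + ?q ^ l * C"
 \<comment> \<open>The gain from the zeros is \<open>n\<close> units of \<open>q^N\<close>, the
   losses are \<open>t0\<close>, \<open>C\<close> and \<open>q\<close> units. What remains is
   \<open>C2 + 1\<close>, one more than needed.\<close>
 define n where "n = t0 + C + ?q + 1 + C2"
 define N where "N = 2 * l * n"
 define D where "D = (2 * l - 1) * n"
 define Qn where "Qn = ?q ^ N"
 define T where "T = t0 * ?q ^ N"
 have n1: "n \<ge> 1" by (simp add: n_def)
 have Qn: "Qn \<ge> 1" using card_power_pos[where 'a = 'a, of N] by (simp add: Qn_def del: card_power_pos)
 obtain g p where g: "\<And>x. x \<in> I ==> g x \<in> PS (PS UNIV T) D" and gnz: "\<exists>x\<in>I. g x \<noteq> 0"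
  and p: "\<And>m. p m \<in> I" "\<And>m. vv \<rho> N m (p m) \<noteq> 0"
  and propo: "\<And>m x. m \<in> {1..N} ==> x \<in> I ==> vv \<rho> N m (p m) * poly (g x) (thA m) = poly (g (p m)) (thA m) * vv \<rho> N m x"
  using siegel_points[of C \<rho> x0, OF C Cr supp nz l_def t0_def n1 N_def D_def T_def] by blast
 have gd: "dtb D T (g x)" if "x \<in> I" for x using PS_dtb[OF g[OF that]] by (rule dtb_mono) auto
 have DN: "N = D + n" using l1 by (simp add: N_def D_def diff_mult_distrib)
 let ?E = "pr g N"
 have "NB (int Qn) ((int T + int Qn * int D) + int Qn * int C) ?E"
  unfolding pr_def
 proof (rule NB_sum)
  fix x assume x: "x \<in> I"
  show "NB (int Qn) ((int T + int Qn * int D) + int Qn * int C) (emb (g x) * tau N (\<psi> x))"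
   using NB_dtb[OF gd[OF x], of "int Qn"] NB_tau[OF Cp[OF x], of N] by (intro NB_mult) (simp_all add: Qn_def)
 qed
 moreover have "DD (int Qn) ?E" unfolding pr_def Qn_def by (intro DD_sum DD_mult DD_emb psi_tau_DD)
 moreover have "Ev (int Qn) \<alpha> ?E 0" if "\<alpha> \<in> th ` {1..N}" for \<alpha>
 proof -
  obtain m where m: "\<alpha> = th m" "m \<in> {1..N}" using \<open>\<alpha> \<in> th ` {1..N}\<close> by blast
  then show ?thesis unfolding Qn_def m(1) by (intro vanish_at[OF _ 0 p(2)[of m] propo]) auto
 qed
 ultimately obtain F where F: "?E = (\<Prod>\<alpha>\<in>th ` {1..N}. fps_X - fps_const \<alpha>) * F"
  "NB (int Qn) ((int T + int Qn * int D) + int Qn * int C - int (card (th ` {1..N} :: 'a fls set)) * int Qn) F"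
  using schwarz[of "th ` {1..N}" "int Qn" ?E] by blast
 have inj: "inj_on (th :: nat => 'a fls) {1..N}" by (auto simp: inj_on_def)
 have F2: "NB 0 ((int T + int Qn * int D) + int Qn * int C - int N * int Qn) F"
 proof -
  have "card (th ` {1..N} :: 'a fls set) = N" using card_image[OF inj] by simp
  then show ?thesis using NB_mono_r[OF F(2), of 0] by (simp only: of_nat_0_le_iff simp_thms)
 qed
 have "NB 0 (\<Sum>m\<in>{1..N}. int (?q ^ m)) (\<Prod>m\<in>{1..N}. fps_X - fps_const (th m :: 'a fls))"
 proof (rule NB_prod)
  fix m assume "m \<in> {1..N}"
  show "NB 0 (int (?q ^ m)) (fps_X - fps_const (th m :: 'a fls))"
   using NB_X[of 0, where 'a = 'a] vge_th[of m m] by (intro NB_diff NB_const) (auto elim: NB_mono)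
 qed
 moreover have "(\<Sum>m\<in>{1..N}. int (?q ^ m)) \<le> int (?q * Qn)"
 proof -
  have "(\<Sum>m\<in>{1..N}. ?q ^ m) = (\<Sum>i<N. ?q ^ (1 + i))"
   by (rule sum.reindex_bij_witness[of _ Suc "\<lambda>i. i - 1"]) auto
  then have "(\<Sum>m\<in>{1..N}. ?q ^ m) \<le> ?q * Qn" using sum_geom_le[of 1 N] by (simp add: Qn_def)
  then show ?thesis by (simp only: of_nat_sum[symmetric] of_nat_le_iff)
 qed
 ultimately have "NB 0 (int (?q * Qn)) (\<Prod>\<alpha>\<in>th ` {1..N}. fps_X - fps_const (\<alpha> :: 'a fls))"
  unfolding prod.reindex[OF inj] o_def by (rule NB_mono)
 from NB_mult[OF this F2] have "NB 0 (int (?q * Qn) + ((int T + int Qn * int D) + int Qn * int C - int N * int Qn)) ?E"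
  by (simp add: F(1))
 moreover have "int (?q * Qn) + ((int T + int Qn * int D) + int Qn * int C - int N * int Qn) = - int ((C2 + 1) * Qn)"
 proof -
  have TQ: "T = t0 * Qn" by (simp add: T_def Qn_def)
  show ?thesis unfolding DN TQ n_def by (simp add: algebra_simps)
 qed
 ultimately have V: "NB 0 (- int ((C2 + 1) * Qn)) ?E" by simp
 have E0: "?E = 0"
 proof (rule E_zero[of C l D T g, OF C Cb l_def ne gd V])
  have "4 * l * (?q ^ l * T + ?q ^ (N + l) * C + 1) + ?q ^ (N + l) * C
   = (4 * l * (?q ^ l * t0 + ?q ^ l * C) + ?q ^ l * C) * Qn + 4 * l"
   by (simp add: T_def Qn_def power_add algebra_simps)
  also have "\<dots> \<le> (4 * l * (?q ^ l * t0 + ?q ^ l * C) + ?q ^ l * C) * Qn + 4 * l * Qn"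
   using Qn by simp
  also have "\<dots> = C2 * Qn" by (simp add: C2_def algebra_simps)
  also have "\<dots> < (C2 + 1) * Qn" using Qn by simp
  finally show "4 * l * (?q ^ l * T + ?q ^ (N + l) * C + 1) + ?q ^ (N + l) * C < (C2 + 1) * Qn" .
 qed
 obtain x1 where x1: "x1 \<in> I" "g x1 \<noteq> 0" using gnz by blast
 \<comment> \<open>The \<open>t\<close>-degree of \<open>g x1\<close> is at most
   \<open>D < N\<close>, so the \<open>N\<close> points cannot all be zeros of it.\<close>
 have "\<exists>m\<in>{1..N}. poly (g x1) (thA m) \<noteq> 0"
 proof (rule ccontr)
  assume "\<not> ?thesis"
  then have "thA ` {1..N} \<subseteq> {a. poly (g x1) a = 0}" by auto
  moreover have "finite {a. poly (g x1) a = 0}" by (rule poly_roots_finite[OF x1(2)])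
  ultimately have "card (thA ` {1..N} :: 'a poly set) \<le> card {a. poly (g x1) a = 0}" by (rule card_mono[rotated])
  also have "\<dots> \<le> degree (g x1)" by (rule card_poly_roots_bound[OF x1(2)])
  also have "\<dots> \<le> D" using gd[OF x1(1)] by (simp add: dtb_def)
  finally show False using DN n1 by (simp add: card_image inj_on_def)
 qed
 then obtain m where m: "m \<in> {1..N}" "poly (g x1) (thA m) \<noteq> 0" by blast
 have "vv \<rho> N m (p m) * poly (g x1) (thA m) \<noteq> 0" using m p by simp
 then have k0: "poly (g (p m)) (thA m) \<noteq> 0" using propo[OF m(1) x1(1)] by auto
 let ?R = "\<lambda>x. [:\<rho> x ^ (?q ^ m):]"
 show ?thesis
 proof (rule descend)
  show "vv \<rho> N m (p m) \<noteq> 0" by (rule p)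
  show "poly (g (p m)) (thA m) * (\<Prod>i<N - m. poly (tw (m + i) \<delta>) (thA m)) \<noteq> 0"
   using k0 delta_prod_nz[of m "N - m"] by (simp only: mult_eq_0_iff disj_not1 simp_thms)
  show "pr (dn m (N - m) g) m = 0" using pr_dn[of g m "N - m"] E0 m(1) by simp
  fix x assume x: "x \<in> I"
  have "vv \<rho> N m (p m) * poly (dn m (N - m) g x) (thA m) = poly (g (p m)) (thA m) * poly (dn m (N - m) (up m (N - m) ?R) x) (thA m)"
   by (rule dn_eval_cong[OF _ x]) (use propo[OF m(1)] in \<open>simp add: vv_def\<close>)
  then show "vv \<rho> N m (p m) * poly (dn m (N - m) g x) (thA m)
    = poly (g (p m)) (thA m) * (\<Prod>i<N - m. poly (tw (m + i) \<delta>) (thA m)) * \<rho> x ^ (?q ^ m)"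
   by (simp add: dn_vv[of \<rho>, OF supp] mult.assoc)
 qed
qed

end

section \<open>An optimization problem on tokens\<close>

text \<open>Base-\<open>p\<close> digits are written with \<open>div\<close> and \<open>mod\<close>
  throughout; this reassembles the lowest \<open>N\<close> of them.\<close>

lemma digit_sum_mod:
 fixes p B :: nat
 shows "(\<Sum>e<N. (B div p ^ e mod p) * p ^ e) = B mod p ^ N"
proof (induction N)
 case (Suc N)
 have "B mod (p ^ N * p) = p ^ N * (B div p ^ N mod p) + B mod p ^ N" by (rule mod_mult2_eq)
 then show ?case using Suc by (simp add: algebra_simps)
qed simp

lemma digit_of_sum:
 fixes s :: "nat => nat"
 assumes "\<And>e. s e < p" "k < N"
 shows "(\<Sum>e<N. s e * p ^ e) div p ^ k mod p = s k"
 using assms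
proof (induction N arbitrary: s k)
 case (Suc N)
 have sp: "(\<Sum>e<Suc N. s e * p ^ e) = s 0 + p * (\<Sum>e<N. s (Suc e) * p ^ e)"
  by (subst sum.lessThan_Suc_shift) (simp add: sum_distrib_left mult.left_commute)
 have p0: "p > 0" "s 0 < p" using Suc.prems(1)[of 0] by auto
 show ?case
 proof (cases k)
  case 0 then show ?thesis using p0 unfolding sp by simp
 next
  case (Suc j)
  have "(s 0 + p * (\<Sum>e<N. s (Suc e) * p ^ e)) div p = (\<Sum>e<N. s (Suc e) * p ^ e)" using p0 by simp
  then show ?thesis using Suc.IH[of "\<lambda>e. s (Suc e)" j] Suc.prems Suc unfolding sp
   by (simp add: div_mult2_eq)
 qed
qed simp

text \<open>A token \<open>x\<close> of weight \<open>p ^ e x\<close> is put on a level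
  \<open>d x\<close>. In the application it stands for a factor \<open>lam i ^ (p^e)\<close> with
  \<open>i = d x\<close>: the cost is the exponent it contributes to the series variable, the value
  is the order of its pole in \<open>t\<close>. The task is to maximize the value with cost below
  \<open>K\<close>.\<close>

locale token_problem =
 fixes p f q :: nat and e :: "'x => nat"
 assumes p: "prime p" and f: "f \<ge> 1" and q: "q = p ^ f"
begin

definition w :: "'x => nat" where "w x = p ^ e x"
definition nu :: "'x set => nat" where "nu X = (\<Sum>x\<in>X. w x)"
definition cost :: "'x set => ('x => int) => real" where
 "cost X d = (\<Sum>x\<in>X. real (w x) * real q powi d x)"
definition val :: "'x set => ('x => int) => int" where
 "val X d = (\<Sum>x\<in>X. int (w x) * d x)"
definition opts :: "'x set => real => ('x => int) set" where
 "opts X K = {d \<in> PiE X (\<lambda>_. UNIV). cost X d < K \<and> (\<forall>d'. cost X d' < K \<longrightarrow> val X d' \<le> val X d)}"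
definition cls :: "'x set => nat => nat" where "cls X k = card {x \<in> X. e x = k}"
text \<open>The excess of the convex function \<open>q^d\<close> over its chord through the levels 0
  and 1.\<close>

definition F :: "int => real" where "F d = real q powi d - 1 - (real q - 1) * real_of_int d"

text \<open>What the cancellation argument consumes: the number of optima is prime to
  \<open>p\<close>; they have the same cost, hence later the same power of \<open>\<theta>\<close>;
  and negative levels, which no term of the series realizes, do not occur once the budget exceeds
  the total weight.\<close>

definition good :: "'x set => real => bool" where
 "good X K \<longleftrightarrow> finite (opts X K) \<and> \<not> p dvd card (opts X K) \<and>
  (\<exists>C. \<forall>d\<in>opts X K. cost X d = C) \<and> (real (nu X) < K \<longrightarrow> (\<forall>d\<in>opts X K. \<forall>x\<in>X. d x \<ge> 0))"

lemma p2: "p \<ge> 2" using p prime_ge_2_nat by auto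
lemma q2: "q \<ge> 2"
proof -
 have "p ^ 1 \<le> p ^ f" using f p2 by (intro power_increasing) auto
 then show ?thesis using p2 q by simp
qed
lemma p_dvd_q: "p dvd q" using f q by (metis dvd_power less_le_trans zero_less_one)
lemma w_pos: "w x > 0" using p2 by (simp add: w_def)

lemma F_01 [simp]: "F 0 = 0" "F 1 = 0" by (simp_all add: F_def)
lemma F_m1: "F (- 1) = (real q - 1)\<^sup>2 / real q"
 using q2 by (simp add: F_def power_int_minus field_simps power2_eq_square)
lemma F_big: assumes "d \<noteq> -1" "d \<noteq> 0" "d \<noteq> 1" shows "F d \<ge> real q - 1"
proof (cases "d \<ge> 0")
 case True
 then obtain n where n: "d = int n" using nonneg_int_cases by blast
 then have "n \<ge> 2" using assms by linarith
 then have "real q ^ n \<ge> 1 + (real q - 1) * real (n + 1)"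
 proof (induction n rule: dec_induct)
  case base
  have "0 \<le> (real q - 1) * (real q - 2)" using q2 by simp
  then show ?case by (simp add: power2_eq_square algebra_simps)
 next
  case (step n)
  have "(real q - 1) * 1 \<le> (real q - 1) * real q ^ n" using q2 by (intro mult_left_mono) auto
  then have "real q ^ Suc n \<ge> real q ^ n + (real q - 1)" by (simp add: algebra_simps)
  then show ?case using step by (simp add: algebra_simps)
 qed
 then show ?thesis by (simp add: F_def n algebra_simps)
next
 case False
 define n where "n = nat (- d)"
 with False have n: "d = - int n" by simp
 then have "n \<ge> 2" using assms by linarith
 define X where "X = (real q - 1) * real n"
 have "(real q - 1) * 2 \<le> X" unfolding X_def using q2 \<open>n \<ge> 2\<close> by (intro mult_left_mono) auto
 then have "2 * real q - 2 \<le> X" by (simp add: algebra_simps)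
 moreover have "real q powi d > 0" "real q \<ge> 2" using q2 by simp_all
 moreover have "F d = real q powi d - 1 + X" by (simp add: F_def n X_def)
 ultimately show ?thesis by linarith
qed
lemma F_m1_le: "(real q - 1)\<^sup>2 / real q \<le> real q - 1"
proof -
 have "(real q - 1) * (real q - 1) \<le> (real q - 1) * real q" using q2 by (intro mult_left_mono) auto
 then show ?thesis using q2 by (simp add: power2_eq_square divide_le_eq)
qed
lemma F_pos: "d \<noteq> 0 ==> d \<noteq> 1 ==> F d \<ge> (real q - 1)\<^sup>2 / real q"
 using F_big[of d] F_m1 F_m1_le by (cases "d = - 1") auto
lemma F_nonneg: "F d \<ge> 0"
proof (cases "d = 0 \<or> d = 1")
 case False
 then show ?thesis using F_pos[of d] q2 by (intro order_trans[OF _ F_pos]) auto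
qed auto

text \<open>The cost is an affine function of the value plus a nonnegative excess that is 0 only
  when all levels are 0 or 1. So the best configurations want to live on these two levels.\<close>

lemma cost_eq: "cost X d = real (nu X) + (real q - 1) * real_of_int (val X d) + (\<Sum>x\<in>X. real (w x) * F (d x))"
 by (simp add: cost_def nu_def val_def F_def sum_distrib_left algebra_simps flip: sum.distrib)

lemma cost_nonneg: "cost X d \<ge> 0"
 unfolding cost_def by (intro sum_nonneg mult_nonneg_nonneg) auto

lemma cost_cong: "(\<And>x. x \<in> X ==> d x = d' x) ==> cost X d = cost X d'"
 unfolding cost_def by (intro sum.cong) auto
lemma val_cong: "(\<And>x. x \<in> X ==> d x = d' x) ==> val X d = val X d'"
 unfolding val_def by (intro sum.cong) auto
lemma cost_restrict [simp]: "cost X (restrict d X) = cost X d" by (rule cost_cong) simp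
lemma val_restrict [simp]: "val X (restrict d X) = val X d" by (rule val_cong) simp

lemma cost_shift: "cost X (\<lambda>x. d x + a) = real q powi a * cost X d"
 using q2 by (simp add: cost_def sum_distrib_left power_int_add mult_ac)
lemma val_shift: "val X (\<lambda>x. d x + a) = val X d + a * int (nu X)"
 by (simp add: val_def nu_def sum_distrib_left algebra_simps sum.distrib)

lemma nu_less:
 assumes "finite X" "\<And>x. x \<in> X ==> e x < N" "\<And>k. cls X k < p"
 shows "nu X < p ^ N"
proof -
 have "nu X = (\<Sum>k<N. \<Sum>x\<in>{x \<in> X. e x = k}. w x)"
  unfolding nu_def by (rule sum.group[symmetric]) (use assms in auto)
 also have "\<dots> = (\<Sum>k<N. cls X k * p ^ k)"
  by (rule sum.cong) (simp_all add: w_def cls_def)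
 also have "\<dots> \<le> (\<Sum>k<N. (p - 1) * p ^ k)"
 proof (intro sum_mono mult_right_mono)
  fix k show "cls X k \<le> p - 1" using assms(3)[of k] by simp
 qed simp
 also have "\<dots> < p ^ N"
 proof (induction N)
  case (Suc N)
  have "(p - 1) * p ^ N + p ^ N = p * p ^ N" using p2 by (simp add: mult_eq_if)
  then show ?case using Suc by simp
 qed simp
 finally show ?thesis .
qed

text \<open>Fewer than \<open>p\<close> tokens of each weight means no carries, so a subset has
  weight \<open>B\<close> iff each class contributes the corresponding digit of \<open>B\<close>.
  The number of such subsets is a product of binomial coefficients with upper entries below
  \<open>p\<close>.\<close>

lemma subset_count:
 assumes fin: "finite X" and lt: "\<And>k. cls X k < p" and B: "\<And>k. B div p ^ k mod p \<le> cls X k"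
 shows "\<not> p dvd card {S. S \<subseteq> X \<and> nu S = B}"
proof -
 obtain N where N: "\<And>x. x \<in> X ==> e x < N" "B < p ^ N"
 proof -
  obtain N1 where N1: "\<And>x. x \<in> X ==> e x < N1" using fin by (metis finite_imageI finite_nat_set_iff_bounded imageI)
  have "B < 2 ^ B" by (rule less_exp)
  also have "\<dots> \<le> p ^ B" using p2 by (intro power_mono) auto
  also have "\<dots> \<le> p ^ (N1 + B)" using p2 by (intro power_increasing) auto
  finally show ?thesis using N1 by (intro that[of "N1 + B"]) (auto intro: trans_less_add1)
 qed
 define b where "b k = B div p ^ k mod p" for k
 define cl where "cl S k = {x \<in> S. e x = k}" for S :: "'x set" and k
 have nuS: "nu S = (\<Sum>k<N. card (cl S k) * p ^ k)" if "S \<subseteq> X" for S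
 proof -
  have "nu S = (\<Sum>k<N. \<Sum>x\<in>{x \<in> S. e x = k}. w x)"
   unfolding nu_def by (rule sum.group[symmetric]) (use fin that N in \<open>auto intro: finite_subset\<close>)
  also have "\<dots> = (\<Sum>k<N. card (cl S k) * p ^ k)"
   by (rule sum.cong) (simp_all add: w_def cl_def)
  finally show ?thesis .
 qed
 have clc: "card (cl X k) = cls X k" for k by (simp add: cl_def cls_def)
 have cl_le: "card (cl S k) < p" if "S \<subseteq> X" for S k
 proof -
  have "card (cl S k) \<le> card (cl X k)" by (rule card_mono) (use fin that in \<open>auto simp: cl_def\<close>)
  then show ?thesis using lt[of k] clc by simp
 qed
 have iff: "nu S = B \<longleftrightarrow> (\<forall>k<N. card (cl S k) = b k)" if S: "S \<subseteq> X" for S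
 proof
  assume "nu S = B"
  then show "\<forall>k<N. card (cl S k) = b k"
   using digit_of_sum[of "\<lambda>k. card (cl S k)" p _ N] cl_le[OF S] nuS[OF S] by (auto simp: b_def)
 next
  assume "\<forall>k<N. card (cl S k) = b k"
  then have "nu S = (\<Sum>k<N. b k * p ^ k)" using nuS[OF S] by simp
  also have "\<dots> = B" unfolding b_def digit_sum_mod using N by simp
  finally show "nu S = B" .
 qed
 have bij: "bij_betw (\<lambda>S. restrict (cl S) {..<N}) {S. S \<subseteq> X \<and> nu S = B} (PiE {..<N} (\<lambda>k. {T. T \<subseteq> cl X k \<and> card T = b k}))"
 proof (rule bij_betwI[where g = "\<lambda>g. \<Union>k<N. g k"])
  show "(\<lambda>S. restrict (cl S) {..<N}) \<in> {S. S \<subseteq> X \<and> nu S = B} \<rightarrow> (PiE {..<N} (\<lambda>k. {T. T \<subseteq> cl X k \<and> card T = b k}))"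
  proof
   fix S assume "S \<in> {S. S \<subseteq> X \<and> nu S = B}"
   then have S: "S \<subseteq> X" "nu S = B" by simp_all
   have "\<forall>k<N. card (cl S k) = b k" using iff[OF S(1)] S(2) by (rule iffD1)
   moreover have "cl S k \<subseteq> cl X k" for k using S(1) by (auto simp: cl_def)
   ultimately show "restrict (cl S) {..<N} \<in> (PiE {..<N} (\<lambda>k. {T. T \<subseteq> cl X k \<and> card T = b k}))"
    by (intro restrict_PiE_iff[THEN iffD2]) simp
  qed
  have cu: "cl (\<Union>k<N. g k) k = g k" if "g \<in> PiE {..<N} (\<lambda>k. {T. T \<subseteq> cl X k \<and> card T = b k})" "k < N" for g k
  proof -
   have "g j \<subseteq> cl X j" if "j < N" for j using that \<open>g \<in> _\<close> by (auto dest: PiE_mem)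
   then show ?thesis using that(2) by (fastforce simp: cl_def)
  qed
  show "(\<lambda>g. \<Union>k<N. g k) \<in> (PiE {..<N} (\<lambda>k. {T. T \<subseteq> cl X k \<and> card T = b k})) \<rightarrow> {S. S \<subseteq> X \<and> nu S = B}"
  proof
   fix g assume g: "g \<in> PiE {..<N} (\<lambda>k. {T. T \<subseteq> cl X k \<and> card T = b k})"
   then have "(\<Union>k<N. g k) \<subseteq> X" by (auto dest!: PiE_mem simp: cl_def)
   moreover have "card (g k) = b k" if "k < N" for k using g that by (auto dest: PiE_mem)
   ultimately show "(\<Union>k<N. g k) \<in> {S. S \<subseteq> X \<and> nu S = B}" using iff cu[OF g] by simp
  qed
  show "(\<Union>k<N. restrict (cl S) {..<N} k) = S" if "S \<in> {S. S \<subseteq> X \<and> nu S = B}" for S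
   using that N(1) by (auto simp: cl_def)
  show "restrict (cl (\<Union>k<N. g k)) {..<N} = g" if "g \<in> PiE {..<N} (\<lambda>k. {T. T \<subseteq> cl X k \<and> card T = b k})" for g
  proof
   fix k show "restrict (cl (\<Union>k<N. g k)) {..<N} k = g k"
    using cu[OF that, of k] PiE_arb[OF that, of k] by (cases "k < N") auto
  qed
 qed
 have "card {S. S \<subseteq> X \<and> nu S = B} = card (PiE {..<N} (\<lambda>k. {T. T \<subseteq> cl X k \<and> card T = b k}))"
  by (rule bij_betw_same_card[OF bij])
 also have "\<dots> = (\<Prod>k<N. cls X k choose b k)"
  using fin by (simp add: card_PiE n_subsets cl_def clc[unfolded cl_def])
 finally have c: "card {S. S \<subseteq> X \<and> nu S = B} = (\<Prod>k<N. cls X k choose b k)" .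
 have "\<not> p dvd (cls X k choose b k)" for k
 proof
  assume "p dvd (cls X k choose b k)"
  then have "p dvd fact (b k) * fact (cls X k - b k) * (cls X k choose b k)" by simp
  also have "fact (b k) * fact (cls X k - b k) * (cls X k choose b k) = (fact (cls X k) :: nat)"
   using B[of k] by (intro binomial_fact_lemma) (simp add: b_def)
  finally show False using lt[of k] p by (simp add: prime_dvd_fact_iff)
 qed
 then show ?thesis unfolding c using p by (simp add: prime_dvd_prod_iff)
qed

section \<open>Normalization of the budget by shifting all levels\<close>

lemma opts_shift: "d \<in> opts X K \<longleftrightarrow> restrict (\<lambda>x. d x + a) X \<in> opts X (real q powi a * K) \<and> d \<in> PiE X (\<lambda>_. UNIV)"
proof -
 have qa: "real q powi a > 0" using q2 by simp
 have c: "cost X (\<lambda>x. d' x + a) < real q powi a * K \<longleftrightarrow> cost X d' < K" for d'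
  using qa by (simp add: cost_shift)
 have "(\<forall>d'. cost X d' < K \<longrightarrow> val X d' \<le> val X d) \<longleftrightarrow>
  (\<forall>d'. cost X d' < real q powi a * K \<longrightarrow> val X d' \<le> val X (\<lambda>x. d x + a))"
 proof safe
  fix d' assume A: "\<forall>d'. cost X d' < K \<longrightarrow> val X d' \<le> val X d" "cost X d' < real q powi a * K"
  have "cost X (\<lambda>x. (d' x - a) + a) < real q powi a * K" using A(2) by simp
  then have "cost X (\<lambda>x. d' x - a) < K" by (simp only: c)
  then have "val X (\<lambda>x. d' x - a) \<le> val X d" using A by blast
  then show "val X d' \<le> val X (\<lambda>x. d x + a)" using val_shift[of X "\<lambda>x. d' x - a" a] val_shift[of X d a] by simp
 next
  fix d' assume A: "\<forall>d'. cost X d' < real q powi a * K \<longrightarrow> val X d' \<le> val X (\<lambda>x. d x + a)" "cost X d' < K"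
  then have "val X (\<lambda>x. d' x + a) \<le> val X (\<lambda>x. d x + a)" using c by blast
  then show "val X d' \<le> val X d" by (simp add: val_shift)
 qed
 then show ?thesis unfolding opts_def by (auto simp: c)
qed

text \<open>A common shift by \<open>a\<close> scales the cost by \<open>q^a\<close> and changes
  every value by the same amount. For negative \<open>a\<close> the new budget is at most the total
  weight, so the clause on nonnegative levels becomes void.\<close>

lemma good_shift:
 assumes "good X K" "real (nu X) < K" "K \<le> real q * real (nu X)" shows "good X (real q powi a * K)"
proof -
 let ?s = "\<lambda>d. restrict (\<lambda>x. d x + a) X"
 have bij: "bij_betw ?s (opts X K) (opts X (real q powi a * K))"
 proof (rule bij_betwI[where g = "\<lambda>d. restrict (\<lambda>x. d x - a) X"])
  show "?s \<in> opts X K \<rightarrow> opts X (real q powi a * K)" using opts_shift by blast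
  have r: "?s (restrict (\<lambda>x. d x - a) X) = d" if "d \<in> PiE X (\<lambda>_. UNIV)" for d
   using that by (auto simp: fun_eq_iff PiE_def extensional_def)
  show "(\<lambda>d. restrict (\<lambda>x. d x - a) X) \<in> opts X (real q powi a * K) \<rightarrow> opts X K"
  proof
   fix d assume d: "d \<in> opts X (real q powi a * K)"
   then have "?s (restrict (\<lambda>x. d x - a) X) = d" using r by (simp add: opts_def)
   then show "restrict (\<lambda>x. d x - a) X \<in> opts X K" using d by (subst opts_shift[of _ _ _ a]) auto
  qed
  show "restrict (\<lambda>x. ?s d x - a) X = d" if "d \<in> opts X K" for d
   using that by (auto simp: fun_eq_iff PiE_def extensional_def opts_def)
  show "?s (restrict (\<lambda>x. d x - a) X) = d" if "d \<in> opts X (real q powi a * K)" for d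
   using that r by (simp add: opts_def)
 qed
 obtain C where C: "\<forall>d\<in>opts X K. cost X d = C" using assms(1) by (auto simp: good_def)
 have im: "opts X (real q powi a * K) = ?s ` opts X K" using bij by (simp add: bij_betw_def)
 have "\<forall>d\<in>opts X (real q powi a * K). cost X d = real q powi a * C"
  unfolding im using C by (simp add: cost_shift)
 moreover have "\<forall>d\<in>opts X (real q powi a * K). \<forall>x\<in>X. d x \<ge> 0" if "a \<ge> 0"
  unfolding im using assms that by (auto simp: good_def)
 moreover have "\<not> real (nu X) < real q powi a * K" if "a < 0"
 proof -
  have "real q powi a \<le> real q powi (- 1)" using that q2 by (intro power_int_increasing) auto
  then have "real q powi a * K \<le> real q powi (- 1) * K" using assms(2) by (intro mult_right_mono) auto
  also have "\<dots> \<le> real (nu X)" using assms(3) q2 by (simp add: power_int_minus divide_simps mult.commute)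
  finally show ?thesis by simp
 qed
 ultimately show ?thesis using assms(1) bij_betw_same_card[OF bij] bij_betw_finite[OF bij]
  unfolding good_def by (metis not_less)
qed

lemma normalize_level:
 assumes "x > 0" shows "\<exists>a. 1 < real q powi (- a) * x \<and> real q powi (- a) * x \<le> real q"
proof -
 define a where "a = \<lceil>log (real q) x\<rceil> - 1"
 have q1: "real q > 1" using q2 by simp
 have "real_of_int a < log (real q) x" "log (real q) x \<le> real_of_int a + 1" unfolding a_def by linarith+
 then have "real q powr real_of_int a < x" "x \<le> real q powr (real_of_int a + 1)"
  using q1 assms by (simp_all add: less_log_iff log_le_iff)
 then have "real q powi a < x" "x \<le> real q powi a * real q"
  using q1 by (simp_all add: powr_real_of_int' powr_add)
 moreover have "real q powi a > 0" using q1 by simp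
 ultimately show ?thesis using q1 by (intro exI[of _ a]) (simp add: power_int_minus field_simps)
qed

lemma good_empty: "K > 0 ==> good {} K"
proof -
 assume "K > 0"
 then have "opts {} K = {\<lambda>x. undefined}" by (auto simp: opts_def cost_def val_def)
 then show ?thesis using p2 by (auto simp: good_def)
qed

lemma cost_split: "finite X ==> H \<subseteq> X ==> cost X d = cost H d + cost (X - H) d"
 unfolding cost_def by (subst sum.subset_diff[of H X]) auto
lemma val_split: "finite X ==> H \<subseteq> X ==> val X d = val H d + val (X - H) d"
 unfolding val_def by (subst sum.subset_diff[of H X]) auto
lemma nu_split: "finite X ==> H \<subseteq> X ==> nu X = nu H + nu (X - H)"
 unfolding nu_def by (subst sum.subset_diff[of H X]) auto
lemma cls_mono: "finite X ==> Y \<subseteq> X ==> cls Y k \<le> cls X k"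
 unfolding cls_def by (rule card_mono) auto

lemma cost_ge: "cost X d \<ge> real (nu X) + (real q - 1) * real_of_int (val X d)"
 unfolding cost_eq using F_nonneg by (simp add: sum_nonneg)

lemma val_01:
 assumes "\<And>x. x \<in> X ==> d x = 0 \<or> d x = 1" "finite X"
 shows "val X d = int (nu {x \<in> X. d x = 1})" "cost X d = real (nu X) + (real q - 1) * real (nu {x \<in> X. d x = 1})"
proof -
 have "val X d = (\<Sum>x\<in>X. if d x = 1 then int (w x) else 0)"
  unfolding val_def using assms(1) by (intro sum.cong) auto
 then show v: "val X d = int (nu {x \<in> X. d x = 1})"
  using assms(2) by (simp add: nu_def sum.inter_filter if_distrib cong: if_cong)
 have "(\<Sum>x\<in>X. real (w x) * F (d x)) = 0" using assms(1) by (intro sum.neutral) (metis F_01 mult_zero_right)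
 then show "cost X d = real (nu X) + (real q - 1) * real (nu {x \<in> X. d x = 1})"
  by (simp add: cost_eq v)
qed

text \<open>The only token configuration off the levels \<open>0, 1\<close> that the budget allows has one lightest token
 at level \<open>-1\<close>; it is excluded by comparing the number of lightest tokens modulo \<open>p\<close>.\<close>
lemma no_tie:
 fixes X :: "'x set"
 assumes fin: "finite X" and lt: "\<And>k. cls X k < p"
  and K: "K = real g * real p powi E" "g \<ge> 1" "g < q"
  and e1: "\<And>x. x \<in> X ==> e1 \<le> e x" and Bh: "p ^ e1 dvd Bh"
  and le: "K - real (nu X) - (real q - 1) * real Bh \<le> (real q - 1) * real p ^ e1"
  and cost: "cost X d < K" and D: "val X d = int Bh" and x0: "x0 \<in> X" "d x0 \<noteq> 0" "d x0 \<noteq> 1"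
 shows False
proof -
 let ?P = "real p ^ e1" and ?c = "(real q - 1)\<^sup>2 / real q"
 define Kl where "Kl = K - real (nu X) - (real q - 1) * real Bh"
 have P: "?P > 0" using p2 by simp
 have rq: "real q \<ge> 2" using q2 by simp
 \<comment> \<open>The excess at level -1 is at least half of \<open>q - 1\<close>. Hence two such
   tokens, or one of more than the smallest weight, would exhaust the slack.\<close>
 have "(real q - 1) * real q \<le> (real q - 1) * (2 * (real q - 1))" using rq by (intro mult_left_mono) auto
 then have "real q - 1 \<le> 2 * ?c" using rq by (simp add: le_divide_eq power2_eq_square mult.left_commute)
 from mult_right_mono[OF this, of ?P] P have imp: "(real q - 1) * ?P \<le> 2 * ?P * ?c" by (simp add: mult_ac)
 have wP: "real (w x) \<ge> ?P" if "x \<in> X" for x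
  using power_increasing[OF e1[OF that], of p] p2 by (simp add: w_def flip: of_nat_power)
 have ex: "(\<Sum>x\<in>X. real (w x) * F (d x)) < Kl" using cost unfolding cost_eq D Kl_def by simp
 have sub: "(\<Sum>x\<in>Y. real (w x) * F (d x)) < Kl" if "Y \<subseteq> X" for Y
  using sum_mono2[OF fin that, of "\<lambda>x. real (w x) * F (d x)"] F_nonneg ex by force
 have KlP: "Kl \<le> (real q - 1) * ?P" using le by (simp add: Kl_def)
 have lvl: "d x = -1 \<and> e x = e1" if x: "x \<in> X" "d x \<noteq> 0" "d x \<noteq> 1" for x
 proof -
  have wF: "real (w x) * F (d x) < (real q - 1) * ?P" using sub[of "{x}"] x KlP by simp
  have "d x = -1"
  proof (rule ccontr)
   assume "d x \<noteq> -1"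
   then have "F (d x) \<ge> real q - 1" using F_big x by blast
   then have "(real q - 1) * ?P \<le> real (w x) * F (d x)"
    using wP[OF x(1)] rq by (subst mult.commute) (intro mult_mono, auto)
   then show False using wF by simp
  qed
  moreover have "e x = e1"
  proof (rule ccontr)
   assume "e x \<noteq> e1"
   then have "e1 + 1 \<le> e x" using e1[OF x(1)] by simp
   then have "p ^ (e1 + 1) \<le> w x" unfolding w_def using p2 by (intro power_increasing) auto
   then have "real p * ?P \<le> real (w x)" by (metis Suc_eq_plus1 of_nat_le_iff of_nat_power power_Suc)
   moreover have "2 * ?P \<le> real p * ?P" using p2 P by (intro mult_right_mono) auto
   ultimately have "2 * ?P * ?c \<le> real (w x) * ?c" by (intro mult_right_mono) auto
   also have "\<dots> < (real q - 1) * ?P" using wF calculation F_m1 \<open>d x = -1\<close> by simp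
   finally show False using imp by (meson not_less)
  qed
  ultimately show ?thesis ..
 qed
 have Pc: "?P * ?c < Kl"
 proof -
  have "?P * ?c \<le> real (w x0) * F (d x0)" using mult_right_mono[OF wP[OF x0(1)], of ?c] lvl[OF x0] F_m1 rq by simp
  then show ?thesis using sub[of "{x0}"] x0 by simp
 qed
 have uniq: "x = x0" if x: "x \<in> X" "d x \<noteq> 0" "d x \<noteq> 1" for x
 proof (rule ccontr)
  assume "x \<noteq> x0"
  then have "real (w x) * F (d x) + real (w x0) * F (d x0) < (real q - 1) * ?P"
   using sub[of "{x, x0}"] x x0 KlP by simp
  then have "2 * ?P * ?c < (real q - 1) * ?P"
   using lvl[OF x] lvl[OF x0] by (simp add: w_def F_m1)
  then show False using imp by (meson not_less)
 qed
 define S where "S = {x \<in> X. d x = 1}"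
 have "val X d = - int (w x0) + val (X - {x0}) d"
  using val_split[OF fin, of "{x0}" d] x0 lvl[OF x0] by (simp add: val_def)
 also have "val (X - {x0}) d = int (nu {x \<in> X - {x0}. d x = 1})"
  by (rule val_01) (use uniq fin in auto)
 also have "{x \<in> X - {x0}. d x = 1} = S" using x0 by (auto simp: S_def)
 finally have "int Bh = - int (p ^ e1) + int (nu S)" using D lvl[OF x0] by (simp add: w_def)
 then have nuS: "nu S = Bh + p ^ e1" by linarith
 have c_gt: "?c > real q - 2"
  using rq by (simp add: power2_eq_square less_divide_eq algebra_simps)
 have "?P * (real q - 2) < Kl" using mult_strict_left_mono[OF c_gt P] Pc by simp
 have nuP: "real (nu X) \<ge> ?P"
 proof -
  have "w x0 \<le> nu X" unfolding nu_def by (rule member_le_sum) (use x0 fin in auto)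
  then show ?thesis using wP[OF x0(1)] by linarith
 qed
 \<comment> \<open>Consequently the budget is divisible by one more power of \<open>p\<close> than
   the lightest token.\<close>
 have Eb: "E > int e1"
 proof (rule ccontr)
  assume "\<not> E > int e1"
  then have "real p powi E \<le> real p powi (int e1)" using p2 by (intro power_int_increasing) auto
  then have "K \<le> (real q - 1) * ?P" unfolding K(1) using K(3) rq by (intro mult_mono) auto
  then have "Kl \<le> (real q - 1) * ?P - ?P" using nuP rq unfolding Kl_def by (smt (verit) mult_nonneg_nonneg of_nat_0_le_iff)
  then show False using \<open>?P * (real q - 2) < Kl\<close> by (simp add: algebra_simps)
 qed
 obtain n where n: "E = int (Suc (e1 + n))" using Eb by (metis zless_iff_Suc_zadd of_nat_Suc of_nat_add add_Suc_right)
 define K1 where "K1 = g * p ^ n"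
 have KK: "K = real (p ^ Suc e1 * K1)" unfolding K(1) n K1_def by (simp only: power_int_of_nat) (simp add: power_add)
 have dv: "p ^ e1 dvd nu X" unfolding nu_def w_def using e1 by (intro dvd_sum le_imp_power_dvd) auto
 have "int (p ^ e1) dvd int (p ^ Suc e1 * K1) - int (nu X) - (int q - 1) * int Bh"
  using dv Bh by (intro dvd_diff dvd_mult) (simp_all flip: of_nat_power add: of_nat_dvd_iff)
 then obtain z where z: "int (p ^ Suc e1 * K1) - int (nu X) - (int q - 1) * int Bh = int (p ^ e1) * z" by (auto elim: dvdE)
 have "Kl = real_of_int (int (p ^ Suc e1 * K1) - int (nu X) - (int q - 1) * int Bh)" unfolding Kl_def KK by simp
 then have Klz: "Kl = ?P * real_of_int z" unfolding z by simp
 \<comment> \<open>The slack, in units of \<open>p ^ e1\<close>, is an integer above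
   \<open>q - 2\<close> and at most \<open>q - 1\<close>.\<close>
 have "real q - 2 < real_of_int z" using \<open>?P * (real q - 2) < Kl\<close> P unfolding Klz by simp
 moreover have "real_of_int z \<le> real q - 1" using KlP P unfolding Klz by (simp add: mult.commute)
 ultimately have zq: "z = int q - 1" by linarith
 have main: "int (p ^ Suc e1 * K1) = int (nu X) + (int q - 1) * int (nu S)"
  using z unfolding zq nuS by (simp add: algebra_simps)
 have md: "\<exists>r. nu Y = cls Y e1 * p ^ e1 + p ^ Suc e1 * r" if "Y \<subseteq> X" for Y
 proof -
  have fY: "finite Y" using fin that finite_subset by blast
  have "nu Y = nu {x \<in> Y. e x = e1} + nu (Y - {x \<in> Y. e x = e1})" by (rule nu_split[OF fY]) auto
  moreover have "nu {x \<in> Y. e x = e1} = cls Y e1 * p ^ e1" by (simp add: nu_def w_def cls_def)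
  moreover have "p ^ Suc e1 dvd nu (Y - {x \<in> Y. e x = e1})"
   unfolding nu_def w_def
  proof (intro dvd_sum le_imp_power_dvd)
   fix x assume "x \<in> Y - {x \<in> Y. e x = e1}"
   then show "Suc e1 \<le> e x" using e1[of x] that by force
  qed
  ultimately show ?thesis by (auto elim: dvdE)
 qed
 have SX: "S \<subseteq> X" by (auto simp: S_def)
 obtain r1 r2 where r1: "nu X = cls X e1 * p ^ e1 + p ^ Suc e1 * r1" and r2: "nu S = cls S e1 * p ^ e1 + p ^ Suc e1 * r2"
  using md[of X] md[OF SX] by blast
 have "int (p ^ e1) * (int (cls X e1) + (int q - 1) * int (cls S e1)) = int (p ^ e1) * (int p * (int K1 - int r1 - (int q - 1) * int r2))"
  using main unfolding r1 r2 by (simp add: algebra_simps)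
 then have eqn: "int (cls X e1) + (int q - 1) * int (cls S e1) = int p * (int K1 - int r1 - (int q - 1) * int r2)"
  using p2 by simp
 obtain q' where q': "q = p * q'" using p_dvd_q by (auto elim: dvdE)
 \<comment> \<open>Modulo \<open>p ^ (e1 + 1)\<close> only the lightest tokens count. The number of
   those outside level 1 would be a positive multiple of \<open>p\<close>, but there are fewer than
   \<open>p\<close> in all.\<close>
 have "int (cls X e1) - int (cls S e1) = int p * (int K1 - int r1 - (int q - 1) * int r2 - int q' * int (cls S e1))"
  using eqn unfolding q' by (simp add: algebra_simps)
 then have "int p dvd int (cls X e1) - int (cls S e1)" by (metis dvd_triv_left)
 moreover have "cls S e1 < cls X e1"
 proof -
  have "x0 \<in> {x \<in> X. e x = e1}" "x0 \<notin> {x \<in> S. e x = e1}" "{x \<in> S. e x = e1} \<subseteq> {x \<in> X. e x = e1}"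
   using x0 lvl[OF x0] by (auto simp: S_def)
  then have "{x \<in> S. e x = e1} \<subset> {x \<in> X. e x = e1}" by blast
  then show ?thesis unfolding cls_def using fin by (intro psubset_card_mono) auto
 qed
 ultimately have "int p \<le> int (cls X e1) - int (cls S e1)" by (intro zdvd_imp_le) auto
 then show False using lt[of e1] by linarith
qed

text \<open>By \<open>cost_ge\<close> no value above \<open>B\<close> is affordable. It is reached
  on levels 0 and 1 if every base-\<open>p\<close> digit of \<open>B\<close> is at most the number
  of tokens of that weight. Otherwise let \<open>e1 - 1\<close> be the highest position where this
  fails: the tokens of exponent at least \<open>e1\<close> realize the upper part \<open>Bh\<close>
  of \<open>B\<close>, and the lighter ones form a smaller instance whose budget \<open>Kl\<close>
  again has the form \<open>g' * p ^ e1\<close>.\<close>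

lemma good_normalized:
 fixes X :: "'x set"
 assumes fin: "finite X" and ne: "X \<noteq> {}" and lt: "\<And>k. cls X k < p"
  and K: "K = real g * real p powi E" "g \<ge> 1" "g < q"
  and norm: "real (nu X) < K" "K \<le> real q * real (nu X)"
  and IH: "\<And>Y g E. Y \<subset> X ==> Y \<noteq> {} ==> g \<ge> 1 ==> g < q ==> good Y (real g * real p powi E)"
 shows "good X K"
proof -
 have rq: "real q \<ge> 2" and rp: "real p \<ge> 2" using q2 p2 by simp_all
 have "\<exists>B. real (nu X) + (real q - 1) * real B < K \<and> K \<le> real (nu X) + (real q - 1) * real (B + 1)"
 proof -
  define z where "z = \<lceil>(K - real (nu X)) / (real q - 1)\<rceil> - 1"
  have "(K - real (nu X)) / (real q - 1) > 0" using norm rq by simp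
  then have z0: "z \<ge> 0" unfolding z_def by linarith
  have "real_of_int z < (K - real (nu X)) / (real q - 1)" "(K - real (nu X)) / (real q - 1) \<le> real_of_int z + 1"
   unfolding z_def by linarith+
  then have "real_of_int z * (real q - 1) < K - real (nu X)" "K - real (nu X) \<le> (real_of_int z + 1) * (real q - 1)"
   using rq by (simp_all add: pos_less_divide_eq pos_divide_le_eq)
  then show ?thesis using z0 by (intro exI[of _ "nat z"]) (simp add: algebra_simps)
 qed
 then obtain B where B: "real (nu X) + (real q - 1) * real B < K" "K \<le> real (nu X) + (real q - 1) * real (B + 1)" by blast
 define b where "b k = B div p ^ k mod p" for k
 define R where "R e1 \<longleftrightarrow> (\<forall>k\<ge>e1. b k \<le> cls X k)" for e1
 define e1 where "e1 = (LEAST e1. R e1)"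
 have "R B"
 proof -
  have "B < p ^ k" if "k \<ge> B" for k
  proof -
   have "B < 2 ^ B" by (rule less_exp)
   also have "\<dots> \<le> p ^ B" using p2 by (intro power_mono) auto
   also have "\<dots> \<le> p ^ k" using p2 that by (intro power_increasing) auto
   finally show ?thesis .
  qed
  then show ?thesis by (simp add: R_def b_def)
 qed
 then have Re1: "R e1" unfolding e1_def by (rule LeastI)
 have notR: "\<not> R k" if "k < e1" for k using not_less_Least that by (simp add: e1_def)
 have top: "b (e1 - 1) > cls X (e1 - 1)" if "e1 \<ge> 1"
 proof -
  have "\<not> R (e1 - 1)" using notR that by simp
  then obtain k where "k \<ge> e1 - 1" "b k > cls X k" by (auto simp: R_def not_le)
  moreover from this have "\<not> k \<ge> e1" using Re1 by (auto simp: R_def not_le[symmetric])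
  ultimately have "k = e1 - 1" by linarith
  then show ?thesis using \<open>b k > cls X k\<close> by simp
 qed
 define H where "H = {x \<in> X. e1 \<le> e x}"
 define Lo where "Lo = X - H"
 have HX: "H \<subseteq> X" by (auto simp: H_def)
 have finH: "finite H" "finite Lo" using fin by (auto simp: H_def Lo_def)
 have Lo_e: "e x < e1" if "x \<in> Lo" for x using that by (auto simp: Lo_def H_def)
 let ?P = "p ^ e1"
 have P: "real ?P > 0" "?P > 0" using p2 by simp_all
 define Bh where "Bh = ?P * (B div ?P)"
 define Bl where "Bl = B mod ?P"
 have BB: "B = Bh + Bl" by (simp add: Bh_def Bl_def)
 have Bl: "Bl < ?P" using P by (simp add: Bl_def)
 have nuX: "nu X = nu H + nu Lo" unfolding Lo_def by (rule nu_split[OF fin HX])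
 have cls_lt: "cls Lo k < p" for k using cls_mono[OF fin, of Lo k] lt[of k] by (simp add: Lo_def)
 have nuLo: "nu Lo < ?P" by (rule nu_less[OF finH(2) Lo_e cls_lt])
 define Kl where "Kl = K - real (nu H) - (real q - 1) * real Bh"
 have Kl1: "real (nu Lo) + (real q - 1) * real Bl < Kl" using B(1) unfolding Kl_def nuX BB by (simp add: algebra_simps)
 have Kl2: "Kl \<le> real (nu Lo) + (real q - 1) * real (Bl + 1)" using B(2) unfolding Kl_def nuX BB by (simp add: algebra_simps)
 have Kl0: "Kl > 0" using Kl1 rq by (intro le_less_trans[OF _ Kl1]) auto
 have KlnuLo: "real (nu Lo) < Kl" using rq by (intro le_less_trans[OF _ Kl1]) auto
 \<comment> \<open>The digit of \<open>B\<close> at \<open>e1 - 1\<close> is nonzero, so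
   \<open>p ^ (e1 - 1) \<le> B < p powi E\<close>. This gives \<open>e1 \<le> E\<close>, and all
   terms of \<open>Kl\<close> are divisible by \<open>p ^ e1\<close>.\<close>
 have Kl_form: "\<exists>g'. g' \<ge> 1 \<and> g' < q \<and> Kl = real g' * real ?P" if "e1 \<ge> 1"
 proof -
  have "b (e1 - 1) > 0" using top[OF that] by simp
  then have "B div p ^ (e1 - 1) \<noteq> 0" unfolding b_def by (metis mod_0 less_irrefl)
  then have "p ^ (e1 - 1) \<le> B" using div_less by (metis not_less)
  have "(real q - 1) * real B < (real q - 1) * real p powi E"
  proof -
   have "(real q - 1) * real B < K" using B(1) by linarith
   also have "K \<le> (real q - 1) * real p powi E" unfolding K(1) using K(3) rp by (intro mult_right_mono) auto
   finally show ?thesis .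
  qed
  then have "real B < real p powi E" using rq by simp
  moreover have "real (p ^ (e1 - 1)) \<le> real B" using \<open>p ^ (e1 - 1) \<le> B\<close> by (simp only: of_nat_le_iff)
  moreover have "real p powi (int (e1 - 1)) = real (p ^ (e1 - 1))" by (simp only: power_int_of_nat of_nat_power)
  ultimately have "real p powi (int (e1 - 1)) < real p powi E" by linarith
  moreover have "real p powi E \<le> real p powi (int (e1 - 1))" if "E \<le> int (e1 - 1)"
   using rp that by (intro power_int_increasing) auto
  ultimately have "int (e1 - 1) < E" by (meson not_less)
  define n where "n = nat E - e1"
  have n: "E = int (e1 + n)" using \<open>int (e1 - 1) < E\<close> that unfolding n_def by linarith
  have KK: "K = real (?P * (g * p ^ n))" unfolding K(1) n by (simp only: power_int_of_nat) (simp add: power_add)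
  have "?P dvd nu H" unfolding nu_def w_def by (intro dvd_sum le_imp_power_dvd) (auto simp: H_def)
  then have "int ?P dvd int (?P * (g * p ^ n)) - int (nu H) - (int q - 1) * int Bh"
   unfolding Bh_def by (intro dvd_diff dvd_mult) (simp_all only: of_nat_dvd_iff dvd_triv_left)
  then obtain z where z: "int (?P * (g * p ^ n)) - int (nu H) - (int q - 1) * int Bh = int ?P * z" by (auto elim: dvdE)
  have "Kl = real_of_int (int (?P * (g * p ^ n)) - int (nu H) - (int q - 1) * int Bh)" unfolding Kl_def KK by simp
  then have Klz: "Kl = real ?P * real_of_int z" unfolding z by simp
  have z0: "z > 0" using Kl0 P unfolding Klz by (simp add: zero_less_mult_iff)
  have "Kl < real q * real ?P"
  proof -
   have "real (Bl + 1) \<le> real ?P" using Bl by (simp only: of_nat_le_iff Suc_eq_plus1[symmetric] Suc_le_eq)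
   then have "(real q - 1) * real (Bl + 1) \<le> (real q - 1) * real ?P" using rq by (intro mult_left_mono) auto
   moreover have "real (nu Lo) < real ?P" using nuLo by (simp only: of_nat_less_iff)
   ultimately have "Kl < real ?P + (real q - 1) * real ?P" using Kl2 by linarith
   then show ?thesis by (simp add: algebra_simps)
  qed
  then have "real_of_int z < real q" using P unfolding Klz by (simp add: mult.commute)
  then have "z < int q" by linarith
  then show ?thesis using z0 by (intro exI[of _ "nat z"]) (auto simp: Klz mult.commute)
 qed
 have KlP: "Kl \<le> (real q - 1) * real ?P"
 proof (cases "e1 \<ge> 1")
  case True
  then obtain g' where "g' < q" "Kl = real g' * real ?P" using Kl_form by blast
  then show ?thesis using P by (auto intro!: mult_right_mono)
 next
  case False
  then have "Lo = {}" using Lo_e by fastforce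
  then have "nu Lo = 0" by (simp add: nu_def)
  moreover have e0: "e1 = 0" using False by simp
  moreover have "Bl = 0" using e0 by (simp add: Bl_def)
  ultimately show ?thesis using Kl2 by simp
 qed
 \<comment> \<open>The light part must be smaller for the induction. If all tokens were light, the
   failing digit would give total weight at most \<open>B\<close>, and the budget would exceed
   \<open>q\<close> times the total weight.\<close>
 have LoX: "Lo \<subset> X \<or> Lo = {}"
 proof (rule ccontr)
  assume "\<not> ?thesis"
  then have Lo: "Lo = X" "Lo \<noteq> {}" by (auto simp: Lo_def)
  then have e11: "e1 \<ge> 1" using Lo_e by fastforce
  let ?k = "e1 - 1"
  have Pk: "?P = p * p ^ ?k" using e11 by (metis Suc_pred less_eq_Suc_le One_nat_def power_Suc)
  have "nu X = nu {x \<in> X. e x = ?k} + nu (X - {x \<in> X. e x = ?k})" by (rule nu_split[OF fin]) auto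
  also have "nu {x \<in> X. e x = ?k} = cls X ?k * p ^ ?k" by (simp add: nu_def w_def cls_def)
  also have "nu (X - {x \<in> X. e x = ?k}) < p ^ ?k"
  proof (rule nu_less)
   show "e x < ?k" if "x \<in> X - {x \<in> X. e x = ?k}" for x
    using that Lo_e[of x] Lo(1) by (auto simp: less_Suc_eq_le)
   show "cls (X - {x \<in> X. e x = ?k}) k < p" for k using cls_mono[OF fin, of "X - {x \<in> X. e x = ?k}" k] lt[of k] by simp
  qed (use fin in auto)
  finally have "nu X < (cls X ?k + 1) * p ^ ?k" by simp
  also have "\<dots> \<le> b ?k * p ^ ?k" using top[OF e11] by (intro mult_right_mono) auto
  also have "\<dots> \<le> B div p ^ ?k * p ^ ?k" unfolding b_def by (intro mult_right_mono) auto
  also have "\<dots> \<le> B" by simp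
  finally have nuB: "nu X \<le> B" by simp
  have "real q * real (nu X) = real (nu X) + (real q - 1) * real (nu X)" by (simp add: algebra_simps)
  also have "\<dots> \<le> real (nu X) + (real q - 1) * real B" using nuB rq by (intro add_left_mono mult_left_mono) auto
  also have "\<dots> < K" by (rule B)
  finally show False using norm by simp
 qed
 have goodLo: "good Lo Kl"
 proof (cases "Lo = {}")
  case True then show ?thesis using good_empty[OF Kl0] by simp
 next
  case False
  then have "e1 \<ge> 1" using Lo_e by fastforce
  then obtain g' where "g' \<ge> 1" "g' < q" "Kl = real g' * real p powi (int e1)" using Kl_form by auto
  then show ?thesis using IH[of Lo g' "int e1"] LoX False by simp
 qed
 then have neLo: "opts Lo Kl \<noteq> {}" unfolding good_def by (metis card.empty dvd_0_right)
 then obtain dl where dl: "dl \<in> opts Lo Kl" by blast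
 define Vl where "Vl = val Lo dl"
 have bnd: "val Lo d \<le> Vl" if "cost Lo d < Kl" for d using dl that by (simp add: opts_def Vl_def)
 have clsH: "cls H k = (if e1 \<le> k then cls X k else 0)" for k
 proof (cases "e1 \<le> k")
  case True then have "{x \<in> H. e x = k} = {x \<in> X. e x = k}" by (auto simp: H_def)
  then show ?thesis using True by (simp add: cls_def)
 next
  case False then have "{x \<in> H. e x = k} = {}" by (auto simp: H_def)
  then show ?thesis unfolding cls_def using False by (simp only: if_False card.empty)
 qed
 define SS where "SS = {S. S \<subseteq> H \<and> nu S = Bh}"
 have cSS: "\<not> p dvd card SS"
  unfolding SS_def
 proof (rule subset_count[OF finH(1)])
  show "cls H k < p" for k using lt[of k] p2 by (simp add: clsH)
  show "Bh div p ^ k mod p \<le> cls H k" for k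
  proof (cases "e1 \<le> k")
   case True
   then obtain j where j: "k = e1 + j" by (metis le_add_diff_inverse)
   have "Bh div p ^ k = B div p ^ k" unfolding Bh_def j power_add using P by (simp add: div_mult2_eq)
   then show ?thesis using Re1 True by (simp add: R_def b_def clsH)
  next
   case False
   then obtain j where j: "e1 = k + Suc j" by (metis less_iff_Suc_add not_le add_Suc_right)
   have "Bh = p ^ k * (p * (p ^ j * (B div ?P)))" unfolding Bh_def j by (simp add: power_add)
   then show ?thesis using p2 by simp
  qed
 qed
 \<comment> \<open>Let the heavy tokens miss \<open>Bh\<close> by \<open>m\<close> units of
   \<open>p ^ e1\<close>. A surplus (\<open>m < 0\<close>) is unaffordable. A deficit of
   \<open>n\<close> units is not recovered: lowering all light tokens by \<open>n\<close> levels
   brings them within \<open>Kl\<close>, so they gain at most \<open>n * nu Lo\<close>, which is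
   less than \<open>n * p ^ e1\<close>.\<close>
 have struct: "(\<forall>x\<in>H. d x = 0 \<or> d x = 1) \<and> val H d = int Bh \<and> cost Lo d < Kl \<and> val Lo d = Vl"
  if cd: "cost X d < K" and vd: "val X d \<ge> int Bh + Vl" for d
 proof -
  have cs: "cost X d = cost H d + cost Lo d" and vs: "val X d = val H d + val Lo d"
   unfolding Lo_def by (rule cost_split[OF fin HX], rule val_split[OF fin HX])
  have "int ?P dvd val H d" unfolding val_def w_def
  proof (intro dvd_sum dvd_mult2)
   fix x assume "x \<in> H" then have "p ^ e1 dvd p ^ e x" by (intro le_imp_power_dvd) (auto simp: H_def)
   then show "int (p ^ e1) dvd int (p ^ e x)" by (simp only: of_nat_dvd_iff)
  qed
  moreover have "int ?P dvd int Bh" by (simp only: Bh_def of_nat_dvd_iff dvd_triv_left)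
  ultimately have "int ?P dvd int Bh - val H d" by (intro dvd_diff)
  then obtain m where m: "int Bh - val H d = int ?P * m" by (auto elim: dvdE)
  have cH: "cost H d \<ge> real (nu H) + (real q - 1) * real_of_int (val H d)" by (rule cost_ge)
  have vH: "val H d = int Bh - int ?P * m" using m by simp
  have rvH: "real_of_int (val H d) = real Bh - real ?P * real_of_int m" unfolding vH by simp
  have cL: "cost Lo d < Kl + (real q - 1) * real ?P * real_of_int m"
   using cd cH unfolding cs rvH Kl_def by (simp add: algebra_simps)
  have m0: "m \<ge> 0"
  proof (rule ccontr)
   assume "\<not> m \<ge> 0"
   then have "real_of_int m \<le> -1" by linarith
   then have "(real q - 1) * real ?P * real_of_int m \<le> (real q - 1) * real ?P * (-1)" using rq P by (intro mult_left_mono) auto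
   then have "cost Lo d < 0" using cL KlP by simp
   then show False using cost_nonneg[of Lo d] by simp
  qed
  have m_0: "m = 0"
  proof (rule ccontr)
   assume "m \<noteq> 0"
   then obtain n where n: "m = int n" "n \<ge> 1" using m0 by (metis nonneg_int_cases of_nat_0 One_nat_def Suc_leI neq0_conv)
   show False
   proof (cases "Lo = {}")
    case True
    then have "Vl = 0" "val Lo d = 0" by (simp_all add: Vl_def val_def)
    moreover have "int ?P * int n > 0" using P n(2) by simp
    ultimately show False using vd vs vH[unfolded n(1)] by linarith
   next
    case False
    then have "e1 \<ge> 1" using Lo_e by fastforce
    then obtain g' where g': "g' \<ge> 1" "Kl = real g' * real ?P" using Kl_form by blast
    have "real g' + (real q - 1) * real n \<le> real q ^ n * real g'"
    proof (induction n)
     case (Suc n)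
     have "(real q - 1) * 1 \<le> (real q - 1) * (real q ^ n * real g')"
      using rq g'(1) by (intro mult_left_mono) (auto intro: mult_ge1_I)
     then show ?case using Suc by (simp add: algebra_simps)
    qed simp
    then have "(real g' + (real q - 1) * real n) * real ?P \<le> real q ^ n * real g' * real ?P" using P by (intro mult_right_mono) auto
    then have "cost Lo d < real q ^ n * Kl" using cL unfolding g'(2) n(1) by (simp add: algebra_simps)
    then have "cost Lo (\<lambda>x. d x + - int n) < Kl" unfolding cost_shift
     using rq by (simp add: power_int_minus divide_simps mult.commute flip: power_int_of_nat)
    then have "val Lo (\<lambda>x. d x + - int n) \<le> Vl" by (rule bnd)
    then have "val Lo d \<le> Vl + int n * int (nu Lo)" unfolding val_shift by simp
    moreover have "int n * int (nu Lo) < int ?P * int n"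
     unfolding mult.commute[of "int ?P"] using nuLo n(2) by (intro mult_strict_left_mono) linarith+
    ultimately show False using vd vs vH[unfolded n(1)] by linarith
   qed
  qed
  then have vHB: "val H d = int Bh" using vH by simp
  then have vLo: "val Lo d \<ge> Vl" using vd vs by simp
  \<comment> \<open>If light tokens exist, a heavy token off the levels 0 and 1 leaves them less
    than \<open>Kl / q\<close>; raising all of them by one level would then beat their optimum
    \<open>Vl\<close>. Without light tokens \<open>no_tie\<close> applies.\<close>
  have d01: "\<forall>x\<in>H. d x = 0 \<or> d x = 1"
  proof (rule ccontr)
   assume "\<not> ?thesis"
   then obtain x0 where x0: "x0 \<in> H" "d x0 \<noteq> 0" "d x0 \<noteq> 1" by auto
   show False
   proof (cases "Lo = {}")
    case True
    then have HX': "H = X" using HX by (auto simp: Lo_def)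
    show False
    proof (rule no_tie[OF fin lt K, of e1 Bh d x0])
     show "e1 \<le> e x" if "x \<in> X" for x using that HX' by (auto simp: H_def)
     show "K - real (nu X) - (real q - 1) * real Bh \<le> (real q - 1) * real p ^ e1" using KlP by (simp add: Kl_def HX')
    qed (use cd vHB x0 HX' in \<open>auto simp: Bh_def\<close>)
   next
    case False
    then have "e1 \<ge> 1" using Lo_e by fastforce
    then obtain g' where g': "g' < q" "Kl = real g' * real ?P" using Kl_form by blast
    let ?c = "(real q - 1)\<^sup>2 / real q"
    have wx: "real ?P \<le> real (w x0)" using x0(1) p2 by (simp add: w_def H_def power_increasing flip: of_nat_power)
    have "real ?P * ?c \<le> real (w x0) * F (d x0)" by (rule mult_mono[OF wx F_pos[OF x0(2,3)]]) auto
    also have "\<dots> \<le> (\<Sum>x\<in>H. real (w x) * F (d x))" by (rule member_le_sum) (use x0 finH F_nonneg in auto)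
    finally have "cost H d \<ge> real (nu H) + (real q - 1) * real Bh + real ?P * ?c" unfolding cost_eq vHB by simp
    then have c1: "cost Lo d < Kl - real ?P * ?c" using cd unfolding cs Kl_def by simp
    have "real g' * (real q - 1) \<le> (real q - 1) * (real q - 1)" using g'(1) rq by (intro mult_right_mono) auto
    then have "real g' * real q - (real q - 1)\<^sup>2 \<le> real g'" by (simp add: power2_eq_square algebra_simps)
    then have "real ?P * (real g' * real q - (real q - 1)\<^sup>2) \<le> real ?P * real g'" by (intro mult_left_mono) auto
    moreover have "real q * (Kl - real ?P * ?c) = real ?P * (real g' * real q - (real q - 1)\<^sup>2)"
     using rq unfolding g'(2) by (simp add: field_simps)
    ultimately have "real q * (Kl - real ?P * ?c) \<le> Kl" unfolding g'(2) by (simp add: mult.commute)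
    moreover have "real q * cost Lo d < real q * (Kl - real ?P * ?c)" using c1 rq by (intro mult_strict_left_mono) auto
    ultimately have "cost Lo (\<lambda>x. d x + 1) < Kl" unfolding cost_shift by simp
    then have "val Lo (\<lambda>x. d x + 1) \<le> Vl" by (rule bnd)
    then have "val Lo d + int (nu Lo) \<le> Vl" by (simp add: val_shift)
    moreover have "nu Lo > 0" unfolding nu_def using False finH w_pos by (intro sum_pos) auto
    ultimately show False using vLo by simp
   qed
  qed
  have "cost H d = real (nu H) + (real q - 1) * real Bh"
   using val_01[of H d] d01 finH(1) vHB by simp
  then have "cost Lo d < Kl" using cd unfolding cs Kl_def by simp
  then show ?thesis using d01 vHB vLo bnd by (auto intro: antisym)
 qed
 have conv: "cost X d < K \<and> val X d = int Bh + Vl \<and> cost X d = real (nu H) + (real q - 1) * real Bh + cost Lo d"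
  if "\<forall>x\<in>H. d x = 0 \<or> d x = 1" "nu {x \<in> H. d x = 1} = Bh" "cost Lo d < Kl" "val Lo d = Vl" for d
 proof -
  have cs: "cost X d = cost H d + cost Lo d" and vs: "val X d = val H d + val Lo d"
   unfolding Lo_def by (rule cost_split[OF fin HX], rule val_split[OF fin HX])
  show ?thesis using val_01[of H d] that finH(1) unfolding cs vs by (simp add: Kl_def)
 qed
 define comb where "comb z = (\<lambda>x. if x \<in> H then (if x \<in> fst z then 1 else 0) else snd z x)" for z :: "'x set \<times> ('x => int)"
 have comb: "cost X (comb z) < K \<and> val X (comb z) = int Bh + Vl" "{x \<in> H. comb z x = 1} = fst z" if z: "z \<in> SS \<times> opts Lo Kl" for z
 proof -
  obtain S d where Sd: "z = (S, d)" "S \<subseteq> H" "nu S = Bh" "d \<in> opts Lo Kl" using z by (auto simp: SS_def)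
  have 1: "{x \<in> H. comb z x = 1} = S" using Sd(1,2) by (auto simp: comb_def)
  have cl: "cost Lo (comb z) = cost Lo d" and vl: "val Lo (comb z) = val Lo d"
   by (rule cost_cong, simp add: comb_def Lo_def Sd(1), rule val_cong, simp add: comb_def Lo_def Sd(1))
  have "val Lo d = Vl" using Sd(4) dl unfolding opts_def Vl_def by (auto intro: antisym)
  then have "cost X (comb z) < K \<and> val X (comb z) = int Bh + Vl \<and> cost X (comb z) = real (nu H) + (real q - 1) * real Bh + cost Lo (comb z)"
   using Sd 1 cl vl by (intro conv) (auto simp: comb_def opts_def)
  then show "cost X (comb z) < K \<and> val X (comb z) = int Bh + Vl" by simp
  show "{x \<in> H. comb z x = 1} = fst z" using 1 Sd(1) by simp
 qed
 have maxv: "val X d \<le> int Bh + Vl" if "cost X d < K" for d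
 proof (rule ccontr)
  assume "\<not> ?thesis"
  moreover from this have "val H d = int Bh" "val Lo d = Vl" using struct[OF that] by auto
  ultimately show False using val_split[OF fin HX, of d] by (simp add: Lo_def)
 qed
 have neSS: "SS \<noteq> {}" using cSS by (metis card.empty dvd_0_right)
 then obtain S0 where S0: "S0 \<in> SS" by blast
 have optv: "val X d = int Bh + Vl" if d: "d \<in> opts X K" for d
 proof -
  have "val X (comb (S0, dl)) \<le> val X d" using d comb(1)[of "(S0, dl)"] S0 dl unfolding opts_def by auto
  moreover have "val X d \<le> int Bh + Vl" using maxv d by (simp add: opts_def)
  ultimately show ?thesis using comb(1)[of "(S0, dl)"] S0 dl by simp
 qed
 have optI: "d \<in> opts X K" if "d \<in> PiE X (\<lambda>_. UNIV)" "cost X d < K" "val X d = int Bh + Vl" for d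
  using that maxv by (simp add: opts_def)
 have ext: "d x = undefined" if "d \<in> opts Y k" "x \<notin> Y" for d x Y k using that by (auto simp: opts_def PiE_def extensional_def)
 have optS: "(\<forall>x\<in>H. d x = 0 \<or> d x = 1) \<and> {x \<in> H. d x = 1} \<in> SS \<and> restrict d Lo \<in> opts Lo Kl" if d: "d \<in> opts X K" for d
 proof -
  have st: "(\<forall>x\<in>H. d x = 0 \<or> d x = 1) \<and> val H d = int Bh \<and> cost Lo d < Kl \<and> val Lo d = Vl"
   using optv[OF d] d by (intro struct) (simp_all add: opts_def)
  moreover have "int (nu {x \<in> H. d x = 1}) = int Bh" using val_01(1)[of H d] st finH(1) by simp
  moreover have "restrict d Lo \<in> opts Lo Kl" using st bnd by (auto simp: opts_def)
  ultimately show ?thesis by (auto simp: SS_def)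
 qed
 \<comment> \<open>Optima are pairs of a heavy subset of weight \<open>Bh\<close> and a light
   optimum. Their number is thus a product of two numbers prime to \<open>p\<close>.\<close>
 have bij: "bij_betw (\<lambda>d. ({x \<in> H. d x = 1}, restrict d Lo)) (opts X K) (SS \<times> opts Lo Kl)"
 proof (rule bij_betwI[where g = comb])
  show "(\<lambda>d. ({x \<in> H. d x = 1}, restrict d Lo)) \<in> opts X K \<rightarrow> SS \<times> opts Lo Kl" using optS by auto
  have cPi: "comb z \<in> PiE X (\<lambda>_. UNIV)" if "z \<in> SS \<times> opts Lo Kl" for z
  proof -
   have "comb z x = undefined" if "x \<notin> X" for x
    using that HX ext[of "snd z" Lo Kl x] \<open>z \<in> _\<close> by (auto simp: comb_def Lo_def)
   then show ?thesis by (auto simp: PiE_def extensional_def)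
  qed
  show "comb \<in> SS \<times> opts Lo Kl \<rightarrow> opts X K" using cPi comb(1) by (intro Pi_I optI) auto
  show "comb ({x \<in> H. d x = 1}, restrict d Lo) = d" if d: "d \<in> opts X K" for d
  proof
   fix x show "comb ({x \<in> H. d x = 1}, restrict d Lo) x = d x"
    using optS[OF d] ext[OF d, of x] HX by (cases "x \<in> X") (auto simp: comb_def Lo_def)
  qed
  show "({x \<in> H. comb z x = 1}, restrict (comb z) Lo) = z" if z: "z \<in> SS \<times> opts Lo Kl" for z
  proof (rule prod_eqI)
   show "fst ({x \<in> H. comb z x = 1}, restrict (comb z) Lo) = fst z" using comb(2)[OF z] by simp
   show "snd ({x \<in> H. comb z x = 1}, restrict (comb z) Lo) = snd z"
   proof
    fix x show "snd ({x \<in> H. comb z x = 1}, restrict (comb z) Lo) x = snd z x"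
     using ext[of "snd z" Lo Kl x] z by (cases "x \<in> Lo") (auto simp: comb_def Lo_def)
   qed
  qed
 qed
 obtain C where C: "\<forall>d\<in>opts Lo Kl. cost Lo d = C" using goodLo by (auto simp: good_def)
 have "cost X d = real (nu H) + (real q - 1) * real Bh + C" if d: "d \<in> opts X K" for d
 proof -
  have "cost Lo d = C" using C optS[OF d] cost_restrict[of Lo d] by metis
  moreover have "cost H d = real (nu H) + (real q - 1) * real Bh" using val_01(2)[of H d] optS[OF d] finH(1) by (simp add: SS_def)
  ultimately show ?thesis using cost_split[OF fin HX, of d] by (simp add: Lo_def)
 qed
 moreover have "finite (opts X K)" "\<not> p dvd card (opts X K)"
 proof -
  have finSS: "finite SS" unfolding SS_def using finH(1) by auto
  show "finite (opts X K)" using bij_betw_finite[OF bij] finSS goodLo by (simp add: good_def)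
  show "\<not> p dvd card (opts X K)" using bij_betw_same_card[OF bij] cSS goodLo p by (simp add: good_def card_cartesian_product prime_dvd_mult_iff)
 qed
 moreover have "d x \<ge> 0" if d: "d \<in> opts X K" and x: "x \<in> X" for d x
 proof (cases "x \<in> H")
  case True then show ?thesis using optS[OF d] by auto
 next
  case False
  then have "x \<in> Lo" using x by (simp add: Lo_def)
  moreover have "\<forall>x\<in>Lo. restrict d Lo x \<ge> 0" using goodLo KlnuLo optS[OF d] unfolding good_def by blast
  ultimately show ?thesis by simp
 qed
 ultimately show ?thesis unfolding good_def by blast
qed

text \<open>Induction on the number of tokens. Budgets of the form \<open>g * p^E\<close> are stable
  under normalization since \<open>q\<close> is a power of \<open>p\<close>.\<close>

theorem good_all:
 assumes "finite X" "\<And>k. cls X k < p" "g \<ge> 1" "g < q"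
 shows "good X (real g * real p powi E)"
 using assms
proof (induction "card X" arbitrary: X g E rule: less_induct)
 case less
 show ?case
 proof (cases "X = {}")
  case True then show ?thesis using p2 less.prems by (simp add: good_empty)
 next
  case False
  let ?K = "real g * real p powi E"
  have nu0: "nu X > 0" unfolding nu_def using False less.prems w_pos by (intro sum_pos) auto
  have K0: "?K > 0" using p2 less.prems by simp
  obtain a where a: "1 < real q powi (- a) * (?K / real (nu X))" "real q powi (- a) * (?K / real (nu X)) \<le> real q"
   using normalize_level[of "?K / real (nu X)"] K0 nu0 by auto
  define K' where "K' = real q powi (- a) * ?K"
  have qp: "real q = real p powi (int f)" by (simp add: q)
  have "real q powi (- a) = real p powi (int f * (- a))" by (simp only: qp power_int_mult)
  moreover have "real p powi (int f * (- a)) * real p powi E = real p powi (int f * (- a) + E)"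
   using p2 by (intro power_int_add[symmetric]) simp
  ultimately have K'E: "K' = real g * real p powi (E - int f * a)" by (simp add: K'_def mult.left_commute)
  have norm: "real (nu X) < K'" "K' \<le> real q * real (nu X)" using a nu0 by (simp_all add: K'_def field_simps)
  have "good X K'"
  proof (rule good_normalized[OF less.prems(1) False less.prems(2) K'E less.prems(3,4) norm])
   fix Y g E assume "Y \<subset> X" "g \<ge> 1" "g < q"
   then show "good Y (real g * real p powi E)"
    using less.prems(1,2) cls_mono[OF less.prems(1), of Y]
    by (intro less.hyps psubset_card_mono) (auto intro: finite_subset le_less_trans)
  qed
  moreover have "real q powi a * K' = ?K" using q2 by (simp add: K'_def power_int_minus field_simps)
  ultimately show ?thesis using good_shift[OF _ norm, of a] by (simp only:)
 qed
qed

end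

section \<open>The polynomials \<open>H\<^sub>s\<close>\<close>

text \<open>The series \<open>\<Sum>i. c i * x^(q^i)\<close>; the inner index set has at most one
  element. Thus \<open>hrec q c\<close> lists the coefficients of the inverse of 1 minus this
  series.\<close>

definition hrec_series :: "nat => (nat => 'b::comm_ring_1) => 'b fps" where
 "hrec_series q c = Abs_fps (\<lambda>k. if k = 0 then 0 else \<Sum>i\<in>{i\<in>{..k}. q ^ i = k}. c i)"
definition hrec :: "nat => (nat => 'b::comm_ring_1) => nat => 'b" where
 "hrec q c n = fps_right_inverse (1 - hrec_series q c) 1 $ n"

lemma hrec_fps: "(1 - hrec_series q c) * Abs_fps (hrec q c) = 1"
proof -
 have "Abs_fps (hrec q c) = fps_right_inverse (1 - hrec_series q c) 1" by (simp add: fps_eq_iff hrec_def)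
 then show ?thesis by (simp add: fps_right_inverse hrec_series_def)
qed

lemma hrec_0 [simp]: "hrec q c 0 = 1"
 using arg_cong[OF hrec_fps[of q c], of "\<lambda>f. f $ 0"] by (simp add: hrec_series_def)

lemma finite_powers_le: "(q::nat) \<ge> 2 ==> {i. q ^ i \<le> n} \<subseteq> {..<Suc n}" for n
proof
 fix i assume "q \<ge> 2" "i \<in> {i. q ^ i \<le> n}"
 moreover have "i < 2 ^ i" by (rule less_exp)
 moreover have "2 ^ i \<le> q ^ i" using calculation by (intro power_mono) auto
 moreover have "q ^ i \<le> n" using calculation by simp
 ultimately have "i < n" by linarith
 then show "i \<in> {..<Suc n}" by simp
qed

lemma hrec_pos:
 assumes q: "q \<ge> 2" and n: "n > 0"
 shows "hrec q c n = (\<Sum>i | q ^ i \<le> n. c i * hrec q c (n - q ^ i))"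
proof -
 have fin: "finite {i. q ^ i \<le> n}" using finite_powers_le[OF q] finite_subset by blast
 have "hrec q c n = (\<Sum>k\<in>{0..n}. hrec_series q c $ k * hrec q c (n - k))"
  using arg_cong[OF hrec_fps[of q c], of "\<lambda>f. f $ n"] n by (simp add: left_diff_distrib fps_mult_nth)
 also have "\<dots> = (\<Sum>k\<in>{0..n}. \<Sum>i\<in>{i \<in> {i. q ^ i \<le> n}. q ^ i = k}. c i * hrec q c (n - q ^ i))"
 proof (rule sum.cong[OF refl])
  fix k assume k: "k \<in> {0..n}"
  have q0: "q ^ i > 0" for i using q by simp
  have "{i \<in> {i. q ^ i \<le> n}. q ^ i = k} = {i \<in> {..k}. q ^ i = k}"
   using k finite_powers_le[OF q, of k] by auto
  then show "hrec_series q c $ k * hrec q c (n - k) = (\<Sum>i\<in>{i \<in> {i. q ^ i \<le> n}. q ^ i = k}. c i * hrec q c (n - q ^ i))"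
   using q by (cases "k = 0") (simp_all add: hrec_series_def sum_distrib_right)
 qed
 also have "\<dots> = (\<Sum>i | q ^ i \<le> n. c i * hrec q c (n - q ^ i))"
  by (rule sum.group) (use fin in auto)
 finally show ?thesis .
qed

lemma hrec_unique:
 assumes q: "q \<ge> 2" and "g 0 = 1" "\<And>n. 0 < n ==> n \<le> N ==> g n = (\<Sum>i | q ^ i \<le> n. c i * g (n - q ^ i))" "n \<le> N"
 shows "g n = hrec q c n"
 using assms(4)
proof (induction n rule: less_induct)
 case (less n)
 show ?case
 proof (cases "n = 0")
  case False
  have "(\<Sum>i | q ^ i \<le> n. c i * g (n - q ^ i)) = (\<Sum>i | q ^ i \<le> n. c i * hrec q c (n - q ^ i))"
  proof (rule sum.cong[OF refl])
   fix i assume "i \<in> {i. q ^ i \<le> n}"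
   then have "n - q ^ i < n" using q False by simp
   then show "c i * g (n - q ^ i) = c i * hrec q c (n - q ^ i)" using less by simp
  qed
  then show ?thesis using assms(3)[of n] less.prems False hrec_pos[OF q, of n c] by simp
 qed (simp add: assms)
qed

lemma hrec_cong:
 assumes q: "q \<ge> 2" and "\<And>i. i \<le> n ==> c i = c' i" shows "hrec q c n = hrec q c' n"
proof (rule hrec_unique[OF q, where N = n])
 fix m assume m: "0 < m" "m \<le> n"
 show "hrec q c m = (\<Sum>i | q ^ i \<le> m. c' i * hrec q c (m - q ^ i))"
  unfolding hrec_pos[OF q m(1)]
 proof (rule sum.cong[OF refl])
  fix i assume "i \<in> {i. q ^ i \<le> m}"
  then have "i \<le> n" using finite_powers_le[OF q, of m] m by auto
  then show "c i * hrec q c (m - q ^ i) = c' i * hrec q c (m - q ^ i)" by (simp add: assms)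
 qed
qed simp_all

lemma hrec_hom:
 fixes h :: "'b::comm_ring_1 => 'c::comm_ring_1"
 assumes q: "q \<ge> 2" and "h 1 = 1" "\<And>a b. h (a * b) = h a * h b" "\<And>a b. h (a + b) = h a + h b"
 shows "h (hrec q c n) = hrec q (\<lambda>i. h (c i)) n"
proof (rule hrec_unique[OF q, where N = n])
 have h0: "h 0 = 0" using assms(4)[of 0 0] by simp
 have hs: "h (sum f S) = (\<Sum>i\<in>S. h (f i))" for f :: "nat => 'b" and S
  by (induction S rule: infinite_finite_induct) (simp_all add: h0 assms)
 show "h (hrec q c 0) = 1" by (simp add: assms)
 show "h (hrec q c n) = (\<Sum>i | q ^ i \<le> n. h (c i) * h (hrec q c (n - q ^ i)))" if "0 < n" for n
  using that by (simp add: hrec_pos[OF q] hs assms)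
qed simp

text \<open>This is the substitution of \<open>a * x\<close> for \<open>x\<close> in the generating
  series.\<close>

lemma hrec_scale:
 assumes q: "q \<ge> 2"
 shows "hrec q (\<lambda>i. a ^ (q ^ i) * c i) n = a ^ n * hrec q c n"
proof (rule hrec_unique[OF q, symmetric, where N = n])
 fix n :: nat assume n: "0 < n"
 show "a ^ n * hrec q c n = (\<Sum>i | q ^ i \<le> n. a ^ (q ^ i) * c i * (a ^ (n - q ^ i) * hrec q c (n - q ^ i)))"
  unfolding hrec_pos[OF q n] sum_distrib_left
 proof (rule sum.cong[OF refl])
  fix i assume "i \<in> {i. q ^ i \<le> n}"
  then have "a ^ n = a ^ (q ^ i) * a ^ (n - q ^ i)" by (simp flip: power_add)
  then show "a ^ n * (c i * hrec q c (n - q ^ i)) = a ^ (q ^ i) * c i * (a ^ (n - q ^ i) * hrec q c (n - q ^ i))"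
   by (simp add: mult_ac)
 qed
qed simp_all

text \<open>Carlitz' \<open>D_i\<close> with \<open>t\<close> in place of
  \<open>\<theta>\<close>.\<close>

definition Dt :: "nat => 'a::{finite,field} poly poly" where
 "Dt i = (\<Prod>j<i. monom 1 (CARD('a) ^ i) - monom 1 (CARD('a) ^ j))"
definition Gt :: "nat => 'a::{finite,field} poly poly" where
 "Gt i = (\<Prod>m\<in>{1..i}. monom 1 (CARD('a) ^ i) - [:thA m:])"
definition Dl :: "nat => 'a::{finite,field} poly poly" where
 "Dl n = (\<Prod>i\<le>n. Dt i)"
text \<open>The quotient \<open>Dl n ^ (q^i) * Gt i / Dt i\<close>, written without division; see
  \<open>Dt_gam\<close>.\<close>

definition gam :: "nat => nat => 'a::{finite,field} poly poly" where
 "gam n i = Dl n ^ (CARD('a) ^ i - 1) * (\<Prod>k\<in>{..n} - {i}. Dt k) * Gt i"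
text \<open>The Anderson-Thakur polynomial of index \<open>s - 1\<close> up to normalization:
  denominators are cleared by a power of the common multiple \<open>Dl (s - 1)\<close> instead of
  the Carlitz factorial. By \<open>hrec_scale\<close> this choice costs only one explicit
  factor.\<close>

definition Hp :: "nat => 'a::{finite,field} poly poly" where
 "Hp s = hrec CARD('a) (gam (s - 1)) (s - 1)"

lemma Dt_gam: "i \<le> n ==> Dt i * gam n i = Dl n ^ (CARD('a) ^ i) * (Gt i :: 'a::{finite,field} poly poly)"
proof -
 assume i: "i \<le> n"
 have "Dl n = Dt i * (\<Prod>k\<in>{..n} - {i}. Dt k :: 'a poly poly)" unfolding Dl_def by (rule prod.remove) (use i in auto)
 moreover have "Dl n ^ (CARD('a) ^ i) = Dl n ^ (CARD('a) ^ i - 1) * (Dl n :: 'a poly poly)"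
  using card_power_neq0[where 'a = 'a, of i] by (metis power_minus_mult bot_nat_0.not_eq_extremum)
 ultimately show ?thesis by (simp add: gam_def mult_ac)
qed

lemma monom_diff_neq_0: "i \<noteq> j ==> monom 1 i - monom 1 j \<noteq> (0 :: 'b::comm_ring_1 poly)"
 by (simp add: monom_eq_iff')

lemma card_power_inj: "CARD('a::{finite,field}) ^ i = CARD('a) ^ j \<longleftrightarrow> i = j"
 using card_ge_2[where 'a = 'a] by (simp add: power_inject_exp)

lemma Dt_nonzero: "Dt i \<noteq> (0 :: 'a::{finite,field} poly poly)"
 unfolding Dt_def by (auto simp: card_power_inj monom_diff_neq_0 simp del: right_minus_eq)

section \<open>An identity in iterated Laurent series\<close>

text \<open>Embeds \<open>A[t]\<close> into the field of Laurent series in \<open>t\<close> over the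
  completed field, where the \<open>Dt i\<close> become invertible.\<close>

definition rho :: "'a::{finite,field} poly poly => 'a fls fls" where
 "rho P = fps_to_fls (emb P)"
definition Lt :: "'a::{finite,field} fls fls" where "Lt = fls_X"
definition Lth :: "nat => 'a::{finite,field} fls fls" where "Lth m = fls_const (th m)"

lemma rho_mult: "rho (P * Q) = rho P * rho Q" by (simp add: rho_def emb_mult fls_times_fps_to_fls)
lemma rho_add: "rho (P + Q) = rho P + rho Q" by (simp add: rho_def emb_add)
lemma rho_1 [simp]: "rho 1 = 1" by (simp add: rho_def)
lemma rho_diff: "rho (P - Q) = rho P - rho Q" by (simp add: rho_def emb_diff)
lemma rho_power: "rho (P ^ n) = rho P ^ n" by (induction n) (simp_all add: rho_mult)
lemma rho_prod: "rho (\<Prod>i\<in>S. f i) = (\<Prod>i\<in>S. rho (f i))"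
 by (induction S rule: infinite_finite_induct) (simp_all add: rho_mult)
lemma rho_eq_0_iff [simp]: "rho P = 0 \<longleftrightarrow> P = 0" by (simp add: rho_def)
lemma rho_monom: "rho (monom 1 n) = Lt ^ n"
proof -
 have "emb (monom 1 n) = (fps_X ^ n :: 'a fls fps)" by (simp add: fps_eq_iff fps_X_power_nth Polynomial.coeff_monom)
 then show ?thesis by (simp add: rho_def Lt_def fps_to_fls_power)
qed
lemma rho_thA: "rho [:thA m:] = Lth m" by (simp add: rho_def Lth_def emb_const)

lemma L_frob_add: "(x + y) ^ (CARD('a) ^ n) = x ^ (CARD('a) ^ n) + y ^ (CARD('a) ^ n)" for x y :: "'a::{finite,field} fls fls"
 by (rule frobenius_add) simp
lemma L_frob_diff: "(x - y) ^ (CARD('a) ^ n) = x ^ (CARD('a) ^ n) - y ^ (CARD('a) ^ n)" for x y :: "'a::{finite,field} fls fls"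
 by (rule frobenius_diff) simp
lemma L_frob_sum: "(\<Sum>i\<in>S. g i) ^ (CARD('a) ^ n) = (\<Sum>i\<in>S. g i ^ (CARD('a) ^ n))" for g :: "'b => 'a::{finite,field} fls fls"
 by (rule frobenius_sum) simp
lemma Lth_power: "Lth m ^ (CARD('a) ^ n) = (Lth (m + n) :: 'a::{finite,field} fls fls)"
 by (simp add: Lth_def flip: fls_const_power)
lemma Lt_diff_nz: "i \<noteq> j ==> Lt ^ (CARD('a) ^ i) - Lt ^ (CARD('a) ^ j) \<noteq> (0 :: 'a::{finite,field} fls fls)"
 using rho_eq_0_iff[of "monom 1 (CARD('a) ^ i) - monom 1 (CARD('a) ^ j) :: 'a poly poly"]
 by (simp add: rho_diff rho_monom card_power_inj monom_diff_neq_0 monom_eq_iff' del: rho_eq_0_iff)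

definition bet :: "nat => 'a::{finite,field} fls fls" where "bet i = rho (Gt i) / rho (Dt i)"
text \<open>Partial products whose successive differences \<open>lam\<close> turn out to be the
  coefficients of the compositional inverse of \<open>\<Sum>i. bet i * x^(q^i)\<close>.\<close>

definition Lam :: "nat => 'a::{finite,field} fls fls" where
 "Lam i = (\<Prod>m\<in>{1..i}. (Lth m - Lt) / (Lt ^ (CARD('a) ^ m) - Lt))"
definition lam :: "nat => 'a::{finite,field} fls fls" where
 "lam i = (if i = 0 then 1 else Lam i - Lam (i - 1))"

lemma rho_Gt: "rho (Gt i) = (\<Prod>m\<in>{1..i}. Lt ^ (CARD('a) ^ i) - Lth m :: 'a::{finite,field} fls fls)"
 by (simp add: Gt_def rho_prod rho_diff rho_monom rho_thA)
lemma rho_Dt: "rho (Dt i) = (\<Prod>j<i. Lt ^ (CARD('a) ^ i) - Lt ^ (CARD('a) ^ j) :: 'a::{finite,field} fls fls)"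
 by (simp add: Dt_def rho_prod rho_diff rho_monom)

lemma prod_ivl_shift: "(\<Prod>m\<in>{1..Suc i}. f m) = f 1 * (\<Prod>m\<in>{1..i}. f (Suc m) :: 'b::comm_monoid_mult)"
 by (induction i) (simp_all add: mult.assoc)
lemma sum_ivl_shift: "(\<Sum>m\<in>{1..Suc i}. f m) = f 1 + (\<Sum>m\<in>{1..i}. f (Suc m) :: 'b::comm_monoid_add)"
 by (induction i) (simp_all add: add.assoc)

lemma bet_Suc: "(Lt ^ (CARD('a) ^ Suc i) - Lt) * bet (Suc i) = (Lt ^ (CARD('a) ^ Suc i) - Lth 1) * (bet i :: 'a::{finite,field} fls fls) ^ CARD('a)"
proof -
 let ?q = "CARD('a)"
 have "rho (Gt (Suc i)) = (Lt ^ (?q ^ Suc i) - Lth 1) * (\<Prod>m\<in>{1..i}. Lt ^ (?q ^ Suc i) - Lth (Suc m) :: 'a fls fls)"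
  unfolding rho_Gt by (rule prod_ivl_shift)
 also have "(\<Prod>m\<in>{1..i}. Lt ^ (?q ^ Suc i) - Lth (Suc m) :: 'a fls fls) = rho (Gt i) ^ ?q"
 proof -
  have "(Lt ^ (?q ^ i) - Lth m :: 'a fls fls) ^ ?q = Lt ^ (?q ^ Suc i) - Lth (Suc m)" for m
   using L_frob_diff[where 'a = 'a, of "Lt ^ (?q ^ i)" "Lth m" 1] Lth_power[where 'a = 'a, of m 1] by (simp add: mult.commute flip: power_mult)
  then show ?thesis unfolding rho_Gt prod_power_distrib by (intro prod.cong) simp_all
 qed
 finally have G: "rho (Gt (Suc i)) = (Lt ^ (?q ^ Suc i) - Lth 1) * (rho (Gt i) :: 'a fls fls) ^ ?q" .
 have "rho (Dt (Suc i)) = (Lt ^ (?q ^ Suc i) - Lt) * (\<Prod>j<i. Lt ^ (?q ^ Suc i) - Lt ^ (?q ^ Suc j) :: 'a fls fls)"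
  unfolding rho_Dt by (subst prod.lessThan_Suc_shift) simp
 also have "(\<Prod>j<i. Lt ^ (?q ^ Suc i) - Lt ^ (?q ^ Suc j) :: 'a fls fls) = rho (Dt i) ^ ?q"
 proof -
  have "(Lt ^ (?q ^ i) - Lt ^ (?q ^ j) :: 'a fls fls) ^ ?q = Lt ^ (?q ^ Suc i) - Lt ^ (?q ^ Suc j)" for j
   using L_frob_diff[where 'a = 'a, of "Lt ^ (?q ^ i)" "Lt ^ (?q ^ j)" 1] by (simp add: mult.commute flip: power_mult)
  then show ?thesis unfolding rho_Dt prod_power_distrib by (intro prod.cong) simp_all
 qed
 finally have D: "rho (Dt (Suc i)) = (Lt ^ (?q ^ Suc i) - Lt) * (rho (Dt i) :: 'a fls fls) ^ ?q" .
 have nz: "Lt ^ (?q ^ Suc i) - Lt \<noteq> (0 :: 'a fls fls)" using Lt_diff_nz[of "Suc i" 0, where 'a = 'a] by simp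
 show ?thesis using nz by (simp add: bet_def G D power_divide)
qed

lemma Lam_Suc: "(Lt ^ (CARD('a) ^ Suc j) - Lt) * Lam (Suc j) = (Lth (Suc j) - Lt) * (Lam j :: 'a::{finite,field} fls fls)"
 using Lt_diff_nz[of "Suc j" 0, where 'a = 'a] by (simp add: Lam_def)

lemma bet_0 [simp]: "bet 0 = 1" by (simp add: bet_def Gt_def Dt_def)
lemma Lam_0 [simp]: "Lam 0 = 1" by (simp add: Lam_def)

text \<open>Two linear relations tie the sums for \<open>Suc m\<close> to those for
  \<open>m\<close>: the recursion of \<open>bet\<close> removes the term \<open>i = 0\<close>, that
  of \<open>Lam\<close> removes the term \<open>i = Suc m\<close>. The second sum \<open>T\<close>,
  weighted by \<open>t^(q^i)\<close>, is carried along to close the system.\<close>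

lemma bet_Lam:
 fixes c T :: "nat => 'a::{finite,field} fls fls"
 defines "c m \<equiv> (\<Sum>i\<le>m. bet i * Lam (m - i) ^ (CARD('a) ^ i))"
 defines "T m \<equiv> (\<Sum>i\<le>m. Lt ^ (CARD('a) ^ i) * (bet i * Lam (m - i) ^ (CARD('a) ^ i)))"
 shows "c m = 1 \<and> T m = Lt + (\<Sum>j\<in>{1..m}. Lt ^ (CARD('a) ^ j) - Lth j)"
proof (induction m)
 case 0 show ?case by (simp add: c_def T_def)
next
 case (Suc m)
 let ?q = "CARD('a)"
 define S where "S m = (\<Sum>j\<in>{1..m}. Lt ^ (?q ^ j) - Lth j :: 'a fls fls)" for m
 have IH: "c m = 1" "T m = Lt + S m" using Suc by (simp_all add: S_def)
 have r1: "T (Suc m) - Lt * c (Suc m) = T m ^ ?q - Lth 1 * c m ^ ?q"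
 proof -
  have "T (Suc m) - Lt * c (Suc m) = (\<Sum>i\<le>Suc m. (Lt ^ (?q ^ i) - Lt) * bet i * Lam (Suc m - i) ^ (?q ^ i))"
   unfolding T_def c_def sum_distrib_left sum_subtractf[symmetric] by (intro sum.cong refl) (simp add: algebra_simps)
  also have "\<dots> = (\<Sum>i\<le>m. (Lt ^ (?q ^ Suc i) - Lt) * bet (Suc i) * Lam (m - i) ^ (?q ^ Suc i))"
   by (subst sum.atMost_Suc_shift) simp
  also have "\<dots> = (\<Sum>i\<le>m. (Lt ^ (?q ^ Suc i) - Lth 1) * (bet i * Lam (m - i) ^ (?q ^ i)) ^ ?q)"
   unfolding bet_Suc by (simp add: power_mult_distrib mult.assoc mult.commute[of ?q] power_mult)
  also have "\<dots> = (\<Sum>i\<le>m. (Lt ^ (?q ^ i) * (bet i * Lam (m - i) ^ (?q ^ i))) ^ ?q) - Lth 1 * (\<Sum>i\<le>m. (bet i * Lam (m - i) ^ (?q ^ i)) ^ ?q)"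
   unfolding sum_distrib_left sum_subtractf[symmetric]
   by (intro sum.cong refl) (simp add: left_diff_distrib power_mult_distrib mult.commute[of ?q] power_mult)
  also have "\<dots> = T m ^ ?q - Lth 1 * c m ^ ?q"
   using L_frob_sum[where 'a = 'a, of "\<lambda>i. Lt ^ (?q ^ i) * (bet i * Lam (m - i) ^ (?q ^ i))" "{..m}" 1]
    L_frob_sum[where 'a = 'a, of "\<lambda>i. bet i * Lam (m - i) ^ (?q ^ i)" "{..m}" 1] by (simp add: T_def c_def)
  finally show ?thesis .
 qed
 have r2: "Lt ^ (?q ^ Suc m) * c (Suc m) - T (Suc m) = Lth (Suc m) * c m - T m"
 proof -
  have st: "(Lt ^ (?q ^ Suc m) - Lt ^ (?q ^ i)) * Lam (Suc m - i) ^ (?q ^ i) = (Lth (Suc m) - Lt ^ (?q ^ i)) * (Lam (m - i) :: 'a fls fls) ^ (?q ^ i)" if "i \<le> m" for i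
  proof -
   have "((Lt ^ (?q ^ Suc (m - i)) - Lt) * Lam (Suc (m - i))) ^ (?q ^ i) = ((Lth (Suc (m - i)) - Lt) * (Lam (m - i) :: 'a fls fls)) ^ (?q ^ i)"
    by (simp only: Lam_Suc)
   moreover have "(Lt ^ (?q ^ Suc (m - i)) :: 'a fls fls) ^ (?q ^ i) = Lt ^ (?q ^ Suc m)"
    using that by (simp flip: power_mult power_add power_Suc)
   moreover have "(Lth (Suc (m - i)) :: 'a fls fls) ^ (?q ^ i) = Lth (Suc m)" using that by (simp add: Lth_power)
   ultimately show ?thesis using that by (simp add: power_mult_distrib L_frob_diff Suc_diff_le)
  qed
  have "Lt ^ (?q ^ Suc m) * c (Suc m) - T (Suc m) = (\<Sum>i\<le>Suc m. bet i * ((Lt ^ (?q ^ Suc m) - Lt ^ (?q ^ i)) * Lam (Suc m - i) ^ (?q ^ i)))"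
   unfolding T_def c_def sum_distrib_left sum_subtractf[symmetric] by (intro sum.cong refl) (simp add: algebra_simps)
  also have "\<dots> = (\<Sum>i\<le>m. bet i * ((Lt ^ (?q ^ Suc m) - Lt ^ (?q ^ i)) * Lam (Suc m - i) ^ (?q ^ i)))" by simp
  also have "\<dots> = (\<Sum>i\<le>m. bet i * ((Lth (Suc m) - Lt ^ (?q ^ i)) * Lam (m - i) ^ (?q ^ i)))" by (rule sum.cong[OF refl]) (simp only: atMost_iff st)
  also have "\<dots> = Lth (Suc m) * c m - T m"
   unfolding T_def c_def sum_distrib_left sum_subtractf[symmetric] by (intro sum.cong refl) (simp add: algebra_simps)
  finally show ?thesis .
 qed
 have Sm: "T m ^ ?q - Lth 1 = S (Suc m)"
 proof -
  have "S m ^ ?q = (\<Sum>j\<in>{1..m}. Lt ^ (?q ^ Suc j) - Lth (Suc j) :: 'a fls fls)"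
  proof -
   have "(Lt ^ (?q ^ j) - Lth j :: 'a fls fls) ^ ?q = Lt ^ (?q ^ Suc j) - Lth (Suc j)" for j
    using L_frob_diff[where 'a = 'a, of "Lt ^ (?q ^ j)" "Lth j" 1] Lth_power[where 'a = 'a, of j 1] by (simp add: mult.commute flip: power_mult)
   then show ?thesis using L_frob_sum[where 'a = 'a, of "\<lambda>j. Lt ^ (?q ^ j) - Lth j" "{1..m}" 1] by (simp add: S_def)
  qed
  moreover have "S (Suc m) = (Lt ^ (?q ^ 1) - Lth 1) + (\<Sum>j\<in>{1..m}. Lt ^ (?q ^ Suc j) - Lth (Suc j) :: 'a fls fls)"
   unfolding S_def by (rule sum_ivl_shift)
  moreover have "T m ^ ?q = Lt ^ ?q + S m ^ ?q" using L_frob_add[where 'a = 'a, of Lt "S m" 1] by (simp add: IH)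
  ultimately show ?thesis by simp
 qed
 have SS: "S (Suc m) = S m + (Lt ^ (?q ^ Suc m) - Lth (Suc m))" by (simp add: S_def)
 have e1: "T (Suc m) = Lt * c (Suc m) + S (Suc m)" using r1 Sm IH by (simp add: algebra_simps)
 have "(Lt ^ (?q ^ Suc m) - Lt) * c (Suc m) = Lt ^ (?q ^ Suc m) - Lt"
  using r2 unfolding e1 IH SS by (simp add: algebra_simps)
 moreover have "Lt ^ (?q ^ Suc m) - Lt \<noteq> (0 :: 'a fls fls)" using Lt_diff_nz[of "Suc m" 0, where 'a = 'a] by simp
 ultimately have "c (Suc m) = 1" by (simp only: mult_cancel_left2) simp
 then show ?case using e1 by (simp add: S_def)
qed

text \<open>The additive series with coefficients \<open>bet\<close> and \<open>lam\<close> are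
  inverse to each other under composition.\<close>

lemma bet_lam: "(\<Sum>i\<le>m. bet i * lam (m - i) ^ (CARD('a) ^ i)) = (if m = 0 then 1 else 0 :: 'a::{finite,field} fls fls)"
proof (cases m)
 case (Suc n)
 have "(\<Sum>i\<le>m. bet i * lam (m - i) ^ (CARD('a) ^ i)) = (\<Sum>i\<le>n. bet i * lam (Suc n - i) ^ (CARD('a) ^ i)) + (bet (Suc n) :: 'a fls fls)"
  by (simp add: Suc lam_def)
 also have "(\<Sum>i\<le>n. bet i * lam (Suc n - i) ^ (CARD('a) ^ i)) = (\<Sum>i\<le>n. bet i * Lam (Suc n - i) ^ (CARD('a) ^ i)) - (\<Sum>i\<le>n. bet i * (Lam (n - i) :: 'a fls fls) ^ (CARD('a) ^ i))"
  unfolding sum_subtractf[symmetric]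
  by (intro sum.cong refl) (simp add: lam_def L_frob_diff Suc_diff_le algebra_simps)
 also have "(\<Sum>i\<le>n. bet i * (Lam (n - i) :: 'a fls fls) ^ (CARD('a) ^ i)) = 1" using bet_Lam[of n, where 'a = 'a] by simp
 also have "(\<Sum>i\<le>n. bet i * Lam (Suc n - i) ^ (CARD('a) ^ i)) = 1 - (bet (Suc n) :: 'a fls fls)"
  using bet_Lam[of "Suc n", where 'a = 'a] by (simp add: algebra_simps)
 finally show ?thesis using Suc by simp
qed (simp add: lam_def)

section \<open>The lowest coefficient of \<open>H\<^sub>s\<close> in \<open>t\<close>\<close>

text \<open>The value \<open>z\<close> may be 0. A term of higher order can thus be treated at a
  common lower order \<open>k\<close>, and sums of terms of different orders need no case
  distinction.\<close>

definition ltc :: "'b::zero => int => 'b fls => bool" where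
 "ltc z k f \<longleftrightarrow> vge k f \<and> f $$ k = z"

lemma ltc_mult:
 fixes f g :: "'b::idom fls"
 assumes "ltc z k f" "ltc z' l g" shows "ltc (z * z') (k + l) (f * g)"
proof -
 have v: "vge k f" "vge l g" and z: "f $$ k = z" "g $$ l = z'" using assms by (auto simp: ltc_def)
 have "(f * g) $$ (k + l) = z * z'"
 proof (cases "f = 0 \<or> g = 0")
  case False
  then have le: "k \<le> fls_subdegree f" "l \<le> fls_subdegree g" using v by (simp_all add: vge_subdegree)
  show ?thesis
  proof (cases "k = fls_subdegree f \<and> l = fls_subdegree g")
   case True then show ?thesis using z by (metis fls_times_base)
  next
   case neq: False
   then have "k < fls_subdegree f \<or> l < fls_subdegree g" using le by linarith
   then have "z * z' = 0" using z by (metis fls_eq0_below_subdegree mult_eq_0_iff)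
   moreover have "k + l < fls_subdegree f + fls_subdegree g" using neq le by linarith
   ultimately show ?thesis by (simp add: fls_times_nth_eq0)
  qed
 qed (use z in auto)
 then show ?thesis using vge_mult[OF v] by (simp add: ltc_def)
qed

lemma ltc_1: "ltc 1 0 (1 :: 'b::idom fls)" by (simp add: ltc_def)

lemma ltc_power: "ltc z k f ==> ltc (z ^ n) (int n * k) (f ^ n)" for f :: "'b::idom fls"
proof (induction n)
 case (Suc n)
 from ltc_mult[OF Suc.prems Suc.IH[OF Suc.prems]] show ?case by (simp add: algebra_simps)
qed (simp add: ltc_1)

lemma ltc_prod: "(\<And>i. i \<in> S ==> ltc (z i) (k i) (f i)) ==> ltc (\<Prod>i\<in>S. z i) (\<Sum>i\<in>S. k i) (\<Prod>i\<in>S. f i :: 'b::idom fls)"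
 by (induction S rule: infinite_finite_induct) (auto intro: ltc_mult ltc_1)

lemma ltc_sum: "(\<And>i. i \<in> S ==> ltc (z i) k (f i)) ==> ltc (\<Sum>i\<in>S. z i) k (\<Sum>i\<in>S. f i :: 'b::comm_monoid_add fls)"
 by (induction S rule: infinite_finite_induct) (auto simp: ltc_def vge_def)

lemma ltc_less: "ltc z k f ==> l < k ==> ltc 0 l f"
 by (auto simp: ltc_def vge_def)

lemma ltc_diff: "ltc z k f ==> ltc z' k g ==> ltc (z - z') k (f - g :: 'b::group_add fls)"
 by (auto simp: ltc_def vge_def)

lemma ltc_subdegree: "ltc z k f ==> z \<noteq> 0 ==> fls_subdegree f = k"
 unfolding ltc_def vge_def by (intro fls_subdegree_eqI) auto

lemma ltc_divide:
 fixes f g :: "'b::field fls"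
 assumes "ltc z k f" "ltc z' l g" "z' \<noteq> 0" shows "ltc (z / z') (k - l) (f / g)"
proof -
 have g0: "g \<noteq> 0" using assms by (auto simp: ltc_def)
 have "fls_subdegree g = l" using ltc_subdegree assms(2,3) by blast
 then have "vge (- l) (inverse g)" using g0 by (simp add: vge_inverse)
 then have i: "ltc (inverse g $$ (- l)) (- l) (inverse g)" by (simp add: ltc_def)
 from ltc_mult[OF assms(2) i] have "z' * (inverse g $$ (- l)) = 1" using g0 by (simp add: ltc_def)
 then have "inverse g $$ (- l) = inverse z'" by (simp add: inverse_unique)
 then show ?thesis using ltc_mult[OF assms(1) i] by (simp add: divide_inverse)
qed

definition ul :: "nat => 'a::{finite,field} fls" where
 "ul i = (- 1) ^ i * fls_X_inv ^ (\<Sum>m\<in>{1..i}. CARD('a) ^ m)"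

lemma ltc_X_diff:
 assumes "i < j"
 shows "ltc (-1) (int i) (fls_X ^ j - fls_X ^ i :: 'b::idom fls)"
 using assms by (auto simp: ltc_def vge_def)

text \<open>Each factor has a simple pole at \<open>t = 0\<close> with leading coefficient
  \<open>- \<theta>^(q^m)\<close>. The passage to \<open>lam\<close> below leaves the leading term
  alone, as \<open>Lam (i - 1)\<close> has a pole of smaller order.\<close>

lemma ltc_Lam: "ltc (ul i :: 'a::{finite,field} fls) (- int i) (Lam i)"
proof -
 have "ltc (th m / (-1)) (0 - 1) ((Lth m - Lt) / (Lt ^ (CARD('a) ^ m) - Lt) :: 'a fls fls)" if "m \<in> {1..i}" for m
 proof (rule ltc_divide)
  show "ltc (th m) 0 (Lth m - Lt :: 'a fls fls)" by (auto simp: ltc_def vge_def Lth_def Lt_def)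
  have "CARD('a) ^ 0 < CARD('a) ^ m" using that card_ge_2[where 'a = 'a] by (intro power_strict_increasing) auto
  then show "ltc (- 1) 1 (Lt ^ (CARD('a) ^ m) - Lt :: 'a fls fls)" using ltc_X_diff[of 1 "CARD('a) ^ m", where 'b = "'a fls"] by (simp add: Lt_def)
 qed simp
 from ltc_prod[of "{1..i}" "\<lambda>m. - th m :: 'a fls" "\<lambda>_. -1" "\<lambda>m. (Lth m - Lt) / (Lt ^ (CARD('a) ^ m) - Lt)"] this
 have "ltc (\<Prod>m\<in>{1..i}. - th m :: 'a fls) (- int i) (Lam i)" by (simp add: Lam_def)
 moreover have "(\<Prod>m\<in>{1..i}. - th m :: 'a fls) = ul i"
  by (induction i) (simp_all add: ul_def th_def power_add)
 ultimately show ?thesis by simp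
qed

lemma ltc_lam: "ltc (ul i :: 'a::{finite,field} fls) (- int i) (lam i)"
proof (cases i)
 case 0 then show ?thesis using ltc_Lam[of 0, where 'a = 'a] by (simp add: lam_def)
next
 case (Suc j)
 from ltc_diff[OF ltc_Lam[of "Suc j", where 'a = 'a] ltc_less[OF ltc_Lam[of j], of "- int (Suc j)"]]
 show ?thesis by (simp add: Suc lam_def)
qed

section \<open>Expansion over base-\<open>p\<close> tokens and Lagrange inversion\<close>

lemma frobenius_p_sum:
 fixes g :: "'c => 'b::comm_semiring_1"
 assumes "prime CHAR('b)"
 shows "(\<Sum>i\<in>S. g i) ^ (CHAR('b) ^ n) = (\<Sum>i\<in>S. g i ^ (CHAR('b) ^ n))"
proof -
 have p0: "CHAR('b) ^ n \<noteq> 0" using prime_gt_0_nat[OF assms] by simp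
 have "(0 :: 'b) ^ (CHAR('b) ^ n) = 0" by (simp only: power_0_left p0 if_False)
 moreover have "(x + y) ^ (CHAR('b) ^ n) = x ^ (CHAR('b) ^ n) + y ^ (CHAR('b) ^ n)" for x y :: 'b
  by (rule freshmans_dream'[OF assms refl])
 ultimately show ?thesis by (induction S rule: infinite_finite_induct) simp_all
qed

text \<open>The base-\<open>p\<close> digits of \<open>\<nu>\<close> as a set: a digit
  \<open>b\<close> at position \<open>e\<close> is represented by \<open>b\<close> tokens with first
  component \<open>e\<close>.\<close>

definition tok :: "nat => nat => nat => (nat \<times> nat) set" where
 "tok p M \<nu> = (SIGMA e:{..<M}. {..<\<nu> div p ^ e mod p})"

lemma finite_tok [simp]: "finite (tok p M \<nu>)" by (simp add: tok_def)

lemma sum_tok: "\<nu> < p ^ M ==> (\<Sum>x\<in>tok p M \<nu>. p ^ fst x) = \<nu>"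
proof -
 assume "\<nu> < p ^ M"
 have "(\<Sum>x\<in>tok p M \<nu>. p ^ fst x) = (\<Sum>(e, k)\<in>tok p M \<nu>. p ^ e)" by (rule sum.cong) auto
 also have "\<dots> = (\<Sum>e<M. (\<nu> div p ^ e mod p) * p ^ e)"
  unfolding tok_def by (subst sum.Sigma[symmetric]) auto
 finally show ?thesis using \<open>\<nu> < p ^ M\<close> by (simp add: digit_sum_mod)
qed

lemma card_tok: "card (tok p M \<nu>) = (\<Sum>e<M. \<nu> div p ^ e mod p)" by (simp add: tok_def)

text \<open>Modulo \<open>p^M\<close> the number -1 has \<open>M\<close> digits equal to
  \<open>p - 1\<close>, so that many powers of \<open>p\<close> are needed to produce it. In the
  induction on \<open>M\<close> the lowest digit is split off and \<open>t\<close> records the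
  carry.\<close>

lemma card_powers_minus_one:
 assumes "finite X" "p \<ge> 2" "p ^ M dvd (\<Sum>x\<in>X. p ^ a x) + t + 1"
 shows "M * (p - 1) \<le> card X + t"
 using assms(1,3)
proof (induction M arbitrary: X a t)
 case (Suc M)
 define Z where "Z = {x \<in> X. a x = 0}"
 define Y where "Y = X - Z"
 have fin: "finite Z" "finite Y" using Suc.prems by (auto simp: Z_def Y_def)
 have "(\<Sum>x\<in>X. p ^ a x) = (\<Sum>x\<in>Y. p ^ a x) + (\<Sum>x\<in>Z. p ^ a x)"
  unfolding Y_def using Suc.prems by (intro sum.subset_diff) (auto simp: Z_def)
 also have "(\<Sum>x\<in>Z. p ^ a x) = card Z" by (simp add: Z_def)
 also have "(\<Sum>x\<in>Y. p ^ a x) = p * (\<Sum>x\<in>Y. p ^ (a x - 1))"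
  unfolding sum_distrib_left by (rule sum.cong) (auto simp: Y_def Z_def simp flip: power_Suc)
 finally have s: "p ^ Suc M dvd p * (\<Sum>x\<in>Y. p ^ (a x - 1)) + (card Z + t + 1)" using Suc.prems by (simp add: add.assoc)
 then have "p dvd p * (\<Sum>x\<in>Y. p ^ (a x - 1)) + (card Z + t + 1)" using dvd_trans[of p "p ^ Suc M"] by simp
 then have "p dvd card Z + t + 1" by (simp only: dvd_add_right_iff[OF dvd_triv_left])
 then obtain t' where t': "card Z + t + 1 = p * t'" by (auto elim: dvdE)
 then have "t' \<ge> 1" by (cases t') auto
 then obtain t'' where t'': "t' = t'' + 1" by (metis le_add_diff_inverse2)
 have "p ^ Suc M dvd p * ((\<Sum>x\<in>Y. p ^ (a x - 1)) + t'' + 1)" using s unfolding t' t'' by (simp add: algebra_simps)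
 then have "p ^ M dvd (\<Sum>x\<in>Y. p ^ (a x - 1)) + t'' + 1" using assms(2) unfolding power_Suc by (subst (asm) nat_mult_dvd_cancel_disj) simp
 from Suc.IH[OF fin(2) this] have "M * (p - 1) \<le> card Y + t''" .
 moreover have "card X = card Y + card Z" unfolding Y_def using Suc.prems fin by (subst card_Diff_subset) (auto simp: Z_def card_mono)
 moreover have "t'' + (p - 1) \<le> card Z + t"
 proof -
  have "t'' * 1 \<le> p * t''" using assms(2) by (simp add: mult_le_mono1)
  then have "t'' + p \<le> p * t'" unfolding t'' by (simp add: algebra_simps)
  then show ?thesis using t' assms(2) by linarith
 qed
 ultimately show ?case by simp
qed simp

definition ell :: "nat => 'a::{finite,field} fls fls fps" where
 "ell N = (\<Sum>i\<le>N. fps_const (lam i) * fps_X ^ (CARD('a) ^ i))"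

definition tcost :: "nat => nat => (nat \<times> nat) set => (nat \<times> nat => nat) => nat" where
 "tcost p q X g = (\<Sum>x\<in>X. q ^ g x * p ^ fst x)"

text \<open>By the digits of \<open>\<nu>\<close> the power is a product over tokens of
  \<open>ell N ^ (p^e)\<close>, and such a power is formed term by term. Expanding the product means
  choosing a level for each token.\<close>

lemma ell_power:
 fixes N :: nat
 assumes "\<nu> < CHAR('a::{finite,field}) ^ M"
 shows "(ell N :: 'a fls fls fps) ^ \<nu> =
  (\<Sum>g\<in>PiE (tok CHAR('a) M \<nu>) (\<lambda>_. {..N}). fps_const (\<Prod>x\<in>tok CHAR('a) M \<nu>. lam (g x) ^ (CHAR('a) ^ fst x))
   * fps_X ^ tcost CHAR('a) CARD('a) (tok CHAR('a) M \<nu>) g)"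
proof -
 let ?p = "CHAR('a)" and ?X = "tok CHAR('a) M \<nu>"
 have pr: "prime ?p" by (rule prime_CHAR_finite)
 have fr: "(ell N :: 'a fls fls fps) ^ (?p ^ e) = (\<Sum>i\<le>N. fps_const (lam i ^ (?p ^ e)) * fps_X ^ (CARD('a) ^ i * ?p ^ e))" for e
  using frobenius_p_sum[of "\<lambda>i. fps_const (lam i) * fps_X ^ (CARD('a) ^ i) :: 'a fls fls fps" "{..N}" e] pr
  by (simp add: ell_def power_mult_distrib fps_const_power power_mult)
 have "(ell N :: 'a fls fls fps) ^ \<nu> = (\<Prod>x\<in>?X. ell N ^ (?p ^ fst x))"
  by (simp add: sum_tok[OF assms] flip: power_sum)
 also have "\<dots> = (\<Prod>x\<in>?X. \<Sum>i\<le>N. fps_const (lam i ^ (?p ^ fst x)) * fps_X ^ (CARD('a) ^ i * ?p ^ fst x))"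
  by (simp only: fr)
 also have "\<dots> = (\<Sum>g\<in>PiE ?X (\<lambda>_. {..N}). \<Prod>x\<in>?X. fps_const (lam (g x) ^ (?p ^ fst x)) * fps_X ^ (CARD('a) ^ g x * ?p ^ fst x))"
  by (rule prod_sum_PiE) auto
 also have "\<dots> = (\<Sum>g\<in>PiE ?X (\<lambda>_. {..N}). fps_const (\<Prod>x\<in>?X. lam (g x) ^ (?p ^ fst x)) * fps_X ^ tcost ?p CARD('a) ?X g)"
 proof (rule sum.cong[OF refl])
  have fc: "(\<Prod>x\<in>Y. fps_const (h x)) = fps_const (\<Prod>x\<in>Y. h x)" for h :: "nat \<times> nat => 'a fls fls" and Y
   by (induction Y rule: infinite_finite_induct) simp_all
  fix g show "(\<Prod>x\<in>?X. fps_const (lam (g x) ^ (?p ^ fst x)) * fps_X ^ (CARD('a) ^ g x * ?p ^ fst x)) =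
   fps_const (\<Prod>x\<in>?X. lam (g x) ^ (?p ^ fst x)) * (fps_X ^ tcost ?p CARD('a) ?X g :: 'a fls fls fps)"
   by (simp add: prod.distrib fc tcost_def power_sum)
 qed
 finally show ?thesis .
qed

lemma ell_power_nth:
 assumes "\<nu> < CHAR('a::{finite,field}) ^ M"
 shows "((ell N :: 'a fls fls fps) ^ \<nu>) $ C =
  (\<Sum>g\<in>PiE (tok CHAR('a) M \<nu>) (\<lambda>_. {..N}). if tcost CHAR('a) CARD('a) (tok CHAR('a) M \<nu>) g = C
   then \<Prod>x\<in>tok CHAR('a) M \<nu>. lam (g x) ^ (CHAR('a) ^ fst x) else 0)"
 unfolding ell_power[OF assms] fps_sum_nth
 by (rule sum.cong[OF refl]) (simp add: fps_X_power_nth eq_commute)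

text \<open>Equivalently the coefficient of \<open>x^(K - 1)\<close> in \<open>f / (1 - x)\<close>,
  that is, a residue.\<close>

definition cut :: "nat => 'b::comm_monoid_add fps => 'b" where "cut K f = (\<Sum>C<K. f $ C)"

lemma cut_add: "cut K (f + g) = cut K f + cut K g" by (simp add: cut_def sum.distrib)
lemma cut_sum: "cut K (\<Sum>i\<in>S. f i) = (\<Sum>i\<in>S. cut K (f i))"
 by (induction S rule: infinite_finite_induct) (simp_all add: cut_add, simp_all add: cut_def)
lemma cut_const: "cut K (fps_const c * f) = c * cut K (f :: 'b::comm_ring_1 fps)" by (simp add: cut_def sum_distrib_left)
lemma cut_high: "(\<And>C. C < K ==> f $ C = 0) ==> cut K f = 0" by (simp add: cut_def)

lemma ell_nth_0: "ell N $ 0 = 0"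
 by (simp add: ell_def fps_sum_nth fps_X_power_nth)

lemma ell_power_low: "C < k ==> ell N ^ k $ C = 0"
 using startsby_zero_power_prefix[of "ell N" k] ell_nth_0 by blast

lemma ell_power_diag: "(ell N :: 'a::{finite,field} fls fls fps) ^ k $ k = 1"
proof -
 have "(ell N :: 'a fls fls fps) $ 1 = (\<Sum>i\<le>N. if i = 0 then lam i else 0)"
  unfolding ell_def fps_sum_nth
 proof (rule sum.cong[OF refl])
  fix i
  have "1 = CARD('a) ^ i \<longleftrightarrow> i = 0" using card_power_inj[of 0 i, where 'a = 'a] by auto
  then show "(fps_const (lam i) * fps_X ^ (CARD('a) ^ i) :: 'a fls fls fps) $ 1 = (if i = 0 then lam i else 0)"
   by (simp add: fps_X_power_nth)
 qed
 then have "(ell N :: 'a fls fls fps) $ 1 = 1" by (simp add: lam_def)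
 then show ?thesis using startsby_zero_power_nth_same[of "ell N :: 'a fls fls fps" k] by (simp add: ell_nth_0)
qed

text \<open>The truncation at \<open>N\<close> still inverts exactly in degrees below
  \<open>q ^ Suc N\<close>.\<close>

lemma bet_ell:
 assumes "C < CARD('a::{finite,field}) ^ Suc N"
 shows "((\<Sum>i\<le>N. fps_const (bet i) * (ell N :: 'a fls fls fps) ^ (CARD('a) ^ i)) $ C) = (fps_X $ C :: 'a fls fls)"
proof -
 let ?q = "CARD('a)"
 have q2: "?q \<ge> 2" by (rule card_ge_2)
 have pw: "(ell N :: 'a fls fls fps) ^ (?q ^ i) = (\<Sum>j\<le>N. fps_const (lam j ^ (?q ^ i)) * fps_X ^ (?q ^ (i + j)))" for i
 proof -
  have "(\<Sum>j\<le>N. fps_const (lam j) * fps_X ^ (?q ^ j) :: 'a fls fls fps) ^ (?q ^ i) = (\<Sum>j\<le>N. (fps_const (lam j) * fps_X ^ (?q ^ j)) ^ (?q ^ i))"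
   by (rule frobenius_sum) simp
  then show ?thesis by (simp add: ell_def power_mult_distrib fps_const_power power_add mult.commute flip: power_mult)
 qed
 have "(\<Sum>i\<le>N. fps_const (bet i) * (ell N :: 'a fls fls fps) ^ (?q ^ i)) $ C = (\<Sum>i\<le>N. \<Sum>j\<le>N. if ?q ^ (i + j) = C then bet i * lam j ^ (?q ^ i) else 0)"
  by (simp add: pw fps_sum_nth sum_distrib_left fps_X_power_nth if_distrib eq_commute[of C] cong: if_cong)
 also have "\<dots> = fps_X $ C"
 proof (cases "\<exists>m. C = ?q ^ m")
  case False
  then have "C \<noteq> 1" by (metis power_0)
  moreover have "(\<Sum>i\<le>N. \<Sum>j\<le>N. if ?q ^ (i + j) = C then bet i * lam j ^ (?q ^ i) else 0) = (0 :: 'a fls fls)"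
   using False by (intro sum.neutral ballI) metis
  ultimately show ?thesis by simp
 next
  case True
  then obtain m where m: "C = ?q ^ m" by blast
  then have mN: "m \<le> N" using assms q2 by (simp add: power_strict_increasing_iff del: power_Suc)
  have "(\<Sum>i\<le>N. \<Sum>j\<le>N. if ?q ^ (i + j) = C then bet i * lam j ^ (?q ^ i) else 0)
   = (\<Sum>i\<le>N. if i \<le> m then bet i * (lam (m - i) :: 'a fls fls) ^ (?q ^ i) else 0)"
  proof (rule sum.cong[OF refl])
   fix i
   have "(\<Sum>j\<le>N. if ?q ^ (i + j) = C then bet i * lam j ^ (?q ^ i) else 0) = (\<Sum>j\<le>N. if j = m - i then (if i \<le> m then bet i * (lam j :: 'a fls fls) ^ (?q ^ i) else 0) else 0)"
    by (rule sum.cong[OF refl]) (auto simp: m card_power_inj)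
   also have "\<dots> = (if i \<le> m then bet i * (lam (m - i) :: 'a fls fls) ^ (?q ^ i) else 0)" using mN by (auto dest: order_trans[OF diff_le_self])
   finally show "(\<Sum>j\<le>N. if ?q ^ (i + j) = C then bet i * lam j ^ (?q ^ i) else 0) = (if i \<le> m then bet i * (lam (m - i) :: 'a fls fls) ^ (?q ^ i) else 0)" .
  qed
  also have "\<dots> = (\<Sum>i\<in>{i\<in>{..N}. i \<le> m}. bet i * (lam (m - i) :: 'a fls fls) ^ (?q ^ i))" by (rule sum.inter_filter[symmetric]) simp
  also have "{i\<in>{..N}. i \<le> m} = {..m}" using mN by auto
  also have "(\<Sum>i\<le>m. bet i * (lam (m - i) :: 'a fls fls) ^ (?q ^ i)) = (if m = 0 then 1 else 0)" by (rule bet_lam)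
  also have "\<dots> = fps_X $ C"
  proof -
   have "C = 1 \<longleftrightarrow> m = 0" using m q2 card_power_inj[of m 0, where 'a = 'a] by simp
   then show ?thesis by simp
  qed
  finally show ?thesis .
 qed
 finally show ?thesis .
qed

lemma sum_top_digits: "(p::nat) \<ge> 1 ==> (\<Sum>e<M. (p - 1) * p ^ e) + 1 = p ^ M"
proof -
 assume "p \<ge> 1"
 then obtain r where "p = Suc r" by (cases p) auto
 then show ?thesis by (induction M) (simp_all add: algebra_simps)
qed

text \<open>Exponents occurring in \<open>ell N ^ \<nu>\<close> are sums of as many powers of
  \<open>p\<close> as the digit sum of \<open>\<nu>\<close>. The exponent \<open>p^M - 1\<close>
  needs \<open>M * (p - 1)\<close> of them, and below \<open>p^M\<close> only \<open>p^M - 1\<close>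
  itself has that digit sum.\<close>

lemma ell_top_zero:
 assumes "\<nu> + 1 < CHAR('a::{finite,field}) ^ M"
 shows "((ell N :: 'a fls fls fps) ^ \<nu>) $ (CHAR('a) ^ M - 1) = 0"
proof -
 let ?p = "CHAR('a)" and ?X = "tok CHAR('a) M \<nu>"
 have pr: "prime ?p" by (rule prime_CHAR_finite)
 have p2: "?p \<ge> 2" using pr prime_ge_2_nat by blast
 obtain f where f: "CARD('a) = ?p ^ f" using card_finite_field by blast
 have "tcost ?p CARD('a) ?X g \<noteq> ?p ^ M - 1" for g
 proof
  assume "tcost ?p CARD('a) ?X g = ?p ^ M - 1"
  then have "(\<Sum>x\<in>?X. ?p ^ (f * g x + fst x)) + 0 + 1 = ?p ^ M"
   using p2 by (simp add: tcost_def f power_add power_mult)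
  then have c: "M * (?p - 1) \<le> card ?X" using card_powers_minus_one[of ?X ?p M "\<lambda>x. f * g x + fst x" 0] p2 by simp
  have le: "\<nu> div ?p ^ e mod ?p \<le> ?p - 1" for e
   using mod_less_divisor[of ?p "\<nu> div ?p ^ e"] p2 by linarith
  have "\<nu> div ?p ^ e mod ?p = ?p - 1" if "e < M" for e
  proof (rule ccontr)
   assume "\<not> ?thesis"
   then have "\<nu> div ?p ^ e mod ?p < ?p - 1" using le[of e] by linarith
   then have "(\<Sum>e<M. \<nu> div ?p ^ e mod ?p) < (\<Sum>e<M. ?p - 1)" using that le by (intro sum_strict_mono_ex1) auto
   then show False using c by (simp add: card_tok)
  qed
  then have "(\<Sum>e<M. (\<nu> div ?p ^ e mod ?p) * ?p ^ e) = (\<Sum>e<M. (?p - 1) * ?p ^ e)" by (intro sum.cong) auto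
  moreover have "(\<Sum>e<M. (?p - 1) * ?p ^ e) + 1 = ?p ^ M"
   using p2 by (intro sum_top_digits) simp
  ultimately show False using assms by (simp add: digit_sum_mod)
 qed
 then show ?thesis using assms by (subst ell_power_nth[of _ M]) simp_all
qed

text \<open>Lagrange inversion. The coefficient of \<open>x^n\<close> in
  \<open>1 / (1 - \<beta>(x))\<close> is a residue; substituting \<open>x = ell(y)\<close>, where
  the derivative of \<open>ell\<close> is 1, gives the residue of
  \<open>ell^(-n-1) / (1 - y)\<close>. With \<open>K = p^M\<close>, the power \<open>ell^K\<close>
  is \<open>y^K\<close> up to terms too high to matter, so \<open>ell^(-n-1)\<close> may be replaced
  by \<open>y^(-K) * ell^(K-1-n)\<close>. The proof checks the recurrence for the resulting
  expression.\<close>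

lemma hrec_bet_cut:
 assumes "n < CHAR('a::{finite,field}) ^ M" "CHAR('a) ^ M \<le> CARD('a) ^ Suc N"
 shows "hrec CARD('a) (bet :: nat => 'a fls fls) n = cut (CHAR('a) ^ M) ((ell N :: 'a fls fls fps) ^ (CHAR('a) ^ M - 1 - n))"
proof -
 let ?q = "CARD('a)"
 define K where "K = CHAR('a) ^ M"
 define g where "g n = cut K ((ell N :: 'a fls fls fps) ^ (K - 1 - n))" for n
 have K0: "K > 0" using assms(1) unfolding K_def by linarith
 have q2: "?q \<ge> 2" by (rule card_ge_2)
 have "g n = hrec ?q bet n"
 proof (rule hrec_unique[OF q2, where N = "K - 1"])
  have "g 0 = (\<Sum>C\<in>{..<K}. if C = K - 1 then 1 else 0)"
   unfolding g_def cut_def by (rule sum.cong[OF refl]) (use ell_power_low[where 'a = 'a and N = N and k = "K - 1"] ell_power_diag[where 'a = 'a and N = N and k = "K - 1"] in force)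
  then show "g 0 = 1" using K0 by simp
  show "n \<le> K - 1" using assms(1) by (simp add: K_def)
  fix m assume m: "0 < m" "m \<le> K - 1"
  define \<nu> where "\<nu> = K - 1 - m"
  let ?e = "ell N :: 'a fls fls fps"
  have sub: "{i. ?q ^ i \<le> m} \<subseteq> {..N}"
  proof
   fix i assume "i \<in> {i. ?q ^ i \<le> m}"
   then have "?q ^ i < ?q ^ Suc N" using m K0 assms(2) by (simp add: K_def[symmetric] del: power_Suc)
   then show "i \<in> {..N}" using q2 by (simp add: power_strict_increasing_iff del: power_Suc)
  qed
  have "(\<Sum>i | ?q ^ i \<le> m. bet i * g (m - ?q ^ i)) = (\<Sum>i | ?q ^ i \<le> m. bet i * cut K (?e ^ (\<nu> + ?q ^ i)))"
   using m by (intro sum.cong refl) (auto simp: g_def \<nu>_def intro!: arg_cong[where f = "\<lambda>k. cut K (?e ^ k)"])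
  also have "\<dots> = (\<Sum>i\<le>N. bet i * cut K (?e ^ (\<nu> + ?q ^ i)))"
  proof (rule sum.mono_neutral_left[OF _ sub])
   show "\<forall>i\<in>{..N} - {i. ?q ^ i \<le> m}. bet i * cut K (?e ^ (\<nu> + ?q ^ i)) = 0"
   proof
    fix i assume "i \<in> {..N} - {i. ?q ^ i \<le> m}"
    then have "K \<le> \<nu> + ?q ^ i" using m K0 unfolding \<nu>_def by auto
    then have "cut K (?e ^ (\<nu> + ?q ^ i)) = 0" by (intro cut_high ell_power_low) simp
    then show "bet i * cut K (?e ^ (\<nu> + ?q ^ i)) = 0" by simp
   qed
  qed simp
  also have "\<dots> = cut K (?e ^ \<nu> * (\<Sum>i\<le>N. fps_const (bet i) * ?e ^ (?q ^ i)))"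
   by (simp add: sum_distrib_left cut_sum power_add mult.left_commute cut_const)
  also have "\<dots> = cut K (?e ^ \<nu> * fps_X)"
   unfolding cut_def
  proof (rule sum.cong[OF refl])
   fix C assume C: "C \<in> {..<K}"
   show "(?e ^ \<nu> * (\<Sum>i\<le>N. fps_const (bet i) * ?e ^ (?q ^ i))) $ C = (?e ^ \<nu> * fps_X) $ C"
    unfolding fps_mult_nth
    by (rule sum.cong[OF refl], subst bet_ell) (use C assms(2) in \<open>auto simp: K_def[symmetric]\<close>)
  qed
  \<comment> \<open>The factor \<open>fps_X\<close> moves the cut from \<open>K\<close> to
    \<open>K - 1\<close>; the coefficient at \<open>K - 1\<close> that would be missing is 0 by
    \<open>ell_top_zero\<close>.\<close>
  also have "\<dots> = (\<Sum>C<K - 1. ?e ^ \<nu> $ C)"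
  proof -
   have "cut K (?e ^ \<nu> * fps_X) = (\<Sum>C<Suc (K - 1). (?e ^ \<nu> * fps_X) $ C)" using K0 by (simp add: cut_def)
   also have "\<dots> = (\<Sum>C<K - 1. ?e ^ \<nu> $ C)" by (subst sum.lessThan_Suc_shift) simp
   finally show ?thesis .
  qed
  also have "\<dots> = g m"
  proof -
   have "g m = (\<Sum>C<Suc (K - 1). ?e ^ \<nu> $ C)" using K0 by (simp add: g_def cut_def \<nu>_def)
   moreover have "?e ^ \<nu> $ (K - 1) = 0" using m ell_top_zero[of \<nu> M N, where 'a = 'a] by (simp add: \<nu>_def K_def)
   ultimately show ?thesis by simp
  qed
  finally show "g m = (\<Sum>i | ?q ^ i \<le> m. bet i * g (m - ?q ^ i))" by simp
 qed
 then show ?thesis by (simp add: g_def K_def)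
qed

lemma hrec_bet_tokens:
 assumes "n < CHAR('a::{finite,field}) ^ M" "CHAR('a) ^ M \<le> CARD('a) ^ Suc N"
 defines "X \<equiv> tok CHAR('a) M (CHAR('a) ^ M - 1 - n)"
 shows "hrec CARD('a) (bet :: nat => 'a fls fls) n =
  (\<Sum>g\<in>{g \<in> PiE X (\<lambda>_. {..N}). tcost CHAR('a) CARD('a) X g < CHAR('a) ^ M}. \<Prod>x\<in>X. lam (g x) ^ (CHAR('a) ^ fst x))"
proof -
 let ?p = "CHAR('a)"
 have lt: "?p ^ M - 1 - n < ?p ^ M" using assms(1) by simp
 have finP: "finite (PiE X (\<lambda>_. {..N}))" by (intro finite_PiE) (simp_all add: X_def)
 have "hrec CARD('a) (bet :: nat => 'a fls fls) n = (\<Sum>C<?p ^ M. \<Sum>g\<in>PiE X (\<lambda>_. {..N}). if tcost ?p CARD('a) X g = C then \<Prod>x\<in>X. lam (g x) ^ (?p ^ fst x) else 0)"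
  unfolding hrec_bet_cut[OF assms(1,2)] cut_def X_def using ell_power_nth[OF lt] by simp
 also have "\<dots> = (\<Sum>g\<in>PiE X (\<lambda>_. {..N}). \<Sum>C<?p ^ M. if tcost ?p CARD('a) X g = C then \<Prod>x\<in>X. lam (g x) ^ (?p ^ fst x) else 0)"
  by (rule sum.swap)
 also have "\<dots> = (\<Sum>g\<in>PiE X (\<lambda>_. {..N}). if tcost ?p CARD('a) X g < ?p ^ M then \<Prod>x\<in>X. lam (g x) ^ (?p ^ fst x) else 0)"
  by (rule sum.cong[OF refl]) simp
 also have "\<dots> = (\<Sum>g\<in>{g \<in> PiE X (\<lambda>_. {..N}). tcost ?p CARD('a) X g < ?p ^ M}. \<Prod>x\<in>X. lam (g x) ^ (?p ^ fst x))"
  by (rule sum.inter_filter[symmetric, OF finP])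
 finally show ?thesis .
qed

lemma sum_powers_card: "(CARD('a::{finite,field}) - 1) * (\<Sum>m\<in>{1..i}. CARD('a) ^ m) + CARD('a) = CARD('a) * CARD('a) ^ i"
proof (induction i)
 case (Suc i)
 obtain r where r: "CARD('a) = Suc r" using card_ge_2[where 'a = 'a] by (cases "CARD('a)") auto
 show ?case using Suc unfolding r by (simp add: algebra_simps)
qed simp

text \<open>A placement \<open>g\<close> contributes a pole in \<open>t\<close> whose order is its
  value, with leading coefficient a sign times \<open>\<theta> ^ ex g\<close>. By \<open>exq\<close>
  the exponent depends on the cost alone, which is the same for all optima, and so is the sign.
  Hence the leading terms add up to one monomial times the number of optima.\<close>

lemma hrec_bet_lowest:
 "\<exists>a V E N. ltc ((- 1) ^ a * of_nat N * fls_X_inv ^ E :: 'a::{finite,field} fls) V (hrec CARD('a) (bet :: nat => 'a fls fls) n) \<and> \<not> CHAR('a) dvd N"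
proof -
 let ?p = "CHAR('a)" and ?q = "CARD('a)"
 have pr: "prime ?p" by (rule prime_CHAR_finite)
 have p2: "?p \<ge> 2" using pr prime_ge_2_nat by blast
 obtain f where f: "f \<ge> 1" "?q = ?p ^ f" using card_finite_field by blast
 interpret tp: token_problem ?p f ?q "fst :: nat \<times> nat => nat" by standard (use pr f in auto)
 define M where "M = n"
 have nM: "n < ?p ^ M"
 proof -
  have "n < 2 ^ n" by (rule less_exp)
  also have "\<dots> \<le> ?p ^ n" by (rule power_mono[OF p2]) simp
  finally show ?thesis by (simp add: M_def)
 qed
 have pq: "?p ^ M \<le> ?q ^ Suc M"
 proof -
  have "?p ^ 1 \<le> ?p ^ f" by (rule power_increasing[OF f(1)]) (use p2 in simp)
  then have "?p \<le> ?q" by (simp add: f(2))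
  then have "?p ^ M \<le> ?q ^ M" by (rule power_mono) simp
  also have "\<dots> \<le> ?q ^ Suc M" using card_ge_2[where 'a = 'a] by (intro power_increasing) auto
  finally show ?thesis .
 qed
 define \<nu> where "\<nu> = ?p ^ M - 1 - n"
 define X where "X = tok ?p M \<nu>"
 define K where "K = ?p ^ M"
 have \<nu>K: "\<nu> < K" using nM by (simp add: \<nu>_def K_def)
 have finX: "finite X" by (simp add: X_def)
 have nuX: "tp.nu X = \<nu>" using sum_tok[of \<nu> ?p M] \<nu>K by (simp add: tp.nu_def tp.w_def X_def K_def)
 have cls: "tp.cls X k < ?p" for k
 proof -
  have "{x \<in> X. fst x = k} = (if k < M then {k} \<times> {..<\<nu> div ?p ^ k mod ?p} else {})" by (auto simp: X_def tok_def)
  then show ?thesis using p2 by (simp add: tp.cls_def card_cartesian_product)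
 qed
 have "tp.good X (real 1 * real ?p powi (int M))"
  by (rule tp.good_all[OF finX cls]) (use card_ge_2[where 'a = 'a] in auto)
 then have good: "tp.good X (real K)" by (simp add: K_def)
 define Op where "Op = tp.opts X (real K)"
 have "Op \<noteq> {}" using good unfolding tp.good_def Op_def by (metis card.empty dvd_0_right)
 then obtain d0 where d0: "d0 \<in> Op" by blast
 define V where "V = tp.val X d0"
 have valV: "tp.val X d = V" if "d \<in> Op" for d using that d0 unfolding Op_def tp.opts_def V_def by (auto intro: antisym)
 have maxV: "tp.val X d \<le> V" if "tp.cost X d < real K" for d using d0 that unfolding Op_def tp.opts_def V_def by auto
 obtain C where C: "\<And>d. d \<in> Op ==> tp.cost X d = C" using good by (auto simp: tp.good_def Op_def)
 have pos: "d x \<ge> 0" if "d \<in> Op" "x \<in> X" for d x using good that \<nu>K by (auto simp: tp.good_def Op_def nuX)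
 define emd :: "(nat \<times> nat => nat) => nat \<times> nat => int" where "emd g = restrict (\<lambda>x. int (g x)) X" for g
 have cost: "tp.cost X (emd g) = real (tcost ?p ?q X g)" for g
  by (simp add: tp.cost_def tcost_def emd_def tp.w_def mult.commute)
 define A where "A = {g \<in> PiE X (\<lambda>_. {..M}). tcost ?p ?q X g < K}"
 define S where "S = {g \<in> A. emd g \<in> Op}"
 have finA: "finite A" unfolding A_def using finX by (intro finite_subset[OF _ finite_PiE[of X "\<lambda>_. {..M}"]]) auto
 \<comment> \<open>The optimization runs over all integer levels. Optima are nonnegative because
   \<open>\<nu> < K\<close>, and at most \<open>M\<close> because the budget forbids more, so each
   one is a placement occurring in the sum.\<close>
 have bij: "bij_betw emd S Op"
 proof (rule bij_betwI[where g = "\<lambda>d. restrict (\<lambda>x. nat (d x)) X"])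
  show "emd \<in> S \<rightarrow> Op" by (auto simp: S_def)
  have ed: "emd (restrict (\<lambda>x. nat (d x)) X) = d" if "d \<in> Op" for d
  proof
   fix x show "emd (restrict (\<lambda>x. nat (d x)) X) x = d x"
    using that pos[OF that, of x] PiE_arb[of d X "\<lambda>_. UNIV" x]
    by (cases "x \<in> X") (simp_all add: emd_def Op_def tp.opts_def)
  qed
  then show "emd (restrict (\<lambda>x. nat (d x)) X) = d" if "d \<in> Op" for d using that by blast
  show "(\<lambda>d. restrict (\<lambda>x. nat (d x)) X) \<in> Op \<rightarrow> S"
  proof
   fix d assume d: "d \<in> Op"
   let ?g = "restrict (\<lambda>x. nat (d x)) X"
   have lt: "tcost ?p ?q X ?g < K" using d cost[of ?g] unfolding ed[OF d] by (simp add: Op_def tp.opts_def)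
   have "?g x \<le> M" if "x \<in> X" for x
   proof -
    have "?q ^ ?g x * 1 \<le> ?q ^ ?g x * ?p ^ fst x" using p2 by (intro mult_left_mono) auto
    also have "\<dots> \<le> tcost ?p ?q X ?g" unfolding tcost_def using finX that
     by (intro member_le_sum[where f = "\<lambda>x. ?q ^ ?g x * ?p ^ fst x"]) auto
    finally have "?q ^ ?g x < ?q ^ Suc M" using lt pq unfolding K_def by linarith
    then show ?thesis using card_ge_2[where 'a = 'a] by (simp add: power_strict_increasing_iff del: power_Suc)
   qed
   then have "?g \<in> A" using lt by (auto simp: A_def)
   then show "?g \<in> S" using ed[OF d] d by (simp add: S_def)
  qed
  show "restrict (\<lambda>x. nat (emd g x)) X = g" if "g \<in> S" for g
  proof
   fix x show "restrict (\<lambda>x. nat (emd g x)) X x = g x"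
    using that PiE_arb[of g X "\<lambda>_. {..M}" x] by (cases "x \<in> X") (simp_all add: emd_def S_def A_def)
  qed
 qed
 have cardS: "\<not> ?p dvd card S" using good bij_betw_same_card[OF bij] by (simp add: tp.good_def Op_def)
 then have "S \<noteq> {}" by (metis card.empty dvd_0_right)
 then obtain g0 where g0: "g0 \<in> S" by blast
 define a where "a = nat V"
 define ex where "ex g = (\<Sum>x\<in>X. (\<Sum>m\<in>{1..g x}. ?q ^ m) * ?p ^ fst x)" for g :: "nat \<times> nat => nat"
 have exq: "(?q - 1) * ex g + ?q * \<nu> = ?q * tcost ?p ?q X g" for g
 proof -
  have "(?q - 1) * ex g + ?q * \<nu> = (\<Sum>x\<in>X. ((?q - 1) * (\<Sum>m\<in>{1..g x}. ?q ^ m) + ?q) * ?p ^ fst x)"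
   by (simp add: ex_def nuX[symmetric] tp.nu_def tp.w_def sum_distrib_left sum.distrib algebra_simps)
  also have "\<dots> = (\<Sum>x\<in>X. ?q * (?q ^ g x * ?p ^ fst x))" by (simp only: sum_powers_card mult.assoc)
  also have "\<dots> = ?q * tcost ?p ?q X g" by (simp add: tcost_def sum_distrib_left)
  finally show ?thesis .
 qed
 have ex_eq: "ex g = ex g0" if "g \<in> S" for g
 proof -
  have "real (tcost ?p ?q X g) = real (tcost ?p ?q X g0)" using C that g0 by (simp add: S_def flip: cost)
  then have "(?q - 1) * ex g + ?q * \<nu> = (?q - 1) * ex g0 + ?q * \<nu>" unfolding exq by simp
  then show ?thesis using card_ge_2[where 'a = 'a] by simp
 qed
 have trm: "ltc (if g \<in> S then (- 1) ^ a * fls_X_inv ^ ex g0 else 0 :: 'a fls) (- V) (\<Prod>x\<in>X. lam (g x) ^ (?p ^ fst x))" if g: "g \<in> A" for g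
 proof -
  let ?v = "\<Sum>x\<in>X. g x * ?p ^ fst x"
  have vg: "tp.val X (emd g) = int ?v" by (simp add: tp.val_def emd_def tp.w_def mult.commute)
  have "ltc (\<Prod>x\<in>X. ul (g x) ^ (?p ^ fst x)) (\<Sum>x\<in>X. int (?p ^ fst x) * (- int (g x))) (\<Prod>x\<in>X. lam (g x) ^ (?p ^ fst x) :: 'a fls fls)"
   by (intro ltc_prod ltc_power ltc_lam)
  moreover have "(\<Sum>x\<in>X. int (?p ^ fst x) * (- int (g x))) = - int ?v" by (simp add: sum_negf mult.commute)
  moreover have "(\<Prod>x\<in>X. ul (g x) ^ (?p ^ fst x) :: 'a fls) = (- 1) ^ ?v * fls_X_inv ^ ex g"
   by (simp add: ul_def ex_def power_mult_distrib prod.distrib power_sum power_mult)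
  ultimately have l: "ltc ((- 1) ^ ?v * fls_X_inv ^ ex g) (- int ?v) (\<Prod>x\<in>X. lam (g x) ^ (?p ^ fst x) :: 'a fls fls)" by simp
  have cg: "tp.cost X (emd g) < real K" using g by (simp add: cost A_def)
  show ?thesis
  proof (cases "g \<in> S")
   case True
   then have "int ?v = V" using valV[of "emd g"] vg by (simp add: S_def)
   moreover from this have "?v = a" unfolding a_def by linarith
   ultimately show ?thesis using l True ex_eq[OF True] by (simp only: if_True)
  next
   case False
   have "int ?v \<noteq> V"
   proof
    assume "int ?v = V"
    then have vV: "tp.val X (emd g) = V" using vg by (simp only:)
    have "emd g \<in> PiE X (\<lambda>_. UNIV)" by (simp add: emd_def)
    moreover have "\<forall>d'. tp.cost X d' < real K \<longrightarrow> tp.val X d' \<le> tp.val X (emd g)" unfolding vV using maxV by blast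
    ultimately have "emd g \<in> Op" using cg unfolding Op_def tp.opts_def by blast
    then show False using False g by (simp add: S_def)
   qed
   then have "int ?v < V" using maxV[OF cg] vg by simp
   then show ?thesis using ltc_less[OF l, of "- V"] False by simp
  qed
 qed
 have "hrec ?q (bet :: nat => 'a fls fls) n = (\<Sum>g\<in>A. \<Prod>x\<in>X. lam (g x) ^ (?p ^ fst x))"
  using hrec_bet_tokens[OF nM pq] by (simp add: A_def X_def \<nu>_def K_def)
 moreover have "ltc (\<Sum>g\<in>A. if g \<in> S then (- 1) ^ a * fls_X_inv ^ ex g0 else 0 :: 'a fls) (- V) (\<Sum>g\<in>A. \<Prod>x\<in>X. lam (g x) ^ (?p ^ fst x))"
  by (intro ltc_sum trm)
 moreover have "(\<Sum>g\<in>A. if g \<in> S then (- 1) ^ a * fls_X_inv ^ ex g0 else 0 :: 'a fls) = (- 1) ^ a * of_nat (card S) * fls_X_inv ^ ex g0"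
 proof -
  have "(\<Sum>g\<in>A. if g \<in> S then (- 1) ^ a * fls_X_inv ^ ex g0 else 0 :: 'a fls) = (\<Sum>g\<in>{g\<in>A. g \<in> S}. (- 1) ^ a * fls_X_inv ^ ex g0)"
   using finA by (rule sum.inter_filter[symmetric])
  also have "{g\<in>A. g \<in> S} = S" by (auto simp: S_def)
  finally show ?thesis by (simp add: mult_ac)
 qed
 ultimately show ?thesis using cardS by metis
qed

lemma rho_Hp: "rho (Hp s :: 'a::{finite,field} poly poly) = rho (Dl (s - 1)) ^ (s - 1) * hrec CARD('a) bet (s - 1)"
proof -
 define n where "n = s - 1"
 have q2: "CARD('a) \<ge> 2" by (rule card_ge_2)
 have "rho (Hp s :: 'a poly poly) = hrec CARD('a) (\<lambda>i. rho (gam n i)) n"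
  unfolding Hp_def n_def[symmetric] by (rule hrec_hom[OF q2]) (simp_all add: rho_mult rho_add)
 also have "\<dots> = hrec CARD('a) (\<lambda>i. rho (Dl n) ^ (CARD('a) ^ i) * bet i) n"
 proof (rule hrec_cong[OF q2])
  fix i assume "i \<le> n"
  have "rho (Dt i) * rho (gam n i) = rho (Dl n) ^ (CARD('a) ^ i) * (rho (Gt i) :: 'a fls fls)"
   using arg_cong[OF Dt_gam[OF \<open>i \<le> n\<close>], of rho] by (simp add: rho_mult rho_power)
  then show "rho (gam n i) = rho (Dl n) ^ (CARD('a) ^ i) * (bet i :: 'a fls fls)"
   using Dt_nonzero[of i, where 'a = 'a] by (simp add: bet_def field_simps)
 qed
 also have "\<dots> = rho (Dl n) ^ n * hrec CARD('a) bet n" by (rule hrec_scale[OF q2])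
 finally show ?thesis by (simp add: n_def)
qed

lemma rho_Dl_lowest: "\<exists>a k. ltc ((- 1) ^ a :: 'a::{finite,field} fls) k (rho (Dl n))"
proof -
 have "ltc ((- 1) ^ i :: 'a fls) (\<Sum>j<i. int (CARD('a) ^ j)) (rho (Dt i))" for i
 proof -
  have "ltc (\<Prod>j<i. - 1 :: 'a fls) (\<Sum>j<i. int (CARD('a) ^ j)) (rho (Dt i))"
   unfolding rho_Dt
  proof (rule ltc_prod)
   fix j assume "j \<in> {..<i}"
   then have "CARD('a) ^ j < CARD('a) ^ i" using card_ge_2[where 'a = 'a] by (intro power_strict_increasing) auto
   then show "ltc (- 1 :: 'a fls) (int (CARD('a) ^ j)) (Lt ^ (CARD('a) ^ i) - Lt ^ (CARD('a) ^ j))"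
    unfolding Lt_def by (rule ltc_X_diff)
  qed
  then show ?thesis by simp
 qed
 then have "ltc (\<Prod>i\<le>n. (- 1) ^ i :: 'a fls) (\<Sum>i\<le>n. \<Sum>j<i. int (CARD('a) ^ j)) (rho (Dl n))"
  unfolding Dl_def rho_prod by (intro ltc_prod)
 then show ?thesis unfolding power_sum[symmetric] by blast
qed

theorem Hp_lowest:
 "\<exists>k c m. c \<noteq> 0 \<and> (\<forall>j<k. coeff (Hp s :: 'a::{finite,field} poly poly) j = 0) \<and> coeff (Hp s :: 'a poly poly) k = monom c m"
proof -
 define n where "n = s - 1"
 obtain a V E N where 1: "ltc ((- 1) ^ a * of_nat N * fls_X_inv ^ E :: 'a fls) V (hrec CARD('a) (bet :: nat => 'a fls fls) n)" and N: "\<not> CHAR('a) dvd N"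
  using hrec_bet_lowest by metis
 obtain b k where 2: "ltc ((- 1) ^ b :: 'a fls) k (rho (Dl n))" using rho_Dl_lowest by metis
 have N0: "(of_nat N :: 'a) \<noteq> 0" using N by (simp add: of_nat_eq_0_iff_char_dvd)
 let ?c = "((- 1) ^ b) ^ n * ((- 1) ^ a * of_nat N) :: 'a"
 have c0: "?c \<noteq> 0" using N0 by simp
 let ?z = "((- 1) ^ b) ^ n * ((- 1) ^ a * of_nat N * fls_X_inv ^ E) :: 'a fls"
 have z: "?z = AK (monom ?c E)"
  by (simp add: AK_monom fls_of_nat fls_const_power mult.assoc fls_const_mult_const[symmetric] del: fls_const_mult_const)
 have l: "ltc ?z (int n * k + V) (rho (Hp s))"
  unfolding rho_Hp n_def[symmetric] by (intro ltc_mult ltc_power 1 2)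
 have z0: "?z \<noteq> 0" unfolding z using c0 by (simp only: AK_eq_0_iff monom_eq_0_iff not_False_eq_True)
 have "fls_subdegree (rho (Hp s) :: 'a fls fls) = int n * k + V" using ltc_subdegree[OF l z0] .
 then have "int n * k + V \<ge> 0" unfolding rho_def by (simp add: fls_subdegree_fls_to_fps)
 then obtain w where w: "int n * k + V = int w" by (metis nonneg_int_cases)
 have nth: "rho (Hp s) $$ int j = AK (coeff (Hp s :: 'a poly poly) j)" for j by (simp add: rho_def)
 have low: "coeff (Hp s :: 'a poly poly) j = 0" if "j < w" for j
 proof -
  have "rho (Hp s :: 'a poly poly) $$ int j = 0" using l that unfolding w ltc_def vge_def by simp
  then show ?thesis by (simp only: nth AK_eq_0_iff)
 qed
 have lead: "coeff (Hp s) w = monom ?c E"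
 proof -
  have "rho (Hp s) $$ int w = ?z" using l unfolding w ltc_def by simp
  then show ?thesis unfolding z nth by (simp only: AK_inj)
 qed
 show ?thesis by (rule exI[of _ w], rule exI[of _ ?c], rule exI[of _ E], intro conjI c0 allI impI low lead)
qed

section \<open>Power sums of monic polynomials\<close>

definition Mon :: "nat => 'a::{finite,field} poly set" where
 "Mon d = {a. degree a = d \<and> Polynomial.lead_coeff a = 1}"
definition Sd :: "nat => nat => 'a::{finite,field} fls" where
 "Sd d s = (\<Sum>a\<in>Mon d. 1 / AK a ^ s)"
definition Ld :: "nat => 'a::{finite,field} fls" where "Ld d = (\<Prod>j\<in>{1..d}. th 0 - th j)"
definition Dk :: "nat => 'a::{finite,field} fls" where "Dk i = (\<Prod>j<i. th i - th j)"
definition ed :: "nat => nat => 'a::{finite,field} fls" where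
 "ed d i = (if i \<le> d then 1 / (Dk i * Ld (d - i) ^ (CARD('a) ^ i)) else 0)"
text \<open>Carlitz' additive polynomial, the product over all polynomials of degree below
  \<open>d\<close> divided by \<open>D_d\<close>, given here by its expansion. It is identified by
  \<open>Ed_A\<close>: on polynomials of degree at most \<open>d\<close> it returns the coefficient
  at \<open>\<theta>^d\<close>.\<close>

definition Ed :: "nat => 'a::{finite,field} fls => 'a fls" where
 "Ed d x = (\<Sum>i\<le>d. ed d i * x ^ (CARD('a) ^ i))"

lemma Dk_A: "Dk i = AK (carlitz_D i :: 'a::{finite,field} poly)"
 by (simp add: Dk_def carlitz_D_def AK_hom flip: AK_thA thA_def)

lemma Ld_nonzero [simp]: "Ld d \<noteq> 0" and Dk_nonzero [simp]: "Dk i \<noteq> 0"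
 by (simp_all add: Ld_def Dk_def)

lemma Dk_Suc: "Dk (Suc i) = (th (Suc i) - th 0) * (Dk i :: 'a::{finite,field} fls) ^ CARD('a)"
proof -
 have s: "(th m - th n :: 'a fls) ^ CARD('a) = th (Suc m) - th (Suc n)" for m n
  using fls_frob_diff[where 'a = 'a, of "th m" "th n" 1] th_power[where 'a = 'a, of m 1] th_power[where 'a = 'a, of n 1] by simp
 have "Dk (Suc i) = (th (Suc i) - th 0) * (\<Prod>j<i. th (Suc i) - th (Suc j) :: 'a fls)"
  unfolding Dk_def by (rule prod.lessThan_Suc_shift)
 also have "(\<Prod>j<i. th (Suc i) - th (Suc j) :: 'a fls) = Dk i ^ CARD('a)"
  unfolding Dk_def prod_power_distrib by (intro prod.cong refl) (simp add: s)
 finally show ?thesis .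
qed

lemma ed_step1: "i \<le> d ==> (th (Suc i) - th 0) * ed (Suc d) (Suc i) = (ed d i :: 'a::{finite,field} fls) ^ CARD('a)"
 by (simp add: ed_def Dk_Suc power_divide power_mult_distrib mult.commute[of "CARD('a)"] power_mult)

lemma ed_step2: "i \<le> Suc d ==> (th i - th (Suc d)) * ed (Suc d) i = (ed d i :: 'a::{finite,field} fls)"
proof -
 assume i: "i \<le> Suc d"
 show ?thesis
 proof (cases "i = Suc d")
  case False
  then have id: "i \<le> d" using i by simp
  have "Ld (Suc d - i) = Ld (d - i) * (th 0 - th (Suc d - i) :: 'a fls)"
   using id by (simp add: Ld_def Suc_diff_le)
  moreover have "(th 0 - th (Suc d - i) :: 'a fls) ^ (CARD('a) ^ i) = th i - th (Suc d)"
   using id by (simp add: fls_frob_diff)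
  moreover have "(th i - th (Suc d) :: 'a fls) \<noteq> 0" using id by simp
  ultimately show ?thesis using id by (simp add: ed_def power_mult_distrib)
 qed (simp add: ed_def)
qed

lemma Ed_mult_theta: "Ed (Suc d) (th 0 * x) = th 0 * Ed (Suc d) x + Ed d (x :: 'a::{finite,field} fls) ^ CARD('a)"
proof -
 have "Ed (Suc d) (th 0 * x) - th 0 * Ed (Suc d) x = (\<Sum>i\<le>Suc d. (th i - th 0) * ed (Suc d) i * x ^ (CARD('a) ^ i))"
  unfolding Ed_def sum_distrib_left sum_subtractf[symmetric]
  by (intro sum.cong refl) (simp add: power_mult_distrib algebra_simps)
 also have "\<dots> = (\<Sum>i\<le>d. (ed d i * x ^ (CARD('a) ^ i)) ^ CARD('a))"
  by (subst sum.atMost_Suc_shift) (simp add: ed_step1 power_mult_distrib mult.commute[of "CARD('a)"] power_mult)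
 also have "\<dots> = Ed d x ^ CARD('a)"
  using fls_frob_sum[where 'a = 'a, of "\<lambda>i. ed d i * x ^ (CARD('a) ^ i)" "{..d}" 1] by (simp add: Ed_def)
 finally show ?thesis by (simp add: algebra_simps)
qed

text \<open>The two recursions for \<open>ed\<close> evaluate \<open>Ed (Suc d)\<close> at
  \<open>\<theta>\<close> in two ways. Comparison gives \<open>(\<theta> - \<theta>^(q^(d+1))) * Ed
  (Suc d) 1 = Ed d 1 - Ed d 1 ^ q\<close>, and the right side vanishes because \<open>Ed d 1\<close>
  is 0 or 1.\<close>

lemma Ed_1: "Ed d 1 = (if d = 0 then 1 else 0 :: 'a::{finite,field} fls)"
proof (induction d)
 case 0 show ?case by (simp add: Ed_def ed_def Dk_def Ld_def)
next
 case (Suc d)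
 have "Ed (Suc d) (th 0 * 1) - th (Suc d) * Ed (Suc d) 1 = (\<Sum>i\<le>Suc d. (th i - th (Suc d)) * ed (Suc d) i :: 'a fls)"
  unfolding Ed_def sum_distrib_left sum_subtractf[symmetric]
  by (intro sum.cong refl) (simp add: algebra_simps)
 also have "\<dots> = (\<Sum>i\<le>Suc d. ed d i)" by (rule sum.cong[OF refl]) (simp only: atMost_iff ed_step2)
 also have "\<dots> = Ed d 1" by (simp add: Ed_def ed_def)
 finally have "(th 0 - th (Suc d)) * Ed (Suc d) 1 = (Ed d 1 :: 'a fls) - Ed d 1 ^ CARD('a)"
  unfolding Ed_mult_theta by (simp add: algebra_simps)
 also have "\<dots> = 0" using Suc card_ge_2[where 'a = 'a] by (auto simp: power_0_left)
 finally show ?case by simp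
qed

lemma Ed_theta_power: "j \<le> d ==> Ed d (th 0 ^ j) = (if j = d then 1 else 0 :: 'a::{finite,field} fls)"
proof (induction j arbitrary: d)
 case 0 then show ?case by (simp add: Ed_1)
next
 case (Suc j)
 then obtain d' where d: "d = Suc d'" "j \<le> d'" by (cases d) auto
 have "Ed (Suc d') (th 0 * th 0 ^ j) = (if j = d' then 1 else 0 :: 'a fls)"
  unfolding Ed_mult_theta using Suc.IH[of "Suc d'"] Suc.IH[of d'] d card_ge_2[where 'a = 'a] by (auto simp: power_0_left)
 then show ?case using d by simp
qed

lemma Ed_sum: "Ed d (\<Sum>j\<in>S. g j) = (\<Sum>j\<in>S. Ed d (g j))"
 by (simp add: Ed_def fls_frob_sum sum_distrib_left) (rule sum.swap)
lemma Ed_scale: "Ed d (fls_const c * x) = fls_const c * Ed d (x :: 'a::{finite,field} fls)"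
 by (simp add: Ed_def power_mult_distrib sum_distrib_left mult.left_commute finite_field_power_card_power flip: fls_const_power)

lemma Ed_A: assumes "degree a \<le> d"
 shows "Ed d (AK a) = (fls_const (coeff a d) :: 'a::{finite,field} fls)"
proof -
 have "a = (\<Sum>j\<le>d. monom (coeff a j) j)" using assms by (rule poly_as_sum_of_monoms'[symmetric])
 then have "AK a = (\<Sum>j\<le>d. fls_const (coeff a j) * th 0 ^ j)"
  by (metis (no_types, lifting) AK_monom AK_sum sum.cong power_0 power_one_right th_def)
 then have "Ed d (AK a) = (\<Sum>j\<le>d. fls_const (coeff a j) * Ed d (th 0 ^ j))" by (simp add: Ed_sum Ed_scale)
 also have "\<dots> = (\<Sum>j\<le>d. if j = d then fls_const (coeff a j) else 0)"
  by (intro sum.cong refl) (simp add: Ed_theta_power)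
 finally show ?thesis by simp
qed

lemma Mon_eq: "Mon d = (\<lambda>a. a + monom 1 d) ` PS (UNIV :: 'a::{finite,field} set) d"
proof safe
 fix a :: "'a poly" assume "a \<in> Mon d"
 then have a: "degree a = d" "coeff a d = 1" by (auto simp: Mon_def)
 have "a - monom 1 d \<in> PS UNIV d" using a by (auto simp: PS_def Polynomial.coeff_monom coeff_eq_0 le_less)
 then show "a \<in> (\<lambda>a. a + monom 1 d) ` PS UNIV d" by (intro image_eqI[of _ _ "a - monom 1 d"]) auto
next
 fix a :: "'a poly" assume a: "a \<in> PS UNIV d"
 have co: "coeff (a + monom 1 d) d = 1" using a by (simp add: PS_def)
 have "degree (a + monom 1 d) \<le> d" using a by (intro degree_le) (auto simp: PS_def)
 moreover have "d \<le> degree (a + monom 1 d)" by (rule le_degree) (simp only: co one_neq_zero not_False_eq_True)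
 ultimately show "a + monom 1 d \<in> Mon d" using co by (simp add: Mon_def)
qed

lemma finite_Mon [simp]: "finite (Mon d)" unfolding Mon_eq by (simp add: finite_PS)
lemma card_Mon: "card (Mon d :: 'a::{finite,field} poly set) = CARD('a) ^ d"
 unfolding Mon_eq by (subst card_image) (auto simp: card_PS inj_on_def)
lemma Mon_nonzero: "a \<in> Mon d ==> a \<noteq> 0" by (auto simp: Mon_def)

text \<open>Both sides have degree at most \<open>q^d\<close> and agree at 0 and at the
  \<open>q^d\<close> monic polynomials of degree \<open>d\<close>, one point too many for them to
  differ.\<close>

lemma Ed_product:
 "1 - (\<Sum>i\<le>d. monom (ed d i) (CARD('a) ^ i)) = (\<Prod>a\<in>Mon d. [:1, - (1 / AK a):] :: 'a::{finite,field} fls poly)"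
proof -
 let ?P = "1 - (\<Sum>i\<le>d. monom (ed d i) (CARD('a) ^ i)) :: 'a fls poly"
 let ?R = "\<Prod>a\<in>Mon d. [:1, - (1 / AK a):] :: 'a fls poly"
 have P: "poly ?P x = 1 - Ed d x" for x by (simp add: Ed_def poly_sum poly_monom)
 have R: "poly ?R x = (\<Prod>a\<in>Mon d. 1 - x / AK a)" for x by (simp add: poly_prod)
 have dP: "degree ?P \<le> CARD('a) ^ d"
 proof (intro degree_diff_le degree_sum_le)
  fix i assume "i \<in> {..d}"
  then show "degree (monom (ed d i) (CARD('a) ^ i) :: 'a fls poly) \<le> CARD('a) ^ d"
   using card_ge_2[where 'a = 'a] by (intro order_trans[OF degree_monom_le] power_increasing) auto
 qed simp_all
 have dR: "degree ?R \<le> CARD('a) ^ d"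
 proof -
  have "degree ?R \<le> sum (degree \<circ> (\<lambda>a. [:1, - (1 / AK (a :: 'a poly)):])) (Mon d)" by (rule degree_prod_sum_le) simp
  also have "\<dots> \<le> (\<Sum>a\<in>(Mon d :: 'a poly set). 1)" by (rule sum_mono) simp
  finally show ?thesis by (simp add: card_Mon)
 qed
 have "?P - ?R = 0"
 proof (rule ccontr)
  assume nz: "?P - ?R \<noteq> 0"
  have ed0: "Ed d 0 = (0 :: 'a fls)" by (simp add: Ed_def)
  have sub: "insert 0 (AK ` (Mon d :: 'a poly set)) \<subseteq> {x. poly (?P - ?R) x = 0}"
  proof safe
   show "poly (?P - ?R) 0 = 0" unfolding poly_diff[of ?P ?R] P R by (simp add: ed0)
   fix a :: "'a poly" assume a: "a \<in> Mon d"
   have "Ed d (AK a) = 1" using a by (subst Ed_A) (auto simp: Mon_def)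
   moreover have "(\<Prod>b\<in>Mon d. 1 - AK a / AK b) = 0" using a Mon_nonzero[OF a] by (intro prod_zero) auto
   ultimately show "poly (?P - ?R) (AK a) = 0" unfolding poly_diff[of ?P ?R] P R by simp
  qed
  have c: "card (insert 0 (AK ` (Mon d :: 'a poly set))) = Suc (CARD('a) ^ d)"
   using Mon_nonzero[where 'a = 'a and a = 0 and d = d] by (subst card_insert_disjoint) (auto simp: card_image inj_on_def card_Mon)
  have "Suc (CARD('a) ^ d) \<le> card {x. poly (?P - ?R) x = 0}"
   unfolding c[symmetric] by (rule card_mono[OF poly_roots_finite[OF nz] sub])
  also have "\<dots> \<le> degree (?P - ?R)" by (rule card_poly_roots_bound[OF nz])
  also have "\<dots> \<le> CARD('a) ^ d" by (rule degree_diff_le[OF dP dR])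
  finally show False by simp
 qed
 then show ?thesis by (rule right_minus_eq[THEN iffD1])
qed

lemma fps_of_poly_ed: "fps_of_poly (1 - (\<Sum>i\<le>d. monom (ed d i) (CARD('a) ^ i))) = 1 - hrec_series CARD('a) (ed d :: nat => 'a::{finite,field} fls)"
proof (rule fps_ext)
 fix k
 have "(\<Sum>i\<le>d. if CARD('a) ^ i = k then ed d i else 0) = (hrec_series CARD('a) (ed d :: nat => 'a fls) $ k)"
 proof (cases "k = 0")
  case False
  have "(\<Sum>i\<le>d. if CARD('a) ^ i = k then ed d i else 0) = (\<Sum>i\<in>{i\<in>{..d}. CARD('a) ^ i = k}. ed d i :: 'a fls)" by (rule sum.inter_filter[symmetric]) simp
  also have "\<dots> = (\<Sum>i\<in>{i\<in>{..k}. CARD('a) ^ i = k}. ed d i)"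
  proof (rule sum.mono_neutral_cong)
   show "ed d i = 0" if "i \<in> {i\<in>{..k}. CARD('a) ^ i = k} - {i\<in>{..d}. CARD('a) ^ i = k}" for i
    using that by (auto simp: ed_def)
   show "ed d i = 0" if "i \<in> {i\<in>{..d}. CARD('a) ^ i = k} - {i\<in>{..k}. CARD('a) ^ i = k}" for i
    using that finite_powers_le[OF card_ge_2[where 'a = 'a], of k] by auto
  qed simp_all
  finally show ?thesis using False by (simp add: hrec_series_def)
 qed (simp add: hrec_series_def)
 moreover have "coeff (1 - (\<Sum>i\<le>d. monom (ed d i) (CARD('a) ^ i)) :: 'a fls poly) k = (if k = 0 then 1 else 0) - (\<Sum>i\<le>d. if CARD('a) ^ i = k then ed d i else 0)"
  by (simp add: coeff_sum Polynomial.coeff_monom)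
 ultimately show "fps_of_poly (1 - (\<Sum>i\<le>d. monom (ed d i) (CARD('a) ^ i))) $ k = (1 - hrec_series CARD('a) (ed d :: nat => 'a fls)) $ k"
  by (simp only: fps_of_poly_nth fps_sub_nth fps_one_nth)
qed

lemma fps_deriv_prod_sum:
 fixes F :: "'b => 'c::comm_ring_1 fps"
 shows "finite S ==> fps_deriv (\<Prod>b\<in>S. F b) = (\<Sum>a\<in>S. fps_deriv (F a) * (\<Prod>b\<in>S - {a}. F b))"
proof (induction S rule: finite_induct)
 case (insert x S)
 have "(\<Sum>a\<in>S. fps_deriv (F a) * (\<Prod>b\<in>insert x S - {a}. F b)) = (\<Sum>a\<in>S. fps_deriv (F a) * (F x * (\<Prod>b\<in>S - {a}. F b)))"
 proof (intro sum.cong refl arg_cong2[where f = times])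
  fix a assume "a \<in> S"
  then have "insert x S - {a} = insert x (S - {a})" "x \<notin> S - {a}" using insert.hyps by auto
  then show "(\<Prod>b\<in>insert x S - {a}. F b) = F x * (\<Prod>b\<in>S - {a}. F b)" using insert.hyps by simp
 qed
 moreover have "insert x S - {x} = S" using insert.hyps by auto
 ultimately show ?case using insert.hyps insert.IH by (simp add: fps_deriv_mult sum_distrib_left algebra_simps)
qed simp

text \<open>Logarithmic derivative of the product in \<open>Ed_product\<close>. In characteristic
  \<open>p\<close> only the linear term survives differentiation, so the numerator is the constant
  \<open>1 / Ld d\<close> and the power sums are the coefficients of the inverse series.\<close>

lemma Sd_hrec: "Sd d (Suc n) = hrec CARD('a) (ed d) n / (Ld d :: 'a::{finite,field} fls)"
proof -
 let ?g = "\<lambda>a. Abs_fps (\<lambda>n. 1 / AK a ^ Suc n) :: 'a fls fps"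
 let ?f = "\<lambda>a. 1 - fps_const (1 / AK a) * fps_X :: 'a fls fps"
 define f where "f = 1 - hrec_series CARD('a) (ed d :: nat => 'a fls)"
 have f: "f = (\<Prod>a\<in>Mon d. ?f a)"
  unfolding f_def fps_of_poly_ed[symmetric] Ed_product unfolding fps_of_poly_prod
  by (intro prod.cong refl) (simp add: fps_of_poly_pCons flip: fps_const_neg)
 have fg: "?f a * ?g a = fps_const (1 / AK a)" if "a \<in> Mon d" for a :: "'a poly"
 proof (rule fps_ext)
  fix n show "(?f a * ?g a) $ n = fps_const (1 / AK a) $ n"
   by (cases n) (simp_all add: left_diff_distrib mult.assoc)
 qed
 have "f * (\<Sum>a\<in>Mon d. ?g a) = (\<Sum>a\<in>Mon d. fps_const (1 / AK a) * (\<Prod>b\<in>Mon d - {a}. ?f b))"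
  unfolding sum_distrib_left
 proof (rule sum.cong[OF refl])
  fix a :: "'a poly" assume a: "a \<in> Mon d"
  let ?p = "\<Prod>b\<in>Mon d - {a}. ?f b"
  have "f = ?f a * ?p" unfolding f by (rule prod.remove) (use a in auto)
  then have "f * ?g a = ?f a * ?p * ?g a" by (rule arg_cong)
  also have "\<dots> = (?f a * ?g a) * ?p" by (simp only: mult_ac)
  also have "?f a * ?g a = fps_const (1 / AK a)" by (rule fg[OF a])
  finally show "f * ?g a = fps_const (1 / AK a) * ?p" .
 qed
 also have "\<dots> = - fps_deriv f"
 proof -
  have "fps_deriv (?f a) = - fps_const (1 / AK a)" for a :: "'a poly" by simp
  moreover have "fps_deriv f = (\<Sum>a\<in>Mon d. fps_deriv (?f a) * (\<Prod>b\<in>Mon d - {a}. ?f b))"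
   unfolding f by (rule fps_deriv_prod_sum) simp
  ultimately show ?thesis by (simp only: mult_minus_left sum_negf minus_minus)
 qed
 also have "fps_deriv f = - fps_const (1 / Ld d)"
 proof (rule fps_ext)
  fix k
  have p0: "(of_nat (CARD('a) ^ i) :: 'a fls) = 0" if "i > 0" for i
  proof -
   obtain f where "f \<ge> 1" "CARD('a) = CHAR('a) ^ f" using card_finite_field by blast
   then have "CHAR('a) dvd CARD('a) ^ i" using that by (metis dvd_power dvd_power_same dvd_trans less_le_trans zero_less_one power_one_right dvd_refl)
   then show ?thesis by (simp only: of_nat_eq_0_iff_char_dvd semiring_char_fls)
  qed
  have "fps_deriv f $ k = of_nat (k + 1) * (- (\<Sum>i\<in>{i\<in>{..k+1}. CARD('a) ^ i = k + 1}. ed d i))"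
   by (simp add: f_def hrec_series_def)
  also have "\<dots> = - (\<Sum>i\<in>{i\<in>{..k+1}. CARD('a) ^ i = k + 1}. of_nat (CARD('a) ^ i) * ed d i)"
   by (simp add: sum_distrib_left)
  also have "\<dots> = - (\<Sum>i\<in>{i\<in>{..k+1}. CARD('a) ^ i = k + 1}. if i = 0 then ed d 0 else 0)"
  proof (intro arg_cong[of _ _ uminus] sum.cong refl)
   fix i show "of_nat (CARD('a) ^ i) * ed d i = (if i = 0 then ed d 0 else 0 :: 'a fls)"
    using p0[of i] by (cases "i = 0") (simp, simp only: neq0_conv mult_zero_left, simp)
  qed
  also have "\<dots> = - (if k = 0 then ed d 0 else 0)"
   by (simp add: sum.delta')
  also have "ed d 0 = (1 / Ld d :: 'a fls)" by (simp add: ed_def Dk_def)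
  finally show "fps_deriv f $ k = (- fps_const (1 / Ld d :: 'a fls)) $ k" by simp
 qed
 finally have e: "f * (\<Sum>a\<in>Mon d. ?g a) = fps_const (1 / Ld d)" by simp
 have "(\<Sum>a\<in>Mon d. ?g a) = (f * Abs_fps (hrec CARD('a) (ed d))) * (\<Sum>a\<in>Mon d. ?g a)" unfolding f_def hrec_fps by simp
 also have "\<dots> = Abs_fps (hrec CARD('a) (ed d)) * fps_const (1 / Ld d)" using e by (simp add: mult_ac)
 finally have "(\<Sum>a\<in>Mon d. ?g a) $ n = (Abs_fps (hrec CARD('a) (ed d)) * fps_const (1 / Ld d)) $ n" by simp
 then show ?thesis by (simp add: Sd_def fps_sum_nth)
qed

section \<open>Interpolation by \<open>H\<^sub>s\<close>\<close>

text \<open>A ring homomorphism sending \<open>t\<close> to \<open>\<theta>\<close> and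
  \<open>\<theta>\<close> to \<open>\<theta>^(q^d)\<close>.\<close>

definition evt :: "nat => 'a::{finite,field} poly poly => 'a fls" where
 "evt d P = AK (poly (tw d P) (thA 0))"
definition gam0 :: "nat => 'a::{finite,field} poly" where
 "gam0 s = poly (Dl (s - 1)) (thA 0) ^ (s - 1)"

lemma evt_mult: "evt d (P * Q) = evt d P * evt d Q" by (simp add: evt_def tw_mult AK_mult)
lemma evt_add: "evt d (P + Q) = evt d P + evt d Q" by (simp add: evt_def tw_add AK_add)
lemma evt_diff: "evt d (P - Q) = evt d P - evt d Q" by (simp add: evt_def tw_diff AK_diff)
lemma evt_1 [simp]: "evt d 1 = 1" by (simp add: evt_def)
lemma evt_power: "evt d (P ^ n) = evt d P ^ n" by (induction n) (simp_all add: evt_mult)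
lemma evt_prod: "evt d (\<Prod>i\<in>S. f i) = (\<Prod>i\<in>S. evt d (f i))"
 by (induction S rule: infinite_finite_induct) (simp_all add: evt_mult)
lemma tw_monom1: "tw d (monom 1 n) = (monom 1 n :: 'a::{finite,field} poly poly)"
 by (rule poly_eqI) (simp add: Polynomial.coeff_monom)
lemma evt_monom: "evt d (monom 1 (CARD('a) ^ i)) = (th i :: 'a::{finite,field} fls)"
 using thA_power[where 'a = 'a, of 0 i] by (simp add: evt_def tw_monom1 poly_monom del: thA_power)
lemma evt_th: "evt d [:thA m:] = (th (m + d) :: 'a::{finite,field} fls)"
 by (simp add: evt_def)
lemma tw_Dt: "tw d (Dt i) = (Dt i :: 'a::{finite,field} poly poly)" by (simp add: Dt_def tw_prod tw_diff tw_monom1)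
lemma tw_Dl: "tw d (Dl i) = (Dl i :: 'a::{finite,field} poly poly)" by (simp add: Dl_def tw_prod tw_Dt)
lemma evt_Dt: "evt d (Dt i) = Dk i" by (simp add: Dt_def evt_prod evt_diff evt_monom Dk_def)

text \<open>For \<open>i > d\<close> one factor becomes
  \<open>\<theta>^(q^i) - \<theta>^(q^i)\<close>, which matches the convention that
  \<open>ed d i\<close> is 0. For \<open>i \<le> d\<close> the product is the \<open>q^i\<close>-th
  power of the last \<open>i\<close> factors of \<open>Ld d\<close>.\<close>

lemma evt_Gt: "evt d (Gt i) = Dk i * (Ld d ^ (CARD('a) ^ i) * (ed d i :: 'a::{finite,field} fls))"
proof -
 have g: "evt d (Gt i) = (\<Prod>m\<in>{1..i}. th i - th (m + d) :: 'a fls)" by (simp add: Gt_def evt_prod evt_diff evt_monom evt_th)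
 show ?thesis
 proof (cases "i \<le> d")
  case False
  then have "(\<Prod>m\<in>{1..i}. th i - th (m + d) :: 'a fls) = 0" by (intro prod_zero) (auto intro!: bexI[of _ "i - d"])
  then show ?thesis using False g by (simp add: ed_def)
 next
  case True
  have "Ld d = Ld (d - i) * (\<Prod>j\<in>{d - i + 1..d}. th 0 - th j :: 'a fls)"
  proof -
   have "{1..d} = {1..d - i} \<union> {d - i + 1..d}" using True by auto
   then show ?thesis unfolding Ld_def by (simp only:) (rule prod.union_disjoint, auto)
  qed
  moreover have "(\<Prod>j\<in>{d - i + 1..d}. th 0 - th j :: 'a fls) ^ (CARD('a) ^ i) = (\<Prod>m\<in>{1..i}. th i - th (m + d))"
   unfolding prod_power_distrib using True
   by (intro prod.reindex_bij_witness[of _ "\<lambda>m. m + d - i" "\<lambda>j. j + i - d"]) (auto simp: fls_frob_diff)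
  ultimately show ?thesis using True by (simp add: g ed_def power_mult_distrib)
 qed
qed

text \<open>The Anderson-Thakur interpolation formula. Under \<open>evt d\<close> the recurrence
  defining \<open>Hp s\<close> becomes that of the power sums in \<open>Sd_hrec\<close>, up to the
  scaling of \<open>hrec_scale\<close>.\<close>

lemma evt_Hp: assumes "s \<ge> 1"
 shows "evt d (Hp s) = AK (gam0 s) * Sd d s * (Ld d :: 'a::{finite,field} fls) ^ s"
proof -
 define n where "n = s - 1"
 have s: "s = Suc n" using assms by (simp add: n_def)
 have q2: "CARD('a) \<ge> 2" by (rule card_ge_2)
 have "evt d (Hp s :: 'a poly poly) = hrec CARD('a) (\<lambda>i. evt d (gam n i)) n"
  unfolding Hp_def n_def[symmetric] by (rule hrec_hom[OF q2]) (simp_all add: evt_mult evt_add)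
 also have "\<dots> = hrec CARD('a) (\<lambda>i. (evt d (Dl n) * Ld d) ^ (CARD('a) ^ i) * ed d i) n"
 proof (rule hrec_cong[OF q2])
  fix i assume "i \<le> n"
  have "evt d (Dt i) * evt d (gam n i) = evt d (Dl n) ^ (CARD('a) ^ i) * (evt d (Gt i) :: 'a fls)"
   using arg_cong[OF Dt_gam[OF \<open>i \<le> n\<close>], of "evt d"] by (simp add: evt_mult evt_power)
  then have "Dk i * evt d (gam n i) = Dk i * ((evt d (Dl n) * Ld d) ^ (CARD('a) ^ i) * (ed d i :: 'a fls))"
   unfolding evt_Dt evt_Gt by (simp add: power_mult_distrib mult_ac)
  then show "evt d (gam n i) = (evt d (Dl n) * Ld d) ^ (CARD('a) ^ i) * (ed d i :: 'a fls)" by simp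
 qed
 also have "\<dots> = (evt d (Dl n) * Ld d) ^ n * hrec CARD('a) (ed d) n" by (rule hrec_scale[OF q2])
 also have "\<dots> = evt d (Dl n) ^ n * Sd d s * Ld d ^ s" unfolding s Sd_hrec by (simp add: power_mult_distrib)
 also have "evt d (Dl n) ^ n = AK (gam0 s :: 'a poly)" by (simp add: gam0_def n_def evt_def tw_Dl AK_power)
 finally show ?thesis .
qed

lemma gam0_nonzero: "gam0 s \<noteq> (0 :: 'a::{finite,field} poly)"
proof -
 have "poly (Dl n) (thA 0) \<noteq> (0 :: 'a poly)" for n
 proof -
  have "evt 0 (Dl n) \<noteq> (0 :: 'a fls)" unfolding Dl_def evt_prod evt_Dt by simp
  then show ?thesis by (simp add: evt_def)
 qed
 then show ?thesis by (simp add: gam0_def)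
qed

section \<open>The degree of \<open>H\<^sub>s\<close> in \<open>\<theta>\<close>\<close>

definition tb :: "nat => 'a::field poly poly => bool" where
 "tb T P \<longleftrightarrow> (\<forall>i. degree (coeff P i) \<le> T)"

lemma tb_dtb: "tb T P \<longleftrightarrow> dtb (degree P) T P" by (simp add: tb_def dtb_def)
lemma tb_mult: "tb T P ==> tb T' Q ==> tb (T + T') (P * Q)"
 using dtb_mult[of "degree P" T P "degree Q" T' Q] by (auto simp: tb_dtb) (simp add: dtb_def)
lemma tb_mono: "tb T P ==> T \<le> T' ==> tb T' P" by (auto simp: tb_def intro: order_trans)
lemma tb_sum: "(\<And>i. i \<in> S ==> tb T (f i)) ==> tb T (\<Sum>i\<in>S. f i)"
 by (induction S rule: infinite_finite_induct) (auto simp: tb_def intro: degree_add_le)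
lemma tb_1 [simp]: "tb T 1" by (simp add: tb_def)
lemma tb_power: "tb T P ==> tb (n * T) (P ^ n)" by (induction n) (auto intro: tb_mult)
lemma tb_prod: "(\<And>i. i \<in> S ==> tb (T i) (f i)) ==> tb (\<Sum>i\<in>S. T i) (\<Prod>i\<in>S. f i)"
 by (induction S rule: infinite_finite_induct) (auto intro: tb_mult)
lemma tb_diff: "tb T P ==> tb T Q ==> tb T (P - Q)" by (auto simp: tb_def intro: degree_diff_le)

text \<open>Among the factors of \<open>gam\<close> only \<open>Gt i\<close> involves
  \<open>\<theta>\<close>, in degree \<open>q + ... + q^i\<close>, which is at most
  \<open>q * q^i / (q - 1)\<close>. That the bound stays strictly below
  \<open>q * s / (q - 1)\<close> is what makes the deformation series converge.\<close>

lemma tb_Hp: "tb (CARD('a) * (s - 1) div (CARD('a) - 1)) (Hp s :: 'a::{finite,field} poly poly)"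
proof -
 let ?q = "CARD('a)"
 have q2: "?q \<ge> 2" by (rule card_ge_2)
 have mono: "tb 0 (monom 1 k :: 'a poly poly)" for k by (simp add: tb_def Polynomial.coeff_monom)
 have Dt: "tb 0 (Dt i :: 'a poly poly)" for i
  unfolding Dt_def using tb_prod[of "{..<i}" "\<lambda>_. 0"] tb_diff mono by force
 have Dl: "tb 0 (\<Prod>k\<in>S. Dt k :: 'a poly poly)" for S using tb_prod[of S "\<lambda>_. 0"] Dt by force
 have Gt: "tb (\<Sum>m\<in>{1..i}. ?q ^ m) (Gt i :: 'a poly poly)" for i
  unfolding Gt_def
 proof (intro tb_prod tb_diff)
  fix m show "tb (?q ^ m) (monom 1 (?q ^ i) :: 'a poly poly)" using mono by (rule tb_mono) simp
  show "tb (?q ^ m) [:thA m :: 'a poly:]" by (auto simp: tb_def coeff_pCons split: nat.split)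
 qed
 have gam: "tb (\<Sum>m\<in>{1..i}. ?q ^ m) (gam n i :: 'a poly poly)" for n i
  using tb_mult[OF tb_mult[OF tb_power[OF Dl[of "{..n}"], of "?q ^ i - 1"] Dl[of "{..n} - {i}"]] Gt[of i]]
  by (simp add: gam_def Dl_def)
 have "tb (?q * m div (?q - 1)) (hrec ?q (gam n :: nat => 'a poly poly) m)" for n m
 proof (induction m rule: less_induct)
  case (less m)
  show ?case
  proof (cases "m = 0")
   case False
   show ?thesis unfolding hrec_pos[OF q2 False[unfolded neq0_conv]]
   proof (rule tb_sum)
    fix i assume "i \<in> {i. ?q ^ i \<le> m}"
    then have i: "?q ^ i \<le> m" by simp
    have "m - ?q ^ i < m" using False by simp
    from tb_mult[OF gam less.IH[OF this]]
    have "tb ((\<Sum>m\<in>{1..i}. ?q ^ m) + ?q * (m - ?q ^ i) div (?q - 1)) (gam n i * hrec ?q (gam n :: nat => 'a poly poly) (m - ?q ^ i))" .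
    moreover have "(\<Sum>m\<in>{1..i}. ?q ^ m) + ?q * (m - ?q ^ i) div (?q - 1) \<le> ?q * m div (?q - 1)"
    proof -
     have "(?q - 1) * (\<Sum>m\<in>{1..i}. ?q ^ m) \<le> ?q * ?q ^ i" using sum_powers_card[where 'a = 'a, of i] by linarith
     moreover have "(?q - 1) * (?q * (m - ?q ^ i) div (?q - 1)) \<le> ?q * (m - ?q ^ i)" by simp
     moreover have "?q * ?q ^ i + ?q * (m - ?q ^ i) = ?q * m" using i by (simp flip: add_mult_distrib2)
     ultimately have "((\<Sum>m\<in>{1..i}. ?q ^ m) + ?q * (m - ?q ^ i) div (?q - 1)) * (?q - 1) \<le> ?q * m"
      by (simp only: add_mult_distrib2 mult.commute[of _ "?q - 1"])
     then show ?thesis using q2 by (simp add: less_eq_div_iff_mult_less_eq)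
    qed
    ultimately show "tb (?q * m div (?q - 1)) (gam n i * hrec ?q (gam n :: nat => 'a poly poly) (m - ?q ^ i))" by (rule tb_mono)
   qed
  qed simp
 qed
 then show ?thesis by (simp add: Hp_def)
qed

section \<open>The deformation series\<close>

lemma NB_prod':
 fixes f :: "'b => 'a::idom fls fps"
 shows "(\<And>i. i \<in> S ==> NB r (c i) (f i)) ==> NB r (\<Sum>i\<in>S. c i) (\<Prod>i\<in>S. f i)"
 by (induction S rule: infinite_finite_induct) (auto intro: NB_mult NB_1)

text \<open>The inverse of \<open>t - \<theta>^(q^j)\<close>, expanded in powers of
  \<open>t\<close>.\<close>

definition il :: "nat => 'a::{finite,field} fls fps" where
 "il j = Abs_fps (\<lambda>n. - (1 / th j ^ Suc n))"

lemma il_mult: "(fps_X - fps_const (th j)) * il j = 1"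
proof (rule fps_ext)
 fix n show "((fps_X - fps_const (th j)) * il j) $ n = (1 :: 'a::{finite,field} fls fps) $ n"
  by (cases n) (simp_all add: il_def left_diff_distrib)
qed

lemma vge_il: "vge (int CARD('a) ^ j * (int n + 1)) ((il j :: 'a::{finite,field} fls fps) $ n)"
 by (simp add: il_def vge_subdegree divide_inverse fls_subdegree_pow algebra_simps del: power_Suc)

lemma NB_il: "NB 1 (- (int CARD('a) ^ j)) (il j :: 'a::{finite,field} fls fps)"
 unfolding NB_def
proof
 fix n
 have "1 * int n \<le> int CARD('a) ^ j * int n" using card_ge_2[where 'a = 'a] by (intro mult_right_mono) auto
 then show "vge (1 * int n - (- (int CARD('a) ^ j))) ((il j :: 'a fls fps) $ n)"
  by (intro vge_mono[OF vge_il]) (simp add: algebra_simps)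
qed

lemma DD_il: assumes "j \<ge> 1" shows "DD 1 (il j :: 'a::{finite,field} fls fps)"
 unfolding DD_def
proof
 fix M
 have "int CARD('a) ^ 1 \<le> int CARD('a) ^ j" using assms card_ge_2[where 'a = 'a] by (intro power_increasing) auto
 then have "int CARD('a) \<le> int CARD('a) ^ j" by (simp only: power_one_right)
 then have q: "2 \<le> int CARD('a) ^ j" using card_ge_2[where 'a = 'a] by linarith
 have "vge (1 * int n + M) ((il j :: 'a fls fps) $ n)" if n: "n \<ge> nat M" for n
 proof -
  have "2 * (int n + 1) \<le> int CARD('a) ^ j * (int n + 1)" using q by (intro mult_right_mono) auto
  moreover have "1 * int n + M \<le> 2 * (int n + 1)" using n by (simp add: nat_le_iff)
  ultimately show ?thesis by (intro vge_mono[OF vge_il]) (rule order_trans)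
 qed
 then show "\<exists>n0. \<forall>n\<ge>n0. vge (1 * int n + M) ((il j :: 'a fls fps) $ n)" by blast
qed

lemma vge_th0: "vge (- 1) (th 0 :: 'a::{finite,field} fls)" by (simp add: vge_subdegree)

lemma Ev_il: assumes "j \<ge> 1" shows "Ev 1 (th 0) (il j) (1 / (th 0 - th j) :: 'a::{finite,field} fls)"
proof -
 obtain y where y: "Ev 1 (th 0) (il j :: 'a fls fps) y" using Ev_exists[OF vge_th0 DD_il[OF assms]] by blast
 have "Ev 1 (th 0) ((fps_X - fps_const (th j)) * il j) ((th 0 - th j) * y)"
  by (intro Ev_mult Ev_diff Ev_X Ev_const vge_th0 y)
 then have "Ev 1 (th 0) (1 :: 'a fls fps) ((th 0 - th j) * y)" by (simp only: il_mult)
 then have "(th 0 - th j) * y = 1" using Ev_unique Ev_1[OF vge_th0] by blast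
 then have "y = 1 / (th 0 - th j)" using assms by (simp add: nonzero_eq_divide_eq mult.commute)
 then show ?thesis using y by simp
qed

text \<open>A deformation of the power sum \<open>Sd d x\<close>: by \<open>Ev_Ti\<close> its value
  at \<open>t = \<theta>\<close> is that sum times \<open>gam0 x\<close>.\<close>

definition Ti :: "nat => nat => 'a::{finite,field} fls fps" where
 "Ti d x = tau d (emb (Hp x)) * (\<Prod>j\<in>{1..d}. il j) ^ x"

definition bb :: "'a::{finite,field} fls fps" where "bb = fps_X - fps_const (th 1)"

lemma tau_il: "tau 1 (il j) = (il (Suc j) :: 'a::{finite,field} fls fps)"
proof (rule fps_ext)
 fix n
 have thp: "th j ^ CARD('a) = (th (Suc j) :: 'a fls)" using th_power[where 'a = 'a, of j 1] by simp
 have "(th j ^ Suc n) ^ CARD('a) = (th j ^ CARD('a) :: 'a fls) ^ Suc n" by (simp only: power_mult[symmetric] mult.commute)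
 then have "(1 / th j ^ Suc n) ^ CARD('a) = (1 / th (Suc j) ^ Suc n :: 'a fls)" by (simp only: power_divide power_one thp)
 then show "tau 1 (il j) $ n = (il (Suc j) :: 'a fls fps) $ n"
  using fls_frob_minus[where 'a = 'a, of "1 / th j ^ Suc n" 1] by (simp add: il_def del: power_Suc)
qed

lemma bb_il: "bb * il 1 = 1" by (simp add: bb_def il_mult del: One_nat_def)
lemma bb_nonzero [simp]: "bb \<noteq> 0"
 using bb_il by (metis mult_zero_left zero_neq_one)

lemma Ti_Suc: "Ti (Suc d) x = tau 1 (Ti d x) * (il 1 :: 'a::{finite,field} fls fps) ^ x"
proof -
 have "(\<Prod>j\<in>{1..Suc d}. il j :: 'a fls fps) = il 1 * (\<Prod>j\<in>{1..d}. il (Suc j))" by (rule prod_ivl_shift)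
 also have "(\<Prod>j\<in>{1..d}. il (Suc j) :: 'a fls fps) = tau 1 (\<Prod>j\<in>{1..d}. il j)" by (simp add: tau_prod tau_il del: One_nat_def)
 finally have p: "(\<Prod>j\<in>{1..Suc d}. il j :: 'a fls fps) = il 1 * tau 1 (\<Prod>j\<in>{1..d}. il j)" .
 show ?thesis unfolding Ti_def p by (simp add: tau_tau power_mult_distrib mult_ac)
qed

lemma Ti_0: "Ti 0 x = emb (Hp x)" by (simp add: Ti_def)

text \<open>Up to constants, the twisted \<open>Hp x\<close> grows like
  \<open>q^d * q(x-1)/(q-1)\<close> while the product decays like \<open>q^d * qx/(q-1)\<close>. The
  decay wins by \<open>q^(d+1)/(q-1)\<close>, which is weakened to a linear term in
  \<open>d\<close>. The factor \<open>q - 1\<close> stays on the left to avoid division.\<close>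

lemma Ti_NB:
 "\<exists>K\<ge>0. \<forall>d. \<exists>c. NB 1 c (Ti d x :: 'a::{finite,field} fls fps) \<and> (int CARD('a) - 1) * c \<le> K - int d \<or> x = 0"
proof (cases "x = 0")
 case False
 let ?q = "CARD('a)"
 define T where "T = ?q * (x - 1) div (?q - 1)"
 define D where "D = degree (Hp x :: 'a poly poly)"
 have q2: "?q \<ge> 2" by (rule card_ge_2)
 have dH: "dtb D T (Hp x :: 'a poly poly)" using tb_Hp[of x, where 'a = 'a] by (simp add: tb_dtb T_def D_def)
 define K where "K = (int ?q - 1) * int D + int x * int ?q"
 have "\<exists>c. NB 1 c (Ti d x :: 'a fls fps) \<and> (int ?q - 1) * c \<le> K - int d" for d
 proof -
  define S where "S = (\<Sum>j\<in>{1..d}. int ?q ^ j)"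
  define c where "c = (int (?q ^ d * T) + 1 * int D) + int x * (- S)"
  have "NB 1 (\<Sum>j\<in>{1..d}. - (int ?q ^ j)) (\<Prod>j\<in>{1..d}. il j :: 'a fls fps)" by (intro NB_prod' NB_il)
  then have "NB 1 (- S) (\<Prod>j\<in>{1..d}. il j :: 'a fls fps)" by (simp only: S_def sum_negf)
  then have "NB 1 c (Ti d x :: 'a fls fps)" unfolding Ti_def c_def tau_emb
   by (intro NB_mult NB_power NB_dtb dtb_tw dH) simp_all
  moreover have "(int ?q - 1) * c \<le> K - int d"
  proof -
   have S: "(int ?q - 1) * S = int ?q * int ?q ^ d - int ?q"
   proof -
    have "int ((?q - 1) * (\<Sum>m\<in>{1..d}. ?q ^ m) + ?q) = int (?q * ?q ^ d)" by (simp only: sum_powers_card)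
    then show ?thesis using q2 by (simp add: S_def of_nat_diff)
   qed
   have "(?q - 1) * T \<le> ?q * (x - 1)" by (simp add: T_def)
   then have "int ((?q - 1) * T) \<le> int (?q * (x - 1))" by (simp only: of_nat_le_iff)
   then have T: "(int ?q - 1) * int T \<le> int ?q * int x - int ?q" using q2 False by (simp add: of_nat_diff right_diff_distrib)
   have "int ?q ^ d * ((int ?q - 1) * int T) \<le> int ?q ^ d * (int ?q * int x - int ?q)" using T by (intro mult_left_mono) auto
   moreover have "(int ?q - 1) * c = int ?q ^ d * ((int ?q - 1) * int T) + (int ?q - 1) * int D - int x * ((int ?q - 1) * S)"
    by (simp add: c_def algebra_simps)
   ultimately have "(int ?q - 1) * c \<le> K - int ?q ^ d * int ?q" unfolding S by (simp add: K_def algebra_simps)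
   moreover have "int d \<le> int ?q ^ d * int ?q"
   proof -
    have "d < 2 ^ d" by (rule less_exp)
    also have "\<dots> \<le> ?q ^ d" by (rule power_mono[OF q2]) simp
    also have "\<dots> \<le> ?q ^ d * ?q" using q2 by simp
    finally show ?thesis by (metis less_imp_le of_nat_le_iff of_nat_mult of_nat_power)
   qed
   ultimately show ?thesis by linarith
  qed
  ultimately show ?thesis by blast
 qed
 moreover have "K \<ge> 0" using q2 by (simp add: K_def)
 ultimately show ?thesis by blast
qed auto

lemma Ti_bounded:
 assumes "x \<ge> 1"
 shows "\<exists>C\<ge>0. \<forall>d. NB 1 C (Ti d x :: 'a::{finite,field} fls fps)"
  and "\<exists>d0. \<forall>d\<ge>d0. NB 1 (- C) (Ti d x :: 'a fls fps)"
proof -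
 obtain K where K: "K \<ge> 0" "\<And>d. \<exists>c. NB 1 c (Ti d x :: 'a fls fps) \<and> (int CARD('a) - 1) * c \<le> K - int d"
  using Ti_NB[of x, where 'a = 'a] assms by auto
 have q: "int CARD('a) - 1 \<ge> 1" using card_ge_2[where 'a = 'a] by simp
 show "\<exists>C\<ge>0. \<forall>d. NB 1 C (Ti d x :: 'a fls fps)"
 proof (intro exI[of _ K] conjI allI K(1))
  fix d
  obtain c where c: "NB 1 c (Ti d x :: 'a fls fps)" "(int CARD('a) - 1) * c \<le> K - int d" using K(2) by blast
  have "c \<le> K"
  proof (rule ccontr)
   assume n: "\<not> c \<le> K"
   then have "1 * c \<le> (int CARD('a) - 1) * c" using q K(1) by (intro mult_right_mono) auto
   then show False using c(2) n by linarith
  qed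
  then show "NB 1 K (Ti d x :: 'a fls fps)" using c(1) NB_mono by blast
 qed
 show "\<exists>d0. \<forall>d\<ge>d0. NB 1 (- C) (Ti d x :: 'a fls fps)"
 proof (intro exI[of _ "nat (K + (int CARD('a) - 1) * \<bar>C\<bar>)"] allI impI)
  fix d assume d: "d \<ge> nat (K + (int CARD('a) - 1) * \<bar>C\<bar>)"
  obtain c where c: "NB 1 c (Ti d x :: 'a fls fps)" "(int CARD('a) - 1) * c \<le> K - int d" using K(2) by blast
  have "(int CARD('a) - 1) * c \<le> - ((int CARD('a) - 1) * \<bar>C\<bar>)" using c(2) d by linarith
  then have "(int CARD('a) - 1) * c \<le> (int CARD('a) - 1) * (- \<bar>C\<bar>)" by simp
  then have "c \<le> - \<bar>C\<bar>" using q by (subst (asm) mult_le_cancel_left_pos) auto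
  then show "NB 1 (- C) (Ti d x :: 'a fls fps)" using c(1) NB_mono by force
 qed
qed

lemma DD_Ti: "DD 1 (Ti d x)"
 unfolding Ti_def tau_emb by (intro DD_mult DD_power DD_prod DD_emb DD_il) auto

primrec Sg :: "nat list => nat => 'a::{finite,field} fls fps" where
 "Sg [] D = 1"
| "Sg (x # s) D = (\<Sum>d<D. Ti d x * Sg s d)"

lemma DD_Sg: "DD 1 (Sg s D)"
 by (induction s arbitrary: D) (auto intro!: DD_sum DD_mult DD_Ti)

lemma Sg_bounded:
 assumes "\<forall>x\<in>set s. x \<ge> 1"
 shows "\<exists>C\<ge>0. \<forall>D. NB 1 C (Sg s D :: 'a::{finite,field} fls fps)"
 using assms
proof (induction s)
 case Nil show ?case by (intro exI[of _ 0]) (auto simp: NB_1)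
next
 case (Cons x s)
 then obtain C where C: "C \<ge> 0" "\<And>D. NB 1 C (Sg s D :: 'a fls fps)" by auto
 obtain C' where C': "C' \<ge> 0" "\<And>d. NB 1 C' (Ti d x :: 'a fls fps)" using Ti_bounded(1)[of x, where 'a = 'a] Cons.prems by auto
 have "NB 1 (C' + C) (Sg (x # s) D :: 'a fls fps)" for D
  by simp (intro NB_sum NB_mult C C')
 then show ?case using C C' by (intro exI[of _ "C' + C"]) auto
qed

lemma Sg_diff:
 assumes "\<forall>x\<in>set s. x \<ge> 1"
 shows "\<exists>D0. \<forall>D\<ge>D0. NB 1 (- C) (Sg s (Suc D) - Sg s D :: 'a::{finite,field} fls fps)"
proof (cases s)
 case (Cons x s')
 obtain B where B: "B \<ge> 0" "\<And>D. NB 1 B (Sg s' D :: 'a fls fps)" using Sg_bounded[of s', where 'a = 'a] assms Cons by auto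
 obtain D0 where D0: "\<forall>d\<ge>D0. NB 1 (- (C + B)) (Ti d x :: 'a fls fps)" using Ti_bounded(2)[of x "C + B", where 'a = 'a] assms Cons by auto
 have "NB 1 (- C) (Sg s (Suc D) - Sg s D :: 'a fls fps)" if "D \<ge> D0" for D
  using NB_mult[OF D0[rule_format, OF that] B(2)[of D]] by (simp add: Cons)
 then show ?thesis by blast
qed (auto simp: NB_def)

lemma fps_Cauchy_limit:
 fixes s :: "nat => 'a::ab_group_add fls fps"
 assumes "\<And>C. \<exists>D0. \<forall>D\<ge>D0. NB r (- C) (s (Suc D) - s D)"
 shows "\<exists>l. \<forall>C. \<exists>D0. \<forall>D\<ge>D0. NB r (- C) (s D - l)"
proof -
 have ex: "\<exists>l. \<forall>c. \<exists>n0. \<forall>D\<ge>n0. vge c (s D $ n - l)" for n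
 proof (rule fls_Cauchy_limit)
  fix c
  obtain D0 where "\<forall>D\<ge>D0. NB r (- (c - r * int n)) (s (Suc D) - s D)" using assms by blast
  then have "\<forall>D\<ge>D0. vge (r * int n - - (c - r * int n)) ((s (Suc D) - s D) $ n)" unfolding NB_def by blast
  then have "\<forall>D\<ge>D0. vge c (s (Suc D) $ n - s D $ n)" by simp
  then show "\<exists>n0. \<forall>D\<ge>n0. vge c (s (Suc D) $ n - s D $ n)" by blast
 qed
 have "\<exists>l. \<forall>n c. \<exists>n0. \<forall>D\<ge>n0. vge c (s D $ n - l n)" by (rule choice) (use ex in blast)
 then obtain l where l: "\<And>n c. \<exists>n0. \<forall>D\<ge>n0. vge c (s D $ n - l n)" by blast
 have "\<exists>D0. \<forall>D\<ge>D0. NB r (- C) (s D - Abs_fps l)" for C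
 proof -
  obtain D0 where D0: "\<forall>D\<ge>D0. NB r (- C) (s (Suc D) - s D)" using assms by blast
  have st: "NB r (- C) (s (D + k) - s D)" if "D \<ge> D0" for D k
  proof (induction k)
   case (Suc k)
   have "NB r (- C) (s (Suc (D + k)) - s (D + k))" using D0 that by simp
   from NB_add[OF this Suc] show ?case by simp
  qed (simp add: NB_def)
  have "NB r (- C) (s D - Abs_fps l)" if D: "D \<ge> D0" for D
   unfolding NB_def
  proof
   fix n
   obtain n0 where n0: "\<forall>D\<ge>n0. vge (r * int n - - C) (s D $ n - l n)" using l by blast
   have "vge (r * int n - - C) ((s (D + n0) - s D) $ n)" using st[OF D, of n0] unfolding NB_def by blast
   moreover have "vge (r * int n - - C) (s (D + n0) $ n - l n)" using n0 by simp
   ultimately have "vge (r * int n - - C) ((s (D + n0) $ n - l n) - (s (D + n0) - s D) $ n)" by (rule vge_diff[rotated])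
   then show "vge (r * int n - - C) ((s D - Abs_fps l) $ n)" by simp
  qed
  then show ?thesis by blast
 qed
 then show ?thesis by blast
qed

definition phi :: "nat list => 'a::{finite,field} fls fps" where
 "phi s = (SOME l. \<forall>C. \<exists>D0. \<forall>D\<ge>D0. NB 1 (- C) (Sg s D - l))"

lemma phi_limit:
 assumes "\<forall>x\<in>set s. x \<ge> 1"
 shows "\<exists>D0. \<forall>D\<ge>D0. NB 1 (- C) (Sg s D - phi s :: 'a::{finite,field} fls fps)"
proof -
 have "\<exists>l :: 'a fls fps. \<forall>C. \<exists>D0. \<forall>D\<ge>D0. NB 1 (- C) (Sg s D - l)"
  by (rule fps_Cauchy_limit) (rule Sg_diff[OF assms])
 from someI_ex[OF this] show ?thesis unfolding phi_def by blast
qed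

lemma NB_small_eq_0: "(\<And>C. NB r (- C) f) ==> f = (0 :: 'a::zero fls fps)"
proof (rule fps_ext)
 fix n assume A: "\<And>C. NB r (- C) f"
 have "vge c (f $ n)" for c using A[of "c - r * int n"] unfolding NB_def by (auto dest!: spec[of _ n])
 then show "f $ n = 0 $ n" by (simp add: vge_all_imp_0)
qed

lemma phi_Nil [simp]: "phi [] = (1 :: 'a::{finite,field} fls fps)"
proof -
 have "NB 1 (- C) (1 - phi [] :: 'a fls fps)" for C using phi_limit[of "[]" C, where 'a = 'a] by auto
 from NB_small_eq_0[OF this] show ?thesis by simp
qed

lemma DD_phi: assumes "\<forall>x\<in>set s. x \<ge> 1" shows "DD 1 (phi s :: 'a::{finite,field} fls fps)"
proof (rule DD_limit)
 fix M
 obtain D where "NB 1 (- (- M)) (Sg s D - phi s :: 'a fls fps)" using phi_limit[OF assms, of "- M", where 'a = 'a] by blast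
 then have "NB 1 M (phi s - Sg s D :: 'a fls fps)" unfolding NB_def by (metis fps_sub_nth minus_diff_eq minus_minus vge_uminus)
 then show "\<exists>g. DD 1 g \<and> NB 1 M (phi s - g :: 'a fls fps)" using DD_Sg[of s D] by blast
qed

text \<open>Since \<open>Ti (Suc d) x\<close> is the twist of \<open>Ti d x\<close> divided by
  \<open>bb ^ x\<close>, multiplication by powers of \<open>bb\<close> shifts all summation indices
  down by one. The summands whose last index is 0 cannot be shifted and give the term with
  \<open>Hp x\<close>.\<close>

lemma Sg_step:
 "bb ^ sum_list (s @ [x]) * Sg (s @ [x]) (Suc D) = tau 1 (Sg (s @ [x]) D) + bb ^ x * emb (Hp x) * tau 1 (Sg s D :: 'a::{finite,field} fls fps)"
proof (induction s arbitrary: D)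
 case Nil
 have c: "bb ^ x * Ti (Suc d) x = tau 1 (Ti d x :: 'a fls fps)" for d
 proof -
  have "bb ^ x * (il 1 :: 'a fls fps) ^ x = 1" by (simp only: bb_il power_mult_distrib[symmetric] power_one)
  then show ?thesis unfolding Ti_Suc by (metis mult.left_commute mult.right_neutral)
 qed
 have "bb ^ x * (\<Sum>d<Suc D. Ti d x) = bb ^ x * emb (Hp x) + (\<Sum>d<D. bb ^ x * Ti (Suc d) x :: 'a fls fps)"
  by (subst sum.lessThan_Suc_shift) (simp add: distrib_left sum_distrib_left Ti_0)
 then show ?case by (simp add: c tau_sum add.commute)
next
 case (Cons y s)
 have c: "bb ^ y * Ti (Suc d) y = tau 1 (Ti d y :: 'a fls fps)" for d
 proof -
  have "bb ^ y * (il 1 :: 'a fls fps) ^ y = 1" by (simp only: bb_il power_mult_distrib[symmetric] power_one)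
  then show ?thesis unfolding Ti_Suc by (metis mult.left_commute mult.right_neutral)
 qed
 let ?W = "sum_list (s @ [x])"
 have z: "Sg (s @ [x]) 0 = (0 :: 'a fls fps)" by (cases s) simp_all
 have "bb ^ sum_list ((y # s) @ [x]) * Sg ((y # s) @ [x]) (Suc D) = (\<Sum>d<D. (bb ^ y * Ti (Suc d) y) * (bb ^ ?W * Sg (s @ [x]) (Suc d)) :: 'a fls fps)"
  unfolding append_Cons Sg.simps by (subst sum.lessThan_Suc_shift) (simp add: z sum_distrib_left power_add mult_ac)
 also have "\<dots> = (\<Sum>d<D. tau 1 (Ti d y) * (tau 1 (Sg (s @ [x]) d) + bb ^ x * emb (Hp x) * tau 1 (Sg s d)))"
  unfolding c Cons.IH ..
 also have "\<dots> = tau 1 (Sg ((y # s) @ [x]) D) + bb ^ x * emb (Hp x) * tau 1 (Sg (y # s) D)"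
  by (simp add: tau_sum distrib_left sum.distrib sum_distrib_left mult_ac)
 finally show ?case .
qed

lemma phi_step:
 assumes "\<forall>y\<in>set s. y \<ge> 1" "x \<ge> 1"
 shows "bb ^ sum_list (s @ [x]) * phi (s @ [x]) = tau 1 (phi (s @ [x])) + bb ^ x * emb (Hp x) * tau 1 (phi s :: 'a::{finite,field} fls fps)"
proof -
 let ?s = "s @ [x]" and ?A = "bb ^ sum_list (s @ [x]) :: 'a fls fps" and ?B = "bb ^ x * emb (Hp x) :: 'a fls fps"
 let ?q = "int (CARD('a) ^ 1)"
 have s1: "\<forall>y\<in>set ?s. y \<ge> 1" using assms by auto
 have bbe: "bb = (emb [:- thA 1, 1:] :: 'a fls fps)" by (simp add: bb_def emb_pCons AK_minus flip: fps_const_neg)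
 obtain cA where cA: "cA \<ge> 0" "NB 1 cA ?A" using DD_NB[of 1 ?A] DD_power[of 1 "bb :: 'a fls fps"] DD_emb by (metis bbe)
 obtain cB where cB: "cB \<ge> 0" "NB 1 cB ?B" using DD_NB[of 1 ?B] DD_mult[OF DD_power[of 1 "bb :: 'a fls fps"] DD_emb] DD_emb by (metis bbe)
 have tb: "NB 1 (- C) (tau 1 f)" if "NB 1 (- C) f" "C \<ge> 0" for C and f :: "'a fls fps"
 proof -
  have q1: "?q \<ge> 1" using card_ge_2[where 'a = 'a] by simp
  have "NB 1 (?q * (- C)) (tau 1 f)" using NB_mono_r[OF NB_tau[OF that(1), of 1], of 1] q1 by simp
  moreover have "1 * C \<le> ?q * C" by (rule mult_right_mono[OF q1 that(2)])
  ultimately show ?thesis by (elim NB_mono) simp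
 qed
 let ?X = "?A * phi ?s - (tau 1 (phi ?s) + ?B * tau 1 (phi s))"
 have "NB 1 (- C) ?X" for C
 proof -
  let ?C = "\<bar>C\<bar> + cA + cB"
  obtain D1 D2 where D: "\<forall>D\<ge>D1. NB 1 (- ?C) (Sg ?s D - phi ?s :: 'a fls fps)" "\<forall>D\<ge>D2. NB 1 (- ?C) (Sg s D - phi s :: 'a fls fps)"
   using phi_limit[OF s1, of ?C] phi_limit[of s ?C] assms by blast
  let ?D = "max D1 D2"
  have a1: "NB 1 (cA + - ?C) (?A * (Sg ?s (Suc ?D) - phi ?s))" using D by (intro NB_mult cA) simp
  have a2: "NB 1 (- ?C) (tau 1 (Sg ?s ?D - phi ?s :: 'a fls fps))" using D cA cB by (intro tb) auto
  have a3: "NB 1 (cB + - ?C) (?B * tau 1 (Sg s ?D - phi s))" using D cA cB by (intro NB_mult cB tb) auto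
  have "NB 1 (- C) (tau 1 (Sg ?s ?D - phi ?s) + ?B * tau 1 (Sg s ?D - phi s) - ?A * (Sg ?s (Suc ?D) - phi ?s))"
   by (intro NB_diff NB_add NB_mono[OF a1] NB_mono[OF a2] NB_mono[OF a3]) (use cA(1) cB(1) in linarith)+
  also have "tau 1 (Sg ?s ?D - phi ?s) + ?B * tau 1 (Sg s ?D - phi s) - ?A * (Sg ?s (Suc ?D) - phi ?s) = ?X"
   unfolding right_diff_distrib Sg_step tau_diff by (simp add: algebra_simps)
  finally show ?thesis .
 qed
 from NB_small_eq_0[OF this] show ?thesis by simp
qed

section \<open>Order in \<open>t\<close> of the deformation series\<close>

definition low :: "nat => 'b::zero fps => bool" where "low k f \<longleftrightarrow> (\<forall>j<k. f $ j = 0)"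

lemma low_mult: "low k f ==> low l g ==> low (k + l) (f * g :: 'b::idom fps)"
 unfolding low_def fps_mult_nth
proof (intro allI impI sum.neutral ballI)
 fix j i assume A: "\<forall>j<k. f $ j = 0" "\<forall>j<l. g $ j = 0" "j < k + l" "i \<in> {0..j}"
 then have "i < k \<or> j - i < l" by auto
 then show "f $ i * g $ (j - i) = 0" using A by auto
qed
lemma low_sum: "(\<And>i. i \<in> S ==> low k (f i)) ==> low k (\<Sum>i\<in>S. f i :: 'b::comm_monoid_add fps)"
 by (auto simp: low_def fps_sum_nth)

text \<open>Twists do not change the order in \<open>t\<close>, so every summand
  \<open>Ti d x\<close> vanishes at least to the order of \<open>Hp x\<close>, and this passes to
  products, sums and limits.\<close>

lemma low_phi:
 assumes "\<forall>x\<in>set s. x \<ge> 1"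
 shows "low (\<Sum>x\<leftarrow>s. subdegree (emb (Hp x :: 'a poly poly))) (phi s :: 'a::{finite,field} fls fps)"
proof -
 have T: "low (subdegree (emb (Hp x :: 'a poly poly))) (Ti d x :: 'a fls fps)" for d x
 proof -
  have "low (subdegree (emb (Hp x :: 'a poly poly)) + 0) (Ti d x :: 'a fls fps)"
   unfolding Ti_def
  proof (rule low_mult)
   show "low (subdegree (emb (Hp x :: 'a poly poly))) (tau d (emb (Hp x)) :: 'a fls fps)"
    unfolding low_def
   proof (intro allI impI)
    fix j assume "j < subdegree (emb (Hp x :: 'a poly poly))"
    from nth_less_subdegree_zero[OF this] have "tau d (emb (Hp x :: 'a poly poly)) $ j = 0 ^ (CARD('a) ^ d)" unfolding tau_nth by (rule arg_cong)
    then show "tau d (emb (Hp x :: 'a poly poly)) $ j = 0" by (simp only: power_0_left) simp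
   qed
  qed (simp add: low_def)
  then show ?thesis by simp
 qed
 have S: "low (\<Sum>x\<leftarrow>s. subdegree (emb (Hp x :: 'a poly poly))) (Sg s D :: 'a fls fps)" for D
  by (induction s arbitrary: D) (auto simp: low_def[of 0] intro!: low_sum low_mult T)
 show ?thesis unfolding low_def
 proof (intro allI impI)
  fix j assume j: "j < (\<Sum>x\<leftarrow>s. subdegree (emb (Hp x :: 'a poly poly)))"
  have "vge c (phi s $ j :: 'a fls)" for c
  proof -
   obtain D where "NB 1 (- (c - int j)) (Sg s D - phi s :: 'a fls fps)" using phi_limit[OF assms, of "c - int j"] by blast
   then have "vge c (Sg s D $ j - phi s $ j :: 'a fls)" unfolding NB_def by (auto dest!: spec[of _ j])
   moreover have "Sg s D $ j = (0 :: 'a fls)" using S j by (simp add: low_def)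
   ultimately show ?thesis by simp
  qed
  then show "phi s $ j = (0 :: 'a fls)" by (rule vge_all_imp_0)
 qed
qed

section \<open>Specialization to multiple zeta values\<close>

primrec Zt :: "nat list => nat => 'a::{finite,field} fls" where
 "Zt [] D = 1"
| "Zt (x # s) D = (\<Sum>d<D. Sd d x * Zt s d)"

definition gams :: "nat list => 'a::{finite,field} poly" where "gams s = (\<Prod>x\<leftarrow>s. gam0 x)"

lemma gams_nonzero: "gams s \<noteq> (0 :: 'a::{finite,field} poly)"
 unfolding gams_def by (induction s) (simp_all add: gam0_nonzero)

lemma Ev_Ti: assumes "x \<ge> 1" shows "Ev 1 (th 0) (Ti d x) (AK (gam0 x) * Sd d x :: 'a::{finite,field} fls)"
proof -
 have "Ev 1 (th 0) (tau d (emb (Hp x))) (evt d (Hp x) :: 'a fls)"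
  unfolding tau_emb evt_def using Ev_emb[of 1 "thA 0" "tw d (Hp x :: 'a poly poly)"] vge_th0[where 'a = 'a] by simp
 moreover have "Ev 1 (th 0) ((\<Prod>j\<in>{1..d}. il j) ^ x) ((\<Prod>j\<in>{1..d}. 1 / (th 0 - th j) :: 'a fls) ^ x)"
  by (intro Ev_power Ev_prod vge_th0 Ev_il) simp
 moreover have "(\<Prod>j\<in>{1..d}. 1 / (th 0 - th j) :: 'a fls) = 1 / Ld d" by (simp add: Ld_def prod_dividef)
 ultimately have "Ev 1 (th 0) (Ti d x) (evt d (Hp x) * (1 / Ld d :: 'a fls) ^ x)" unfolding Ti_def by (metis Ev_mult)
 then show ?thesis by (simp add: evt_Hp[OF assms] power_one_over)
qed

lemma Ev_Sg:
 assumes "\<forall>x\<in>set s. x \<ge> 1"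
 shows "Ev 1 (th 0) (Sg s D) (AK (gams s) * Zt s D :: 'a::{finite,field} fls)"
 using assms
proof (induction s arbitrary: D)
 case Nil then show ?case by (simp add: gams_def Ev_1[OF vge_th0])
next
 case (Cons x s)
 have "Ev 1 (th 0) (Sg (x # s) D) (\<Sum>d<D. (AK (gam0 x) * Sd d x) * (AK (gams s) * Zt s d) :: 'a fls)"
  unfolding Sg.simps using Cons by (intro Ev_sum Ev_mult Ev_Ti vge_th0) auto
 moreover have "(\<Sum>d<D. (AK (gam0 x) * Sd d x) * (AK (gams s) * Zt s d)) = AK (gams (x # s)) * (Zt (x # s) D :: 'a fls)"
  by (simp add: gams_def AK_mult sum_distrib_left mult_ac)
 ultimately show ?case by (simp only:)
qed

lemma Zt_limit:
 assumes "\<forall>x\<in>set s. x \<ge> 1"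
 shows "\<exists>z. Ev 1 (th 0) (phi s) (AK (gams s) * z :: 'a::{finite,field} fls) \<and> (\<forall>c. \<exists>D0. \<forall>D\<ge>D0. vge c (Zt s D - z))"
proof -
 obtain v where v: "Ev 1 (th 0) (phi s) (v :: 'a fls)" using Ev_exists[OF vge_th0 DD_phi[OF assms]] by blast
 define g where "g = AK (gams s :: 'a poly)"
 have g0: "g \<noteq> 0" using gams_nonzero[of s, where 'a = 'a] by (simp add: g_def)
 define z where "z = v / g"
 have gz: "g * z = v" using g0 by (simp add: z_def)
 have "\<exists>D0. \<forall>D\<ge>D0. vge c (Zt s D - z)" for c
 proof -
  let ?c = "c + fls_subdegree g"
  obtain D0 where D0: "\<forall>D\<ge>D0. NB 1 (- ?c) (Sg s D - phi s :: 'a fls fps)" using phi_limit[OF assms] by blast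
  have "vge c (Zt s D - z)" if "D \<ge> D0" for D
  proof -
   have "Ev 1 (th 0) (Sg s D - phi s) (g * Zt s D - v)" unfolding g_def by (intro Ev_diff Ev_Sg assms v)
   then have "vge (- (- ?c)) (g * Zt s D - v)" by (rule Ev_bound) (use D0 that in blast)
   then have "vge ?c (g * (Zt s D - z))" by (simp only: minus_minus right_diff_distrib gz)
   then show ?thesis using g0 by (cases "Zt s D - z = 0") (auto simp: vge_subdegree)
  qed
  then show ?thesis by blast
 qed
 then show ?thesis using v gz by (intro exI[of _ z]) (simp add: g_def)
qed

definition Mx :: "nat list => nat => 'a::{finite,field} poly list set" where
 "Mx s D = {as\<in>mzv_index (length s). \<forall>a\<in>set as. degree a < D}"

definition zterm :: "nat list => 'a::{finite,field} poly list => 'a fls" where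
 "zterm s as = 1 / (\<Prod>i<length s. AK (as ! i) ^ (s ! i))"

lemma zterm_Cons: "zterm (x # s) (a # as) = 1 / AK a ^ x * zterm s as"
 unfolding zterm_def by (simp add: lessThan_Suc_eq_insert_0 prod.reindex)

lemma Mx_Cons: "Mx (x # s) D = (\<Union>d<D. (\<lambda>(a, as). a # as) ` (Mon d \<times> Mx s d))"
proof (intro Set.set_eqI iffI)
 fix bs :: "'a poly list" assume bs: "bs \<in> Mx (x # s) D"
 then obtain a as where "bs = a # as" by (cases bs) (auto simp: Mx_def mzv_index_def)
 with bs show "bs \<in> (\<Union>d<D. (\<lambda>(a, as). a # as) ` (Mon d \<times> Mx s d))"
  by (auto simp: Mx_def mzv_index_def Mon_def intro!: bexI[of _ "degree a"] image_eqI[of _ _ "(a, as)"])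
qed (fastforce simp: Mx_def mzv_index_def Mon_def)

lemma Mx_Zt: "finite (Mx s D :: 'a::{finite,field} poly list set) \<and> (\<Sum>as\<in>Mx s D. zterm s as) = (Zt s D :: 'a fls)"
proof (induction s arbitrary: D)
 case Nil
 have "Mx [] D = ({[]} :: 'a poly list set)" by (auto simp: Mx_def mzv_index_def)
 then show ?case by (simp add: zterm_def)
next
 case (Cons x s)
 let ?F = "\<lambda>d. (\<lambda>(a, as). a # as) ` (Mon d \<times> Mx s d :: ('a poly \<times> 'a poly list) set)"
 have fin: "finite (?F d)" for d using Cons by auto
 have "(\<Sum>as\<in>Mx (x # s) D. zterm (x # s) as) = (\<Sum>d<D. \<Sum>as\<in>?F d. zterm (x # s) as :: 'a fls)"
  unfolding Mx_Cons by (rule sum.UNION_disjoint) (use fin in \<open>auto simp: Mon_def\<close>)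
 also have "\<dots> = (\<Sum>d<D. Sd d x * Zt s d)"
 proof (rule sum.cong[OF refl])
  fix d
  have "(\<Sum>as\<in>?F d. zterm (x # s) as) = (\<Sum>(a, as)\<in>Mon d \<times> Mx s d. zterm (x # s) (a # as) :: 'a fls)"
   by (subst sum.reindex) (auto intro!: inj_onI simp: case_prod_unfold)
  also have "\<dots> = (\<Sum>a\<in>Mon d. 1 / AK a ^ x) * (\<Sum>as\<in>Mx s d. zterm s as)"
   by (simp add: zterm_Cons sum_product sum.cartesian_product)
  finally show "(\<Sum>as\<in>?F d. zterm (x # s) as) = (Sd d x * Zt s d :: 'a fls)" using Cons by (simp add: Sd_def)
 qed
 finally show ?case using fin by (simp add: Mx_Cons)
qed

lemma vge_zterm:
 assumes s: "s \<noteq> []" "\<forall>x\<in>set s. x \<ge> 1" and as: "as \<in> mzv_index (length s)" "as \<notin> Mx s D"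
 shows "vge (int D) (zterm s as :: 'a::{finite,field} fls)"
proof -
 obtain x s' where sx: "s = x # s'" using s by (cases s) auto
 have lead: "Polynomial.lead_coeff (as ! i) = 1" if "i < length s" for i using as that by (auto simp: mzv_index_def)
 then have nz: "as ! i \<noteq> 0" if "i < length s" for i using that by fastforce
 obtain a where a: "a \<in> set as" "degree a \<ge> D" using as by (auto simp: Mx_def not_less)
 have len: "length as = length s" using as by (simp add: mzv_index_def)
 obtain i where i: "i < length s" "as ! i = a" using a len by (auto simp: in_set_conv_nth)
 have "zterm s as = (\<Prod>i<length s. 1 / AK (as ! i) ^ (s ! i))" by (simp add: zterm_def prod_dividef)
 moreover have "vge (\<Sum>i<length s. int (s ! i * degree (as ! i))) (\<Prod>i<length s. 1 / AK (as ! i) ^ (s ! i))"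
  by (rule vge_prod) (use nz in \<open>simp add: subdegree_A fls_subdegree_pow AK_eq_0_iff vge_inverse flip: inverse_eq_divide\<close>)
 moreover have "int D \<le> (\<Sum>i<length s. int (s ! i * degree (as ! i)))"
 proof -
  have "1 * D \<le> s ! i * degree (as ! i)" using i a s by (intro mult_mono) auto
  also have "\<dots> \<le> (\<Sum>i<length s. s ! i * degree (as ! i))" using i by (intro member_le_sum) auto
  finally show ?thesis by (simp only: of_nat_sum[symmetric] of_nat_le_iff)
 qed
 ultimately show ?thesis by (metis vge_mono)
qed

theorem zeta_A_Ev:
 assumes s: "\<forall>x\<in>set s. x \<ge> 1"
 shows "Ev 1 (th 0) (phi s) (AK (gams s) * zeta_A s :: 'a::{finite,field} fls)" (is ?E)
  and "\<exists>D0. \<forall>D\<ge>D0. vge C (Zt s D - zeta_A s :: 'a fls)" (is ?L)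
proof -
 obtain z where z: "Ev 1 (th 0) (phi s) (AK (gams s) * z :: 'a fls)" "\<And>c. \<exists>D0. \<forall>D\<ge>D0. vge c (Zt s D - z)"
  using Zt_limit[OF s, where 'a = 'a] by blast
 have "zeta_A s = z"
  unfolding zeta_A_def zterm_def[symmetric]
 proof (rule infsumI, unfold has_sum_def tendsto_fls_iff, rule allI)
  fix c :: int
  show "\<forall>\<^sub>F F in finite_subsets_at_top (mzv_index (length s)). vge c (sum (zterm s) F - z)"
  proof -
   obtain D0 where D0: "\<forall>D\<ge>D0. vge c (Zt s D - z)" using z(2) by blast
   let ?D = "max D0 (nat c)"
   have X: "finite (Mx s ?D :: 'a poly list set)" "(Mx s ?D :: 'a poly list set) \<subseteq> mzv_index (length s)" using Mx_Zt by (auto simp: Mx_def)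
   show ?thesis unfolding eventually_finite_subsets_at_top
   proof (intro exI conjI allI impI)
    fix Y assume Y: "finite Y \<and> Mx s ?D \<subseteq> Y \<and> Y \<subseteq> (mzv_index (length s) :: 'a poly list set)"
    have "sum (zterm s) Y = sum (zterm s) (Mx s ?D) + sum (zterm s) (Y - Mx s ?D)"
     using Y by (metis add.commute sum.subset_diff)
    then have "sum (zterm s) Y - z = (Zt s ?D - z) + sum (zterm s) (Y - Mx s ?D)" using Mx_Zt[of s ?D, where 'a = 'a] by simp
    moreover have "vge c (Zt s ?D - z)" using D0 by simp
    \<comment> \<open>The infinite sum runs over arbitrary finite sets, but indices outside
      \<open>Mx s ?D\<close> contain a polynomial of degree at least \<open>?D\<close> and
      contribute nothing of valuation below \<open>c\<close>.\<close>
    moreover have "vge c (sum (zterm s) (Y - Mx s ?D))"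
    proof (rule vge_sum)
     fix as assume as: "as \<in> Y - Mx s ?D"
     have "s \<noteq> []"
     proof
      assume "s = []"
      then show False using as Y by (auto simp: Mx_def mzv_index_def)
     qed
     then have "vge (int ?D) (zterm s as)" using as Y by (intro vge_zterm s) auto
     then show "vge c (zterm s as)" by (rule vge_mono) simp
    qed
    ultimately show "vge c (sum (zterm s) Y - z)" by (metis vge_add)
   qed (use X in auto)
  qed
 qed
 then show ?E ?L using z by simp_all
qed

text \<open>The term of degree 0 is 1, and all other terms have positive valuation.\<close>

lemma zeta_A_single_nonzero:
 assumes "w \<ge> 1" shows "zeta_A [w] \<noteq> (0 :: 'a::{finite,field} fls)"
proof
 assume z: "zeta_A [w] = (0 :: 'a fls)"
 have "\<exists>D0. \<forall>D\<ge>D0. vge 1 (Zt [w] D - zeta_A [w] :: 'a fls)" using assms by (intro zeta_A_Ev(2)) simp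
 then obtain D0 where D0: "\<forall>D\<ge>D0. vge 1 (Zt [w] D :: 'a fls)" using z by auto
 have S: "vge 1 (Sd d w :: 'a fls)" if "d \<ge> 1" for d
  unfolding Sd_def
 proof (rule vge_sum)
  fix a :: "'a poly" assume a: "a \<in> Mon d"
  have "1 * 1 \<le> w * d" using assms that by (intro mult_mono) auto
  then have "1 \<le> int w * int d" by (simp only: of_nat_mult[symmetric])
  then show "vge 1 (1 / AK a ^ w)"
   using a Mon_nonzero[OF a] by (simp add: Mon_def subdegree_A fls_subdegree_pow vge_inverse flip: inverse_eq_divide)
 qed
 have "Mon 0 = {1 :: 'a poly}" by (auto simp: Mon_def elim!: degree_eq_zeroE)
 then have "Zt [w] (Suc D0) = 1 + (\<Sum>d<D0. Sd (Suc d) w :: 'a fls)"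
  by (simp add: sum.lessThan_Suc_shift Sd_def del: sum.lessThan_Suc)
 then have "1 = Zt [w] (Suc D0) - (\<Sum>d<D0. Sd (Suc d) w :: 'a fls)" by simp
 moreover have "vge 1 (Zt [w] (Suc D0) - (\<Sum>d<D0. Sd (Suc d) w :: 'a fls))"
  by (rule vge_diff[OF D0[rule_format] vge_sum[OF S]]) simp_all
 ultimately show False by (metis not_one_le_zero vge_one)
qed

section \<open>Finite extensions of the coefficient ring\<close>

text \<open>Gaussian elimination without division, so that it works over any domain.\<close>

lemma linear_dependence:
 fixes v :: "'i => 'j => 'r::idom"
 assumes "finite J" "finite S" "card J < card S"
 shows "\<exists>a. (\<exists>i\<in>S. a i \<noteq> 0) \<and> (\<forall>j\<in>J. (\<Sum>i\<in>S. a i * v i j) = 0)"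
 using assms
proof (induction J arbitrary: S v rule: finite_induct)
 case empty
 then have "S \<noteq> {}" by auto
 then show ?case by (intro exI[of _ "\<lambda>_. 1"]) auto
next
 case (insert j J)
 show ?case
 proof (cases "\<forall>i\<in>S. v i j = 0")
  case True
  have "card J < card S" using insert by simp
  from insert.IH[OF insert.prems(1) this, of v] True show ?thesis by auto
 next
  case False
  then obtain i0 where i0: "i0 \<in> S" "v i0 j \<noteq> 0" by blast
  let ?S = "S - {i0}"
  have "card J < card ?S" using insert i0 by simp
  from insert.IH[OF _ this, of "\<lambda>i k. v i0 j * v i k - v i j * v i0 k"] insert.prems(1)
  obtain a where a: "\<exists>i\<in>?S. a i \<noteq> 0" "\<And>k. k \<in> J ==> (\<Sum>i\<in>?S. a i * (v i0 j * v i k - v i j * v i0 k)) = 0" by auto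
  define a' where "a' i = (if i = i0 then - (\<Sum>i\<in>?S. a i * v i j) else a i * v i0 j)" for i
  have s: "(\<Sum>i\<in>S. a' i * v i k) = (\<Sum>i\<in>?S. a i * (v i0 j * v i k - v i j * v i0 k))" for k
  proof -
   have "(\<Sum>i\<in>S. a' i * v i k) = a' i0 * v i0 k + (\<Sum>i\<in>?S. a' i * v i k)" using insert.prems i0 by (simp add: sum.remove)
   also have "(\<Sum>i\<in>?S. a' i * v i k) = (\<Sum>i\<in>?S. a i * v i0 j * v i k)" by (rule sum.cong) (auto simp: a'_def)
   also have "a' i0 * v i0 k = (\<Sum>i\<in>?S. - (a i * v i j * v i0 k))" by (simp add: a'_def sum_distrib_right sum_negf)
   also have "(\<Sum>i\<in>?S. - (a i * v i j * v i0 k)) + (\<Sum>i\<in>?S. a i * v i0 j * v i k) = (\<Sum>i\<in>?S. a i * (v i0 j * v i k - v i j * v i0 k))"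
    unfolding sum.distrib[symmetric] by (rule sum.cong) (simp_all add: algebra_simps)
   finally show ?thesis .
  qed
  have "(\<Sum>i\<in>S. a' i * v i k) = 0" if "k \<in> insert j J" for k
   using that a(2)[of k] unfolding s by (cases "k = j") (simp_all add: mult.commute)
  moreover have "\<exists>i\<in>S. a' i \<noteq> 0" using a(1) i0 by (auto simp: a'_def)
  ultimately show ?thesis by blast
 qed
qed

text \<open>The powers of \<open>c\<close> below \<open>e\<close> form a basis of
  \<open>A[c]\<close> over \<open>A\<close>. In the application \<open>c\<close> is a multiple of
  the ratio of zeta values by an element of \<open>A\<close> that makes it integral.\<close>

locale alg_ext =
 fixes c :: "'a::{finite,field} fls" and e :: nat
 assumes e_pos: "e \<ge> 1"
  and ind: "(\<Sum>i<e. AK (a i) * c ^ i) = 0 ==> i < e ==> a i = 0"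
  and integral: "\<exists>a. c ^ e = (\<Sum>i<e. AK (a i) * c ^ i)"
begin

definition cmb :: "(nat => 'a poly poly) => 'a fls fps" where
 "cmb P = (\<Sum>i<e. emb (P i) * fps_const (c ^ i))"
text \<open>The ring \<open>A[c][t]\<close> inside the power series.\<close>

definition OT :: "'a fls fps set" where "OT = range cmb"

lemma cmb_add: "cmb P + cmb Q = cmb (\<lambda>i. P i + Q i)" by (simp add: cmb_def emb_add distrib_right sum.distrib)
lemma cmb_scale: "emb u * cmb P = cmb (\<lambda>i. u * P i)" by (simp add: cmb_def emb_mult sum_distrib_left mult_ac)
lemma cmb_nth: "cmb P $ n = (\<Sum>i<e. AK (coeff (P i) n) * c ^ i)" by (simp add: cmb_def fps_sum_nth)

lemma cmb_eq_0: assumes "cmb P = 0" "i < e" shows "P i = 0"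
proof (rule poly_eqI)
 fix n
 have "(\<Sum>i<e. AK (coeff (P i) n) * c ^ i) = 0" using assms(1) cmb_nth[of P n] by simp
 from ind[OF this assms(2)] show "coeff (P i) n = coeff 0 n" by simp
qed
lemma cmb_inj: assumes "cmb P = cmb Q" "i < e" shows "P i = Q i"
proof -
 have "cmb (\<lambda>i. P i + (- 1) * Q i) = cmb P + emb (- 1) * cmb Q" by (simp only: cmb_add cmb_scale)
 also have "\<dots> = 0" using assms(1) by (simp add: emb_minus)
 finally show ?thesis using cmb_eq_0[OF _ assms(2)] by fastforce
qed

lemma OT_add: "f \<in> OT ==> g \<in> OT ==> f + g \<in> OT" by (auto simp: OT_def cmb_add)
lemma OT_scale: "f \<in> OT ==> emb u * f \<in> OT" by (auto simp: OT_def cmb_scale)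
lemma OT_uminus: "f \<in> OT ==> - f \<in> OT" using OT_scale[of f "- 1"] by (simp add: emb_minus)
lemma OT_emb [simp]: "emb u \<in> OT"
proof -
 have "emb u = cmb (\<lambda>i. if i = 0 then u else 0)" using e_pos unfolding cmb_def by (subst sum.remove[of _ 0]) auto
 then show ?thesis by (simp add: OT_def)
qed
lemma OT_0 [simp]: "0 \<in> OT" using OT_emb[of 0] by simp
lemma OT_sum: "(\<And>i. i \<in> S ==> f i \<in> OT) ==> sum f S \<in> OT"
 by (induction S rule: infinite_finite_induct) (auto intro: OT_add)

lemma cmb_const: "fps_const (\<Sum>i<e. AK (a i) * c ^ i) = cmb (\<lambda>i. [:a i:])"
proof (rule fps_ext)
 fix n show "fps_const (\<Sum>i<e. AK (a i) * c ^ i) $ n = cmb (\<lambda>i. [:a i:]) $ n" by (cases n) (simp_all add: cmb_nth)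
qed

lemma power_span: "\<exists>a. c ^ m = (\<Sum>i<e. AK (a i) * c ^ i)"
proof (induction m)
 case 0 show ?case using e_pos by (intro exI[of _ "\<lambda>i. if i = 0 then 1 else 0"]) (subst sum.remove[of _ 0], auto)
next
 case (Suc m)
 then obtain a where a: "c ^ m = (\<Sum>i<e. AK (a i) * c ^ i)" by blast
 obtain b where b: "c ^ e = (\<Sum>i<e. AK (b i) * c ^ i)" using integral by blast
 obtain e' where e': "e = Suc e'" using e_pos by (cases e) auto
 define d where "d i = (case i of 0 => 0 | Suc j => a j) + a e' * b i" for i
 have "c ^ Suc m = (\<Sum>i<e'. AK (a i) * c ^ Suc i) + AK (a e') * c ^ e"
  unfolding e' by (simp add: a e' sum_distrib_left distrib_left mult_ac)
 also have "(\<Sum>i<e'. AK (a i) * c ^ Suc i) = (\<Sum>i<e. AK (case i of 0 => 0 | Suc j => a j) * c ^ i)"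
  unfolding e' by (subst sum.lessThan_Suc_shift) simp
 also have "\<dots> + AK (a e') * c ^ e = (\<Sum>i<e. AK (d i) * c ^ i)"
  unfolding b by (simp add: d_def AK_add AK_mult sum_distrib_left sum.distrib algebra_simps)
 finally show ?case by blast
qed

lemma OT_power_c: "fps_const (c ^ m) \<in> OT"
 using power_span[of m] cmb_const by (auto simp: OT_def)

lemma OT_mult: assumes "f \<in> OT" "g \<in> OT" shows "f * g \<in> OT"
proof -
 obtain P Q where PQ: "f = cmb P" "g = cmb Q" using assms by (auto simp: OT_def)
 have "f * g = (\<Sum>i<e. \<Sum>j<e. emb (P i * Q j) * fps_const (c ^ (i + j)))"
  by (simp add: PQ cmb_def sum_product emb_mult power_add mult_ac flip: fps_const_mult)
 then show ?thesis by (auto intro!: OT_sum OT_scale OT_power_c)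
qed
lemma OT_power: "f \<in> OT ==> f ^ n \<in> OT" using OT_emb[of 1] by (induction n) (auto intro: OT_mult)
lemma tau_cmb: "tau 1 (cmb P) = (\<Sum>i<e. emb (tw 1 (P i)) * fps_const (c ^ (CARD('a) * i)))"
 by (simp add: cmb_def tau_sum tau_emb power_mult[symmetric] mult.commute)
lemma OT_tau: "f \<in> OT ==> tau 1 f \<in> OT"
proof -
 assume "f \<in> OT"
 then obtain P where "f = cmb P" by (auto simp: OT_def)
 then show ?thesis unfolding \<open>f = cmb P\<close> tau_cmb by (intro OT_sum OT_scale OT_power_c)
qed

text \<open>The powers \<open>1, f, ..., f^e\<close> are dependent over \<open>A[t]\<close>. After
  cancelling a power of \<open>f\<close>, the lowest nonzero coefficient of the dependence is a
  multiple of \<open>f\<close>.\<close>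

lemma norm_exists:
 assumes "f \<in> OT" "f \<noteq> 0" shows "\<exists>Q\<in>OT. \<exists>p. p \<noteq> 0 \<and> Q * f = emb p"
proof -
 have "\<exists>V. f ^ j = cmb V" for j using OT_power[OF assms(1), of j] by (auto simp: OT_def)
 then obtain V where V: "\<And>j. f ^ j = cmb (V j)" by metis
 obtain a where a: "\<exists>j\<in>{..e}. a j \<noteq> 0" "\<forall>i\<in>{..<e}. (\<Sum>j\<le>e. a j * V j i) = 0"
  using linear_dependence[of "{..<e}" "{..e}" V] by auto
 have "(\<Sum>j\<le>e. emb (a j) * f ^ j) = cmb (\<lambda>i. \<Sum>j\<le>e. a j * V j i)"
  unfolding V cmb_def emb_sum sum_distrib_left sum_distrib_right emb_mult mult.assoc by (rule sum.swap)
 also have "\<dots> = 0" using a(2) unfolding cmb_def by (intro sum.neutral) auto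
 finally have 0: "(\<Sum>j\<le>e. emb (a j) * f ^ j) = 0" .
 define j0 where "j0 = (LEAST j. a j \<noteq> 0)"
 have j0: "a j0 \<noteq> 0" "\<And>j. j < j0 ==> a j = 0" unfolding j0_def using a(1) LeastI_ex[of "\<lambda>j. a j \<noteq> 0"] not_less_Least by blast+
 have j0e: "j0 \<le> e" unfolding j0_def using a(1) by (auto intro: order_trans Least_le)
 have "(\<Sum>j\<le>e. emb (a j) * f ^ j) = (\<Sum>j\<in>{j0..e}. emb (a j) * f ^ j)"
  by (rule sum.mono_neutral_right) (auto simp: j0)
 also have "\<dots> = emb (a j0) * f ^ j0 + (\<Sum>j\<in>{Suc j0..e}. emb (a j) * f ^ j)" using j0e by (simp add: sum.atLeast_Suc_atMost)
 also have "(\<Sum>j\<in>{Suc j0..e}. emb (a j) * f ^ j) = f ^ j0 * (f * (\<Sum>j\<in>{Suc j0..e}. emb (a j) * f ^ (j - Suc j0)))"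
  unfolding sum_distrib_left
 proof (rule sum.cong[OF refl])
  fix j assume "j \<in> {Suc j0..e}"
  then have "f ^ j = f ^ j0 * (f * f ^ (j - Suc j0))" by (simp flip: power_add power_Suc)
  then show "emb (a j) * f ^ j = f ^ j0 * (f * (emb (a j) * f ^ (j - Suc j0)))" by (simp add: mult_ac)
 qed
 finally have "f ^ j0 * (emb (a j0) + f * (\<Sum>j\<in>{Suc j0..e}. emb (a j) * f ^ (j - Suc j0))) = 0"
  using 0 by (simp add: algebra_simps)
 then have "emb (a j0) = (- (\<Sum>j\<in>{Suc j0..e}. emb (a j) * f ^ (j - Suc j0))) * f" using assms(2) by (simp add: eq_neg_iff_add_eq_0 mult.commute)
 moreover have "- (\<Sum>j\<in>{Suc j0..e}. emb (a j) * f ^ (j - Suc j0)) \<in> OT"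
  by (intro OT_uminus OT_sum OT_scale OT_power assms)
 ultimately show ?thesis using j0(1) by metis
qed

text \<open>The coefficients are split along \<open>\<theta>^j\<close>, \<open>j < q\<close>;
  \<open>theta_independent\<close> separates the parts, and taking \<open>q\<close>-th roots reduces
  the claim to the independence of the powers of \<open>c\<close>.\<close>

lemma frobenius_ind:
 assumes "(\<Sum>i<e. AK (a i) * c ^ (CARD('a) * i)) = 0" "i < e" shows "a i = 0"
proof -
 have "\<forall>i. \<exists>g. a i = (\<Sum>j<CARD('a). monom 1 j * g j ^ CARD('a))" using poly_frobenius_decomp[where 'a = 'a and n = 1] by simp
 then obtain g where g: "\<And>i. a i = (\<Sum>j<CARD('a). monom 1 j * g i j ^ CARD('a))" by metis
 have "(\<Sum>j<CARD('a) ^ 1. fls_X_inv ^ j * (\<Sum>i<e. AK (g i j) * c ^ i) ^ (CARD('a) ^ 1)) = (\<Sum>i<e. AK (a i) * c ^ (CARD('a) * i))"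
  unfolding fls_frob_sum sum_distrib_left
  by (subst sum.swap) (simp add: g AK_sum AK_mult AK_power AK_monom power_mult_distrib sum_distrib_left sum_distrib_right mult_ac flip: power_mult)
 then have "(\<Sum>i<e. AK (g i j) * c ^ i) = 0" if "j < CARD('a)" for j
  using theta_independent[where 'a = 'a and n = 1 and j = j and x = "\<lambda>j. \<Sum>i<e. AK (g i j) * c ^ i"] assms that by simp
 then have "g i j = 0" if "j < CARD('a)" for j using ind[of "\<lambda>i. g i j" i] that assms(2) by blast
 then show ?thesis unfolding g by (auto intro!: sum.neutral)
qed

text \<open>Base change in both directions between the powers of \<open>c\<close> and of
  \<open>c^q\<close>, with one common denominator \<open>x\<close>. The twist sends
  \<open>\<psi> * c^i\<close> to \<open>tau 1 \<psi> * c^(q*i)\<close>, so \<open>abp_system\<close>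
  needs both matrices.\<close>

lemma frobenius_basis:
 "\<exists>B C x. x \<noteq> 0 \<and> (\<forall>i<e. AK x * c ^ i = (\<Sum>j<e. AK (B i j) * c ^ (CARD('a) * j)))
  \<and> (\<forall>i<e. c ^ (CARD('a) * i) = (\<Sum>j<e. AK (C i j) * c ^ j))
  \<and> (\<forall>i<e. \<forall>k<e. (\<Sum>j<e. B i j * C j k) = (if i = k then x else 0))"
proof -
 have "\<exists>a. c ^ (CARD('a) * i) = (\<Sum>j<e. AK (a j) * c ^ j)" for i by (rule power_span)
 then obtain C where C: "\<And>i. c ^ (CARD('a) * i) = (\<Sum>j<e. AK (C i j) * c ^ j)" by metis
 have ex: "\<exists>b y. y \<noteq> 0 \<and> AK y * c ^ i = (\<Sum>j<e. AK (b j) * c ^ (CARD('a) * j))" if i: "i < e" for i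
 proof -
  define v where "v j k = (if j = e then if k = i then 1 else 0 else C j k)" for j k
  obtain a where a: "\<exists>j\<in>{..e}. a j \<noteq> 0" "\<forall>k\<in>{..<e}. (\<Sum>j\<le>e. a j * v j k) = 0"
   using linear_dependence[of "{..<e}" "{..e}" v] by auto
  have "(\<Sum>k<e. AK (\<Sum>j\<le>e. a j * v j k) * c ^ k) = 0" using a(2) by (intro sum.neutral) auto
  moreover have "(\<Sum>k<e. AK (\<Sum>j\<le>e. a j * v j k) * c ^ k) = (\<Sum>j\<le>e. AK (a j) * (\<Sum>k<e. AK (v j k) * c ^ k))"
   by (simp add: AK_sum AK_mult sum_distrib_left sum_distrib_right mult_ac sum.swap[of _ _ "{..e}"])
  moreover have "\<dots> = (\<Sum>j<e. AK (a j) * (\<Sum>k<e. AK (v j k) * c ^ k)) + AK (a e) * (\<Sum>k<e. AK (v e k) * c ^ k)"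
   by (simp add: lessThan_Suc_atMost[symmetric])
  moreover have "(\<Sum>k<e. AK (v e k) * c ^ k) = c ^ i"
   using i by (subst sum.remove[of _ i]) (auto simp: v_def intro!: sum.neutral)
  moreover have "(\<Sum>j<e. AK (a j) * (\<Sum>k<e. AK (v j k) * c ^ k)) = (\<Sum>j<e. AK (a j) * c ^ (CARD('a) * j))"
   by (rule sum.cong) (auto simp: v_def C)
  ultimately have r: "(\<Sum>j<e. AK (a j) * c ^ (CARD('a) * j)) + AK (a e) * c ^ i = 0" by simp
  have "a e \<noteq> 0"
  proof
   assume z: "a e = 0"
   then have "a j = 0" if "j < e" for j using frobenius_ind[of a j] r that by simp
   with z a(1) show False by (metis atMost_iff le_neq_implies_less)
  qed
  moreover have "AK (a e) * c ^ i = (\<Sum>j<e. AK (- a j) * c ^ (CARD('a) * j))"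
   using r by (simp add: AK_minus sum_negf eq_neg_iff_add_eq_0 add.commute)
  ultimately show ?thesis by (intro exI[of _ "\<lambda>j. - a j"] exI[of _ "a e"]) simp
 qed
 have "\<forall>i. \<exists>b y. i < e \<longrightarrow> y \<noteq> 0 \<and> AK y * c ^ i = (\<Sum>j<e. AK (b j) * c ^ (CARD('a) * j))" using ex by blast
 then obtain b y where bby: "\<And>i. i < e ==> y i \<noteq> 0 \<and> AK (y i) * c ^ i = (\<Sum>j<e. AK (b i j) * c ^ (CARD('a) * j))" by metis
 define x where "x = (\<Prod>i<e. y i)"
 define B where "B i j = (\<Prod>k\<in>{..<e} - {i}. y k) * b i j" for i j
 have x: "x \<noteq> 0" using bby by (auto simp: x_def)
 have B: "AK x * c ^ i = (\<Sum>j<e. AK (B i j) * c ^ (CARD('a) * j))" if "i < e" for i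
 proof -
  have "x = (\<Prod>k\<in>{..<e} - {i}. y k) * y i" unfolding x_def using that by (subst prod.remove[of _ i]) auto
  then have "AK x * c ^ i = AK (\<Prod>k\<in>{..<e} - {i}. y k) * (AK (y i) * c ^ i)" by (simp add: AK_mult mult_ac)
  also have "\<dots> = (\<Sum>j<e. AK (B i j) * c ^ (CARD('a) * j))" using bby that by (simp add: B_def AK_mult sum_distrib_left mult_ac)
  finally show ?thesis .
 qed
 have "(\<Sum>j<e. B i j * C j k) = (if i = k then x else 0)" if ik: "i < e" "k < e" for i k
 proof -
  let ?d = "\<lambda>k. (\<Sum>j<e. B i j * C j k) - (if k = i then x else 0)"
  have "(\<Sum>k<e. AK (?d k) * c ^ k) = (\<Sum>k<e. AK (\<Sum>j<e. B i j * C j k) * c ^ k) - (\<Sum>k<e. AK (if k = i then x else 0) * c ^ k)"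
   by (simp add: AK_diff left_diff_distrib sum_subtractf)
  also have "(\<Sum>k<e. AK (if k = i then x else 0) * c ^ k) = AK x * c ^ i"
   using ik by (subst sum.remove[of _ i]) (auto intro!: sum.neutral)
  also have "(\<Sum>k<e. AK (\<Sum>j<e. B i j * C j k) * c ^ k) = AK x * c ^ i"
   unfolding B[OF ik(1)] C AK_sum sum_distrib_left sum_distrib_right AK_mult mult.assoc by (rule sum.swap)
  finally have "?d k = 0" using ind[of ?d k] ik by simp
  then show ?thesis by auto
 qed
 with x B C show ?thesis by (intro exI[of _ B] exI[of _ C] exI[of _ x]) auto
qed

text \<open>A \<open>t\<close>-degree comparison of the components along \<open>c\<^sup>i\<close>, \<open>i \<ge> 1\<close>, which \<open>tau\<close> mixes among themselves.\<close>

lemma descent: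
 assumes f: "f \<in> OT" and eq: "emb u * f = emb h + emb v * tau 1 f" and deg: "degree v < degree u"
 shows "\<exists>g. f = emb g"
proof -
 obtain P where P: "f = cmb P" using f by (auto simp: OT_def)
 have "\<exists>a. c ^ (CARD('a) * i) = (\<Sum>j<e. AK (a j) * c ^ j)" for i by (rule power_span)
 then obtain C where C: "\<And>i. c ^ (CARD('a) * i) = (\<Sum>j<e. AK (C i j) * c ^ j)" by metis
 \<comment> \<open>The power \<open>c^0\<close> is its own twist, so component 0 does not feed the
   others, and these form a closed system.\<close>
 have C0: "C 0 j = 0" if "j < e" "j \<noteq> 0" for j
 proof -
  have "(\<Sum>k<e. AK (C 0 k - (if k = 0 then 1 else 0)) * c ^ k) = c ^ (CARD('a) * 0) - (\<Sum>k<e. AK (if k = 0 then 1 else 0) * c ^ k)"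
   unfolding C by (simp add: AK_diff left_diff_distrib sum_subtractf)
  also have "(\<Sum>k<e. AK (if k = 0 then 1 else 0) * c ^ k) = 1"
   using e_pos by (subst sum.remove[of _ 0]) (auto intro!: sum.neutral)
  finally have "C 0 j - (if j = 0 then 1 else 0) = 0" using ind[of "\<lambda>k. C 0 k - (if k = 0 then 1 else 0)" j] that by simp
  then show ?thesis using that by simp
 qed
 have tc: "tau 1 (cmb P) = cmb (\<lambda>j. \<Sum>i<e. [:C i j:] * tw 1 (P i))"
 proof -
  have "tau 1 (cmb P) = (\<Sum>i<e. emb (tw 1 (P i)) * cmb (\<lambda>j. [:C i j:]))" unfolding tau_cmb C cmb_const ..
  also have "\<dots> = cmb (\<lambda>j. \<Sum>i<e. [:C i j:] * tw 1 (P i))"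
   unfolding cmb_def emb_sum sum_distrib_right sum_distrib_left by (subst sum.swap) (simp only: emb_mult mult_ac)
  finally show ?thesis .
 qed
 have hc: "emb h = cmb (\<lambda>i. if i = 0 then h else 0)" using e_pos unfolding cmb_def by (subst sum.remove[of _ 0]) auto
 have comp: "u * P j = v * (\<Sum>i\<in>{1..<e}. [:C i j:] * tw 1 (P i))" if j: "j < e" "j \<noteq> 0" for j
 proof -
  have "cmb (\<lambda>i. u * P i) = cmb (\<lambda>j. (if j = 0 then h else 0) + v * (\<Sum>i<e. [:C i j:] * tw 1 (P i)))"
   using eq unfolding P tc hc cmb_scale cmb_add .
  from cmb_inj[OF this j(1)] have "u * P j = v * (\<Sum>i<e. [:C i j:] * tw 1 (P i))" using j by simp
  also have "(\<Sum>i<e. [:C i j:] * tw 1 (P i)) = (\<Sum>i\<in>{1..<e}. [:C i j:] * tw 1 (P i))"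
   by (rule sum.mono_neutral_right) (use C0[OF j] in \<open>auto simp: not_less_eq_eq\<close>)
  finally show ?thesis .
 qed
 have z: "P j = 0" if "j < e" "j \<noteq> 0" for j
 proof (rule ccontr)
  assume Pj: "P j \<noteq> 0"
  let ?J = "{k\<in>{1..<e}. P k \<noteq> 0}"
  define d where "d = Max ((\<lambda>k. degree (P k)) ` ?J)"
  have ne: "j \<in> ?J" using that Pj by auto
  have "d \<in> (\<lambda>k. degree (P k)) ` ?J" unfolding d_def using ne by (intro Max_in) auto
  then obtain k where k: "k \<in> ?J" "degree (P k) = d" by auto
  have le: "degree (P i) \<le> d" if "i \<in> {1..<e}" for i
  proof (cases "P i = 0")
   case False then show ?thesis unfolding d_def using that by (intro Max_ge) auto
  qed simp
  \<comment> \<open>At a component of maximal \<open>t\<close>-degree the left side of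
    \<open>comp\<close> has degree \<open>degree u + d\<close>, the right side at most
    \<open>degree v + d\<close>.\<close>
  have u0: "u \<noteq> 0" using deg by auto
  have "degree u + d = degree (u * P k)" using k u0 by (simp add: degree_mult_eq)
  also have "\<dots> = degree (v * (\<Sum>i\<in>{1..<e}. [:C i k:] * tw 1 (P i)))" using comp[of k] k by simp
  also have "\<dots> \<le> degree v + degree (\<Sum>i\<in>{1..<e}. [:C i k:] * tw 1 (P i))" by (rule degree_mult_le)
  also have "degree (\<Sum>i\<in>{1..<e}. [:C i k:] * tw 1 (P i)) \<le> d"
  proof (rule degree_sum_le)
   fix i assume "i \<in> {1..<e}"
   then show "degree ([:C i k:] * tw 1 (P i)) \<le> d" using le[of i] by (auto intro: order_trans[OF degree_mult_le])
  qed simp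
  finally show False using deg by simp
 qed
 have "f = emb (P 0)" unfolding P cmb_def using e_pos z by (subst sum.remove[of _ 0]) (auto intro!: sum.neutral)
 then show ?thesis by blast
qed

end

section \<open>Systems indexed by a tree\<close>

definition bp :: "'a::{finite,field} poly poly" where "bp = [:- thA 1, 1:]"

lemma emb_bp: "emb bp = (bb :: 'a::{finite,field} fls fps)"
 by (simp add: bp_def bb_def emb_pCons AK_minus flip: fps_const_neg)
lemma emb_smult: "emb (smult a P) = fps_const (AK a) * emb P"
 using emb_mult[of "[:a:]" P] by (simp add: emb_const)
lemma bp_nonzero [simp]: "bp \<noteq> 0" by (simp add: bp_def)
lemma power_diff_mult: "a \<le> b ==> b \<le> d ==> z ^ (d - b) * z ^ (b - a) = z ^ (d - a)" for z :: "'z::monoid_mult"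
proof -
 assume "a \<le> b" "b \<le> d"
 then have "d - b + (b - a) = d - a" by arith
 then show ?thesis by (metis power_add)
qed
lemma power_diff_mult': "b \<le> d ==> z ^ (d - b) * z ^ b = z ^ d" for z :: "'z::monoid_mult"
 using power_diff_mult[of 0 b d z] by simp
lemma degree_bp_power: "degree (bp ^ n :: 'a::{finite,field} poly poly) = n"
 by (simp add: degree_power_eq bp_def)

lemma sum_Times_product: "(\<Sum>p\<in>A \<times> B. f (fst p) * g (snd p)) = (\<Sum>a\<in>A. f a) * (\<Sum>b\<in>B. g b :: 'r::semiring_0)"
 by (simp add: sum_product sum.cartesian_product case_prod_unfold)

text \<open>Node \<open>l\<close> carries a series of weight \<open>W l\<close>, tied to its parent
  by \<open>h l\<close>. A chain of initial segments and the extra branch of a single index are both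
  of this shape, with the root for the empty index.\<close>

locale tree_system = alg_ext c e for c :: "'a::{finite,field} fls" and e +
 fixes K :: nat and par :: "nat => nat" and W :: "nat => nat" and h :: "nat => 'a poly poly" and \<psi> :: "nat => 'a fls fps"
 assumes par_lt: "0 < l ==> l < K ==> par l < l"
  and W_par: "0 < l ==> l < K ==> W (par l) \<le> W l"
  and sys_0: "bb ^ W 0 * \<psi> 0 = tau 1 (\<psi> 0)"
  and sys: "0 < l ==> l < K ==> bb ^ W l * \<psi> l = tau 1 (\<psi> l) + bb ^ (W l - W (par l)) * emb (h l) * tau 1 (\<psi> (par l))"
  and DD_psi: "l < K ==> DD 1 (\<psi> l)"
begin

text \<open>The matrix expressing \<open>tau 1 (\<psi> l)\<close> by the untwisted series, found by
  solving the equations from the root outward. The test \<open>par l < l\<close> only secures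
  termination; for nodes it fails at most at the root.\<close>

fun M :: "nat => nat => 'a poly poly" where
 "M l m = (if m = l then bp ^ W l else 0) - (if par l < l then bp ^ (W l - W (par l)) * h l * M (par l) m else 0)"

declare M.simps [simp del]
lemma M_0: "M 0 m = (if m = 0 then bp ^ W 0 else 0)" by (simp add: M.simps[of 0])
lemma M_pos: "0 < l ==> l < K ==> M l m = (if m = l then bp ^ W l else 0) - bp ^ (W l - W (par l)) * h l * M (par l) m"
 using par_lt[of l] by (simp add: M.simps[of l])

lemma tau_psi: "l < K ==> tau 1 (\<psi> l) = (\<Sum>m<K. emb (M l m) * \<psi> m)"
proof (induction l rule: less_induct)
 case (less l)
 have one: "(\<Sum>m<K. emb (if m = l then bp ^ W l else 0) * \<psi> m) = bb ^ W l * \<psi> l"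
  using less.prems by (subst sum.remove[of _ l]) (auto simp: emb_power emb_bp intro!: sum.neutral)
 show ?case
 proof (cases "l = 0")
  case True
  then show ?thesis using one sys_0 unfolding True M_0 by simp
 next
  case False
  then have l: "0 < l" "par l < l" "par l < K" using less.prems par_lt[of l] by auto
  have "(\<Sum>m<K. emb (M l m) * \<psi> m) = bb ^ W l * \<psi> l - bb ^ (W l - W (par l)) * emb (h l) * (\<Sum>m<K. emb (M (par l) m) * \<psi> m)"
   unfolding M_pos[OF l(1) less.prems] emb_diff left_diff_distrib sum_subtractf one
   by (simp add: emb_mult emb_power emb_bp sum_distrib_left mult_ac)
  then show ?thesis using sys[OF l(1) less.prems] less.IH[OF l(2,3)] by simp
 qed
qed

lemma M_upper: "l < K ==> l < m ==> M l m = 0"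
proof (induction l rule: less_induct)
 case (less l)
 show ?case
 proof (cases "l = 0")
  case False
  then have l: "0 < l" "par l < l" "par l < K" using less.prems par_lt[of l] by auto
  then show ?thesis using less.IH[OF l(2,3)] less.prems by (simp add: M_pos)
 qed (use less.prems in \<open>simp add: M_0\<close>)
qed
lemma M_diag: assumes "l < K" shows "M l l = bp ^ W l"
proof (cases "l = 0")
 case False
 then have l: "0 < l" "par l < l" "par l < K" using assms par_lt[of l] by auto
 then show ?thesis using M_upper[OF l(3,2)] assms by (simp add: M_pos)
qed (simp add: M_0)
lemma M_leaf:
 assumes "\<And>l. 0 < l ==> l < K ==> par l \<noteq> n" shows "l < K ==> l \<noteq> n ==> M l n = 0"
proof (induction l rule: less_induct)
 case (less l)
 show ?case
 proof (cases "l = 0")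
  case False
  then have l: "0 < l" "par l < l" "par l < K" using less.prems par_lt[of l] by auto
  then show ?thesis using less.IH[OF l(2,3)] assms[of l] less.prems by (simp add: M_pos)
 qed (use less.prems in \<open>simp add: M_0\<close>)
qed

text \<open>The criterion is applied to the functions \<open>\<psi> l * c^i\<close>. The matrix is
  the Kronecker product of the tree matrix \<open>F\<close> with the base change \<open>B\<close>,
  and its inverse up to a scalar is that of \<open>M\<close> with \<open>C\<close>.\<close>

theorem tree_criterion:
 assumes nz: "l0 < K" "i0 < e" "\<rho> l0 i0 \<noteq> 0"
  and 0: "Ev 1 (th 0) (\<Sum>l<K. fps_const (\<Sum>i<e. AK (\<rho> l i) * c ^ i) * \<psi> l) 0"
 shows "\<exists>P \<mu>. \<mu> \<noteq> 0 \<and> (\<forall>l<K. \<forall>i<e. poly (P l i) (thA 0) = \<mu> * \<rho> l i) \<and> (\<Sum>l<K. cmb (P l) * \<psi> l) = 0"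
proof -
 obtain B C x where x: "x \<noteq> 0" and B: "\<And>i. i < e ==> AK x * c ^ i = (\<Sum>j<e. AK (B i j) * c ^ (CARD('a) * j))"
  and C: "\<And>i. i < e ==> c ^ (CARD('a) * i) = (\<Sum>j<e. AK (C i j) * c ^ j)"
  and BC: "\<And>i k. i < e ==> k < e ==> (\<Sum>j<e. B i j * C j k) = (if i = k then x else 0)"
  using frobenius_basis by blast
 \<comment> \<open>A weight above all \<open>W l\<close>, so that one scalar
   \<open>bp ^ w * [:x:]\<close> serves every row.\<close>
 define w where "w = (\<Sum>l<K. W l)"
 have w: "W l \<le> w" if "l < K" for l unfolding w_def using that by (intro member_le_sum) auto
 define F where "F l m = (if m = l then bp ^ (w - W l) else 0) + (if 0 < l \<and> m = par l then bp ^ (w - W (par l)) * h l else 0)" for l m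
 have F_sum: "(\<Sum>m<K. g (F l m) * y m) = g (bp ^ (w - W l)) * y l + (if 0 < l then g (bp ^ (w - W (par l)) * h l) * y (par l) else 0)"
  if l: "l < K" and g: "g 0 = 0" "\<And>u v. g (u + v) = g u + g v" for l g and y :: "nat => 'z::comm_ring_1"
 proof -
  have 1: "(\<Sum>m<K. g (if m = l then bp ^ (w - W l) else 0) * y m) = g (bp ^ (w - W l)) * y l"
   using l by (subst sum.remove[of _ l]) (auto simp: g intro!: sum.neutral)
  have 2: "(\<Sum>m<K. g (if 0 < l \<and> m = par l then bp ^ (w - W (par l)) * h l else 0) * y m) = (if 0 < l then g (bp ^ (w - W (par l)) * h l) * y (par l) else 0)"
  proof (cases "0 < l")
   case True
   then have "par l < K" using par_lt[OF True l] l by simp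
   then show ?thesis using True by (subst sum.remove[of _ "par l"]) (auto simp: g intro!: sum.neutral)
  qed (simp add: g)
  show ?thesis unfolding F_def g(2) distrib_right sum.distrib 1 2 ..
 qed
 have FM: "(\<Sum>m<K. F l m * M m k) = (if l = k then bp ^ w else 0)" if l: "l < K" and k: "k < K" for l k
 proof -
  have s: "(\<Sum>m<K. F l m * M m k) = bp ^ (w - W l) * M l k + (if 0 < l then bp ^ (w - W (par l)) * h l * M (par l) k else 0)"
   using F_sum[OF l, of "\<lambda>u. u" "\<lambda>m. M m k"] by simp
  show ?thesis
  proof (cases "0 < l")
   case True
   have "bp ^ (w - W l) * (bp ^ (W l - W (par l)) * h l * M (par l) k) = bp ^ (w - W (par l)) * h l * M (par l) k"
    by (simp only: mult.assoc[symmetric] power_diff_mult[OF W_par[OF True l] w[OF l]])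
   then have "(\<Sum>m<K. F l m * M m k) = bp ^ (w - W l) * (if k = l then bp ^ W l else 0)"
    unfolding s M_pos[OF True l] right_diff_distrib using True by (simp only: if_True diff_add_cancel)
   also have "\<dots> = (if l = k then bp ^ w else 0)" using power_diff_mult'[OF w[OF l], of "bp :: 'a poly poly"] by auto
   finally show ?thesis .
  next
   case False
   then show ?thesis unfolding s using power_diff_mult'[OF w[OF l], of "bp :: 'a poly poly"] by (simp add: M_0)
  qed
 qed
 let ?I = "{..<K} \<times> {..<e}"
 let ?F = "\<lambda>p p'. F (fst p) (fst p') * [:B (snd p) (snd p'):]" and ?F' = "\<lambda>p p'. M (fst p) (fst p') * [:C (snd p) (snd p'):]"
 let ?\<beta> = "bp ^ w * [:x:]" and ?\<psi> = "\<lambda>p. \<psi> (fst p) * fps_const (c ^ snd p)"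
 have tb: "tw i bp = [:- thA (Suc i), 1 :: 'a poly:]" for i by (simp add: bp_def poly_frob_minus)
 interpret abp_system ?I ?\<psi> ?F ?F' ?\<beta> ?\<beta>
 proof
  show "finite ?I" by simp
  show "?\<beta> \<noteq> 0" using x by simp
  \<comment> \<open>The \<open>i\<close>-th twist of \<open>bp\<close> vanishes only at
    \<open>\<theta>^(q^(i+1))\<close>, and here \<open>m \<le> i\<close>.\<close>
  show "poly (tw i ?\<beta>) (thA m) \<noteq> 0" if "m \<le> i" for m i
   by (simp only: tw_mult tw_power tb poly_mult poly_power) (use that x in simp)
 next
  fix p assume p: "p \<in> ?I"
  obtain l i where li: "p = (l, i)" "l < K" "i < e" using p by auto
  show "DD 1 (?\<psi> p)" using li by (auto intro!: DD_mult DD_psi)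
  have "(\<Sum>p'\<in>?I. emb (?F p p') * tau 1 (?\<psi> p')) = (\<Sum>p'\<in>?I. (emb (F l (fst p')) * tau 1 (\<psi> (fst p'))) * (fps_const (AK (B i (snd p'))) * fps_const (c ^ (CARD('a) * snd p'))))"
   by (rule sum.cong) (auto simp: li emb_mult emb_smult mult_ac simp flip: power_mult)
  also have "\<dots> = (\<Sum>m<K. emb (F l m) * tau 1 (\<psi> m)) * (\<Sum>j<e. fps_const (AK (B i j)) * fps_const (c ^ (CARD('a) * j)))"
   by (rule sum_Times_product)
  also have "(\<Sum>j<e. fps_const (AK (B i j)) * fps_const (c ^ (CARD('a) * j))) = fps_const (AK x * c ^ i)"
   unfolding B[OF li(3)] by (rule fps_ext) (simp add: fps_sum_nth)
  also have "(\<Sum>m<K. emb (F l m) * tau 1 (\<psi> m)) = bb ^ w * \<psi> l"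
  proof (cases "0 < l")
   case True
   have "bb ^ w * \<psi> l = bb ^ (w - W l) * (bb ^ W l * \<psi> l)" by (simp only: mult.assoc[symmetric] power_diff_mult'[OF w[OF li(2)]])
   then have a1: "bb ^ w * \<psi> l = bb ^ (w - W l) * tau 1 (\<psi> l) + bb ^ (w - W l) * (bb ^ (W l - W (par l)) * emb (h l) * tau 1 (\<psi> (par l)))"
    unfolding sys[OF True li(2)] distrib_left .
   have a2: "bb ^ (w - W l) * (bb ^ (W l - W (par l)) * emb (h l) * tau 1 (\<psi> (par l))) = bb ^ (w - W (par l)) * emb (h l) * tau 1 (\<psi> (par l))"
    by (simp only: mult.assoc[symmetric] power_diff_mult[OF W_par[OF True li(2)] w[OF li(2)]])
   show ?thesis unfolding a1 a2 using F_sum[OF li(2), of emb "\<lambda>m. tau 1 (\<psi> m)"] True by (simp add: emb_add emb_mult emb_power emb_bp)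
  next
   case False
   have "bb ^ w * \<psi> 0 = bb ^ (w - W 0) * (bb ^ W 0 * \<psi> 0)" using power_diff_mult'[OF w[OF li(2)], of "bb :: 'a fls fps"] False by (simp add: mult.assoc[symmetric])
   then show ?thesis using F_sum[OF li(2), of emb "\<lambda>m. tau 1 (\<psi> m)"] False by (simp add: sys_0 emb_add emb_power emb_bp)
  qed
  finally show "emb ?\<beta> * ?\<psi> p = (\<Sum>p'\<in>?I. emb (?F p p') * tau 1 (?\<psi> p'))"
   by (simp add: li emb_mult emb_power emb_bp emb_smult mult_ac flip: fps_const_mult)
  have "(\<Sum>p'\<in>?I. emb (?F' p p') * ?\<psi> p') = (\<Sum>p'\<in>?I. (emb (M l (fst p')) * \<psi> (fst p')) * (fps_const (AK (C i (snd p'))) * fps_const (c ^ snd p')))"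
   by (rule sum.cong) (auto simp: li emb_mult emb_smult mult_ac)
  also have "\<dots> = (\<Sum>m<K. emb (M l m) * \<psi> m) * (\<Sum>j<e. fps_const (AK (C i j)) * fps_const (c ^ j))"
   by (rule sum_Times_product)
  also have "(\<Sum>j<e. fps_const (AK (C i j)) * fps_const (c ^ j)) = fps_const (c ^ (CARD('a) * i))"
   unfolding C[OF li(3)] by (rule fps_ext) (simp add: fps_sum_nth)
  also have "(\<Sum>m<K. emb (M l m) * \<psi> m) = tau 1 (\<psi> l)" using tau_psi[OF li(2)] by simp
  finally show "emb ?\<beta> * (\<Sum>p'\<in>?I. emb (?F' p p') * ?\<psi> p') = emb ?\<beta> * tau 1 (?\<psi> p)"
   by (simp add: li mult.commute flip: power_mult)
  fix p2 assume "p2 \<in> ?I"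
  then obtain k j where kj: "p2 = (k, j)" "k < K" "j < e" by auto
  have "(\<Sum>p'\<in>?I. ?F p p' * ?F' p' p2) = (\<Sum>p'\<in>?I. (F l (fst p') * M (fst p') k) * [:B i (snd p') * C (snd p') j:])"
   by (rule sum.cong) (auto simp: li kj mult_ac)
  also have "\<dots> = (\<Sum>m<K. F l m * M m k) * (\<Sum>m<e. [:B i m * C m j:])" by (rule sum_Times_product)
  also have "(\<Sum>m<e. [:B i m * C m j:]) = [:\<Sum>m<e. B i m * C m j:]" by (induction e) auto
  finally show "(\<Sum>p'\<in>?I. ?F p p' * ?F' p' p2) = (if p = p2 then ?\<beta> else 0)"
   using FM[OF li(2) kj(2)] BC[OF li(3) kj(3)] by (simp add: li kj)
 qed
 define \<rho>' where "\<rho>' p = (if p \<in> ?I then \<rho> (fst p) (snd p) else 0)" for p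
 have "(\<Sum>p\<in>?I. fps_const (AK (\<rho>' p)) * ?\<psi> p) = (\<Sum>l<K. \<Sum>i<e. fps_const (AK (\<rho> l i)) * (\<psi> l * fps_const (c ^ i)))"
  unfolding sum.cartesian_product by (rule sum.cong) (auto simp: \<rho>'_def)
 also have "\<dots> = (\<Sum>l<K. fps_const (\<Sum>i<e. AK (\<rho> l i) * c ^ i) * \<psi> l)"
 proof (rule sum.cong[OF refl])
  fix l
  have f: "fps_const (\<Sum>i<e. AK (\<rho> l i) * c ^ i) = (\<Sum>i<e. fps_const (AK (\<rho> l i)) * fps_const (c ^ i))"
   by (rule fps_ext) (simp add: fps_sum_nth)
  show "(\<Sum>i<e. fps_const (AK (\<rho> l i)) * (\<psi> l * fps_const (c ^ i))) = fps_const (\<Sum>i<e. AK (\<rho> l i) * c ^ i) * \<psi> l"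
   unfolding f sum_distrib_right by (simp only: mult_ac)
 qed
 finally have "Ev 1 (th 0) (\<Sum>p\<in>?I. fps_const (AK (\<rho>' p)) * ?\<psi> p) 0" using 0 by simp
 then have "\<exists>P \<mu>. \<mu> \<noteq> 0 \<and> (\<forall>p\<in>?I. poly (P p) (thA 0) = \<mu> * \<rho>' p) \<and> (\<Sum>p\<in>?I. emb (P p) * ?\<psi> p) = 0"
  by (intro criterion[of \<rho>' "(l0, i0)"]) (use nz in \<open>auto simp: \<rho>'_def\<close>)
 then obtain P \<mu> where P: "\<mu> \<noteq> 0" "\<forall>p\<in>?I. poly (P p) (thA 0) = \<mu> * \<rho>' p" "(\<Sum>p\<in>?I. emb (P p) * ?\<psi> p) = 0" by blast
 have "(\<Sum>l<K. cmb (\<lambda>i. P (l, i)) * \<psi> l) = (\<Sum>l<K. \<Sum>i<e. emb (P (l, i)) * (\<psi> l * fps_const (c ^ i)))"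
  unfolding cmb_def sum_distrib_right by (simp only: mult_ac)
 also have "\<dots> = (\<Sum>p\<in>?I. emb (P p) * ?\<psi> p)" unfolding sum.cartesian_product by (rule sum.cong) auto
 finally show ?thesis using P by (intro exI[of _ "\<lambda>l i. P (l, i)"] exI[of _ \<mu>]) (auto simp: \<rho>'_def)
qed

text \<open>The matrix \<open>M\<close> is triangular with nonzero diagonal, and the leaf
  \<open>n\<close> occurs in its own row only. So independence of the series other than
  \<open>\<psi> n\<close> passes to their twists; the largest index with a nonzero coefficient gives
  the contradiction.\<close>

lemma tau_independent:
 assumes leaf: "\<And>l. 0 < l ==> l < K ==> par l \<noteq> n"
  and low: "\<And>Q. (\<And>l. Q l \<in> OT) ==> (\<Sum>l\<in>{..<K} - {n}. Q l * \<psi> l) = 0 ==> \<forall>l\<in>{..<K} - {n}. Q l = 0"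
  and V: "\<And>l. V l \<in> OT" "(\<Sum>l\<in>{..<K} - {n}. V l * tau 1 (\<psi> l)) = 0"
 shows "\<forall>l\<in>{..<K} - {n}. V l = 0"
proof (rule ccontr)
 let ?L = "{..<K} - {n}"
 assume "\<not> (\<forall>l\<in>?L. V l = 0)"
 then have ne: "{l\<in>?L. V l \<noteq> 0} \<noteq> {}" by auto
 define m where "m = Max {l\<in>?L. V l \<noteq> 0}"
 have m: "m \<in> {l\<in>?L. V l \<noteq> 0}" unfolding m_def using ne by (intro Max_in) auto
 have mx: "V l = 0" if "l \<in> ?L" "l > m" for l
 proof (rule ccontr)
  assume "V l \<noteq> 0"
  then have "l \<le> m" unfolding m_def using that by (intro Max_ge) auto
  then show False using that by simp
 qed
 let ?Q = "\<lambda>k. \<Sum>l\<in>?L. V l * emb (M l k)"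
 have "(\<Sum>k\<in>?L. ?Q k * \<psi> k) = (\<Sum>l\<in>?L. V l * (\<Sum>k\<in>?L. emb (M l k) * \<psi> k))"
  unfolding sum_distrib_left sum_distrib_right mult.assoc by (rule sum.swap)
 also have "\<dots> = (\<Sum>l\<in>?L. V l * tau 1 (\<psi> l))"
 proof (rule sum.cong[OF refl])
  fix l assume l: "l \<in> ?L"
  have "(\<Sum>k\<in>?L. emb (M l k) * \<psi> k) = (\<Sum>k<K. emb (M l k) * \<psi> k)"
   using M_leaf[OF leaf, of l] l by (intro sum.mono_neutral_left) auto
  then show "V l * (\<Sum>k\<in>?L. emb (M l k) * \<psi> k) = V l * tau 1 (\<psi> l)" using tau_psi[of l] l by simp
 qed
 finally have Q0: "(\<Sum>k\<in>?L. ?Q k * \<psi> k) = 0" using V by simp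
 have QO: "?Q k \<in> OT" for k by (rule OT_sum, rule OT_mult, rule V(1), rule OT_emb)
 have "\<forall>k\<in>?L. ?Q k = 0" by (rule low[of ?Q, OF QO Q0])
 then have "?Q m = 0" using m by blast
 moreover have "?Q m = V m * emb (M m m) + (\<Sum>l\<in>?L - {m}. V l * emb (M l m))" using m by (subst sum.remove[of _ m]) auto
 moreover have "(\<Sum>l\<in>?L - {m}. V l * emb (M l m)) = 0"
 proof (rule sum.neutral, rule ballI)
  fix l assume l: "l \<in> ?L - {m}"
  show "V l * emb (M l m) = 0"
  proof (cases "l < m")
   case True then show ?thesis using M_upper[of l m] l by simp
  next
   case False then show ?thesis using mx[of l] l by simp
  qed
 qed
 ultimately show False using m M_diag[of m] by simp
qed

text \<open>Multiplied by \<open>bb ^ W n\<close>, the relation becomes one between the twisted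
  series, with coefficients \<open>U l\<close>; twisting it gives another, with coefficients
  \<open>tau 1 (Q l)\<close>. As \<open>n\<close> is a leaf, \<open>U n = Q n\<close>. Eliminating
  \<open>\<psi> n\<close> leaves a relation between independent series, so all cross products
  agree.\<close>

lemma relation_twist:
 assumes n: "n < K" "\<And>l. l < K ==> W l \<le> W n"
  and leaf: "\<And>l. 0 < l ==> l < K ==> par l \<noteq> n"
  and low: "\<And>Q. (\<And>l. Q l \<in> OT) ==> (\<Sum>l\<in>{..<K} - {n}. Q l * \<psi> l) = 0 ==> \<forall>l\<in>{..<K} - {n}. Q l = 0"
  and Q: "\<And>l. Q l \<in> OT" "(\<Sum>l<K. Q l * \<psi> l) = 0" and l: "l < K" "l \<noteq> n"
 shows "bb ^ (W n - W l) * (Q l + (\<Sum>k\<in>{k\<in>{0<..<K}. par k = l}. Q k * emb (h k))) * tau 1 (Q n) = tau 1 (Q l) * Q n"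
proof -
 define U where "U l = bb ^ (W n - W l) * (Q l + (\<Sum>k\<in>{k\<in>{0<..<K}. par k = l}. Q k * emb (h k)))" for l
 let ?g = "\<lambda>k. bb ^ (W n - W (par k)) * (Q k * emb (h k)) * tau 1 (\<psi> (par k))"
 have K0: "K > 0" using l by simp
 have "0 = bb ^ W n * (\<Sum>l<K. Q l * \<psi> l)" using Q by simp
 also have "\<dots> = (\<Sum>l<K. bb ^ (W n - W l) * Q l * (bb ^ W l * \<psi> l))"
  unfolding sum_distrib_left
 proof (rule sum.cong[OF refl])
  fix l assume "l \<in> {..<K}"
  then have "bb ^ W n = (bb ^ (W n - W l) * bb ^ W l :: 'a fls fps)" using n(2)[of l] by (simp add: power_diff_mult')
  then show "bb ^ W n * (Q l * \<psi> l) = bb ^ (W n - W l) * Q l * (bb ^ W l * \<psi> l)" by (simp add: mult_ac)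
 qed
 also have "\<dots> = (\<Sum>l<K. bb ^ (W n - W l) * Q l * tau 1 (\<psi> l) + (if 0 < l then ?g l else 0))"
 proof (rule sum.cong[OF refl])
  fix l assume l: "l \<in> {..<K}"
  show "bb ^ (W n - W l) * Q l * (bb ^ W l * \<psi> l) = bb ^ (W n - W l) * Q l * tau 1 (\<psi> l) + (if 0 < l then ?g l else 0)"
  proof (cases "0 < l")
   case True
   then have "bb ^ (W n - W (par l)) = (bb ^ (W n - W l) * bb ^ (W l - W (par l)) :: 'a fls fps)"
    using n(2)[of l] W_par[of l] l by (simp add: power_diff_mult)
   then show ?thesis using sys[of l] True l by (simp add: algebra_simps)
  qed (use sys_0 in simp)
 qed
 also have "\<dots> = (\<Sum>l<K. bb ^ (W n - W l) * Q l * tau 1 (\<psi> l)) + (\<Sum>k\<in>{0<..<K}. ?g k)"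
  unfolding sum.distrib by (intro arg_cong2[of _ _ _ _ "(+)"] refl sum.mono_neutral_cong_right) auto
 also have "(\<Sum>k\<in>{0<..<K}. ?g k) = (\<Sum>l<K. \<Sum>k\<in>{k\<in>{0<..<K}. par k = l}. ?g k)"
 proof (rule sum.group[symmetric])
  show "par ` {0<..<K} \<subseteq> {..<K}"
  proof
   fix y assume "y \<in> par ` {0<..<K}"
   then obtain k where "y = par k" "0 < k" "k < K" by auto
   then show "y \<in> {..<K}" using par_lt[of k] by simp
  qed
 qed simp_all
 also have "\<dots> = (\<Sum>l<K. bb ^ (W n - W l) * (\<Sum>k\<in>{k\<in>{0<..<K}. par k = l}. Q k * emb (h k)) * tau 1 (\<psi> l))"
  by (rule sum.cong) (simp_all add: sum_distrib_left sum_distrib_right)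
 also have "(\<Sum>l<K. bb ^ (W n - W l) * Q l * tau 1 (\<psi> l)) + \<dots> = (\<Sum>l<K. U l * tau 1 (\<psi> l))"
  unfolding sum.distrib[symmetric] by (rule sum.cong) (simp_all add: U_def algebra_simps)
 finally have U0: "(\<Sum>l<K. U l * tau 1 (\<psi> l)) = 0" by simp
 have T0: "(\<Sum>l<K. tau 1 (Q l) * tau 1 (\<psi> l)) = 0" using arg_cong[OF Q(2), of "tau 1"] by (simp add: tau_sum)
 have Un: "U n = Q n" unfolding U_def using leaf by (auto intro!: sum.neutral)
 define V where "V l = U l * tau 1 (Q n) - tau 1 (Q l) * Q n" for l
 have UO: "U l \<in> OT" for l unfolding U_def emb_bp[symmetric] by (intro OT_mult OT_add OT_sum OT_power Q OT_emb)
 have VO: "V l \<in> OT" for l unfolding V_def diff_conv_add_uminus by (intro OT_mult OT_add OT_uminus OT_tau Q UO)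
 have "(\<Sum>l<K. V l * tau 1 (\<psi> l)) = tau 1 (Q n) * (\<Sum>l<K. U l * tau 1 (\<psi> l)) - Q n * (\<Sum>l<K. tau 1 (Q l) * tau 1 (\<psi> l))"
  unfolding sum_distrib_left sum_subtractf[symmetric] by (rule sum.cong) (simp_all add: V_def algebra_simps)
 then have "(\<Sum>l\<in>{..<K} - {n}. V l * tau 1 (\<psi> l)) = 0"
  using n(1) Un U0 T0 by (subst (asm) sum.remove[of _ n]) (simp_all add: V_def)
 from tau_independent[OF leaf low VO this] have "V l = 0" using l by blast
 then show ?thesis by (simp add: V_def U_def)
qed

end

section \<open>Lowest coefficients of relations\<close>

definition ld :: "'a::{finite,field} poly poly => nat" where "ld P = subdegree (emb P)"
definition lc :: "'a::{finite,field} poly poly => 'a poly" where "lc P = coeff P (ld P)"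

lemma A_lc: "AK (lc P) = emb P $ ld P" by (simp add: lc_def)
lemma lc_nonzero: "P \<noteq> 0 ==> lc P \<noteq> 0"
 by (metis A_lc AK_0 emb_eq_0_iff ld_def nth_subdegree_zero_iff)
lemma ld_mult: "P \<noteq> 0 ==> Q \<noteq> 0 ==> ld (P * Q) = ld P + ld Q" by (simp add: ld_def emb_mult)
lemma lc_mult: assumes "P \<noteq> 0" "Q \<noteq> 0" shows "lc (P * Q) = lc P * lc Q"
proof -
 have "AK (lc (P * Q)) = emb P $ ld P * emb Q $ ld Q"
  unfolding A_lc ld_mult[OF assms] emb_mult unfolding ld_def by (rule nth_subdegree_mult)
 also have "\<dots> = AK (lc P * lc Q)" by (simp only: A_lc AK_mult)
 finally show ?thesis by simp
qed
lemma lcI: assumes "\<And>j. j < k ==> coeff P j = 0" "coeff P k \<noteq> 0"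
 shows "ld P = k" "lc P = coeff P k"
proof -
 show "ld P = k" unfolding ld_def by (rule subdegreeI) (use assms in auto)
 then show "lc P = coeff P k" by (simp add: lc_def)
qed
lemma below_ld: "j < ld P ==> coeff P j = 0"
 using nth_less_subdegree_zero[of j "emb P"] by (simp add: ld_def)
lemma lc_power: "P \<noteq> 0 ==> lc (P ^ n) = lc P ^ n"
 by (induction n) (simp_all add: lc_mult lcI(2)[of 0 1])
lemma ld_power: "P \<noteq> 0 ==> ld (P ^ n) = n * ld P" by (simp add: ld_def emb_power)
lemma ld_tw: fixes P :: "'a::{finite,field} poly poly" assumes "P \<noteq> 0" shows "ld (tw n P) = ld P" "lc (tw n P) = lc P ^ (CARD('a) ^ n)"
proof -
 have c: "coeff (tw n P) (ld P) = lc P ^ (CARD('a) ^ n)" by (simp add: lc_def)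
 have z: "coeff (tw n P) j = 0" if "j < ld P" for j using below_ld[OF that] by simp
 have n: "coeff (tw n P) (ld P) \<noteq> 0" unfolding c using lc_nonzero[OF assms] by simp
 show "ld (tw n P) = ld P" "lc (tw n P) = lc P ^ (CARD('a) ^ n)" using lcI[OF z n] c by simp_all
qed
lemma thA_nonzero [simp]: "thA m \<noteq> (0 :: 'a::{finite,field} poly)" by (simp add: thA_def)
lemma order_power: "P \<noteq> 0 ==> order x (P ^ n) = n * order x P" for P :: "'b::idom poly"
 by (induction n) (simp_all add: order_mult)
lemma ld_bp: "ld (bp :: 'a::{finite,field} poly poly) = 0" "lc bp = - (thA 1 :: 'a::{finite,field} poly)"
 using lcI[of 0 "bp :: 'a poly poly"] by (simp_all add: bp_def)

lemma minus_one_power_card: "(- 1 :: 'a::{finite,field}) ^ CARD('a) = - 1"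
 by (rule finite_field_power_card)
lemma poly_thA1: "poly (- thA 1) (- 1) = (1 :: 'a::{finite,field})"
 by (simp add: thA_def poly_monom minus_one_power_card)

text \<open>The equation \<open>r\<^sup>q = (-\<theta>\<^sup>q)\<^sup>D (r + v)\<close> for \<open>r = a / b\<close>, \<open>v = u / b\<close> is contradictory at \<open>\<theta> = -1\<close>
 when \<open>v\<close> is a unit there.\<close>

lemma no_solution:
 fixes a u b :: "'a::{finite,field} poly"
 assumes nz: "a \<noteq> 0" "u \<noteq> 0" "b \<noteq> 0" and ord: "order (- 1) u = order (- 1) b"
  and eq: "(- thA 1) ^ D * (a + u) * b ^ CARD('a) = a ^ CARD('a) * b"
 shows False
proof -
 let ?q = "CARD('a)" and ?L = "[:- (- 1), 1:] :: 'a poly"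
 define k where "k = order (- 1) a"
 define m where "m = order (- 1) b"
 obtain a' where a': "a = ?L ^ k * a'" "\<not> ?L dvd a'" using order_decomp[OF nz(1)] unfolding k_def by blast
 obtain b' where b': "b = ?L ^ m * b'" "\<not> ?L dvd b'" using order_decomp[OF nz(3)] unfolding m_def by blast
 obtain u' where u': "u = ?L ^ m * u'" "\<not> ?L dvd u'" using order_decomp[OF nz(2), of "- 1"] unfolding ord m_def by blast
 have v: "poly a' (- 1) \<noteq> 0" "poly b' (- 1) \<noteq> 0" "poly u' (- 1) \<noteq> 0"
  using a'(2) b'(2) u'(2) unfolding poly_eq_0_iff_dvd by auto
 have q: "?q \<ge> 2" by (rule card_ge_2)
 have T: "poly ((- thA 1) ^ D) (- 1) = (1 :: 'a)" unfolding poly_power poly_thA1 by simp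
 have L0: "?L \<noteq> 0" by simp
 have L1: "poly ?L (- 1) = 0" by simp
 show False
 proof (cases "k < m")
  case True
  then obtain d where d: "m = k + d" "d > 0" by (metis less_imp_add_positive)
  obtain q' where q': "?q = Suc q'" "q' > 0" using q by (cases "?q") auto
  let ?x = "?L ^ k" and ?y = "?L ^ d"
  \<comment> \<open>Here \<open>a / b\<close> has a pole at -1. After cancellation the left side
    still contains \<open>?y ^ q'\<close>, which vanishes at -1, and the right side does
    not.\<close>
  have 1: "(- thA 1) ^ D * (?x * a' + ?x * ?y * u') * (?x * ?y * b') ^ Suc q' = (?x * ?x ^ Suc q' * ?y) * ((- thA 1) ^ D * (a' + ?y * u') * b' ^ Suc q' * ?y ^ q')"
   by (simp only: power_mult_distrib) (simp add: algebra_simps)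
  have 2: "(?x * a') ^ Suc q' * (?x * ?y * b') = (?x * ?x ^ Suc q' * ?y) * (a' ^ Suc q' * b')"
   by (simp only: power_mult_distrib) (simp add: algebra_simps)
  have "(- thA 1) ^ D * (?x * a' + ?x * ?y * u') * (?x * ?y * b') ^ Suc q' = (?x * a') ^ Suc q' * (?x * ?y * b')"
   using eq unfolding a'(1) b'(1) u'(1) d(1) q'(1) power_add .
  then have "(- thA 1) ^ D * (a' + ?y * u') * b' ^ Suc q' * ?y ^ q' = a' ^ Suc q' * b'" unfolding 1 2 using L0 by (metis mult_left_cancel power_eq_0_iff no_zero_divisors)
  from arg_cong[OF this, of "\<lambda>f. poly f (- 1)"] have "0 = poly a' (- 1) ^ Suc q' * poly b' (- 1)"
   using d q' by (simp add: power_0_left)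
  then show False using v by simp
 next
  case False
  then obtain d where d: "k = m + d" by (metis le_add_diff_inverse not_less)
  let ?a = "?L ^ d * a'"
  let ?x = "?L ^ m"
  have 1: "(- thA 1) ^ D * (?x * ?a + ?x * u') * (?x * b') ^ ?q = (?x * ?x ^ ?q) * ((- thA 1) ^ D * (?a + u') * b' ^ ?q)"
   unfolding power_mult_distrib[of ?x b'] distrib_left[symmetric] by (simp only: mult_ac)
  have 2: "(?x * ?a) ^ ?q * (?x * b') = (?x * ?x ^ ?q) * (?a ^ ?q * b')"
   unfolding power_mult_distrib[of ?x ?a] by (simp only: mult_ac)
  have "(- thA 1) ^ D * (?x * ?a + ?x * u') * (?x * b') ^ ?q = (?x * ?a) ^ ?q * (?x * b')"
   using eq unfolding a'(1) b'(1) u'(1) d(1) power_add mult.assoc[of ?x "?L ^ d"] .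
  then have "(- thA 1) ^ D * (?a + u') * b' ^ ?q = ?a ^ ?q * b'" unfolding 1 2 using L0 by (metis mult_left_cancel power_eq_0_iff no_zero_divisors)
  \<comment> \<open>Values at -1 lie in the finite field, where \<open>q\<close>-th powers change
    nothing; the equation then forces \<open>u'\<close> to vanish at -1.\<close>
  from arg_cong[OF this, of "\<lambda>f. poly f (- 1)"]
  have "(poly ?a (- 1) + poly u' (- 1)) * poly b' (- 1) = poly ?a (- 1) * poly b' (- 1)"
   unfolding poly_mult poly_add poly_power[of _ ?q] T finite_field_power_card by (simp only: mult_1_left finite_field_power_card poly_power poly_mult)
  then show False using v by (simp add: distrib_right)
 qed
qed

text \<open>Comparing orders in \<open>t\<close> shows that \<open>P + Q * H\<close> and
  \<open>P\<close> have the same order. If \<open>Q * H\<close> had smaller order this would fail,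
  and if it had the same order \<open>no_solution\<close> would apply. So \<open>P\<close> alone
  gives the lowest term, and its coefficient satisfies
  \<open>lc P ^ (q-1) = (-\<theta>^q)^D * lc p ^ (q-1)\<close>.\<close>

lemma lowest_step:
 fixes P Q p H :: "'a::{finite,field} poly poly"
 assumes p: "p \<noteq> 0" and Q: "Q \<noteq> 0" "order (- 1) (lc Q) = order (- 1) (lc p)"
  and H: "H \<noteq> 0" "lc H = monom u m"
  and eq: "bp ^ D * (P + Q * H) * tw 1 p = tw 1 P * p"
 shows "P \<noteq> 0 \<and> order (- 1) (lc P) = order (- 1) (lc p) \<and> ld P < ld Q + ld H \<and> CARD('a) - 1 dvd D"
proof -
 let ?q = "CARD('a)"
 define R where "R = Q * H"
 have R: "R \<noteq> 0" "ld R = ld Q + ld H" "lc R = lc Q * lc H" using Q H by (simp_all add: R_def ld_mult lc_mult)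
 have tp: "tw 1 p \<noteq> 0" using p by simp
 have B: "bp ^ D \<noteq> (0 :: 'a poly poly)" by simp
 have P: "P \<noteq> 0" using eq R(1) p by (auto simp flip: R_def)
 define S where "S = P + R"
 have eq': "bp ^ D * S * tw 1 p = tw 1 P * p" using eq by (simp add: S_def R_def)
 have S: "S \<noteq> 0" using eq' P p by auto
 have tP: "tw 1 P \<noteq> 0" using P by simp
 have BS: "bp ^ D * S \<noteq> 0" using B S by simp
 have "ld (bp ^ D * S * tw 1 p) = ld S + ld p" using ld_mult[OF BS tp] ld_mult[OF B S] ld_tw(1)[OF p] by (simp add: ld_power ld_bp)
 moreover have "ld (tw 1 P * p) = ld P + ld p" using ld_mult[OF tP p] ld_tw(1)[OF P] by simp
 ultimately have lS: "ld S = ld P" using eq' by simp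
 have "lc (bp ^ D * S * tw 1 p) = (- thA 1) ^ D * lc S * lc p ^ ?q" using lc_mult[OF BS tp] lc_mult[OF B S] ld_tw(2)[OF p] by (simp add: lc_power ld_bp)
 moreover have "lc (tw 1 P * p) = lc P ^ ?q * lc p" using lc_mult[OF tP p] ld_tw(2)[OF P] by simp
 ultimately have E: "(- thA 1) ^ D * lc S * lc p ^ ?q = lc P ^ ?q * lc p" using eq' by simp
 have cS: "lc S = lc P + coeff R (ld P)" unfolding lc_def[of S] lS by (simp add: S_def lc_def)
 have lH: "lc H \<noteq> 0" by (rule lc_nonzero[OF H(1)])
 have u0: "u \<noteq> 0" using lH H(2) by auto
 have oH: "order (- 1) (lc H) = 0" unfolding H(2) by (rule order_0I) (use u0 in \<open>simp add: poly_monom\<close>)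
 have oR: "order (- 1) (lc R) = order (- 1) (lc p)"
  unfolding R(3) using order_mult[of "lc Q" "lc H" "- 1"] lc_nonzero[OF Q(1)] lH oH Q(2) by simp
 have "\<not> ld R < ld P"
 proof
  assume "ld R < ld P"
  then have "ld S = ld R" unfolding ld_def S_def emb_add by (rule subdegree_add_eq2[rotated]) (use R in simp)
  then show False using lS \<open>ld R < ld P\<close> by simp
 qed
 moreover have "ld R \<noteq> ld P"
 proof
  assume "ld R = ld P"
  then have "lc S = lc P + lc R" using cS by (simp add: lc_def)
  with E have "(- thA 1) ^ D * (lc P + lc R) * lc p ^ ?q = lc P ^ ?q * lc p" by simp
  from no_solution[OF _ _ _ oR this] show False using lc_nonzero P R(1) p by blast
 qed
 ultimately have lt: "ld P < ld R" by simp
 then have "lc S = lc P" using cS below_ld[of "ld P" R] by simp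
 obtain q' where q': "?q = Suc q'" "q' > 0" using card_ge_2[where 'a = 'a] by (cases "?q") auto
 have l0: "lc P \<noteq> 0" "lc p \<noteq> 0" using lc_nonzero P p by auto
 have "lc P * lc p * ((- thA 1) ^ D * lc p ^ q') = lc P * lc p * lc P ^ q'"
  using E unfolding \<open>lc S = lc P\<close> q' by (simp add: mult_ac)
 then have F: "(- thA 1) ^ D * lc p ^ q' = lc P ^ q'" using l0 by simp
 have t0: "(- thA 1) ^ D \<noteq> (0 :: 'a poly)" using thA_inj by (auto simp: thA_def)
 have "order (- 1) ((- thA 1) ^ D :: 'a poly) = 0" by (rule order_0I) (simp only: poly_power poly_thA1, simp)
 then have "order (- 1) (lc p ^ q') = order (- 1) (lc P ^ q')" unfolding F[symmetric] using t0 l0 by (subst order_mult) simp_all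
 then have "q' * order (- 1) (lc p) = q' * order (- 1) (lc P)" using l0 by (simp add: order_power)
 then have o: "order (- 1) (lc P) = order (- 1) (lc p)" using q' by simp
 \<comment> \<open>Comparing degrees in \<open>\<theta>\<close> makes \<open>D * q\<close> a
   multiple of \<open>q - 1\<close>, and \<open>q\<close> is 1 modulo \<open>q - 1\<close>.\<close>
 have "degree ((- thA 1) ^ D * lc p ^ q') = D * ?q + q' * degree (lc p)"
  using t0 l0 by (simp add: degree_mult_eq degree_power_eq thA_def degree_monom_eq)
 moreover have "degree (lc P ^ q') = q' * degree (lc P)" using l0 by (simp add: degree_power_eq)
 ultimately have "D * ?q + q' * degree (lc p) = q' * degree (lc P)" using F by simp
 then have "D + q' * (D + degree (lc p)) = q' * degree (lc P)" unfolding q' by (simp add: algebra_simps)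
 then have "q' dvd D" by (metis dvd_add_left_iff dvd_triv_left)
 then show ?thesis using P o lt R(2) q' by simp
qed

lemma Hp_lc: "(Hp x :: 'a::{finite,field} poly poly) \<noteq> 0" "\<exists>u m. lc (Hp x :: 'a poly poly) = monom u m"
proof -
 obtain k u m where k: "u \<noteq> 0" "\<forall>j<k. coeff (Hp x :: 'a poly poly) j = 0" "coeff (Hp x :: 'a poly poly) k = monom u m"
  using Hp_lowest by blast
 then show "(Hp x :: 'a poly poly) \<noteq> 0" by auto
 have "lc (Hp x :: 'a poly poly) = monom u m" using k lcI(2)[of k "Hp x :: 'a poly poly"] by simp
 then show "\<exists>u m. lc (Hp x :: 'a poly poly) = monom u m" by blast
qed

text \<open>Induction downward from \<open>n\<close>, where the condition on orders at -1 is
  trivial. The start \<open>l0\<close> is 0 for a plain chain and 1 for the tree with two branches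
  at the root.\<close>

lemma lowest_chain:
 fixes P :: "nat => 'a::{finite,field} poly poly"
 assumes p: "P n \<noteq> 0"
  and eq: "\<And>l. l0 \<le> l ==> l < n ==> bp ^ D l * (P l + P (Suc l) * Hp (x l)) * tw 1 (P n) = tw 1 (P l) * P n"
  and l: "l0 \<le> l" "l \<le> n"
 shows "P l \<noteq> 0 \<and> order (- 1) (lc (P l)) = order (- 1) (lc (P n))"
  and "l < n ==> ld (P l) < ld (P (Suc l)) + ld (Hp (x l) :: 'a poly poly) \<and> CARD('a) - 1 dvd D l"
proof -
 have st: "P l \<noteq> 0 \<and> order (- 1) (lc (P l)) = order (- 1) (lc (P n)) \<and> ld (P l) < ld (P (Suc l)) + ld (Hp (x l) :: 'a poly poly) \<and> CARD('a) - 1 dvd D l"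
  if "l0 \<le> l" "l < n" "P (Suc l) \<noteq> 0 \<and> order (- 1) (lc (P (Suc l))) = order (- 1) (lc (P n))" for l
  using lowest_step[OF p _ _ Hp_lc(1) _ eq[OF that(1,2)]] that(3) Hp_lc(2)[of "x l", where 'a = 'a] by blast
 have main: "l0 \<le> l ==> P l \<noteq> 0 \<and> order (- 1) (lc (P l)) = order (- 1) (lc (P n))" if "l \<le> n" for l
  using that
 proof (induction rule: inc_induct)
  case (step m) then show ?case using st[of m] by simp
 qed (use p in simp)
 show "P l \<noteq> 0 \<and> order (- 1) (lc (P l)) = order (- 1) (lc (P n))" using main l by blast
 show "l < n ==> ld (P l) < ld (P (Suc l)) + ld (Hp (x l) :: 'a poly poly) \<and> CARD('a) - 1 dvd D l"
  using st[of l] main[of "Suc l"] l by simp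
qed

section \<open>Relations between the deformation series\<close>

context alg_ext
begin

text \<open>Solved for \<open>F l\<close>, each equation has the form required by
  \<open>descent\<close>: twisting keeps the \<open>t\<close>-degree of \<open>p\<close>, and the
  factor \<open>bp ^ D l\<close> with \<open>D l > 0\<close> makes the degree on the left strictly
  larger.\<close>

lemma chain_descent:
 assumes p: "p \<noteq> 0" and F: "\<And>l. l0 \<le> l ==> l \<le> n ==> F l \<in> OT" and Fn: "F n = emb p"
  and D: "\<And>l. l0 \<le> l ==> l < n ==> D l > 0"
  and eq: "\<And>l. l0 \<le> l ==> l < n ==> bb ^ D l * (F l + F (Suc l) * emb (Hp (x l))) * tau 1 (emb p) = tau 1 (F l) * emb p"
 shows "\<exists>P. P n = p \<and> (\<forall>l. l0 \<le> l \<longrightarrow> l \<le> n \<longrightarrow> F l = emb (P l))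
  \<and> (\<forall>l. l0 \<le> l \<longrightarrow> l < n \<longrightarrow> bp ^ D l * (P l + P (Suc l) * Hp (x l)) * tw 1 (P n) = tw 1 (P l) * P n)"
proof -
 have ex: "l0 \<le> l ==> \<exists>g. F l = emb g" if "l \<le> n" for l
  using that
 proof (induction rule: inc_induct)
  case (step m)
  then obtain g where g: "F (Suc m) = emb g" by auto
  show ?case
  proof (rule descent)
   show "F m \<in> OT" using F step by simp
   have "bb ^ D m * F m * tau 1 (emb p) + bb ^ D m * emb g * emb (Hp (x m)) * tau 1 (emb p) = tau 1 (F m) * emb p"
    using eq[of m] step g by (simp add: algebra_simps)
   then show "emb (bp ^ D m * tw 1 p) * F m = emb (- (bp ^ D m * g * Hp (x m) * tw 1 p)) + emb p * tau 1 (F m)"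
    unfolding emb_minus emb_mult emb_power emb_bp tau_emb by (simp add: algebra_simps)
   show "degree p < degree (bp ^ D m * tw 1 p)"
    using p D[of m] step by (subst degree_mult_eq) (simp_all add: degree_bp_power)
  qed
 qed (use Fn in blast)
 define P where "P l = (SOME g. F l = emb g)" for l
 have P: "F l = emb (P l)" if "l0 \<le> l" "l \<le> n" for l unfolding P_def using someI_ex[OF ex[OF that(2,1)]] .
 have Pn: "P n = p" unfolding P_def Fn by (auto intro: some_equality)
 have "bp ^ D l * (P l + P (Suc l) * Hp (x l)) * tw 1 (P n) = tw 1 (P l) * P n" if "l0 \<le> l" "l < n" for l
 proof -
  have "emb (bp ^ D l * (P l + P (Suc l) * Hp (x l)) * tw 1 (P n)) = emb (tw 1 (P l) * P n)"
   using eq[OF that] P[of l] P[of "Suc l"] that by (simp add: emb_mult emb_add emb_power emb_bp tau_emb Pn)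
  then show ?thesis by simp
 qed
 then show ?thesis using P Pn by (intro exI[of _ P]) auto
qed

end

text \<open>Nodes \<open>0, ..., r\<close> with \<open>r = length s\<close> are the initial segments
  of \<open>s\<close>. Node \<open>r + 1\<close> is the single index \<open>sum_list s\<close>, a
  second child of the root.\<close>

definition tpar :: "nat list => nat => nat" where "tpar s l = (if l = Suc (length s) then 0 else l - 1)"
definition tW :: "nat list => nat => nat" where "tW s l = (if l = Suc (length s) then sum_list s else sum_list (take l s))"
definition tH :: "nat list => nat => 'a::{finite,field} poly poly" where
 "tH s l = (if l = Suc (length s) then Hp (sum_list s) else Hp (s ! (l - 1)))"
definition tphi :: "nat list => nat => 'a::{finite,field} fls fps" where
 "tphi s l = (if l = Suc (length s) then phi [sum_list s] else phi (take l s))"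

lemma sum_list_take_mono: "l \<le> n ==> sum_list (take l s) \<le> (sum_list (take n s) :: nat)"
proof -
 assume "l \<le> n"
 then have "take n s = take l s @ take (n - l) (drop l s)" by (metis le_add_diff_inverse take_add)
 then show ?thesis by simp
qed
lemma sum_list_take_less:
 assumes "\<forall>x\<in>set s. x \<ge> 1" "l < n" "n \<le> length s" shows "sum_list (take l s) < (sum_list (take n s) :: nat)"
proof -
 have "sum_list (take (Suc l) s) = sum_list (take l s) + s ! l" using assms by (simp add: take_Suc_conv_app_nth)
 moreover have "s ! l \<ge> 1" using assms by simp
 ultimately show ?thesis using sum_list_take_mono[of "Suc l" n s] assms(2) by linarith
qed

lemma (in alg_ext) phi_tree:
 assumes s: "\<forall>x\<in>set s. x \<ge> 1" "s \<noteq> []" and K: "K \<le> Suc (Suc (length s))"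
 shows "tree_system c e K (tpar s) (tW s) (tH s) (tphi s)"
proof
 fix l assume l: "0 < l" "l < K"
 show "tpar s l < l" using l by (simp add: tpar_def)
 have sw: "1 \<le> sum_list s" using s by (cases s) auto
 show "tW s (tpar s l) \<le> tW s l" using l K by (auto simp: tW_def tpar_def intro: sum_list_take_mono)
 show "bb ^ tW s l * tphi s l = tau 1 (tphi s l) + bb ^ (tW s l - tW s (tpar s l)) * emb (tH s l) * tau 1 (tphi s (tpar s l) :: 'a fls fps)"
 proof (cases "l = Suc (length s)")
  case True
  then show ?thesis using phi_step[of "[]" "sum_list s", where 'a = 'a] sw by (simp add: tW_def tpar_def tH_def tphi_def)
 next
  case False
  define m where "m = l - 1"
  have m: "l = Suc m" "m < length s" using l K False by (auto simp: m_def)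
  have t: "take l s = take m s @ [s ! m]" using m by (simp add: take_Suc_conv_app_nth)
  have "bb ^ sum_list (take m s @ [s ! m]) * phi (take m s @ [s ! m]) = tau 1 (phi (take m s @ [s ! m])) + bb ^ (s ! m) * emb (Hp (s ! m)) * tau 1 (phi (take m s) :: 'a fls fps)"
   by (rule phi_step) (use s m in \<open>auto dest: in_set_takeD\<close>)
  then show ?thesis using m t False by (simp add: tW_def tpar_def tH_def tphi_def)
 qed
next
 show "bb ^ tW s 0 * tphi s 0 = tau 1 (tphi s 0 :: 'a fls fps)" by (simp add: tW_def tphi_def)
 fix l assume "l < K"
 show "DD 1 (tphi s l :: 'a fls fps)" unfolding tphi_def using s by (auto intro!: DD_phi dest: in_set_takeD) (cases s, auto)
qed

context alg_ext
begin

text \<open>In a nontrivial relation, with last coefficient made an element of \<open>A[t]\<close>,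
  all coefficients lie in \<open>A[t]\<close> and \<open>lowest_chain\<close> applies down to
  \<open>l = 0\<close>. It shows that \<open>P 0\<close> has smaller order in \<open>t\<close> than
  every other term \<open>P l * phi (take l s)\<close>, using \<open>low_phi\<close>, so its lowest
  coefficient cannot cancel.\<close>

lemma chain_independent:
 assumes s: "\<forall>x\<in>set s. x \<ge> 1" "s \<noteq> []"
 shows "n \<le> Suc (length s) ==> (\<And>l. Q l \<in> OT) ==> (\<Sum>l<n. Q l * phi (take l s)) = 0 ==> \<forall>l<n. Q l = 0"
proof (induction n arbitrary: Q)
 case (Suc n)
 have Qn: "Q n = 0"
 proof (rule ccontr)
  assume "Q n \<noteq> 0"
  then obtain N p where N: "N \<in> OT" "p \<noteq> 0" "N * Q n = emb p" using norm_exists[OF Suc.prems(2) \<open>Q n \<noteq> 0\<close>] by blast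
  interpret tree_system c e "Suc n" "tpar s" "tW s" "tH s" "tphi s" using phi_tree[OF s] Suc.prems(1) by simp
  have n: "n \<le> length s" using Suc.prems by simp
  have ph: "tphi s l = (phi (take l s) :: 'a fls fps)" "tW s l = sum_list (take l s)" "tpar s l = l - 1" "tH s l = (Hp (s ! (l - 1)) :: 'a poly poly)" if "l \<le> n" for l
   using that n by (auto simp: tphi_def tW_def tpar_def tH_def)
  define F where "F l = N * Q l" for l
  have FO: "F l \<in> OT" for l unfolding F_def by (intro OT_mult N Suc.prems)
  have "(\<Sum>l<Suc n. F l * tphi s l) = (\<Sum>l<Suc n. N * (Q l * phi (take l s)))"
   by (rule sum.cong) (use ph in \<open>auto simp: F_def mult.assoc\<close>)
  also have "\<dots> = 0" using Suc.prems(3) by (simp only: sum_distrib_left[symmetric] mult_zero_right)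
  finally have F0: "(\<Sum>l<Suc n. F l * tphi s l) = 0" .
  have low: "\<forall>l\<in>{..<Suc n} - {n}. Q' l = 0" if "\<And>l. Q' l \<in> OT" "(\<Sum>l\<in>{..<Suc n} - {n}. Q' l * tphi s l) = 0" for Q'
  proof -
   have e: "{..<Suc n} - {n} = {..<n}" by auto
   have "(\<Sum>l<n. Q' l * tphi s l) = (\<Sum>l<n. Q' l * phi (take l s))" by (rule sum.cong) (use ph in auto)
   then have 0: "(\<Sum>l<n. Q' l * phi (take l s)) = 0" using that(2) unfolding e by (simp only:)
   have "\<forall>l<n. Q' l = 0" by (rule Suc.IH[OF _ that(1) 0]) (use Suc.prems(1) in simp)
   then show ?thesis unfolding e by blast
  qed
  have eq: "bb ^ (tW s n - tW s l) * (F l + F (Suc l) * emb (Hp (s ! l))) * tau 1 (emb p) = tau 1 (F l) * emb p" if l: "l < n" for l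
  proof -
   have "{k \<in> {0<..<Suc n}. tpar s k = l} = {Suc l}" using l ph by auto
   moreover have "tH s (Suc l) = (Hp (s ! l) :: 'a poly poly)" using ph(4)[of "Suc l"] l by simp
   moreover have "bb ^ (tW s n - tW s l) * (F l + (\<Sum>k\<in>{k\<in>{0<..<Suc n}. tpar s k = l}. F k * emb (tH s k))) * tau 1 (F n) = tau 1 (F l) * F n"
   proof (rule relation_twist[OF _ _ _ low FO F0])
    show "tW s k \<le> tW s n" if "k < Suc n" for k using that ph(2) by (simp add: sum_list_take_mono)
    show "tpar s k \<noteq> n" if "0 < k" "k < Suc n" for k using that ph(3)[of k] by simp
   qed (use l in auto)
   ultimately show ?thesis using N(3) by (simp add: F_def)
  qed
  have "\<exists>P. P n = p \<and> (\<forall>l. 0 \<le> l \<longrightarrow> l \<le> n \<longrightarrow> F l = emb (P l))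
   \<and> (\<forall>l. 0 \<le> l \<longrightarrow> l < n \<longrightarrow> bp ^ (tW s n - tW s l) * (P l + P (Suc l) * Hp (s ! l)) * tw 1 (P n) = tw 1 (P l) * P n)"
  proof (rule chain_descent[OF N(2)])
   show "F n = emb p" using N(3) by (simp add: F_def)
   show "tW s n - tW s l > 0" if "l < n" for l using sum_list_take_less[OF s(1) that n] ph(2) that by simp
  qed (use FO eq in auto)
  then obtain P where P: "P n = p" "\<And>l. l \<le> n ==> F l = emb (P l)"
   "\<And>l. l < n ==> bp ^ (tW s n - tW s l) * (P l + P (Suc l) * Hp (s ! l)) * tw 1 (P n) = tw 1 (P l) * P n" by auto
  have Pn: "P n \<noteq> 0" using P(1) N by simp
  have lt: "ld (P l) < ld (P (Suc l)) + ld (Hp (s ! l) :: 'a poly poly)" if "l < n" for l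
   using lowest_chain(2)[of P n 0 "\<lambda>l. tW s n - tW s l" "\<lambda>l. s ! l" l] Pn P(3) that by simp
  have P0: "P 0 \<noteq> 0" using lowest_chain(1)[of P n 0 "\<lambda>l. tW s n - tW s l" "\<lambda>l. s ! l" 0] Pn P(3) by simp
  have ge: "l \<le> n ==> 0 < l ==> ld (P 0) < ld (P l) + (\<Sum>x\<leftarrow>take l s. subdegree (emb (Hp x :: 'a poly poly)))" for l
  proof (induction l)
   case (Suc l)
   have "take (Suc l) s = take l s @ [s ! l]" using Suc.prems n by (simp add: take_Suc_conv_app_nth)
   then have "(\<Sum>x\<leftarrow>take (Suc l) s. subdegree (emb (Hp x :: 'a poly poly))) = (\<Sum>x\<leftarrow>take l s. subdegree (emb (Hp x :: 'a poly poly))) + ld (Hp (s ! l) :: 'a poly poly)"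
    by (simp add: ld_def)
   then show ?case using Suc lt[of l] by (cases "l = 0") auto
  qed simp
  have z: "(emb (P l) * phi (take l s)) $ ld (P 0) = 0" if "l \<le> n" "0 < l" for l
  proof -
   have "low (ld (P l)) (emb (P l))" unfolding low_def ld_def using nth_less_subdegree_zero by blast
   moreover have "low (\<Sum>x\<leftarrow>take l s. subdegree (emb (Hp x :: 'a poly poly))) (phi (take l s) :: 'a fls fps)"
    by (rule low_phi) (use s in \<open>auto dest: in_set_takeD\<close>)
   ultimately show ?thesis using low_mult ge[OF that] unfolding low_def by blast
  qed
  have "(\<Sum>l<Suc n. F l * tphi s l) $ ld (P 0) = (\<Sum>l<Suc n. (emb (P l) * phi (take l s)) $ ld (P 0))"
   unfolding fps_sum_nth by (rule sum.cong) (use ph(1) P(2) in auto)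
  also have "\<dots> = (emb (P 0) * phi (take 0 s)) $ ld (P 0) + (\<Sum>l<n. (emb (P (Suc l)) * phi (take (Suc l) s)) $ ld (P 0))"
   by (rule sum.lessThan_Suc_shift)
  also have "(\<Sum>l<n. (emb (P (Suc l)) * phi (take (Suc l) s)) $ ld (P 0)) = 0" using z by (intro sum.neutral) auto
  finally have "AK (lc (P 0)) = 0" unfolding F0 A_lc by simp
  then show False using lc_nonzero[OF P0] by simp
 qed
 then have 0: "(\<Sum>l<n. Q l * phi (take l s)) = 0" using Suc.prems(3) by simp
 have "\<forall>l<n. Q l = 0" by (rule Suc.IH[OF _ Suc.prems(2) 0]) (use Suc.prems(1) in simp)
 then show ?case using Qn less_Suc_eq by metis
qed simp

lemma Ev_cmb: "Ev 1 (th 0) (cmb P) (\<Sum>i<e. AK (poly (P i) (thA 0)) * c ^ i)"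
 unfolding cmb_def
proof (intro Ev_sum Ev_mult Ev_const vge_th0)
 fix i show "Ev 1 (th 0) (emb (P i)) (AK (poly (P i) (thA 0)))"
  using Ev_emb[of 1 "thA 0" "P i"] vge_th0[where 'a = 'a] by simp
qed

end

text \<open>Clearing \<open>c\<close> may have introduced a factor \<open>(t - \<theta>)^m\<close>
  into \<open>p\<close>. Since \<open>f\<close> does not vanish at \<open>\<theta>\<close>, the same
  factor divides \<open>P\<close>, and what remains still vanishes there because \<open>g\<close>
  does.\<close>

lemma cancel_linear:
 fixes P p' :: "'a::{finite,field} poly poly"
 assumes f: "Ev 1 (th 0) f \<alpha>" "\<alpha> \<noteq> 0" and g: "Ev 1 (th 0) g 0" and p': "poly p' (thA 0) \<noteq> 0"
  and eq: "emb P * f = emb ([:- thA 0, 1:] ^ m * p') * g"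
 shows "\<exists>P'. P = [:- thA 0, 1:] ^ m * P' \<and> poly P' (thA 0) = 0"
proof (cases "P = 0")
 case False
 let ?L = "[:- thA 0, 1:] :: 'a poly poly"
 define k where "k = order (thA 0) P"
 obtain R where R: "P = ?L ^ k * R" "\<not> ?L dvd R" using order_decomp[OF False] unfolding k_def by blast
 have R0: "poly R (thA 0) \<noteq> 0" using R(2) by (simp add: poly_eq_0_iff_dvd)
 have "\<not> k \<le> m"
 proof
  assume "k \<le> m"
  then have L: "?L ^ m = ?L ^ k * ?L ^ (m - k)" by (simp flip: power_add)
  have "emb (?L ^ k) * (emb R * f) = emb (?L ^ k) * (emb (?L ^ (m - k) * p') * g)"
   using eq unfolding R(1) L by (simp only: emb_mult mult.assoc)
  moreover have "emb (?L ^ k) \<noteq> 0" by simp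
  ultimately have e: "emb R * f = emb (?L ^ (m - k) * p') * g" by (metis mult_left_cancel)
  have E: "Ev 1 (th 0) (emb S) (AK (poly S (thA 0)))" for S :: "'a poly poly"
   using Ev_emb[of 1 "thA 0" S] vge_th0[where 'a = 'a] by simp
  have "Ev 1 (th 0) (emb R * f) (AK (poly R (thA 0)) * \<alpha>)" by (rule Ev_mult[OF E f(1)])
  moreover have "Ev 1 (th 0) (emb R * f) (AK (poly (?L ^ (m - k) * p') (thA 0)) * 0)" unfolding e by (rule Ev_mult[OF E g])
  ultimately have "AK (poly R (thA 0)) * \<alpha> = 0" using Ev_unique by fastforce
  then show False using f(2) R0 by simp
 qed
 then have "P = ?L ^ m * (?L ^ (k - m) * R)" unfolding R(1) by (simp flip: power_add mult.assoc)
 moreover have "poly (?L ^ (k - m) * R) (thA 0) = 0" using \<open>\<not> k \<le> m\<close> by simp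
 ultimately show ?thesis by blast
qed (auto intro: exI[of _ 0])

text \<open>The shortest dependence between powers of \<open>z\<close> over \<open>A\<close> has
  nonzero leading coefficient \<open>a e\<close>; multiplying \<open>z\<close> by it makes the
  dependence monic.\<close>

lemma algebraic_integral:
 assumes "algebraic_over k_in_kinf (z :: 'a::{finite,field} fls)"
 shows "\<exists>\<alpha> e. \<alpha> \<noteq> 0 \<and> alg_ext (AK \<alpha> * z) e"
proof -
 obtain p where p: "p \<noteq> 0" "\<And>i. coeff p i \<in> k_in_kinf" "poly p z = 0" using assms by (auto simp: algebraic_over_def)
 have "\<forall>i. \<exists>a b. coeff p i = AK a / AK b \<and> b \<noteq> 0" using p(2) by (force simp: k_in_kinf_def)
 then obtain x y where xy: "\<And>i. coeff p i = AK (x i) / AK (y i)" "\<And>i. y i \<noteq> 0" by metis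
 define dep where "dep n \<longleftrightarrow> (\<exists>a. (\<exists>i\<le>n. a i \<noteq> 0) \<and> (\<Sum>i\<le>n. AK (a i) * z ^ i) = 0)" for n
 have "dep (degree p)"
 proof -
  let ?n = "degree p" and ?Y = "\<Prod>i\<le>degree p. y i"
  define a where "a i = x i * (\<Prod>j\<in>{..?n} - {i}. y j)" for i
  have a: "AK (a i) = AK ?Y * coeff p i" if "i \<le> ?n" for i
  proof -
   have "?Y = y i * (\<Prod>j\<in>{..?n} - {i}. y j)" using that by (simp add: prod.remove)
   then show ?thesis using xy(2)[of i] by (simp add: a_def xy(1) AK_mult)
  qed
  have "(\<Sum>i\<le>?n. AK (a i) * z ^ i) = AK ?Y * poly p z"
   unfolding poly_altdef sum_distrib_left by (rule sum.cong) (simp_all add: a mult.assoc)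
  moreover have "a ?n \<noteq> 0" using a[of ?n] p(1) xy(2) by (metis AK_eq_0_iff finite_atMost leading_coeff_0_iff mult_eq_0_iff order_refl prod_zero_iff)
  ultimately show ?thesis unfolding dep_def using p(3) by (intro exI[of _ a]) auto
 qed
 define e where "e = (LEAST n. dep n)"
 have de: "dep e" unfolding e_def by (rule LeastI) fact
 then obtain a where a: "\<exists>i\<le>e. a i \<noteq> 0" "(\<Sum>i\<le>e. AK (a i) * z ^ i) = 0" by (auto simp: dep_def)
 have e1: "e \<ge> 1"
 proof (rule ccontr)
  assume "\<not> e \<ge> 1"
  then have "e = 0" by simp
  then show False using a by simp
 qed
 have ind: "b i = 0" if "(\<Sum>i<e. AK (b i) * z ^ i) = 0" "i < e" for b i
 proof (rule ccontr)
  assume "b i \<noteq> 0"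
  then have "dep (e - 1)" unfolding dep_def using that e1 by (intro exI[of _ b]) (auto simp: lessThan_Suc_atMost[symmetric] intro!: exI[of _ i])
  then have "e \<le> e - 1" unfolding e_def by (rule Least_le)
  then show False using e1 by simp
 qed
 have split: "(\<Sum>i\<le>e. AK (a i) * z ^ i) = (\<Sum>i<e. AK (a i) * z ^ i) + AK (a e) * z ^ e"
  by (simp add: lessThan_Suc_atMost[symmetric])
 have ae: "a e \<noteq> 0"
 proof
  assume "a e = 0"
  then have "a i = 0" if "i < e" for i using ind[of a i] split a(2) that by simp
  then show False using a(1) \<open>a e = 0\<close> by (metis le_neq_implies_less)
 qed
 let ?c = "AK (a e) * z"
 have "alg_ext ?c e"
 proof
  show "1 \<le> e" by fact
  show "b i = 0" if "(\<Sum>i<e. AK (b i) * ?c ^ i) = 0" "i < e" for b i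
  proof -
   have "(\<Sum>i<e. AK (b i * a e ^ i) * z ^ i) = 0" using that(1) by (simp add: AK_mult AK_power power_mult_distrib mult_ac)
   from ind[OF this that(2)] show ?thesis using ae by simp
  qed
  have "AK (a e) * z ^ e = - (\<Sum>i<e. AK (a i) * z ^ i)" using split a(2) by (simp add: eq_neg_iff_add_eq_0 add.commute)
  then have "AK (a e) ^ (e - 1) * (AK (a e) * z ^ e) = (\<Sum>i<e. AK (- (a i * a e ^ (e - 1))) * z ^ i)"
   by (simp add: AK_minus AK_mult AK_power sum_distrib_left sum_negf mult_ac)
  moreover have "?c ^ e = AK (a e) ^ (e - 1) * (AK (a e) * z ^ e)" using e1 by (cases e) (simp_all add: power_mult_distrib)
  moreover have "AK (- (a i * a e ^ (e - 1))) * z ^ i = AK (- (a i * a e ^ (e - 1 - i))) * ?c ^ i" if "i < e" for i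
  proof -
   have "a e ^ (e - 1) = a e ^ (e - 1 - i) * a e ^ i" using that by (simp flip: power_add)
   then show ?thesis by (simp add: AK_minus AK_mult AK_power power_mult_distrib)
  qed
  ultimately have "?c ^ e = (\<Sum>i<e. AK (- (a i * a e ^ (e - 1 - i))) * ?c ^ i)" by simp
  then show "\<exists>a'. ?c ^ e = (\<Sum>i<e. AK (a' i) * ?c ^ i)" by (rule exI[of _ "\<lambda>i. - (a i * a e ^ (e - 1 - i))"])
 qed
 then show ?thesis using ae by blast
qed

text \<open>Of the relation given by the criterion only the values at \<open>\<theta>\<close> and
  the twisted equations are kept: the coefficient at \<open>s\<close> does not vanish at
  \<open>\<theta>\<close>, those at the shorter nonempty segments do.\<close>

theorem main_relation:
 fixes s :: "nat list"
 defines "r \<equiv> length s"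
 assumes s: "\<forall>x\<in>set s. x \<ge> 1" "s \<noteq> []"
  and alg: "algebraic_over k_in_kinf (zeta_A s / zeta_A [sum_list s] :: 'a::{finite,field} fls)"
 shows "\<exists>P :: nat => 'a poly poly. poly (P r) (thA 0) \<noteq> 0 \<and> (\<forall>l. 1 \<le> l \<longrightarrow> l < r \<longrightarrow> poly (P l) (thA 0) = 0)
  \<and> (\<forall>l. 1 \<le> l \<longrightarrow> l < r \<longrightarrow> bp ^ sum_list (drop l s) * (P l + P (Suc l) * Hp (s ! l)) * tw 1 (P r) = tw 1 (P l) * P r)"
proof -
 define w where "w = sum_list s"
 have w1: "w \<ge> 1" using s by (cases s) (auto simp: w_def)
 have zw: "zeta_A [w] \<noteq> (0 :: 'a fls)" using w1 by (rule zeta_A_single_nonzero)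
 have r1: "r \<ge> 1" using s by (cases s) (auto simp: r_def)
 obtain \<alpha> e where \<alpha>: "\<alpha> \<noteq> 0" and ext: "alg_ext (AK \<alpha> * (zeta_A s / zeta_A [w]) :: 'a fls) e"
  using algebraic_integral[OF alg] unfolding w_def by blast
 define c :: "'a fls" where "c = AK \<alpha> * (zeta_A s / zeta_A [w])"
 interpret alg_ext c e using ext unfolding c_def .
 interpret tree_system c e "Suc (Suc r)" "tpar s" "tW s" "tH s" "tphi s" unfolding r_def by (rule phi_tree[OF s]) simp
 have ph: "tphi s l = (phi (take l s) :: 'a fls fps)" "tW s l = sum_list (take l s)" "tpar s l = l - 1" "tH s l = (Hp (s ! (l - 1)) :: 'a poly poly)" if "l \<le> r" for l
  using that by (auto simp: tphi_def tW_def tpar_def tH_def r_def)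
 have phw: "tphi s (Suc r) = (phi [w] :: 'a fls fps)" "tW s (Suc r) = w" "tpar s (Suc r) = 0"
  by (simp_all add: tphi_def tW_def tpar_def r_def w_def)
 have phr: "tphi s r = (phi s :: 'a fls fps)" "tW s r = w" using ph[of r] by (simp_all add: r_def w_def)
 have drop: "tW s r - tW s l = sum_list (drop l s)" if "l \<le> r" for l
 proof -
  have "w = sum_list (take l s) + sum_list (drop l s)" unfolding w_def by (metis append_take_drop_id sum_list_append)
  then show ?thesis using ph(2)[OF that] phr by simp
 qed
 obtain \<kappa> where \<kappa>: "c = (\<Sum>i<e. AK (\<kappa> i) * c ^ i)" using power_span[of 1] by auto
 define gs where "gs = (gams s :: 'a poly)"
 define gw where "gw = (gams [w] :: 'a poly)"
 have g0: "gs \<noteq> 0" "gw \<noteq> 0" by (simp_all add: gs_def gw_def gams_nonzero)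
 \<comment> \<open>The relation \<open>\<alpha> * gw * (gs * zeta_A s) - gs * c * (gw * zeta_A [w])
   = 0\<close>, which only restates the definition of \<open>c\<close>; the
   \<open>\<kappa> i\<close> are the coordinates of \<open>c\<close> itself and also cover
   \<open>e = 1\<close>.\<close>
 define \<rho> where "\<rho> l i = (if l = r then if i = 0 then \<alpha> * gw else 0 else if l = Suc r then - (gs * \<kappa> i) else 0)" for l i :: nat
 define v where "v l = (\<Sum>i<e. AK (\<rho> l i) * c ^ i)" for l
 have v: "v r = AK (\<alpha> * gw)" "v (Suc r) = - AK gs * c" "l \<noteq> r ==> l \<noteq> Suc r ==> v l = 0" for l
 proof -
  have "v r = (\<Sum>i<e. if i = 0 then AK (\<alpha> * gw) else 0)" unfolding v_def by (rule sum.cong) (auto simp: \<rho>_def)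
  then show "v r = AK (\<alpha> * gw)" using e_pos by simp
  have "v (Suc r) = - AK gs * (\<Sum>i<e. AK (\<kappa> i) * c ^ i)"
   unfolding v_def sum_distrib_left by (rule sum.cong) (simp_all add: \<rho>_def AK_minus AK_mult mult.assoc)
  then show "v (Suc r) = - AK gs * c" using \<kappa> by simp
  show "l \<noteq> r ==> l \<noteq> Suc r ==> v l = 0" by (simp add: v_def \<rho>_def)
 qed
 have "Ev 1 (th 0) (\<Sum>l<Suc (Suc r). fps_const (v l) * tphi s l) 0"
 proof -
  have "(\<Sum>l<Suc (Suc r). fps_const (v l) * tphi s l) = (\<Sum>l<r. fps_const (v l) * tphi s l) + fps_const (v r) * phi s + fps_const (v (Suc r)) * phi [w]"
   by (simp add: phr phw)
  also have "(\<Sum>l<r. fps_const (v l) * tphi s l) = 0" using v(3) by (intro sum.neutral) auto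
  finally have 1: "(\<Sum>l<Suc (Suc r). fps_const (v l) * tphi s l) = fps_const (v r) * phi s + fps_const (v (Suc r)) * phi [w]" by simp
  have "Ev 1 (th 0) (fps_const (v r) * phi s + fps_const (v (Suc r)) * phi [w]) (v r * (AK gs * zeta_A s) + v (Suc r) * (AK gw * zeta_A [w]))"
   unfolding gs_def gw_def using s w1 by (intro Ev_add Ev_mult Ev_const vge_th0 zeta_A_Ev) auto
  moreover have "v r * (AK gs * zeta_A s) + v (Suc r) * (AK gw * zeta_A [w]) = 0"
   unfolding v c_def using zw by (simp add: AK_mult)
  ultimately show ?thesis unfolding 1 by simp
 qed
 from tree_criterion[of r 0 \<rho>, OF _ _ _ this[unfolded v_def]]
 obtain P0 \<mu> where P0: "\<mu> \<noteq> 0" "\<And>l i. l < Suc (Suc r) ==> i < e ==> poly (P0 l i) (thA 0) = \<mu> * \<rho> l i" "(\<Sum>l<Suc (Suc r). cmb (P0 l) * tphi s l) = 0"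
  using \<alpha> g0 e_pos by (auto simp: \<rho>_def)
 define F0 where "F0 l = cmb (P0 l)" for l
 have F0O: "F0 l \<in> OT" for l by (simp add: F0_def OT_def)
 have F0v: "Ev 1 (th 0) (F0 l) (AK \<mu> * v l)" if "l < Suc (Suc r)" for l
 proof -
  have "(\<Sum>i<e. AK (poly (P0 l i) (thA 0)) * c ^ i) = AK \<mu> * v l"
   unfolding v_def sum_distrib_left by (rule sum.cong) (simp_all add: P0(2)[OF that] AK_mult mult.assoc)
  then show ?thesis using Ev_cmb[of "P0 l"] unfolding F0_def by simp
 qed
 have vr: "AK \<mu> * v r \<noteq> 0" using v(1) P0(1) \<alpha> g0 by simp
 have F0r: "F0 r \<noteq> 0"
 proof
  assume z: "F0 r = 0"
  have "AK \<mu> * v r = 0" by (rule Ev_unique[OF F0v[of r, unfolded z] Ev_0[OF vge_th0]]) simp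
  then show False using vr by simp
 qed
 obtain N p where N: "N \<in> OT" "p \<noteq> 0" "N * F0 r = emb p" using norm_exists[OF F0O F0r] by blast
 define F where "F l = N * F0 l" for l
 have FO: "F l \<in> OT" for l unfolding F_def by (intro OT_mult N F0O)
 have rel: "(\<Sum>l<Suc (Suc r). F l * tphi s l) = 0"
 proof -
  have "(\<Sum>l<Suc (Suc r). F l * tphi s l) = N * (\<Sum>l<Suc (Suc r). F0 l * tphi s l)" unfolding sum_distrib_left F_def by (simp only: mult.assoc)
  then show ?thesis using P0(3) unfolding F0_def by simp
 qed
 have set: "{..<Suc (Suc r)} - {r} = insert (Suc r) {..<r}" by auto
 \<comment> \<open>Independence of all series but the one at \<open>s\<close>: the known relation
   eliminates \<open>phi [w]\<close> and leaves a relation on the chain, whose last coefficient is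
   \<open>Q (Suc r) * F r\<close>.\<close>
 have low: "\<forall>l\<in>{..<Suc (Suc r)} - {r}. Q l = 0" if Q: "\<And>l. Q l \<in> OT" "(\<Sum>l\<in>{..<Suc (Suc r)} - {r}. Q l * tphi s l) = 0" for Q
 proof -
  have Q0: "Q (Suc r) * phi [w] + (\<Sum>l<r. Q l * phi (take l s)) = 0"
  proof -
   have "(\<Sum>l<r. Q l * phi (take l s)) = (\<Sum>l<r. Q l * tphi s l)" by (rule sum.cong) (simp_all add: ph)
   then show ?thesis using Q(2) unfolding set by (simp add: phw)
  qed
  have rel': "(\<Sum>l<r. F l * phi (take l s)) + F r * phi s + F (Suc r) * phi [w] = 0"
  proof -
   have "(\<Sum>l<r. F l * phi (take l s)) = (\<Sum>l<r. F l * tphi s l)" by (rule sum.cong) (simp_all add: ph)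
   then show ?thesis using rel by (simp add: phw phr)
  qed
  define G where "G l = Q (Suc r) * F l - (if l < r then F (Suc r) * Q l else 0)" for l
  have "(\<Sum>l<Suc r. G l * phi (take l s)) = (\<Sum>l<r. G l * phi (take l s)) + Q (Suc r) * F r * phi s" by (simp add: G_def r_def)
  also have "(\<Sum>l<r. G l * phi (take l s)) = Q (Suc r) * (\<Sum>l<r. F l * phi (take l s)) - F (Suc r) * (\<Sum>l<r. Q l * phi (take l s))"
   unfolding sum_distrib_left sum_subtractf[symmetric] by (rule sum.cong) (simp_all add: G_def algebra_simps)
  also have "\<dots> + Q (Suc r) * F r * phi s = Q (Suc r) * ((\<Sum>l<r. F l * phi (take l s)) + F r * phi s + F (Suc r) * phi [w]) - F (Suc r) * (Q (Suc r) * phi [w] + (\<Sum>l<r. Q l * phi (take l s)))"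
   by (simp add: algebra_simps)
  finally have G0: "(\<Sum>l<Suc r. G l * phi (take l s)) = 0" unfolding rel' Q0 by simp
  have GO: "G l \<in> OT" for l unfolding G_def diff_conv_add_uminus by (intro OT_add OT_uminus OT_mult Q FO) (simp add: OT_mult Q FO)
  have "\<forall>l<Suc r. G l = 0" by (rule chain_independent[OF s _ GO G0]) (simp add: r_def)
  then have "Q (Suc r) * F r = 0" by (auto simp: G_def)
  then have Qr: "Q (Suc r) = 0" using N F_def by simp
  then have Q1: "(\<Sum>l<r. Q l * phi (take l s)) = 0" using Q0 by simp
  have "\<forall>l<r. Q l = 0" by (rule chain_independent[OF s _ Q(1) Q1]) (simp add: r_def)
  then show ?thesis using Qr unfolding set by auto
 qed
 \<comment> \<open>At the root the sum over children would also contain the branch of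
   \<open>w\<close>, so \<open>l\<close> starts at 1.\<close>
 have eq: "bb ^ sum_list (drop l s) * (F l + F (Suc l) * emb (Hp (s ! l))) * tau 1 (emb p) = tau 1 (F l) * emb p" if l: "1 \<le> l" "l < r" for l
 proof -
  have "tpar s k = l \<longleftrightarrow> k = Suc l" if "k \<in> {0<..<Suc (Suc r)}" for k using that l by (auto simp: tpar_def r_def)
  then have "{k \<in> {0<..<Suc (Suc r)}. tpar s k = l} = {Suc l}" using l by auto
  moreover have "tH s (Suc l) = (Hp (s ! l) :: 'a poly poly)" using ph(4)[of "Suc l"] l by simp
  moreover have "bb ^ (tW s r - tW s l) * (F l + (\<Sum>k\<in>{k\<in>{0<..<Suc (Suc r)}. tpar s k = l}. F k * emb (tH s k))) * tau 1 (F r) = tau 1 (F l) * F r"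
  proof (rule relation_twist[OF _ _ _ low FO rel])
   show "tW s k \<le> tW s r" if "k < Suc (Suc r)" for k
   proof (cases "k = Suc r")
    case False
    then have "k \<le> r" using that by simp
    then show ?thesis using ph(2)[of k] ph(2)[of r] sum_list_take_mono[of k r s] by simp
   qed (simp add: phw phr)
   show "tpar s k \<noteq> r" if "0 < k" "k < Suc (Suc r)" for k using that r1 by (auto simp: tpar_def r_def)
  qed (use l in auto)
  ultimately show ?thesis using N(3) drop[of l] l by (simp add: F_def)
 qed
 have "\<exists>P. P r = p \<and> (\<forall>l. 1 \<le> l \<longrightarrow> l \<le> r \<longrightarrow> F l = emb (P l))
  \<and> (\<forall>l. 1 \<le> l \<longrightarrow> l < r \<longrightarrow> bp ^ sum_list (drop l s) * (P l + P (Suc l) * Hp (s ! l)) * tw 1 (P r) = tw 1 (P l) * P r)"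
 proof (rule chain_descent[where F = F and D = "\<lambda>l. sum_list (drop l s)" and x = "\<lambda>l. s ! l", OF N(2) FO _ _ eq])
  show "F r = emb p" using N(3) by (simp add: F_def)
  show "sum_list (drop l s) > 0" if "1 \<le> l" "l < r" for l
   using sum_list_take_less[OF s(1) that(2)] drop[of l] ph(2)[of l] ph(2)[of r] that by (simp add: r_def)
 qed
 then obtain P where P: "P r = p" "\<And>l. 1 \<le> l ==> l \<le> r ==> F l = emb (P l)"
  "\<And>l. 1 \<le> l ==> l < r ==> bp ^ sum_list (drop l s) * (P l + P (Suc l) * Hp (s ! l)) * tw 1 (P r) = tw 1 (P l) * P r" by blast
 let ?L = "[:- thA 0, 1:] :: 'a poly poly"
 define m where "m = order (thA 0) p"
 obtain p' where p': "p = ?L ^ m * p'" "\<not> ?L dvd p'" using order_decomp[OF N(2)] unfolding m_def by blast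
 have p'0: "poly p' (thA 0) \<noteq> 0" using p'(2) by (simp add: poly_eq_0_iff_dvd)
 have "\<exists>P'. P l = ?L ^ m * P' \<and> (if l = r then P' = p' else poly P' (thA 0) = 0)" if l: "1 \<le> l" "l \<le> r" for l
 proof (cases "l = r")
  case True then show ?thesis using P(1) p'(1) by auto
 next
  case False
  have "emb (P l) * F0 r = emb (?L ^ m * p') * F0 l"
   unfolding P(2)[OF l, symmetric] p'(1)[symmetric] N(3)[symmetric] F_def by (simp only: mult_ac)
  moreover have "Ev 1 (th 0) (F0 l) 0" using F0v[of l] v(3)[of l] False l by simp
  ultimately show ?thesis using cancel_linear[OF F0v[of r] vr _ p'0] False by simp
 qed
 then obtain R where R: "\<And>l. 1 \<le> l ==> l \<le> r ==> P l = ?L ^ m * R l" "\<And>l. 1 \<le> l ==> l \<le> r ==> if l = r then R l = p' else poly (R l) (thA 0) = 0" by metis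
 have "bp ^ sum_list (drop l s) * (R l + R (Suc l) * Hp (s ! l)) * tw 1 (R r) = tw 1 (R l) * R r" if l: "1 \<le> l" "l < r" for l
 proof -
  have "(?L ^ m * tw 1 (?L ^ m)) * (bp ^ sum_list (drop l s) * (R l + R (Suc l) * Hp (s ! l)) * tw 1 (R r)) = (?L ^ m * tw 1 (?L ^ m)) * (tw 1 (R l) * R r)"
   using P(3)[OF l] l r1 unfolding R(1)[OF l(1) less_imp_le[OF l(2)]] R(1)[of r, OF r1 order_refl] R(1)[of "Suc l", OF le_SucI[OF l(1)] Suc_leI[OF l(2)]] tw_mult
   by (simp only: distrib_left mult_ac)
  moreover have "?L ^ m * tw 1 (?L ^ m) \<noteq> 0" by simp
  ultimately show ?thesis by (metis mult_left_cancel)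
 qed
 moreover have "poly (R r) (thA 0) \<noteq> 0" using R(2)[of r] r1 p'0 by simp
 moreover have "poly (R l) (thA 0) = 0" if "1 \<le> l" "l < r" for l using R(2)[of l] that by simp
 ultimately show ?thesis by (intro exI[of _ R]) auto
qed

section \<open>The product \<open>\<Omega>\<close>\<close>

text \<open>Partial products of the Anderson-Thakur function without its factor
  \<open>(-\<theta>)^(-q/(q-1))\<close>, which in general lies outside the completed field. This is
  why \<open>Om_tau\<close> has the extra factor \<open>- \<theta>^q\<close>.\<close>

definition Omn :: "nat => 'a::{finite,field} fls fps" where
 "Omn n = (\<Prod>j\<in>{1..n}. 1 - fps_X * fps_const (1 / th j))"
definition omn :: "nat => 'a::{finite,field} fls" where "omn n = (\<Prod>j\<in>{1..n}. 1 - th 0 / th j)"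

lemma vge_inverse_th: "vge (int (CARD('a) ^ j)) (1 / th j :: 'a::{finite,field} fls)"
 by (simp add: vge_inverse flip: inverse_eq_divide)

lemma NB_Om_factor: "NB 1 (1 - int (CARD('a) ^ j)) (fps_X * fps_const (1 / th j) :: 'a::{finite,field} fls fps)"
 using NB_mult[OF NB_X[of 1] NB_const[of "- int (CARD('a) ^ j)" "1 / th j :: 'a fls" 1]] vge_inverse_th[of j, where 'a = 'a] by simp

lemma NB_Omn: "NB 1 0 (Omn n :: 'a::{finite,field} fls fps)"
proof -
 have "NB 1 (\<Sum>j\<in>{1..n}. 0) (Omn n :: 'a fls fps)" unfolding Omn_def
 proof (rule NB_prod')
  fix j
  have "NB 1 0 (fps_X * fps_const (1 / th j) :: 'a fls fps)"
   by (rule NB_mono[OF NB_Om_factor]) (use card_power_pos[where 'a = 'a and n = j] in linarith)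
  then show "NB 1 0 (1 - fps_X * fps_const (1 / th j) :: 'a fls fps)" by (intro NB_diff NB_1)
 qed
 then show ?thesis by simp
qed

lemma Omn_Suc: "Omn (Suc n) = Omn n - Omn n * (fps_X * fps_const (1 / th (Suc n)))"
 by (simp add: Omn_def algebra_simps)

lemma Omn_tau: "Omn (Suc n) = (1 - fps_X * fps_const (1 / th 1)) * tau 1 (Omn n :: 'a::{finite,field} fls fps)"
proof -
 have "tau 1 (Omn n) = (\<Prod>j\<in>{1..n}. 1 - fps_X * fps_const (1 / th (Suc j)) :: 'a fls fps)"
  unfolding Omn_def tau_prod
 proof (rule prod.cong[OF refl])
  fix j
  have "(1 / th j :: 'a fls) ^ CARD('a) ^ 1 = 1 / th (Suc j)" unfolding power_one_over th_power by simp
  then show "tau 1 (1 - fps_X * fps_const (1 / th j)) = (1 - fps_X * fps_const (1 / th (Suc j)) :: 'a fls fps)" by simp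
 qed
 also have "\<dots> = (\<Prod>j\<in>{2..Suc n}. 1 - fps_X * fps_const (1 / th j))"
  using prod.shift_bounds_cl_Suc_ivl[of "\<lambda>j. 1 - fps_X * fps_const (1 / th j) :: 'a fls fps" 1 n] by (simp add: numeral_2_eq_2)
 finally show ?thesis unfolding Omn_def by (subst prod.atLeast_Suc_atMost) (simp_all add: numeral_2_eq_2)
qed

definition Om :: "'a::{finite,field} fls fps" where
 "Om = (SOME l. \<forall>C. \<exists>D0. \<forall>D\<ge>D0. NB 1 (- C) (Omn D - l))"

lemma int_less_card_power: "\<exists>n0. \<forall>n\<ge>n0. C \<le> int (CARD('a::{finite,field}) ^ n)"
proof (intro exI allI impI)
 fix n assume n: "n \<ge> nat C"
 have "n < CARD('a) ^ n" using card_ge_2[where 'a = 'a] by (intro power_gt_expt) simp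
 then have "int n \<le> int (CARD('a) ^ n)" by (simp only: of_nat_le_iff)
 then show "C \<le> int (CARD('a) ^ n)" using n by linarith
qed

lemma Om_limit: "\<exists>D0. \<forall>D\<ge>D0. NB 1 (- C) (Omn D - Om :: 'a::{finite,field} fls fps)"
proof -
 have "\<exists>D0. \<forall>D\<ge>D0. NB 1 (- C) (Omn (Suc D) - Omn D :: 'a fls fps)" for C
 proof -
  obtain n0 where n0: "\<forall>n\<ge>n0. C + 1 \<le> int (CARD('a) ^ n)" using int_less_card_power[where 'a = 'a] by blast
  have "NB 1 (- C) (Omn (Suc D) - Omn D :: 'a fls fps)" if "D \<ge> n0" for D
  proof -
   have "NB 1 (0 + (1 - int (CARD('a) ^ Suc D))) (Omn D * (fps_X * fps_const (1 / th (Suc D))) :: 'a fls fps)"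
    by (intro NB_mult NB_Omn NB_Om_factor)
   then have "NB 1 (- C) (Omn D * (fps_X * fps_const (1 / th (Suc D))) :: 'a fls fps)"
    by (rule NB_mono) (use n0[rule_format, of "Suc D"] that in linarith)
   from NB_diff[OF NB_0 this] show ?thesis unfolding Omn_Suc by simp
  qed
  then show ?thesis by blast
 qed
 from someI_ex[OF fps_Cauchy_limit[OF this]] show ?thesis unfolding Om_def by blast
qed

lemma DD_Omn: "DD 1 (Omn n :: 'a::{finite,field} fls fps)"
 unfolding Omn_def by (intro DD_prod DD_diff DD_mult DD_1 DD_X DD_const)

lemma DD_Om: "DD 1 (Om :: 'a::{finite,field} fls fps)"
proof (rule DD_limit)
 fix M
 obtain D where "NB 1 (- (- M)) (Omn D - Om :: 'a fls fps)" using Om_limit[of "- M", where 'a = 'a] by blast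
 from NB_diff[OF NB_0 this] have "NB 1 M (Om - Omn D :: 'a fls fps)" by simp
 then show "\<exists>g. DD 1 g \<and> NB 1 M (Om - g :: 'a fls fps)" using DD_Omn by blast
qed

lemma Om_tau: "bb * tau 1 Om = - (fps_const (th 1) * Om :: 'a::{finite,field} fls fps)"
proof -
 let ?F = "1 - fps_X * fps_const (1 / th 1) :: 'a fls fps" and ?q = "int (CARD('a) ^ 1)"
 have "NB 1 (- C) (Om - ?F * tau 1 Om :: 'a fls fps)" for C
 proof -
  let ?C = "\<bar>C\<bar>"
  obtain D0 where D0: "\<forall>D\<ge>D0. NB 1 (- ?C) (Omn D - Om :: 'a fls fps)" using Om_limit by blast
  have q1: "?q \<ge> 1" using card_ge_2[where 'a = 'a] by simp
  have "NB 1 (?q * (- ?C)) (tau 1 (Omn D0 - Om :: 'a fls fps))" using NB_mono_r[OF NB_tau[OF D0[rule_format, OF order_refl], of 1], of 1] q1 by simp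
  moreover have "1 * ?C \<le> ?q * ?C" by (rule mult_right_mono[OF q1]) simp
  ultimately have t: "NB 1 (- ?C) (tau 1 (Omn D0 - Om :: 'a fls fps))" by (elim NB_mono) simp
  have "NB 1 0 ?F" using NB_Omn[of 1, where 'a = 'a] by (simp add: Omn_def)
  from NB_mult[OF this t] have "NB 1 (- ?C) (?F * tau 1 (Omn D0 - Om))" by simp
  moreover have "NB 1 (- ?C) (Omn (Suc D0) - Om :: 'a fls fps)" using D0 by simp
  ultimately have "NB 1 (- ?C) (?F * tau 1 (Omn D0 - Om) - (Omn (Suc D0) - Om))" by (rule NB_diff)
  moreover have "?F * tau 1 (Omn D0 - Om) - (Omn (Suc D0) - Om) = Om - ?F * tau 1 Om" unfolding Omn_tau tau_diff by (simp only: right_diff_distrib) simp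
  ultimately have "NB 1 (- ?C) (Om - ?F * tau 1 Om)" by (simp only:)
  then show ?thesis by (rule NB_mono) simp
 qed
 then have "Om = ?F * tau 1 Om" using NB_small_eq_0[of 1 "Om - ?F * tau 1 Om"] by simp
 then have "fps_const (th 1) * Om = fps_const (th 1) * ?F * tau 1 (Om :: 'a fls fps)" by (simp only: mult.assoc)
 also have "fps_const (th 1) * ?F = - (bb :: 'a fls fps)"
 proof -
  have "fps_const (th 1) * (fps_X * fps_const (1 / th 1)) = (fps_X :: 'a fls fps) * (fps_const (th 1) * fps_const (1 / th 1))" by (simp only: mult_ac)
  also have "\<dots> = fps_X" by (simp add: fps_const_mult del: One_nat_def)
  finally show ?thesis by (simp add: bb_def right_diff_distrib)
 qed
 finally show ?thesis by simp
qed

definition omega :: "'a::{finite,field} fls" where "omega = (THE x. Ev 1 (th 0) Om x)"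

lemma Ev_Om: "Ev 1 (th 0) Om (omega :: 'a::{finite,field} fls)"
proof -
 obtain x where x: "Ev 1 (th 0) Om (x :: 'a fls)" using Ev_exists[OF vge_th0 DD_Om] by blast
 then show ?thesis unfolding omega_def by (rule theI) (rule Ev_unique[OF _ x])
qed

lemma Ev_Omn: "Ev 1 (th 0) (Omn n) (omn n :: 'a::{finite,field} fls)"
proof -
 have "Ev 1 (th 0) (Omn n) (\<Prod>j\<in>{1..n}. 1 - th 0 * (1 / th j) :: 'a fls)"
  unfolding Omn_def by (intro Ev_prod Ev_diff Ev_mult Ev_1 Ev_X Ev_const vge_th0)
 then show ?thesis by (simp add: omn_def)
qed

lemma omn_limit: "\<exists>D0. \<forall>D\<ge>D0. vge C (omn D - omega :: 'a::{finite,field} fls)"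
proof -
 obtain D0 where D0: "\<forall>D\<ge>D0. NB 1 (- C) (Omn D - Om :: 'a fls fps)" using Om_limit by blast
 have "vge (- (- C)) (omn D - omega :: 'a fls)" if "D \<ge> D0" for D
  by (rule Ev_bound[OF Ev_diff[OF Ev_Omn Ev_Om]]) (use D0 that in blast)
 then show ?thesis by auto
qed

section \<open>Rationality\<close>

lemma frobenius_fixed:
 assumes "x ^ CARD('a) = (x :: 'a::{finite,field} fls)" shows "\<exists>c. x = fls_const c"
proof -
 have sd0: "fls_subdegree y = 0" if "y ^ CARD('a) = y" "y \<noteq> 0" for y :: "'a fls"
 proof -
  have "int CARD('a) * fls_subdegree y = fls_subdegree y" using that fls_subdegree_pow[of y "CARD('a)"] by simp
  then have "(int CARD('a) - 1) * fls_subdegree y = 0" by (simp add: algebra_simps)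
  then show ?thesis using card_ge_2[where 'a = 'a] by simp
 qed
 define y where "y = x - fls_const (x $$ 0)"
 have "y ^ CARD('a) = y"
  using fls_frob_diff[of x "fls_const (x $$ 0)" 1] assms by (simp add: y_def fls_const_power[symmetric] finite_field_power_card)
 moreover have "y $$ 0 = 0" by (simp add: y_def)
 ultimately have "y = 0" using sd0[of y] nth_fls_subdegree_nonzero[of y] by force
 then show ?thesis by (auto simp: y_def)
qed

lemma fls_const_sum: "fls_const (\<Sum>i\<in>S. g i) = (\<Sum>i\<in>S. fls_const (g i) :: 'b::comm_monoid_add fls)"
 by (induction S rule: infinite_finite_induct) (simp_all flip: fls_plus_const)

text \<open>The quotient \<open>f / g\<close> is fixed by the twist, so its coefficients lie in the
  finite field. Then the coefficients of \<open>t^n0 * f\<close> lie in \<open>A\<close>, and being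
  convergent they are eventually 0. Reading off one power of \<open>\<theta>\<close> exhibits the
  quotient as a rational function over the finite field.\<close>

lemma rationality:
 fixes f :: "'a::{finite,field} fls fps" and g :: "'a poly poly"
 assumes f: "DD 1 f" "Ev 1 (th 0) f F" and g: "g \<noteq> 0" and eq: "tau 1 f * emb g = tau 1 (emb g) * f"
 shows "F \<in> k_in_kinf"
proof -
 \<comment> \<open>The quotient may have a pole at \<open>t = 0\<close>; the factor
   \<open>fps_X ^ n0\<close> makes it a power series.\<close>
 define n0 where "n0 = subdegree (emb g)"
 have g0: "emb g \<noteq> 0" using g by simp
 have "emb g dvd fps_X ^ n0 * f" using g0 by (intro dvd_mult2) (simp add: fps_dvd_iff n0_def)
 then obtain y where y: "fps_X ^ n0 * f = emb g * y" by (auto simp: dvd_def)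
 have "tau 1 y = y"
 proof -
  have ty: "fps_X ^ n0 * tau 1 f = tau 1 (emb g) * tau 1 y" using arg_cong[OF y, of "tau 1"] by simp
  have "(tau 1 (emb g) * emb g) * tau 1 y = emb g * (fps_X ^ n0 * tau 1 f)" unfolding ty by (simp only: mult_ac)
  also have "\<dots> = fps_X ^ n0 * (tau 1 f * emb g)" by (simp only: mult_ac)
  also have "\<dots> = tau 1 (emb g) * (fps_X ^ n0 * f)" unfolding eq by (simp only: mult_ac)
  also have "\<dots> = (tau 1 (emb g) * emb g) * y" unfolding y by (simp only: mult_ac)
  finally show ?thesis using g0 by simp
 qed
 then have "(y $ n) ^ CARD('a) = y $ n" for n using tau_nth[of 1 y n] by simp
 then have "\<forall>n. \<exists>c. y $ n = fls_const c" using frobenius_fixed by blast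
 then obtain \<eta> where \<eta>: "\<And>n. y $ n = fls_const (\<eta> n)" by metis
 define b where "b n = (\<Sum>j\<le>n. smult (\<eta> j) (coeff g (n - j)))" for n
 have b: "(fps_X ^ n0 * f) $ n = AK (b n)" for n
  unfolding y mult.commute[of "emb g"] fps_mult_nth b_def by (simp add: \<eta> AK_sum AK_smult atMost_atLeast0)
 have "DD 1 (fps_X ^ n0 * f)" by (intro DD_mult DD_power DD_X f)
 then obtain M0 where M0: "\<forall>n\<ge>M0. vge (1 * int n + 0) ((fps_X ^ n0 * f) $ n)" unfolding DD_def by blast
 have "b n = 0" if "n \<ge> Suc M0" for n
 proof (rule vge_1_A)
  have "vge (1 * int n + 0) (AK (b n))" using M0 that unfolding b[symmetric] by simp
  then show "vge 1 (AK (b n))" by (rule vge_mono) (use that in simp)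
 qed
 define M where "M = Suc M0"
 have bM: "b n = 0" if "n \<ge> M" for n using \<open>\<And>n. n \<ge> Suc M0 ==> b n = 0\<close> that by (simp add: M_def)
 obtain j0 where "coeff g j0 \<noteq> 0" using g by (meson leading_coeff_0_iff)
 then obtain m where m: "coeff (coeff g j0) m \<noteq> 0" by (meson leading_coeff_0_iff)
 \<comment> \<open>The part of \<open>g\<close> at a fixed power of \<open>\<theta>\<close> at which
   it is nonzero; multiplying \<open>y\<close> by it gives the same part of the polynomial
   \<open>t^n0 * f\<close>.\<close>
 define G where "G = map_poly (\<lambda>a. coeff a m) g"
 have G: "coeff G n = coeff (coeff g n) m" for n by (simp add: G_def coeff_map_poly)
 have G0: "G \<noteq> 0" using m G[of j0] by auto
 define Q where "Q = (\<Sum>n<M. monom (coeff (b n) m) n)"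
 have Q: "coeff Q n = coeff (b n) m" for n
 proof -
  have "coeff Q n = (\<Sum>i<M. if i = n then coeff (b i) m else 0)" by (simp add: Q_def coeff_sum)
  then show ?thesis using bM[of n] by (cases "n < M") simp_all
 qed
 define lift :: "'a poly => 'a poly poly" where "lift = map_poly (\<lambda>c. [:c:])"
 have lift: "emb (lift R) $ n = fls_const (coeff R n)" for R n by (simp add: lift_def coeff_map_poly AK_const)
 have lift_th: "poly (lift R) (thA 0) = R" for R
 proof -
  have "poly (lift R) (thA 0) = pcompose R [:0, 1:]" by (simp add: lift_def pcompose_altdef thA_def monom_altdef)
  then show ?thesis by (simp add: pcompose_idR)
 qed
 have "y * emb (lift G) = emb (lift Q)"
 proof (rule fps_ext)
  fix n
  have "(y * emb (lift G)) $ n = fls_const (\<Sum>j\<le>n. \<eta> j * coeff G (n - j))"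
   unfolding fps_mult_nth lift \<eta> by (simp add: atMost_atLeast0 fls_const_sum)
  also have "(\<Sum>j\<le>n. \<eta> j * coeff G (n - j)) = coeff Q n" by (simp add: Q G b_def coeff_sum)
  finally show "(y * emb (lift G)) $ n = emb (lift Q) $ n" unfolding lift .
 qed
 then have main: "emb (lift G) * (fps_X ^ n0 * f) = emb (lift Q) * emb g" unfolding y by (metis mult.assoc mult.commute)
 have E: "Ev 1 (th 0) (emb S) (AK (poly S (thA 0)))" for S :: "'a poly poly"
  using Ev_emb[of 1 "thA 0" S] vge_th0[where 'a = 'a] by simp
 have "Ev 1 (th 0) (emb (lift G) * (fps_X ^ n0 * f)) (AK G * (th 0 ^ n0 * F))"
  using E[of "lift G"] unfolding lift_th by (intro Ev_mult Ev_power Ev_X f vge_th0)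
 moreover have "Ev 1 (th 0) (emb (lift Q) * emb g) (AK Q * AK (poly g (thA 0)))"
  using E[of "lift Q"] unfolding lift_th by (intro Ev_mult E)
 ultimately have "AK G * (th 0 ^ n0 * F) = AK Q * AK (poly g (thA 0))" unfolding main by (rule Ev_unique)
 then have "AK (G * thA 0 ^ n0) * F = AK (Q * poly g (thA 0))" by (simp add: AK_mult AK_power mult_ac)
 moreover have "G * thA 0 ^ n0 \<noteq> 0" using G0 by simp
 ultimately have "F = AK (Q * poly g (thA 0)) / AK (G * thA 0 ^ n0)" by (simp add: field_simps)
 then show ?thesis using \<open>G * thA 0 ^ n0 \<noteq> 0\<close> unfolding k_in_kinf_def by blast
qed

lemma k_mult: "x \<in> k_in_kinf ==> y \<in> k_in_kinf ==> x * y \<in> (k_in_kinf :: 'a::field fls set)"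
proof -
 assume "x \<in> k_in_kinf" "y \<in> k_in_kinf"
 then obtain a b a' b' where "x = AK a / AK b" "b \<noteq> 0" "y = AK a' / AK b'" "b' \<noteq> (0 :: 'a poly)" by (auto simp: k_in_kinf_def)
 then show ?thesis unfolding k_in_kinf_def by (intro CollectI exI[of _ "a * a'"] exI[of _ "b * b'"]) (simp add: AK_mult)
qed
lemma k_inverse_A: "1 / AK a \<in> (k_in_kinf :: 'a::field fls set)"
proof (cases "a = 0")
 case True
 have "(0 :: 'a fls) = AK 0 / AK 1" by simp
 then show ?thesis using True unfolding k_in_kinf_def by (metis (mono_tags, lifting) AK_0 CollectI div_by_0 zero_neq_one)
next
 case False
 have "1 / AK a = AK 1 / AK a" by simp
 then show ?thesis using False unfolding k_in_kinf_def by blast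
qed

lemma zeta_A_omega_of_relation:
 fixes P :: "nat => 'a::{finite,field} poly poly" and t :: "nat list"
 defines "w \<equiv> sum_list t" and "r \<equiv> length t"
 assumes t: "\<forall>x\<in>set t. x \<ge> 1"
  and P: "poly (P r) (thA 0) \<noteq> 0" "\<And>l. l < r ==> poly (P l) (thA 0) = 0"
  and eq: "\<And>l. l < r ==> bp ^ sum_list (drop l t) * (P l + P (Suc l) * Hp (t ! l)) * tw 1 (P r) = tw 1 (P l) * P r"
  and dv: "CARD('a) - 1 dvd w"
 shows "zeta_A t * omega ^ w \<in> (k_in_kinf :: 'a fls set)"
proof -
 let ?p = "P r" and ?ph = "\<lambda>l. phi (take l t) :: 'a fls fps"
 define N where "N = (\<Sum>l\<le>r. emb (P l) * ?ph l)"
 have tt: "\<forall>x\<in>set (take l t). x \<ge> 1" for l using t by (auto dest: in_set_takeD)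
 have W: "w = sum_list (drop l t) + sum_list (take l t)" for l unfolding w_def by (metis add.commute append_take_drop_id sum_list_append)
 have step: "bb ^ w * ?ph (Suc l) = bb ^ sum_list (drop (Suc l) t) * tau 1 (?ph (Suc l)) + bb ^ sum_list (drop l t) * emb (Hp (t ! l)) * tau 1 (?ph l)" if l: "l < r" for l
 proof -
  have tk: "take (Suc l) t = take l t @ [t ! l]" and dr: "drop l t = t ! l # drop (Suc l) t" using l by (simp_all add: r_def take_Suc_conv_app_nth Cons_nth_drop_Suc)
  have "bb ^ w * ?ph (Suc l) = bb ^ sum_list (drop (Suc l) t) * (bb ^ sum_list (take (Suc l) t) * ?ph (Suc l))"
   by (simp only: W[of "Suc l"] power_add mult.assoc)
  also have "bb ^ sum_list (take (Suc l) t) * ?ph (Suc l) = tau 1 (?ph (Suc l)) + bb ^ (t ! l) * emb (Hp (t ! l)) * tau 1 (?ph l)"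
   unfolding tk by (rule phi_step[OF tt]) (use t l in \<open>simp add: r_def\<close>)
  finally show ?thesis unfolding dr by (simp add: power_add algebra_simps)
 qed
 have st: "{..r} = insert 0 (Suc ` {..<r})" by (auto simp: image_iff) (metis Suc_pred' Suc_le_eq lessThan_iff not_gr_zero)
 have bN: "bb ^ w * N = emb ?p * tau 1 (?ph r) + (\<Sum>l<r. emb (bp ^ sum_list (drop l t) * (P l + P (Suc l) * Hp (t ! l))) * tau 1 (?ph l))"
 proof -
  have "bb ^ w * N = (\<Sum>l\<le>r. emb (P l) * (bb ^ w * ?ph l))" unfolding N_def sum_distrib_left by (simp only: mult_ac)
  also have "\<dots> = emb (P 0) * bb ^ w + (\<Sum>l<r. emb (P (Suc l)) * (bb ^ w * ?ph (Suc l)))"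
   unfolding lessThan_Suc_atMost[symmetric] sum.lessThan_Suc_shift by simp
  also have "(\<Sum>l<r. emb (P (Suc l)) * (bb ^ w * ?ph (Suc l))) = (\<Sum>l<r. emb (P (Suc l)) * (bb ^ sum_list (drop (Suc l) t) * tau 1 (?ph (Suc l)))) + (\<Sum>l<r. emb (P (Suc l)) * (bb ^ sum_list (drop l t) * emb (Hp (t ! l)) * tau 1 (?ph l)))"
   unfolding sum.distrib[symmetric] by (rule sum.cong) (simp_all add: step distrib_left)
  also have "emb (P 0) * bb ^ w + (\<dots>) = (emb (P 0) * (bb ^ sum_list (drop 0 t) * tau 1 (?ph 0)) + (\<Sum>l<r. emb (P (Suc l)) * (bb ^ sum_list (drop (Suc l) t) * tau 1 (?ph (Suc l))))) + (\<Sum>l<r. emb (P (Suc l)) * (bb ^ sum_list (drop l t) * emb (Hp (t ! l)) * tau 1 (?ph l)))"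
   by (simp add: w_def add.assoc)
  also have "emb (P 0) * (bb ^ sum_list (drop 0 t) * tau 1 (?ph 0)) + (\<Sum>l<r. emb (P (Suc l)) * (bb ^ sum_list (drop (Suc l) t) * tau 1 (?ph (Suc l)))) = (\<Sum>l<Suc r. emb (P l) * (bb ^ sum_list (drop l t) * tau 1 (?ph l)))"
   by (rule sum.lessThan_Suc_shift[symmetric])
  also have "\<dots> = (\<Sum>l<r. emb (P l) * (bb ^ sum_list (drop l t) * tau 1 (?ph l))) + emb ?p * tau 1 (?ph r)" by (simp add: r_def)
  finally show ?thesis by (simp add: emb_mult emb_add emb_power emb_bp sum.distrib algebra_simps)
 qed
 have tN: "tau 1 N * emb ?p = bb ^ w * emb (tw 1 ?p) * N"
 proof -
  have "bb ^ w * emb (tw 1 ?p) * N = (bb ^ w * N) * emb (tw 1 ?p)" by (simp only: mult_ac)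
  also have "\<dots> = emb (tw 1 ?p) * emb ?p * tau 1 (?ph r) + (\<Sum>l<r. emb (bp ^ sum_list (drop l t) * (P l + P (Suc l) * Hp (t ! l)) * tw 1 ?p) * tau 1 (?ph l))"
   unfolding bN distrib_right sum_distrib_right emb_mult by (simp only: mult_ac)
  also have "(\<Sum>l<r. emb (bp ^ sum_list (drop l t) * (P l + P (Suc l) * Hp (t ! l)) * tw 1 ?p) * tau 1 (?ph l)) = (\<Sum>l<r. emb (tw 1 (P l) * ?p) * tau 1 (?ph l))"
   by (rule sum.cong) (simp_all only: eq lessThan_iff)
  also have "emb (tw 1 ?p) * emb ?p * tau 1 (?ph r) + \<dots> = (\<Sum>l<Suc r. emb (tw 1 (P l)) * tau 1 (?ph l)) * emb ?p"
   by (simp add: sum_distrib_right sum_distrib_left emb_mult algebra_simps)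
  also have "(\<Sum>l<Suc r. emb (tw 1 (P l)) * tau 1 (?ph l)) = tau 1 N" by (simp add: N_def tau_sum tau_emb lessThan_Suc_atMost)
  finally show ?thesis by simp
 qed
 obtain v where v: "w = (CARD('a) - 1) * v" using dv by (auto simp: dvd_def)
 have m1: "(- 1 :: 'a fls) ^ w = 1"
 proof -
  have "(- 1 :: 'a fls) ^ (CARD('a) - 1) * (- 1) = (- 1) ^ CARD('a)"
   using card_ge_2[where 'a = 'a] by (metis One_nat_def Suc_1 Suc_leD Suc_pred' power_Suc2 Suc_le_eq)
  also have "\<dots> = - 1" using fls_frob_minus[where 'a = 'a, of 1 1] by simp
  finally show ?thesis unfolding v power_mult by simp
 qed
 \<comment> \<open>The factor \<open>\<theta>^(q*w)\<close> coming from \<open>Om ^ w\<close> equals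
   \<open>(\<theta>^(q*v))^(q-1)\<close> and is absorbed by scaling \<open>?p\<close> with
   \<open>\<theta>^(q*v)\<close>; the sign is 1 by \<open>m1\<close>. Both use that
   \<open>q - 1\<close> divides \<open>w\<close>.\<close>
 define g where "g = smult (thA 1 ^ v) ?p"
 have p0: "?p \<noteq> 0" using P(1) by auto
 have g0: "g \<noteq> 0" using p0 by (simp add: g_def)
 define f where "f = N * Om ^ w"
 have Ow: "bb ^ w * tau 1 Om ^ w = fps_const (th 1 ^ w) * (Om ^ w :: 'a fls fps)"
 proof -
  have "bb ^ w * tau 1 Om ^ w = (fps_const (- 1) * (fps_const (th 1) * Om :: 'a fls fps)) ^ w" unfolding power_mult_distrib[symmetric] Om_tau by (simp only: fps_const_neg[symmetric] fps_const_1_eq_1 mult_minus_left mult_1_left)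
  also have "\<dots> = fps_const ((- 1) ^ w) * (fps_const (th 1 ^ w) * Om ^ w)" by (simp only: power_mult_distrib fps_const_power)
  finally show ?thesis by (simp only: m1 fps_const_1_eq_1 mult_1_left)
 qed
 have kq: "(th 1 :: 'a fls) ^ w * th 1 ^ v = (th 1 ^ v) ^ CARD('a)"
 proof -
  obtain q' where q': "CARD('a) = Suc q'" using card_ge_2[where 'a = 'a] by (cases "CARD('a)") auto
  show ?thesis unfolding v q' by (simp add: power_mult[symmetric] power_add[symmetric] mult.commute add.commute)
 qed
 have eg: "emb g = fps_const (th 1 ^ v) * emb ?p" by (simp add: g_def emb_smult AK_power)
 have "tau 1 f * emb g = tau 1 (emb g) * f"
 proof -
  have "tau 1 f * emb g = fps_const (th 1 ^ v) * (tau 1 N * emb ?p) * tau 1 Om ^ w" unfolding f_def eg by (simp only: tau_mult tau_power mult_ac)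
  also have "\<dots> = fps_const (th 1 ^ v) * emb (tw 1 ?p) * N * (bb ^ w * tau 1 Om ^ w)" unfolding tN by (simp only: mult_ac)
  also have "\<dots> = fps_const (th 1 ^ w * th 1 ^ v) * emb (tw 1 ?p) * N * Om ^ w" unfolding Ow fps_const_mult[symmetric] by (simp only: mult_ac)
  also have "\<dots> = tau 1 (emb g) * f" unfolding kq eg f_def by (simp add: tau_emb mult.assoc)
  finally show ?thesis .
 qed
 moreover have "DD 1 f" unfolding f_def N_def by (intro DD_mult DD_power DD_sum DD_emb DD_Om DD_phi tt)
 moreover have "Ev 1 (th 0) f (AK (poly ?p (thA 0)) * (AK (gams t) * zeta_A t) * omega ^ w)"
 proof -
  have E: "Ev 1 (th 0) (emb S) (AK (poly S (thA 0)))" for S :: "'a poly poly"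
   using Ev_emb[of 1 "thA 0" S] vge_th0[where 'a = 'a] by simp
  have "Ev 1 (th 0) N (\<Sum>l\<le>r. AK (poly (P l) (thA 0)) * (AK (gams (take l t)) * zeta_A (take l t)))"
   unfolding N_def by (intro Ev_sum Ev_mult E zeta_A_Ev tt vge_th0)
  moreover have "(\<Sum>l\<le>r. AK (poly (P l) (thA 0)) * (AK (gams (take l t)) * zeta_A (take l t))) = AK (poly ?p (thA 0)) * (AK (gams t) * zeta_A t)"
   unfolding lessThan_Suc_atMost[symmetric] by (simp add: P(2) r_def)
  ultimately show ?thesis unfolding f_def by (intro Ev_mult Ev_power Ev_Om) simp
 qed
 ultimately have "AK (poly ?p (thA 0)) * (AK (gams t) * zeta_A t) * omega ^ w \<in> (k_in_kinf :: 'a fls set)"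
  using rationality g0 by blast
 then have "AK (poly ?p (thA 0)) * (AK (gams t) * zeta_A t) * omega ^ w * (1 / AK (poly ?p (thA 0) * gams t)) \<in> (k_in_kinf :: 'a fls set)"
  by (rule k_mult[OF _ k_inverse_A])
 moreover have "AK (poly ?p (thA 0)) * (AK (gams t) * zeta_A t) * omega ^ w * (1 / AK (poly ?p (thA 0) * gams t)) = zeta_A t * omega ^ w"
  using P(1) gams_nonzero[of t, where 'a = 'a] by (simp add: AK_mult)
 ultimately show ?thesis by simp
qed

text \<open>The twisted equation at node \<open>l\<close> involves only entries of \<open>s\<close>
  after position \<open>l\<close>. Read from node \<open>i\<close> on, the relation is therefore one
  for \<open>drop i s\<close>, with \<open>P i\<close> as the coefficient of the empty
  segment.\<close>

theorem zeta_like_omega: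
 assumes s: "\<forall>x\<in>set s. x \<ge> 1" "s \<noteq> []"
  and alg: "algebraic_over k_in_kinf (zeta_A s / zeta_A [sum_list s] :: 'a::{finite,field} fls)"
  and i: "1 \<le> i" "i < length s"
 shows "CARD('a) - 1 dvd sum_list (drop i s)"
  and "zeta_A (drop i s) * omega ^ sum_list (drop i s) \<in> (k_in_kinf :: 'a fls set)"
proof -
 let ?r = "length s"
 obtain P :: "nat => 'a poly poly" where P: "poly (P ?r) (thA 0) \<noteq> 0" "\<And>l. 1 \<le> l ==> l < ?r ==> poly (P l) (thA 0) = 0"
  "\<And>l. 1 \<le> l ==> l < ?r ==> bp ^ sum_list (drop l s) * (P l + P (Suc l) * Hp (s ! l)) * tw 1 (P ?r) = tw 1 (P l) * P ?r"
  using main_relation[OF s alg] by blast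
 have Pr: "P ?r \<noteq> 0" using P(1) by auto
 show dv: "CARD('a) - 1 dvd sum_list (drop i s)"
  using lowest_chain(2)[of P ?r 1 "\<lambda>l. sum_list (drop l s)" "\<lambda>l. s ! l" i] Pr P(3) i by simp
 show "zeta_A (drop i s) * omega ^ sum_list (drop i s) \<in> (k_in_kinf :: 'a fls set)"
 proof (rule zeta_A_omega_of_relation[where P = "\<lambda>l. P (i + l)"])
  show "\<forall>x\<in>set (drop i s). 1 \<le> x" using s by (auto dest: in_set_dropD)
  show "poly (P (i + length (drop i s))) (thA 0) \<noteq> 0" using P(1) i by simp
  show "CARD('a) - 1 dvd sum_list (drop i s)" by (rule dv)
  fix l assume l: "l < length (drop i s)"
  show "poly (P (i + l)) (thA 0) = 0" using P(2)[of "i + l"] i l by simp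
  show "bp ^ sum_list (drop l (drop i s)) * (P (i + l) + P (i + Suc l) * Hp (drop i s ! l)) * tw 1 (P (i + length (drop i s))) = tw 1 (P (i + l)) * P (i + length (drop i s))"
   using P(3)[of "i + l"] i l by (simp add: add.commute)
 qed
qed

section \<open>The Carlitz period\<close>

text \<open>With \<open>\<xi>^(q-1) = -\<theta>\<close> this is \<open>\<xi>^(q^n - 1)\<close>. The
  root \<open>\<xi>\<close> itself is avoided so that all series stay in the completed
  field.\<close>

primrec en :: "nat => 'a::{finite,field} fls" where
 "en 0 = 1"
| "en (Suc n) = - th 0 * en n ^ CARD('a)"

text \<open>Partial sums of the Carlitz logarithm of \<open>\<xi>\<close>, divided by
  \<open>\<xi>\<close>; likewise \<open>XN N x\<close> below is a partial sum of the Carlitz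
  exponential of \<open>\<xi> * x\<close>, divided by \<open>\<xi>\<close>.\<close>

definition un :: "nat => 'a::{finite,field} fls" where "un n = (\<Sum>m\<le>n. en m / Ld m)"
definition XN :: "nat => 'a::{finite,field} fls => 'a fls" where
 "XN N x = (\<Sum>i\<le>N. en i * x ^ (CARD('a) ^ i) / Dk i)"

lemma en_step: "en (Suc n) = - th n * (en n :: 'a::{finite,field} fls)"
proof (induction n)
 case (Suc n)
 have "en (Suc (Suc n)) = - th 0 * (- th n * (en n :: 'a fls)) ^ CARD('a)" by (subst en.simps(2)) (simp only: Suc.IH)
 also have "(- th n * (en n :: 'a fls)) ^ CARD('a) = - th (Suc n) * en n ^ CARD('a)"
  unfolding power_mult_distrib using fls_frob_minus[of "th n :: 'a fls" 1] th_power[of n 1, where 'a = 'a] by simp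
 also have "- th 0 * (- th (Suc n) * (en n :: 'a fls) ^ CARD('a)) = - th (Suc n) * en (Suc n)" by simp
 finally show ?case .
qed simp

lemma en_add: "en i * en m ^ (CARD('a) ^ i) = (en (i + m) :: 'a::{finite,field} fls)"
proof (induction i)
 case (Suc i)
 have "en (Suc i) * en m ^ (CARD('a) ^ Suc i) = - th 0 * (en i * en m ^ (CARD('a) ^ i) :: 'a fls) ^ CARD('a)"
  by (simp add: power_mult_distrib mult.commute flip: power_mult)
 then show ?case unfolding Suc.IH by simp
qed simp

lemma vge_inv_diff: assumes "j < i" shows "vge (int CARD('a) ^ i) (1 / (th i - th j) :: 'a::{finite,field} fls)"
proof -
 have "CARD('a) ^ j < CARD('a) ^ i" using assms card_ge_2[where 'a = 'a] by (intro power_strict_increasing) auto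
 then have "int CARD('a) ^ j < int CARD('a) ^ i" by (metis of_nat_less_iff of_nat_power)
 then have "fls_subdegree (th i - th j :: 'a fls) = - (int CARD('a) ^ i)"
  by (subst fls_subdegree_diff_eq1) simp_all
 moreover have "th i - th j \<noteq> (0 :: 'a fls)" using assms by simp
 ultimately show ?thesis using vge_inverse[of "th i - th j :: 'a fls" "int CARD('a) ^ i"] by (simp add: inverse_eq_divide)
qed

definition br :: "nat => nat => int" where "br q n = (\<Sum>m<n. int q ^ m)"

lemma vge_en: "vge (- br CARD('a) n) (en n :: 'a::{finite,field} fls)"
proof (induction n)
 case (Suc n)
 have "vge (- (int CARD('a) ^ n)) (- th n :: 'a fls)" by (simp add: vge_subdegree)
 moreover have "- br CARD('a) (Suc n) = - (int CARD('a) ^ n) + - br CARD('a) n" by (simp add: br_def)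
 ultimately show ?case unfolding en_step using vge_mult Suc by metis
qed (simp add: br_def)

lemma vge_inv_Dk: "vge (int i * int CARD('a) ^ i) (1 / Dk i :: 'a::{finite,field} fls)"
proof -
 have "vge (\<Sum>j<i. int CARD('a) ^ i) (\<Prod>j<i. 1 / (th i - th j) :: 'a fls)" by (intro vge_prod vge_inv_diff) simp
 then show ?thesis by (simp add: Dk_def prod_dividef)
qed

lemma vge_en_Ld: "vge (int CARD('a) ^ n - 1) (en n / Ld n :: 'a::{finite,field} fls)"
proof (induction n)
 case (Suc n)
 have a: "vge (- (int CARD('a) ^ n)) (th n :: 'a fls)" by (simp add: vge_subdegree)
 have b: "vge (int CARD('a) ^ Suc n) (1 / (th (Suc n) - th 0) :: 'a fls)" by (rule vge_inv_diff) simp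
 have "en (Suc n) / Ld (Suc n) = en n / Ld n * (th n * (1 / (th (Suc n) - th 0) :: 'a fls))"
 proof -
  have "Ld (Suc n) = Ld n * (th 0 - th (Suc n) :: 'a fls)" by (simp add: Ld_def)
  moreover have "- th n / (th 0 - th (Suc n)) = th n / (th (Suc n) - th 0 :: 'a fls)" by (metis minus_diff_eq minus_divide_divide)
  ultimately show ?thesis unfolding en_step by (metis (no_types, lifting) mult.commute mult.right_neutral times_divide_times_eq times_divide_eq_right)
 qed
 with vge_mult[OF Suc vge_mult[OF a b]] show ?case by simp
qed (simp add: Ld_def)

text \<open>The identity between the logarithm and the inverse of the product already holds for
  partial sums and products: the second formula evaluates the last summand and makes the first
  telescope.\<close>

lemma un_omn: "un n * omn n = (1 :: 'a::{finite,field} fls)" and en_omn: "en n / Ld n * omn n = (th 0 / th n :: 'a fls)"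
proof (induction n)
 case 0
 show "un 0 * omn 0 = (1 :: 'a fls)" by (simp add: un_def omn_def Ld_def)
 show "en 0 / Ld 0 * omn 0 = (th 0 / th 0 :: 'a fls)" by (simp add: omn_def Ld_def)
next
 case (Suc n)
 let ?t = "th (Suc n) :: 'a fls"
 have o: "omn (Suc n) = omn n * (1 - th 0 / ?t)" by (simp add: omn_def)
 have L: "Ld (Suc n) = Ld n * (th 0 - ?t)" by (simp add: Ld_def)
 have d: "th 0 - ?t \<noteq> 0" by simp
 have "en (Suc n) / Ld (Suc n) * omn (Suc n) = (en n / Ld n * omn n) * (- th n * (1 - th 0 / ?t) / (th 0 - ?t))"
  unfolding en_step o L by (simp add: field_simps)
 also have "- th n * (1 - th 0 / ?t) / (th 0 - ?t) = th n / ?t" using d by (simp add: field_simps)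
 also have "en n / Ld n * omn n * (th n / ?t) = th 0 / ?t" unfolding Suc.IH(2) by simp
 finally show e: "en (Suc n) / Ld (Suc n) * omn (Suc n) = th 0 / ?t" .
 have "un (Suc n) * omn (Suc n) = (un n * omn n) * (1 - th 0 / ?t) + en (Suc n) / Ld (Suc n) * omn (Suc n)"
  by (simp add: un_def o algebra_simps)
 then show "un (Suc n) * omn (Suc n) = (1 :: 'a fls)" unfolding e Suc.IH(1) by simp
qed

lemma period_exists:
 "\<exists>u. u * omega = (1 :: 'a::{finite,field} fls) \<and> (\<forall>N. vge (int CARD('a) ^ Suc N - 1) (u - un N))"
proof -
 let ?q = "int CARD('a)"
 have q1: "?q \<ge> 1" using card_ge_2[where 'a = 'a] by simp
 have st: "vge (?q ^ Suc N - 1) (un m - un N :: 'a fls)" if "N \<le> m" for N m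
  using that
 proof (induction m rule: dec_induct)
  case (step m)
  have "?q ^ Suc N \<le> ?q ^ Suc m" using step q1 by (intro power_increasing) auto
  then have "vge (?q ^ Suc N - 1) (en (Suc m) / Ld (Suc m) :: 'a fls)" by (intro vge_mono[OF vge_en_Ld] diff_right_mono)
  from vge_add[OF step.IH this] show ?case by (simp add: un_def algebra_simps)
 qed simp
 have ge: "\<exists>n0. \<forall>n\<ge>n0. C \<le> ?q ^ Suc n - 1" for C
 proof -
  obtain n0 where n0: "\<forall>n\<ge>n0. C + 1 \<le> int (CARD('a) ^ n)" using int_less_card_power[where 'a = 'a] by blast
  show ?thesis
  proof (intro exI[of _ n0] allI impI)
   fix n assume "n \<ge> n0"
   then show "C \<le> ?q ^ Suc n - 1" using n0[rule_format, of "Suc n"] by simp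
  qed
 qed
 have "\<exists>l. \<forall>C. \<exists>n0. \<forall>n\<ge>n0. vge C (un n - l :: 'a fls)"
 proof (rule fls_Cauchy_limit)
  fix C
  obtain n0 where n0: "\<forall>n\<ge>n0. C \<le> ?q ^ Suc n - 1" using ge by blast
  have "vge C (un (Suc n) - un n :: 'a fls)" if "n \<ge> n0" for n
   by (rule vge_mono[OF st[of n "Suc n"] n0[rule_format, OF that]]) simp
  then show "\<exists>n0. \<forall>n\<ge>n0. vge C (un (Suc n) - un n :: 'a fls)" by blast
 qed
 then obtain u where u: "\<And>C. \<exists>n0. \<forall>n\<ge>n0. vge C (un n - u :: 'a fls)" by blast
 have uN: "vge (?q ^ Suc N - 1) (u - un N)" for N
 proof -
  obtain n0 where "\<forall>n\<ge>n0. vge (?q ^ Suc N - 1) (un n - u)" using u by blast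
  then have "vge (?q ^ Suc N - 1) (un (max n0 N) - u)" by simp
  from vge_diff[OF st[of N "max n0 N"] this] show ?thesis by simp
 qed
 have u0: "vge 0 (un n :: 'a fls)" for n
  unfolding un_def by (intro vge_sum vge_mono[OF vge_en_Ld]) (use q1 in simp)
 obtain c0 where c0: "vge c0 (omega :: 'a fls)" using vge_ex by blast
 have "vge C (u * omega - 1)" for C
 proof -
  obtain n0 where n0: "\<forall>n\<ge>n0. C - c0 \<le> ?q ^ Suc n - 1" using ge by blast
  obtain D0 where D0: "\<forall>D\<ge>D0. vge C (omn D - omega :: 'a fls)" using omn_limit by blast
  let ?n = "max n0 D0"
  have "vge (C - c0) (u - un ?n)" using uN[of ?n] n0 by (elim vge_mono) simp
  from vge_mult[OF this c0] have "vge C ((u - un ?n) * omega)" by simp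
  moreover have "vge (0 + C) (un ?n * (omn ?n - omega) :: 'a fls)" by (rule vge_mult[OF u0 D0[rule_format]]) simp
  ultimately have "vge C ((u - un ?n) * omega - un ?n * (omn ?n - omega))" by (intro vge_diff) simp_all
  moreover have "(u - un ?n) * omega - un ?n * (omn ?n - omega) = u * omega - 1"
   using un_omn[of ?n, where 'a = 'a] by (simp add: algebra_simps)
  ultimately show ?thesis by simp
 qed
 then have "u * omega - 1 = 0" by (rule vge_all_imp_0)
 then show ?thesis using uN by auto
qed

text \<open>Exponential after logarithm, truncated along \<open>i + m \<le> N\<close>. The terms
  with \<open>i + m = d\<close> add up to \<open>en d * Ed d 1\<close>, which vanishes for
  \<open>d > 0\<close>.\<close>

lemma XN_un: "(\<Sum>i\<le>N. en i * un (N - i) ^ (CARD('a) ^ i) / Dk i) = (1 :: 'a::{finite,field} fls)"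
proof -
 have "(\<Sum>i\<le>N. en i * un (N - i) ^ (CARD('a) ^ i) / Dk i) = (\<Sum>i\<le>N. \<Sum>m\<le>N - i. en (i + m) / (Dk i * Ld m ^ (CARD('a) ^ i)) :: 'a fls)"
 proof (rule sum.cong[OF refl])
  fix i
  show "en i * un (N - i) ^ (CARD('a) ^ i) / Dk i = (\<Sum>m\<le>N - i. en (i + m) / (Dk i * Ld m ^ (CARD('a) ^ i)) :: 'a fls)"
   unfolding un_def fls_frob_sum sum_distrib_left sum_divide_distrib by (rule sum.cong) (simp_all add: power_divide mult.commute flip: en_add)
 qed
 also have "\<dots> = (\<Sum>(i, m)\<in>{(i, m). i + m \<le> N}. en (i + m) / (Dk i * Ld m ^ (CARD('a) ^ i)))"
  by (subst sum.Sigma) (auto intro!: sum.cong)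
 also have "\<dots> = (\<Sum>d\<le>N. \<Sum>i\<le>d. en (i + (d - i)) / (Dk i * Ld (d - i) ^ (CARD('a) ^ i)))"
  by (rule sum.triangle_reindex_eq)
 also have "\<dots> = (\<Sum>d\<le>N. en d * Ed d 1)"
 proof (rule sum.cong[OF refl])
  fix d show "(\<Sum>i\<le>d. en (i + (d - i)) / (Dk i * Ld (d - i) ^ (CARD('a) ^ i))) = en d * (Ed d 1 :: 'a fls)"
   unfolding Ed_def sum_distrib_left by (rule sum.cong) (simp_all add: ed_def)
 qed
 also have "\<dots> = (\<Sum>d\<le>N. if d = 0 then 1 else 0)" by (rule sum.cong) (simp_all add: Ed_1)
 finally show ?thesis by simp
qed

lemma vge_XN:
 assumes u: "\<And>N. vge (int CARD('a) ^ Suc N - 1) (u - un N :: 'a::{finite,field} fls)"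
 shows "vge (int CARD('a) ^ N) (XN N u - 1)"
proof -
 let ?q = "int CARD('a)"
 have q2: "?q \<ge> 2" using card_ge_2[where 'a = 'a] by simp
 have "XN N u - 1 = (\<Sum>i\<le>N. en i * (1 / Dk i * (u - un (N - i)) ^ (CARD('a) ^ i)))"
 proof -
  have "XN N u - 1 = XN N u - (\<Sum>i\<le>N. en i * un (N - i) ^ (CARD('a) ^ i) / Dk i)" by (simp only: XN_un)
  also have "\<dots> = (\<Sum>i\<le>N. en i * (1 / Dk i * (u - un (N - i)) ^ (CARD('a) ^ i)))"
   unfolding XN_def sum_subtractf[symmetric] fls_frob_diff by (rule sum.cong) (simp_all add: field_simps)
  finally show ?thesis .
 qed
 moreover have "vge (?q ^ N) (en i * (1 / Dk i * (u - un (N - i)) ^ (CARD('a) ^ i)))" if i: "i \<le> N" for i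
 proof -
  have "vge (- br CARD('a) i + (int i * ?q ^ i + int (CARD('a) ^ i) * (?q ^ Suc (N - i) - 1))) (en i * (1 / Dk i * (u - un (N - i)) ^ (CARD('a) ^ i)))"
   by (intro vge_mult vge_en vge_inv_Dk vge_power u)
  moreover have "?q ^ N \<le> - br CARD('a) i + (int i * ?q ^ i + int (CARD('a) ^ i) * (?q ^ Suc (N - i) - 1))"
  proof -
   have "br CARD('a) i \<le> (\<Sum>m<i. ?q ^ i)" unfolding br_def by (intro sum_mono power_increasing) (use q2 in auto)
   then have 1: "br CARD('a) i \<le> int i * ?q ^ i" by simp
   have 2: "?q ^ i \<le> ?q ^ N" using i q2 by (intro power_increasing) auto
   have "?q ^ i * ?q ^ Suc (N - i) = ?q * ?q ^ N"
   proof -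
    have "i + Suc (N - i) = Suc N" using i by simp
    then show ?thesis by (metis power_add power_Suc)
   qed
   moreover have "2 * ?q ^ N \<le> ?q * ?q ^ N" using q2 by (intro mult_right_mono) auto
   ultimately have 3: "2 * ?q ^ N \<le> ?q ^ i * ?q ^ Suc (N - i)" by (simp only:)
   have 4: "int (CARD('a) ^ i) * (?q ^ Suc (N - i) - 1) = ?q ^ i * ?q ^ Suc (N - i) - ?q ^ i" by (simp add: right_diff_distrib)
   show ?thesis unfolding 4 using 1 2 3 by linarith
  qed
  ultimately show ?thesis by (rule vge_mono)
 qed
 ultimately show ?thesis by (simp only:) (intro vge_sum, simp)
qed

text \<open>The functional equation \<open>exp(\<theta> z) = \<theta> exp(z) + exp(z)^q\<close> for
  partial sums, divided by \<open>\<xi>\<close>; the sign comes from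
  \<open>\<xi>^q = -\<theta> \<xi>\<close>.\<close>

lemma XN_theta: "XN (Suc N) (th 0 * x) = th 0 * XN (Suc N) x - th 0 * XN N (x :: 'a::{finite,field} fls) ^ CARD('a)"
proof -
 let ?q = "CARD('a)"
 have t: "en i * (th 0 * x) ^ (?q ^ i) / Dk i = th 0 * (en i * x ^ (?q ^ i) / Dk i) + (th i - th 0) * (en i * x ^ (?q ^ i)) / Dk i" for i
  using th_power[of 0 i, where 'a = 'a] by (simp add: power_mult_distrib field_simps)
 have s: "(th (Suc i) - th 0) * (en (Suc i) * x ^ (?q ^ Suc i)) / Dk (Suc i) = - th 0 * (en i * x ^ (?q ^ i) / Dk i) ^ ?q" for i
 proof -
  have "th (Suc i) - th 0 \<noteq> (0 :: 'a fls)" by simp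
  then show ?thesis unfolding Dk_Suc by (simp add: power_mult_distrib power_divide mult.commute flip: power_mult)
 qed
 have "XN (Suc N) (th 0 * x) = th 0 * XN (Suc N) x + (\<Sum>i\<le>Suc N. (th i - th 0) * (en i * x ^ (?q ^ i)) / Dk i)"
  unfolding XN_def sum_distrib_left sum.distrib[symmetric] by (rule sum.cong) (simp_all only: t)
 also have "(\<Sum>i\<le>Suc N. (th i - th 0) * (en i * x ^ (?q ^ i)) / Dk i) = (\<Sum>i\<le>N. - th 0 * (en i * x ^ (?q ^ i) / Dk i) ^ ?q)"
  unfolding sum.atMost_Suc_shift s by simp
 also have "\<dots> = - th 0 * XN N x ^ ?q" using fls_frob_sum[of "\<lambda>i. en i * x ^ (?q ^ i) / Dk i" "{..N}" 1]
  by (simp add: XN_def sum_distrib_left)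
 finally show ?thesis by simp
qed

text \<open>Since \<open>XN N u\<close> tends to 1, the functional equation gives the limit
  \<open>\<theta> - \<theta>\<close> at \<open>\<theta> * u\<close>.\<close>

theorem period_limit:
 "\<exists>u. u * omega = (1 :: 'a::{finite,field} fls) \<and> (\<lambda>N. XN N (th 0 * u)) \<longlonglongrightarrow> 0"
proof -
 obtain u where u: "u * omega = (1 :: 'a fls)" "\<And>N. vge (int CARD('a) ^ Suc N - 1) (u - un N)" using period_exists by blast
 let ?q = "int CARD('a)"
 have q1: "?q \<ge> 1" using card_ge_2[where 'a = 'a] by simp
 have v: "vge (?q ^ N - 1) (XN (Suc N) (th 0 * u))" for N
 proof -
  have "XN (Suc N) (th 0 * u) = th 0 * ((XN (Suc N) u - 1) - (XN N u - 1) ^ CARD('a))"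
   unfolding XN_theta using fls_frob_diff[of "XN N u" 1 1] by (simp add: algebra_simps)
  moreover have a: "vge (?q ^ N) (XN (Suc N) u - 1)" by (rule vge_mono[OF vge_XN[OF u(2)]]) (use q1 in \<open>auto intro: power_increasing\<close>)
  moreover have b: "vge (?q ^ N) ((XN N u - 1) ^ CARD('a))"
  proof (rule vge_mono[OF vge_power[OF vge_XN[OF u(2)]]])
   show "?q ^ N \<le> int CARD('a) * ?q ^ N" using q1 by (simp add: mult_le_cancel_right1)
  qed
  ultimately have "vge (- 1 + ?q ^ N) (XN (Suc N) (th 0 * u))" using vge_mult[OF vge_th0 vge_diff[OF a b]] by (simp only:)
  then show ?thesis by simp
 qed
 have "(\<lambda>N. XN N (th 0 * u)) \<longlonglongrightarrow> 0"
  unfolding tendsto_fls_iff eventually_sequentially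
 proof
  fix c
  obtain n0 where n0: "\<forall>n\<ge>n0. c + 1 \<le> int (CARD('a) ^ n)" using int_less_card_power[where 'a = 'a] by blast
  have "vge c (XN N (th 0 * u) - 0)" if Nn: "N \<ge> Suc n0" for N
  proof -
   obtain N' where N': "N = Suc N'" "N' \<ge> n0" using Nn by (cases N) auto
   have "c \<le> ?q ^ N' - 1" using n0[rule_format, OF N'(2)] by simp
   from vge_mono[OF v this] show ?thesis unfolding N' by simp
  qed
  then show "\<exists>N. \<forall>n\<ge>N. vge c (XN n (th 0 * u) - 0)" by blast
 qed
 then show ?thesis using u(1) by blast
qed

section \<open>Transfer to the completed algebraic closure\<close>

context C_infinity
begin

definition jj :: "'a fls => 'c" where "jj z = \<iota> (to_ac z)"

lemma jj_1 [simp]: "jj 1 = 1" by (simp add: jj_def hom_one)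
lemma jj_add: "jj (x + y) = jj x + jj y" by (simp add: jj_def hom_add)
lemma jj_mult: "jj (x * y) = jj x * jj y" by (simp add: jj_def hom_mult)
lemma jj_0 [simp]: "jj 0 = 0" using dist_extends[of 0] by (simp add: jj_def)
lemma jj_power: "jj (x ^ n) = jj x ^ n" by (induction n) (simp_all add: jj_mult)
lemma jj_sum: "jj (\<Sum>i\<in>S. g i) = (\<Sum>i\<in>S. jj (g i))"
 by (induction S rule: infinite_finite_induct) (simp_all add: jj_add)
lemma jj_eq_0: "jj x = 0 \<longleftrightarrow> x = 0"
 using jj_mult[of x "inverse x"] by (cases "x = 0") auto
lemma jj_divide: "jj (x / y) = jj x / jj y"
 using jj_mult[of "x / y" y] by (cases "y = 0") (auto simp: jj_eq_0 field_simps)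
lemma dist_jj: "dist (jj z) 0 = dist z 0" by (simp add: jj_def dist_extends)

lemma period_root:
 assumes \<xi>: "\<xi> ^ (CARD('a) - 1) = jj (- th 0)" and u: "(\<lambda>N. XN N (th 0 * u)) \<longlonglongrightarrow> 0"
 shows "carlitz_exp \<iota> (jj (th 0 * u) * \<xi>) = 0"
proof -
 let ?q = "CARD('a)"
 have \<xi>q: "\<xi> ^ ?q = jj (- th 0) * \<xi>"
  using \<xi> card_ge_2[where 'a = 'a] by (metis One_nat_def Suc_1 Suc_leD Suc_pred' power_Suc2 Suc_le_eq)
 have \<xi>i: "\<xi> ^ (?q ^ i) = jj (en i) * \<xi>" for i
 proof (induction i)
  case (Suc i)
  have "\<xi> ^ (?q ^ Suc i) = (\<xi> ^ (?q ^ i)) ^ ?q" by (simp add: mult.commute flip: power_mult)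
  also have "\<dots> = jj (en (Suc i)) * \<xi>" unfolding Suc.IH power_mult_distrib \<xi>q
   by (simp only: en.simps jj_mult jj_power mult_ac)
  finally show ?case .
 qed simp
 let ?f = "\<lambda>i. (jj (th 0 * u) * \<xi>) ^ (?q ^ i) / \<iota> (to_ac (AK (carlitz_D i :: 'a poly)))"
 have trm: "?f i = jj (en i * (th 0 * u) ^ (?q ^ i) / Dk i) * \<xi>" for i
  unfolding power_mult_distrib[of "jj (th 0 * u)"] \<xi>i Dk_A by (simp add: jj_mult jj_power jj_divide flip: jj_def)
 have part: "(\<Sum>i<Suc N. ?f i) = jj (XN N (th 0 * u)) * \<xi>" for N
  unfolding trm XN_def jj_sum sum_distrib_right lessThan_Suc_atMost ..
 have "(\<lambda>N. dist (XN N (th 0 * u)) 0 * dist \<xi> 0) \<longlonglongrightarrow> 0"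
  using u unfolding tendsto_dist_iff[of _ "0 :: 'a fls"] by (rule tendsto_mult_left_zero)
 then have "(\<lambda>N. dist (\<Sum>i<Suc N. ?f i) 0) \<longlonglongrightarrow> 0" unfolding part dist_mult dist_jj .
 then have "(\<lambda>N. \<Sum>i<Suc N. ?f i) \<longlonglongrightarrow> 0" unfolding tendsto_dist_iff[of _ "0 :: 'c"] .
 then have "(\<lambda>N. \<Sum>i<N. ?f i) \<longlonglongrightarrow> 0" by (rule LIMSEQ_imp_Suc)
 then have "?f sums 0" unfolding sums_def .
 then show ?thesis unfolding carlitz_exp_def by (rule sums_unique[symmetric])
qed

text \<open>The zero \<open>\<theta> * u * \<xi>\<close> of the exponential equals
  \<open>a * \<pi>\<close> for some nonzero \<open>a\<close> in \<open>A\<close>, which is enough,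
  as \<open>a\<close> lies in \<open>k\<close>. The root \<open>\<xi>\<close> disappears because
  \<open>\<xi>^w = (-\<theta>)^v\<close> for \<open>w = (q-1) * v\<close>.\<close>

lemma Eulerian_of_omega:
 assumes per: "fundamental_period \<iota> \<pi>" and dv: "CARD('a) - 1 dvd sum_list t"
  and k: "zeta_A t * omega ^ sum_list t \<in> (k_in_kinf :: 'a fls set)"
 shows "Eulerian \<iota> \<pi> t"
proof -
 let ?q = "CARD('a)" and ?w = "sum_list t"
 have q1: "?q - 1 > 0" using card_ge_2[where 'a = 'a] by simp
 obtain u where u: "u * omega = (1 :: 'a fls)" "(\<lambda>N. XN N (th 0 * u)) \<longlonglongrightarrow> 0" using period_limit by blast
 have u0: "u \<noteq> 0" "omega \<noteq> (0 :: 'a fls)" using u(1) by auto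
 obtain y :: "'a fls alg_closure" where y: "y ^ (?q - 1) = to_ac (- th 0)"
 proof -
  let ?p = "monom 1 (?q - 1) + [:- to_ac (- th 0 :: 'a fls):]"
  have "degree ?p = ?q - 1" using q1 by (subst degree_add_eq_left) (simp_all add: degree_monom_eq)
  then obtain y where "poly ?p y = 0" using alg_closed_imp_poly_has_root[of ?p] q1 by auto
  then show ?thesis by (intro that[of y]) (simp add: poly_monom eq_neg_iff_add_eq_0)
 qed
 define \<xi> where "\<xi> = \<iota> y"
 have "\<iota> (y ^ n) = \<iota> y ^ n" for n by (induction n) (simp_all add: hom_one hom_mult)
 then have \<xi>: "\<xi> ^ (?q - 1) = jj (- th 0)" unfolding \<xi>_def jj_def using y by metis
 have \<xi>0: "\<xi> \<noteq> 0"
 proof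
  assume "\<xi> = 0"
  then have "jj (- th 0) = 0" using \<xi> q1 by (simp add: power_0_left)
  then show False by (simp add: jj_eq_0)
 qed
 have "jj (th 0 * u) * \<xi> \<in> {z. carlitz_exp \<iota> z = 0}" using period_root[OF \<xi> u(2)] by simp
 then obtain a where a: "jj (th 0 * u) * \<xi> = jj (AK a) * \<pi>"
  using per unfolding fundamental_period_def jj_def by auto
 have z0: "jj (th 0 * u) * \<xi> \<noteq> 0" using u0 \<xi>0 by (simp add: jj_eq_0)
 then have a0: "jj (AK a) \<noteq> 0" "\<pi> \<noteq> 0" unfolding a by auto
 obtain v where v: "?w = (?q - 1) * v" using dv by (auto simp: dvd_def)
 have "jj (AK a ^ ?w) * \<pi> ^ ?w = jj ((th 0 * u) ^ ?w * (- th 0) ^ v)"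
 proof -
  have "jj (AK a ^ ?w) * \<pi> ^ ?w = (jj (th 0 * u) * \<xi>) ^ ?w" unfolding a power_mult_distrib jj_power ..
  also have "\<dots> = jj ((th 0 * u) ^ ?w * (- th 0) ^ v)" unfolding power_mult_distrib[of _ \<xi>] v power_mult[of \<xi>] \<xi> jj_mult jj_power ..
  finally show ?thesis .
 qed
 moreover have "jj (AK a ^ ?w) \<noteq> 0" using a0 by (simp add: jj_power)
 ultimately have "\<pi> ^ ?w = jj ((th 0 * u) ^ ?w * (- th 0) ^ v / AK a ^ ?w)" by (simp add: jj_divide field_simps)
 then have "\<iota> (to_ac (zeta_A t)) / \<pi> ^ ?w = jj (zeta_A t / ((th 0 * u) ^ ?w * (- th 0) ^ v / AK a ^ ?w))"
  by (simp only: jj_divide flip: jj_def)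
 also have "zeta_A t / ((th 0 * u) ^ ?w * (- th 0) ^ v / AK a ^ ?w) = zeta_A t * omega ^ ?w * (AK (a ^ ?w) / AK (thA 0 ^ ?w * (- thA 0) ^ v))"
 proof -
  have "omega ^ ?w * u ^ ?w = (1 :: 'a fls)" using u(1) by (simp add: mult.commute flip: power_mult_distrib)
  then have "omega ^ ?w = (1 / u ^ ?w :: 'a fls)" using u0 by (simp add: field_simps)
  then show ?thesis using u0 by (simp add: AK_mult AK_power AK_minus power_mult_distrib)
 qed
 finally have e: "\<iota> (to_ac (zeta_A t)) / \<pi> ^ ?w = jj (zeta_A t * omega ^ ?w * (AK (a ^ ?w) / AK (thA 0 ^ ?w * (- thA 0) ^ v)))" .
 have "thA 0 ^ ?w * (- thA 0) ^ v \<noteq> (0 :: 'a poly)" by simp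
 then have "AK (a ^ ?w) / AK (thA 0 ^ ?w * (- thA 0) ^ v) \<in> (k_in_kinf :: 'a fls set)"
  unfolding k_in_kinf_def by blast
 from k_mult[OF k this] show ?thesis unfolding Eulerian_def e jj_def by (rule imageI)
qed

end


theorem corollary4p4p3:
  fixes \<iota> :: "'a::{finite,field} fls alg_closure \<Rightarrow> 'c::{field,complete_space}"
    and pi_tilde :: 'c
    and s :: "nat list"
  assumes "C_infinity \<iota>"
    and "fundamental_period \<iota> pi_tilde"
    and "length s \<ge> 2"
    and "\<forall>n\<in>set s. n \<ge> 1"
    and "zeta_like TYPE('a) s"
  shows "(\<forall>i\<in>{1..<length s}. Eulerian \<iota> pi_tilde (drop i s)) \<and>
         (\<forall>i\<in>{1..<length s}. (CARD('a) - 1) dvd s ! i)"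
proof -
 interpret C_infinity \<iota> by fact
 have ne: "s \<noteq> []" using assms(3) by auto
 have alg: "algebraic_over k_in_kinf (zeta_A s / zeta_A [sum_list s] :: 'a fls)"
  using assms(5) by (simp add: zeta_like_def)
 note dv = zeta_like_omega(1)[OF assms(4) ne alg] and om = zeta_like_omega(2)[OF assms(4) ne alg]
 have "Eulerian \<iota> pi_tilde (drop i s)" if "i \<in> {1..<length s}" for i
  using that by (intro Eulerian_of_omega assms(2) dv om) auto
 moreover have "CARD('a) - 1 dvd s ! i" if i: "i \<in> {1..<length s}" for i
 \<comment> \<open>The entry is the difference of two consecutive final sums; behind the last entry
   the sum is 0.\<close>
 proof -
  have "sum_list (drop i s) = s ! i + sum_list (drop (Suc i) s)" using i by (simp add: Cons_nth_drop_Suc[symmetric])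
  moreover have "CARD('a) - 1 dvd sum_list (drop i s)" using i by (intro dv) auto
  moreover have "CARD('a) - 1 dvd sum_list (drop (Suc i) s)"
  proof (cases "Suc i < length s")
   case True then show ?thesis by (intro dv) simp_all
  qed simp
  ultimately show ?thesis by (simp add: dvd_add_left_iff)
 qed
 ultimately show ?thesis by blast
qed

end
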